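(* Suppose $1 < p < \infty$. Suppose $g: [1, \infty) \to [1, \infty)$ is a function such that $\lim_{x \to \infty} g(x) = \infty$. Then there exists a real-valued strictly stationary, countable-state, irreducible, aperiodic Markov chain $X := (X_k, k \in \mathbb{Z})$ which is reversible, such that $E[X_0^2] < \infty$ and $E[X_0] = 0$, and such that all of the following hold: (1) $\displaystyle \int_0^{(1/x)^p} Q_{|X(0)|}^2(u)\, du \ll (1/x) \cdot g(x)$ as $x \to \infty$; (2) $\alpha_X(n) \leq \beta_X(n) \leq (1/n)^p$ for all $n \in \mathbb{N}$; (3) $\lim_{n \to \infty} n^{-1}\,\mathrm{Var}\bigl(\sum_{k=1}^n X_k\bigr) = \infty$, and for every $c > 0$, $$\lim_{n \to \infty} \Bigl[\, \sup_{r \in \mathbb{R}} P\Bigl(r - c < n^{-1/2} \sum_{k=1}^n X_k < r + c\Bigr)\Bigr] = 0;$$ (4) there exist a strictly increasing sequence $(J(1), J(2), J(3), \dots)$ of positive integers and a sequence $(b_1, b_2, b_3, \dots)$ of positive constants satisfying $b_n \to \infty$ as $n \to \infty$, such that $$b_n^{-1} \sum_{k=1}^{J(n)} X_k \to \mu_{\mathrm{P1sL}} \quad \text{in distribution as } n \to \infty;$$ (5) defining $\mathbf{h}(n) := n^{-1}\,\mathrm{Var}\bigl(\sum_{k=1}^n X_k\bigr)$ for every $n \in \mathbb{N}$, one has $\mathbf{h}(n) \leq g(n)$ for every $n \in \mathbb{N}$, and for every $N \in \mathbb{N}$, $\limsup_{n \to \infty} \mathbf{h}(Nn)/\mathbf{h}(n)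 = N$.
   Context: $\mathbb{N}$ is the set of positive integers. Markov chains are indexed by the set $\mathbb{Z}$ of all integers; "countable-state" means that the state space is a finite or countably infinite subset of $\mathbb{R}$. The notation $a(x) \ll b(x)$ as $x \to \infty$ means $a(x) = O(b(x))$ as $x \to \infty$. Reversible: a strictly stationary Markov chain $(X_k, k \in \mathbb{Z})$ is reversible if the time-reversed sequence $(X_{-k}, k \in \mathbb{Z})$ has the same distribution on $\mathbb{R}^{\mathbb{Z}}$ as $(X_k, k\in\mathbb{Z})$ (equivalently, $(X_1, X_0)$ has the same distribution as $(X_0, X_1)$). Quantile function: for a nonnegative random variable $W$, $Q_W: (0,1) \to [0,\infty)$ is defined by $Q_W(u) := \inf\{t \geq 0 : P(W > t) \leq u\}$. $Q_{|X(0)|}$ denotes $Q_W$ for $W = |X_0|$. Dependence coefficients: for $\sigma$-fields $\mathcal{A}, \mathcal{B}$ on the probability space, $\alpha(\mathcal{A},\mathcal{B}) := \sup_{A \in \mathcal{A}, B \in \mathcal{B}} |P(A \cap B) - P(A)P(B)|$ and $\beta(\mathcal{A}, \mathcal{B}) := \sup \frac12 \sum_{i=1}^I \sum_{j=1}^J |P(A_i \cap B_j) - P(A_i)P(B_j)|$, the latter supremum being over all pairs of finite partitions $\{A_1,\dots,A_I\}$, $\{B_1,\dots,B_J\}$ of $\Omega$ with $A_i \in \mathcal{A}$, $B_j \in \mathcal{B}$. For a strictly stationary sequence $X$ and $n \in \mathbb{N}$, $\alpha_X(n) := \alpha(\sigma(X_k, k \le 0), \sigma(X_k, k \ge n))$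 and $\beta_X(n) := \beta(\sigma(X_k, k \le 0), \sigma(X_k, k \ge n))$. The distribution $\mu_{\mathrm{P1sL}}$: the distribution of the random variable $Y := \sum_{k=1}^{N} \eta_k$ (with empty sum equal to $0$), where $\eta_1, \eta_2, \dots$ are i.i.d. with the Laplace density $\frac12 e^{-|x|}$, $x \in \mathbb{R}$, and $N$ is a Poisson random variable with mean $1$, independent of $(\eta_1, \eta_2, \dots)$. *)

theory Defs
  imports "HOL-Probability.Probability" "HOL-Library.Landau_Symbols"
begin

text \<open>Processes are families \<open>X :: int \<Rightarrow> 'a \<Rightarrow> real\<close> of random variables on a probability
  space \<open>M\<close>; the index set is all of the integers.\<close>

definition process_law :: "'a measure \<Rightarrow> (int \<Rightarrow> 'a \<Rightarrow> real) \<Rightarrow> (int \<Rightarrow> real) measure" where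
  "process_law M X = distr M (PiM UNIV (\<lambda>_. borel)) (\<lambda>\<omega> k. X k \<omega>)"

definition strictly_stationary :: "'a measure \<Rightarrow> (int \<Rightarrow> 'a \<Rightarrow> real) \<Rightarrow> bool" where
  "strictly_stationary M X \<longleftrightarrow> (\<forall>m. process_law M (\<lambda>k. X (k + m)) = process_law M X)"

definition reversible :: "'a measure \<Rightarrow> (int \<Rightarrow> 'a \<Rightarrow> real) \<Rightarrow> bool" where
  "reversible M X \<longleftrightarrow> process_law M (\<lambda>k. X (- k)) = process_law M X"

text \<open>The Markov property conditions on every finite stretch \<open>X\<^sub>n\<^sub>-\<^sub>m, \<dots>, X\<^sub>n\<close> of the past
  that has positive probability.  Time homogeneity is not part of this notion; below it comes from
  strict stationarity.\<close>

definition countable_state_Markov_chain ::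
    "'a measure \<Rightarrow> real set \<Rightarrow> (int \<Rightarrow> 'a \<Rightarrow> real) \<Rightarrow> bool" where
  "countable_state_Markov_chain M S X \<longleftrightarrow>
     prob_space M \<and> countable S \<and>
     (\<forall>k. X k \<in> borel_measurable M \<and> (\<forall>\<omega>\<in>space M. X k \<omega> \<in> S)) \<and>
     (\<forall>(n::int) (m::nat) (s::int \<Rightarrow> real). \<forall>j\<in>S.
        \<P>(\<omega> in M. \<forall>k\<in>{n - int m..n}. X k \<omega> = s k) > 0 \<longrightarrow>
        \<P>(\<omega> in M. X (n + 1) \<omega> = j \<bar> \<forall>k\<in>{n - int m..n}. X k \<omega> = s k) =
        \<P>(\<omega> in M. X (n + 1) \<omega> = j \<bar> X n \<omega> = s n))"

definition trans_prob ::
    "'a measure \<Rightarrow> (int \<Rightarrow> 'a \<Rightarrow> real) \<Rightarrow> nat \<Rightarrow> real \<Rightarrow> real \<Rightarrow> real" where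
  "trans_prob M X n i j = \<P>(\<omega> in M. X (int n) \<omega> = j \<bar> X 0 \<omega> = i)"

text \<open>Conditioning on a null event gives \<open>0\<close>, so irreducibility on \<open>S\<close> forces
  \<open>P (X\<^sub>0 = i) > 0\<close> for every \<open>i \<in> S\<close>.\<close>

definition irreducible_chain :: "'a measure \<Rightarrow> real set \<Rightarrow> (int \<Rightarrow> 'a \<Rightarrow> real) \<Rightarrow> bool" where
  "irreducible_chain M S X \<longleftrightarrow> (\<forall>i\<in>S. \<forall>j\<in>S. \<exists>n\<ge>1. trans_prob M X n i j > 0)"

definition aperiodic_chain :: "'a measure \<Rightarrow> real set \<Rightarrow> (int \<Rightarrow> 'a \<Rightarrow> real) \<Rightarrow> bool" where
  "aperiodic_chain M S X \<longleftrightarrow> (\<forall>i\<in>S. Gcd {n. n \<ge> 1 \<and> trans_prob M X n i i > 0} = 1)"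

definition quantile_fun :: "'a measure \<Rightarrow> ('a \<Rightarrow> real) \<Rightarrow> real \<Rightarrow> real" where
  "quantile_fun M W u = Inf {t. t \<ge> 0 \<and> \<P>(\<omega> in M. W \<omega> > t) \<le> u}"

definition alpha_coeff :: "'a measure \<Rightarrow> 'a set set \<Rightarrow> 'a set set \<Rightarrow> real" where
  "alpha_coeff M \<A> \<B> =
     (SUP (A, B) \<in> \<A> \<times> \<B>. \<bar>measure M (A \<inter> B) - measure M A * measure M B\<bar>)"

text \<open>\<^const>\<open>partition_on\<close> excludes empty blocks; these would contribute \<open>0\<close> to the sum.\<close>

definition finite_partitions :: "'a measure \<Rightarrow> 'a set set \<Rightarrow> 'a set set set" where
  "finite_partitions M \<A> = {P. finite P \<and> P \<subseteq> \<A> \<and> partition_on (space M) P}"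

definition beta_coeff :: "'a measure \<Rightarrow> 'a set set \<Rightarrow> 'a set set \<Rightarrow> real" where
  "beta_coeff M \<A> \<B> =
     (SUP (P, Q) \<in> finite_partitions M \<A> \<times> finite_partitions M \<B>.
        1 / 2 * (\<Sum>A\<in>P. \<Sum>B\<in>Q. \<bar>measure M (A \<inter> B) - measure M A * measure M B\<bar>))"

definition gen_sigma :: "'a measure \<Rightarrow> (int \<Rightarrow> 'a \<Rightarrow> real) \<Rightarrow> int set \<Rightarrow> 'a set set" where
  "gen_sigma M X K = sigma_sets (space M) {X k -` B \<inter> space M | k B. k \<in> K \<and> B \<in> sets borel}"

definition alpha_mix :: "'a measure \<Rightarrow> (int \<Rightarrow> 'a \<Rightarrow> real) \<Rightarrow> nat \<Rightarrow> real" where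
  "alpha_mix M X n = alpha_coeff M (gen_sigma M X {..0}) (gen_sigma M X {int n..})"

definition beta_mix :: "'a measure \<Rightarrow> (int \<Rightarrow> 'a \<Rightarrow> real) \<Rightarrow> nat \<Rightarrow> real" where
  "beta_mix M X n = beta_coeff M (gen_sigma M X {..0}) (gen_sigma M X {int n..})"

definition partial_sum :: "(int \<Rightarrow> 'a \<Rightarrow> real) \<Rightarrow> nat \<Rightarrow> 'a \<Rightarrow> real" where
  "partial_sum X n \<omega> = (\<Sum>k=1..n. X (int k) \<omega>)"

definition normalized_variance :: "'a measure \<Rightarrow> (int \<Rightarrow> 'a \<Rightarrow> real) \<Rightarrow> nat \<Rightarrow> real" where
  "normalized_variance M X n = prob_space.variance M (partial_sum X n) / real n"

definition laplace_measure :: "real measure" where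
  "laplace_measure = density lborel (\<lambda>x. ennreal (1 / 2 * exp (- \<bar>x\<bar>)))"

text \<open>The product measure makes \<open>N\<close> and the sequence \<open>\<eta>\<close> independent and the \<open>\<eta>\<^sub>k\<close> i.i.d.;
  the unused coordinate \<open>\<eta> 0\<close> is harmless.\<close>

definition mu_P1sL :: "real measure" where
  "mu_P1sL =
     distr (measure_pmf (poisson_pmf 1) \<Otimes>\<^sub>M PiM (UNIV :: nat set) (\<lambda>_. laplace_measure)) borel
       (\<lambda>(N, \<eta>). \<Sum>k=1..N. \<eta> k)"

end

theory Submission
  imports Defs
begin

text \<open>The chain lives on the integers, organised in levels \<open>\<bar>z\<bar>\<close>. In one step a level \<open>j\<close> is drawn; a state in
  \<open>{-j..j}\<close> is then redrawn from the stationary law restricted to that cell, any other state stays. These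
  transition operators are conditional expectations on nested \<open>\<sigma>\<close>-algebras, so the chain is reversible and its
  powers are explicit: a state of level \<open>k\<close> is still frozen after \<open>n\<close> steps with probability \<open>\<theta>\<^sub>k\<^sup>n\<close>,
  \<open>\<theta>\<^sub>k = 1 - 1 / L\<^sub>k\<close>, which controls both \<open>\<beta>(n)\<close> and, for odd observables, all covariances. The observable
  takes the values \<open>\<plusminus> a\<^sub>k\<close> on level \<open>k\<close>, and the scales \<open>L\<^sub>k\<close> grow so fast that a single level at a time
  governs the partial sums. Over a stretch of \<open>L\<^sub>k / \<pi>\<^sub>k\<close> steps, \<open>\<pi>\<^sub>k\<close> being the probability of level \<open>k\<close>, that
  level is visited a Poisson number of times, each visit contributing a geometric holding time with a random sign;
  after rescaling this is the compound Poisson law with Laplace jumps. For arbitrary \<open>n\<close> one picks the level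
  \<open>k\<close> with \<open>k L\<^sub>k / \<pi>\<^sub>k \<le> n < (k + 1) L\<^sub>k\<^sub>+\<^sub>1 / \<pi>\<^sub>k\<^sub>+\<^sub>1\<close>: it is visited often enough for the
  characteristic function of \<open>S\<^sub>n / \<surd>n\<close> to tend to \<open>0\<close>.\<close>

section \<open>Two-sided stationary chains\<close>

text \<open>The obstacle is that \<open>g\<close> may grow arbitrarily slowly, while the variance
  ratio must still approach \<open>N\<close> and concentration must vanish along all
  \<open>n\<close>, not only along a subsequence. The freedom lies in \<open>L k\<close>: it is
  taken so large that level \<open>k\<close> stays invisible in the variance until \<open>g\<close>
  has outgrown all that levels up to \<open>k\<close> can ever contribute. The mass
  \<open>coef k * L k powr - p\<close> is dictated by the mixing rate: since exp (- y) \<le> (p / y)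
  powr p, a level with holding time \<open>L\<close> and mass \<open>c * L powr - p\<close> adds at
  most \<open>c * p powr p * n powr - p\<close>, and
  \<open>coef k = (1 / 2) ^ k / (4 * p powr p)\<close> makes these bounds sum to a quarter of
  \<open>n powr - p\<close>. The amplitude is then tuned so that the share of level \<open>k\<close>
  in the variance per step saturates at the order of \<open>height k\<close>. The heights
  \<open>2 ^ (k ^ 2)\<close> grow by the factor \<open>2 ^ (2 * k + 1)\<close>: already at time
  \<open>L k / 2 ^ k\<close>, where level \<open>k\<close> is still in its linear regime, it
  dominates all lower levels together, which yields the ratio \<open>N\<close>. The same factor
  makes the lower levels negligible in the limit law.\<close>

abbreviation (input) unit_unif :: "real measure" where
  "unit_unif \<equiv> restrict_space lborel {0<..<1}"

lemma prob_space_unit_unif: "prob_space unit_unif"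
  by (auto simp: emeasure_restrict_space space_restrict_space intro!: prob_spaceI)

text \<open>The quantile transform \<open>D.I\<close> realises the image of \<open>q\<close> on the
  reals from a uniform variable, and \<open>floor\<close> carries it back to the integers, being a
  left inverse of \<open>real_of_int\<close>.\<close>

lemma ex_sampler:
  fixes q :: "int pmf"
  shows "\<exists>F. F \<in> measurable unit_unif (count_space UNIV) \<and> distr unit_unif (count_space UNIV) F = measure_pmf q"
proof -
  define D where "D = distr (measure_pmf q) borel real_of_int"
  interpret D: real_distribution D
    unfolding D_def by (intro prob_space.real_distribution_distr) (auto intro: measure_pmf.prob_space_axioms)
  interpret D: cdf_distribution D ..
  have I: "D.I \<in> borel_measurable unit_unif"
    using D.measurable_CI by (simp cong: measurable_cong_sets add: sets_restrict_space)
  define F where "F = (\<lambda>u. \<lfloor>D.I u\<rfloor>)"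
  have F: "F \<in> measurable unit_unif (count_space UNIV)"
    unfolding F_def using I by measurable
  have "distr unit_unif (count_space UNIV) F = distr (distr unit_unif borel D.I) (count_space UNIV) floor"
    unfolding F_def using I by (subst distr_distr) (auto simp: comp_def)
  also have "\<dots> = distr D (count_space UNIV) floor"
    by (simp only: D.distr_I_eq_M)
  also have "\<dots> = distr (measure_pmf q) (count_space UNIV) (\<lambda>x. x)"
    unfolding D_def by (subst distr_distr) (auto simp: comp_def)
  also have "\<dots> = measure_pmf q"
    by (intro distr_id2) simp
  finally show ?thesis using F by blast
qed

definition sampler :: "int pmf \<Rightarrow> real \<Rightarrow> int" where
  "sampler q = (SOME F. F \<in> measurable unit_unif (count_space UNIV) \<and>
     distr unit_unif (count_space UNIV) F = measure_pmf q)"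

lemma
  shows measurable_sampler: "sampler q \<in> measurable unit_unif (count_space UNIV)"
    and distr_sampler: "distr unit_unif (count_space UNIV) (sampler q) = measure_pmf q"
  using someI_ex[OF ex_sampler[of q]] unfolding sampler_def by auto

lemma measure_sampler: "measure unit_unif (sampler q -` {y} \<inter> space unit_unif) = pmf q y"
proof -
  have "pmf q y = measure (distr unit_unif (count_space UNIV) (sampler q)) {y}"
    by (simp add: distr_sampler pmf.rep_eq)
  then show ?thesis
    by (simp add: measure_distr measurable_sampler)
qed

text \<open>The direction \<open>d\<close> is 1 or -1: the forward and the backward walk read the
  positive and the negative coordinates of \<open>\<omega>\<close> and share only coordinate 0,
  hence the starting state.\<close>

primrec sampled_walk :: "int pmf \<Rightarrow> (int \<Rightarrow> int pmf) \<Rightarrow> int \<Rightarrow> (int \<Rightarrow> real) \<Rightarrow> nat \<Rightarrow> int" where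
  "sampled_walk \<mu> K d \<omega> 0 = sampler \<mu> (\<omega> 0)"
| "sampled_walk \<mu> K d \<omega> (Suc n) = sampler (K (sampled_walk \<mu> K d \<omega> n)) (\<omega> (d * int (Suc n)))"

locale reversible_kernel =
  fixes \<mu> :: "int pmf" and K :: "int \<Rightarrow> int pmf"
  assumes detailed_balance: "pmf \<mu> x * pmf (K x) y = pmf \<mu> y * pmf (K y) x"
begin

definition path_weight :: "(int \<Rightarrow> int) \<Rightarrow> int \<Rightarrow> nat \<Rightarrow> real" where
  "path_weight s a n = pmf \<mu> (s a) * (\<Prod>i<n. pmf (K (s (a + int i))) (s (a + int i + 1)))"

lemma path_weight_Suc:
  "path_weight s a (Suc n) = path_weight s a n * pmf (K (s (a + int n))) (s (a + int n + 1))"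
  by (simp add: path_weight_def)

text \<open>Detailed balance moves the stationary factor one site to the left, so a path is
  prolonged into the past by the same kernel as into the future.\<close>

lemma path_weight_extend_left:
  "path_weight s (a - 1) (Suc n) = pmf (K (s a)) (s (a - 1)) * path_weight s a n"
proof -
  have "(\<Prod>i<Suc n. pmf (K (s (a - 1 + int i))) (s (a - 1 + int i + 1))) =
      pmf (K (s (a - 1))) (s a) * (\<Prod>i<n. pmf (K (s (a + int i))) (s (a + int i + 1)))"
    by (subst prod.lessThan_Suc_shift) simp
  then show ?thesis
    using detailed_balance[of "s (a - 1)" "s a"] by (simp add: path_weight_def mult_ac)
qed

text \<open>The form in which the construction below produces the weight: a state at time 0 and one
  walk outwards in each direction.\<close>

lemma path_weight_two_sided:
  "path_weight s (- int m) (m + n) =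
     pmf \<mu> (s 0) * (\<Prod>i<n. pmf (K (s (int i))) (s (int i + 1))) *
       (\<Prod>i<m. pmf (K (s (- int i))) (s (- int i - 1)))"
proof (induction m)
  case (Suc m)
  have "path_weight s (- int (Suc m)) (Suc m + n) =
      pmf (K (s (- int m))) (s (- int m - 1)) * path_weight s (- int m) (m + n)"
    using path_weight_extend_left[of s "- int m" "m + n"] by (simp add: algebra_simps minus_diff_commute)
  then show ?case
    by (simp add: Suc.IH mult_ac)
qed (simp add: path_weight_def)

end

locale stationary_chain = reversible_kernel \<mu> K + prob_space M
  for \<mu> :: "int pmf" and K :: "int \<Rightarrow> int pmf" and M :: "'a measure" +
  fixes Z :: "int \<Rightarrow> 'a \<Rightarrow> int"
  assumes measurable_Z [measurable]: "\<And>k. Z k \<in> measurable M (count_space UNIV)"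
    and prob_cylinder: "\<And>s a n. prob {\<omega> \<in> space M. \<forall>i\<in>{a..a + int n}. Z i \<omega> = s i} = path_weight s a n"

text \<open>The chain is a function of independent uniform variables indexed by the integers: time 0
  is drawn from \<open>\<mu>\<close>, and both halves are then driven by \<open>K\<close>. This
  gives the cylinder probabilities of windows around 0; all others are marginals of these.\<close>

lemma (in reversible_kernel) ex_stationary_chain:
  "\<exists>(M :: (int \<Rightarrow> real) measure) Z. stationary_chain \<mu> K M Z"
proof -
  interpret U: prob_space unit_unif by (rule prob_space_unit_unif)
  interpret P: product_prob_space "\<lambda>_. unit_unif" "UNIV :: int set" ..
  define M where "M = PiM (UNIV :: int set) (\<lambda>_. unit_unif)"
  define W where "W = sampled_walk \<mu> K"
  define Z where "Z = (\<lambda>k \<omega>. if k \<ge> 0 then W 1 \<omega> (nat k) else W (- 1) \<omega> (nat (- k)))"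
  have spM: "space M = UNIV \<rightarrow>\<^sub>E {0<..<1}"
    by (simp add: M_def space_PiM space_restrict_space)
  have mW: "(\<lambda>\<omega>. W d \<omega> n) \<in> measurable M (count_space UNIV)" for d n
  proof (induction n)
    case 0
    have "(\<lambda>\<omega>. \<omega> 0) \<in> measurable M unit_unif" unfolding M_def by simp
    from measurable_compose[OF this measurable_sampler] show ?case by (simp add: W_def)
  next
    case (Suc n)
    have c: "(\<lambda>\<omega>. \<omega> (d * int (Suc n))) \<in> measurable M unit_unif" unfolding M_def by simp
    have *: "(\<lambda>\<omega>. sampler (K z) (\<omega> (d * int (Suc n)))) \<in> measurable M (count_space UNIV)" for z
      by (rule measurable_compose[OF c measurable_sampler])
    have "(\<lambda>\<omega>. (\<lambda>z \<omega>. sampler (K z) (\<omega> (d * int (Suc n)))) (W d \<omega> n) \<omega>) \<in> measurable M (count_space UNIV)"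
      by (rule measurable_compose_countable[OF * Suc])
    then show ?case by (simp add: W_def)
  qed
  have mZ: "Z k \<in> measurable M (count_space UNIV)" for k
    unfolding Z_def using mW by simp
  have Zp: "Z (k + 1) \<omega> = sampler (K (Z k \<omega>)) (\<omega> (k + 1))" if "k \<ge> 0" for k \<omega>
  proof -
    have "nat (k + 1) = Suc (nat k)" "int (Suc (nat k)) = k + 1" using that by auto
    then show ?thesis using that by (simp add: Z_def W_def add.commute)
  qed
  have Zn: "Z (k - 1) \<omega> = sampler (K (Z k \<omega>)) (\<omega> (k - 1))" if "k \<le> 0" for k \<omega>
  proof -
    have "nat (- (k - 1)) = Suc (nat (- k))" "- int (Suc (nat (- k))) = k - 1" using that by auto
    moreover have "Z 0 \<omega> = W (- 1) \<omega> 0" by (simp add: Z_def W_def)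
    ultimately show ?thesis using that by (cases "k = 0") (simp_all add: Z_def W_def)
  qed
  have Z0: "Z 0 \<omega> = sampler \<mu> (\<omega> 0)" for \<omega>
    by (simp add: Z_def W_def)
  \<comment> \<open>Once the path \<open>s\<close> is prescribed, the kernel used at time
    \<open>i\<close> is known: it is the one at the neighbour of \<open>i\<close> nearer to 0. The
    event therefore factors into conditions on single independent coordinates.\<close>
  have two_sided: "measure M {\<omega> \<in> space M. \<forall>i\<in>{- int m..int n}. Z i \<omega> = s i} =
      path_weight s (- int m) (m + n)" for s m n
  proof -
    define q where "q = (\<lambda>i::int. if i = 0 then \<mu> else if i > 0 then K (s (i - 1)) else K (s (i + 1)))"
    define A where "A = (\<lambda>i. sampler (q i) -` {s i} \<inter> space unit_unif)"
    have *: "(\<forall>i\<in>{- int m..int n}. Z i \<omega> = s i) \<longleftrightarrow> (\<forall>i\<in>{- int m..int n}. sampler (q i) (\<omega> i) = s i)" for \<omega>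
    proof
      assume L: "\<forall>i\<in>{- int m..int n}. Z i \<omega> = s i"
      show "\<forall>i\<in>{- int m..int n}. sampler (q i) (\<omega> i) = s i"
      proof
        fix i assume i: "i \<in> {- int m..int n}"
        consider "i = 0" | "i > 0" | "i < 0" by linarith
        then show "sampler (q i) (\<omega> i) = s i"
        proof cases
          case 1
          have "Z 0 \<omega> = s 0" using L by auto
          then show ?thesis using 1 Z0[of \<omega>] by (simp add: q_def)
        next
          case 2 then show ?thesis using L i Zp[of "i - 1" \<omega>] by (auto simp: q_def)
        next
          case 3 then show ?thesis using L i Zn[of "i + 1" \<omega>] by (auto simp: q_def)
        qed
      qed
    next
      assume R: "\<forall>i\<in>{- int m..int n}. sampler (q i) (\<omega> i) = s i"
      have pos: "k \<le> n \<Longrightarrow> Z (int k) \<omega> = s (int k)" for k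
      proof (induction k)
        case 0
        have "sampler (q 0) (\<omega> 0) = s 0" using R by auto
        then show ?case using Z0[of \<omega>] by (simp add: q_def)
      next
        case (Suc k)
        have "sampler (q (int k + 1)) (\<omega> (int k + 1)) = s (int k + 1)" using R Suc.prems by auto
        then show ?case using Suc Zp[of "int k" \<omega>] by (auto simp: q_def add.commute)
      qed
      have neg: "k \<le> m \<Longrightarrow> Z (- int k) \<omega> = s (- int k)" for k
      proof (induction k)
        case 0
        then show ?case using pos[of 0] by simp
      next
        case (Suc k)
        have "sampler (q (- int k - 1)) (\<omega> (- int k - 1)) = s (- int k - 1)" using R Suc.prems by auto
        moreover have "- int (Suc k) = - int k - 1" by simp
        ultimately show ?case using Suc.IH Suc.prems Zn[of "- int k" \<omega>] by (simp only:) (simp add: q_def)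
      qed
      show "\<forall>i\<in>{- int m..int n}. Z i \<omega> = s i"
      proof
        fix i assume i: "i \<in> {- int m..int n}"
        show "Z i \<omega> = s i"
          using i pos[of "nat i"] neg[of "nat (- i)"] by (cases "i \<ge> 0") auto
      qed
    qed
    have I_eq: "{- int m..int n} = insert 0 ((\<lambda>i. int i + 1) ` {..<n} \<union> (\<lambda>i. - int i - 1) ` {..<m})" (is "_ = insert 0 (?P \<union> ?N)")
    proof (intro set_eqI iffI)
      fix i assume i: "i \<in> {- int m..int n}"
      consider "i = 0" | "i > 0" | "i < 0" by linarith
      then show "i \<in> insert 0 (?P \<union> ?N)"
      proof cases
        case 2
        then have "i = int (nat (i - 1)) + 1" "nat (i - 1) \<in> {..<n}" using i by auto
        then show ?thesis by blast
      next
        case 3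
        then have "i = - int (nat (- i - 1)) - 1" "nat (- i - 1) \<in> {..<m}" using i by auto
        then show ?thesis by blast
      qed simp
    qed auto
    have "{\<omega> \<in> space M. \<forall>i\<in>{- int m..int n}. Z i \<omega> = s i} =
        {\<omega> \<in> space (PiM UNIV (\<lambda>_. unit_unif)). \<forall>i\<in>{- int m..int n}. \<omega> i \<in> A i}"
      unfolding * by (auto simp: spM A_def space_restrict_space space_PiM M_def PiE_def Pi_def)
    also have "measure M \<dots> = (\<Prod>i\<in>{- int m..int n}. measure unit_unif (A i))"
      unfolding M_def
      using P.emeasure_PiM_Collect[of "{- int m..int n}" A] measurable_sets[OF measurable_sampler]
      by (simp add: A_def P.emeasure_eq_measure U.emeasure_eq_measure prod_ennreal measure_nonneg prod_nonneg)
    also have "\<dots> = (\<Prod>i\<in>{- int m..int n}. pmf (q i) (s i))"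
      by (simp only: A_def measure_sampler)
    also have "\<dots> = (\<Prod>i\<in>insert 0 (?P \<union> ?N). pmf (q i) (s i))"
      by (simp only: I_eq)
    also have "\<dots> =
        pmf (q 0) (s 0) * ((\<Prod>i\<in>?P. pmf (q i) (s i)) * (\<Prod>i\<in>?N. pmf (q i) (s i)))"
      by (subst prod.insert, simp, force, subst prod.union_disjoint) auto
    also have "(\<Prod>i\<in>?P. pmf (q i) (s i)) = (\<Prod>i<n. pmf (K (s (int i))) (s (int i + 1)))"
      by (subst prod.reindex) (auto simp: inj_on_def q_def intro!: prod.cong)
    also have "(\<Prod>i\<in>?N. pmf (q i) (s i)) = (\<Prod>i<m. pmf (K (s (- int i))) (s (- int i - 1)))"
      by (subst prod.reindex) (auto simp: inj_on_def q_def intro!: prod.cong)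
    finally show ?thesis
      unfolding path_weight_two_sided by (simp add: q_def)
  qed
  interpret M: prob_space M unfolding M_def by (rule P.P.prob_space_axioms)
  \<comment> \<open>Removes one index from a window by summing over the state there; the factor
    \<open>pmf q z\<close> sums to 1.\<close>
  have shrink: "measure M {\<omega> \<in> space M. \<forall>i\<in>I. Z i \<omega> = s i} = c"
    if I: "finite I" "j \<notin> I"
      and ext: "\<And>z. measure M {\<omega> \<in> space M. \<forall>i\<in>insert j I. Z i \<omega> = (s(j := z)) i} = c * pmf q z"
    for I j s c and q :: "int pmf"
  proof -
    have ev: "{\<omega> \<in> space M. \<forall>i\<in>J. Z i \<omega> = t i} \<in> sets M" if "finite J" for J t
      using that mZ by measurable
    \<comment> \<open>A state of positive weight shows \<open>c\<close> to be nonnegative, without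
      which the passage to \<open>ennreal\<close> would lose information.\<close>
    obtain z where "z \<in> set_pmf q" using set_pmf_not_empty[of q] by blast
    then have "pmf q z > 0" by (rule pmf_positive)
    moreover have "c * pmf q z \<ge> 0" unfolding ext[symmetric] by simp
    ultimately have c: "c \<ge> 0" by (simp add: zero_le_mult_iff)
    have "emeasure M {\<omega> \<in> space M. \<forall>i\<in>I. Z i \<omega> = s i} =
        emeasure M (\<Union>z. {\<omega> \<in> space M. \<forall>i\<in>insert j I. Z i \<omega> = (s(j := z)) i})"
      using I by (intro arg_cong[where f = "emeasure M"]) (auto split: if_splits)
    also have "\<dots> = (\<integral>\<^sup>+z. emeasure M {\<omega> \<in> space M. \<forall>i\<in>insert j I. Z i \<omega> = (s(j := z)) i} \<partial>count_space UNIV)"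
    proof (intro emeasure_UN_countable)
      show "disjoint_family (\<lambda>z. {\<omega> \<in> space M. \<forall>i\<in>insert j I. Z i \<omega> = (s(j := z)) i})"
        by (auto simp: disjoint_family_on_def)
      show "{\<omega> \<in> space M. \<forall>i\<in>insert j I. Z i \<omega> = (s(j := z)) i} \<in> sets M" for z
        by (rule ev) (use I in simp)
    qed simp
    also have "\<dots> = (\<integral>\<^sup>+z. ennreal c * ennreal (pmf q z) \<partial>count_space UNIV)"
      using c by (simp only: M.emeasure_eq_measure ext ennreal_mult pmf_nonneg)
    also have "\<dots> = ennreal c"
      by (simp add: nn_integral_cmult nn_integral_pmf)
    finally show ?thesis
      using c by (simp add: M.emeasure_eq_measure)
  qed
  define cyl where "cyl = (\<lambda>a n. \<forall>s. measure M {\<omega> \<in> space M. \<forall>i\<in>{a..a + int n}. Z i \<omega> = s i} = path_weight s a n)"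
  have right: "cyl a (n + k) \<Longrightarrow> cyl a n" for a n k
  proof (induction k)
    case (Suc k)
    have "cyl a (n + k)"
      unfolding cyl_def
    proof (intro allI shrink)
      fix s z
      have "insert (a + int (n + k) + 1) {a..a + int (n + k)} = {a..a + int (n + Suc k)}" by auto
      moreover have "path_weight (s(a + int (n + k) + 1 := z)) a (n + Suc k) =
          path_weight s a (n + k) * pmf (K (s (a + int (n + k)))) z"
        by (simp add: path_weight_Suc) (simp add: path_weight_def)
      ultimately show "measure M {\<omega> \<in> space M. \<forall>i\<in>insert (a + int (n + k) + 1) {a..a + int (n + k)}.
          Z i \<omega> = (s(a + int (n + k) + 1 := z)) i} = path_weight s a (n + k) * pmf (K (s (a + int (n + k)))) z"
        using Suc.prems unfolding cyl_def by metis
    qed auto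
    then show ?case by (rule Suc.IH)
  qed simp
  have left: "cyl (a - int k) (n + k) \<Longrightarrow> cyl a n" for a n k
  proof (induction k)
    case (Suc k)
    have "cyl (a - int k) (n + k)"
      unfolding cyl_def
    proof (intro allI shrink)
      fix s z
      have "insert (a - int k - 1) {a - int k..a - int k + int (n + k)} =
          {a - int (Suc k)..a - int (Suc k) + int (n + Suc k)}" by auto
      moreover have "path_weight (s(a - int k - 1 := z)) (a - int (Suc k)) (n + Suc k) =
          path_weight s (a - int k) (n + k) * pmf (K (s (a - int k))) z"
        using path_weight_extend_left[of "s(a - int k - 1 := z)" "a - int k" "n + k"]
        by (simp add: algebra_simps) (simp add: path_weight_def)
      ultimately show "measure M {\<omega> \<in> space M. \<forall>i\<in>insert (a - int k - 1) {a - int k..a - int k + int (n + k)}.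
          Z i \<omega> = (s(a - int k - 1 := z)) i} = path_weight s (a - int k) (n + k) * pmf (K (s (a - int k))) z"
        using Suc.prems unfolding cyl_def by metis
    qed auto
    then show ?case by (rule Suc.IH)
  qed simp
  \<comment> \<open>The window from \<open>- m\<close> to \<open>m + n\<close> contains 0 and the
    window wanted; it is cut on the right and then on the left.\<close>
  have "cyl a n" for a n
  proof -
    define m where "m = nat \<bar>a\<bar>"
    have "cyl (- int m) (m + (m + n))"
      using two_sided[of m "m + n"] by (simp add: cyl_def)
    moreover have "m + (m + n) = (n + nat (a + int m)) + (2 * m - nat (a + int m))"
      unfolding m_def by (cases "a \<ge> 0") (auto simp: nat_add_distrib)
    ultimately have "cyl (- int m) (n + nat (a + int m))"
      using right by metis
    moreover have "- int m = a - int (nat (a + int m))"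
      unfolding m_def by auto
    ultimately show ?thesis using left by metis
  qed
  then have "stationary_chain \<mu> K M Z"
    by unfold_locales (use mZ in \<open>auto simp: cyl_def\<close>)
  then show ?thesis by blast
qed

section \<open>Trajectories and tilted operators\<close>

lemma integrable_pmf_bounded:
  fixes f :: "'a \<Rightarrow> 'b::{banach, second_countable_topology}"
  assumes "\<And>x. x \<in> set_pmf p \<Longrightarrow> norm (f x) \<le> B"
  shows "integrable (measure_pmf p) f"
  using assms by (intro measure_pmf.integrable_const_bound[where B = B]) (auto intro!: AE_pmfI)

lemma norm_integral_pmf_le:
  fixes f :: "'a \<Rightarrow> 'b::{banach, second_countable_topology}"
  assumes "\<And>x. x \<in> set_pmf p \<Longrightarrow> norm (f x) \<le> B"
  shows "norm (integral\<^sup>L (measure_pmf p) f) \<le> B"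
proof -
  have "norm (integral\<^sup>L (measure_pmf p) f) \<le> (LINT x|measure_pmf p. norm (f x))"
    by (rule integral_norm_bound)
  also have "\<dots> \<le> (LINT x|measure_pmf p. B)"
    using assms by (intro integral_mono_AE AE_pmfI integrable_pmf_bounded[where B = B]
        measure_pmf.integrable_const) auto
  finally show ?thesis by simp
qed

lemma integral_bind_pmf_real:
  fixes f :: "'a \<Rightarrow> real"
  assumes "\<And>x. \<bar>f x\<bar> \<le> B"
  shows "integral\<^sup>L (measure_pmf (bind_pmf p q)) f = (LINT x|measure_pmf p. integral\<^sup>L (measure_pmf (q x)) f)"
  unfolding measure_pmf_bind
  by (rule integral_bind[where K = "count_space UNIV" and B = B and B' = 1])
     (use assms measure_pmf.finite_measure_axioms in \<open>auto simp: measure_pmf.emeasure_space_1[simplified] measure_pmf_in_subprob_algebra\<close>)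

lemma integral_bind_pmf_complex:
  fixes f :: "'a \<Rightarrow> complex"
  assumes B: "\<And>x. norm (f x) \<le> B"
  shows "integral\<^sup>L (measure_pmf (bind_pmf p q)) f = (LINT x|measure_pmf p. integral\<^sup>L (measure_pmf (q x)) f)"
proof -
  have R: "\<bar>Re (f x)\<bar> \<le> B" and I: "\<bar>Im (f x)\<bar> \<le> B" for x
    using B[of x] abs_Re_le_cmod[of "f x"] abs_Im_le_cmod[of "f x"] by linarith+
  have i: "integrable (measure_pmf r) f" for r
    using B by (rule integrable_pmf_bounded)
  have j: "integrable (measure_pmf p) (\<lambda>x. integral\<^sup>L (measure_pmf (q x)) f)"
    by (rule integrable_pmf_bounded[where B = B], rule norm_integral_pmf_le) (rule B)
  show ?thesis
  proof (rule complex_eqI)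
    have "Re (integral\<^sup>L (measure_pmf (bind_pmf p q)) f) = (LINT x|measure_pmf (bind_pmf p q). Re (f x))"
      by (rule integral_Re[symmetric, OF i])
    also have "\<dots> = (LINT x|measure_pmf p. LINT y|measure_pmf (q x). Re (f y))"
      by (rule integral_bind_pmf_real[OF R])
    also have "\<dots> = (LINT x|measure_pmf p. Re (integral\<^sup>L (measure_pmf (q x)) f))"
      by (simp only: integral_Re[OF i])
    finally show "Re (integral\<^sup>L (measure_pmf (bind_pmf p q)) f) =
        Re (LINT x|measure_pmf p. integral\<^sup>L (measure_pmf (q x)) f)"
      by (simp only: integral_Re[OF j])
    have "Im (integral\<^sup>L (measure_pmf (bind_pmf p q)) f) = (LINT x|measure_pmf (bind_pmf p q). Im (f x))"
      by (rule integral_Im[symmetric, OF i])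
    also have "\<dots> = (LINT x|measure_pmf p. LINT y|measure_pmf (q x). Im (f y))"
      by (rule integral_bind_pmf_real[OF I])
    also have "\<dots> = (LINT x|measure_pmf p. Im (integral\<^sup>L (measure_pmf (q x)) f))"
      by (simp only: integral_Im[OF i])
    finally show "Im (integral\<^sup>L (measure_pmf (bind_pmf p q)) f) =
        Im (LINT x|measure_pmf p. integral\<^sup>L (measure_pmf (q x)) f)"
      by (simp only: integral_Im[OF j])
  qed
qed

text \<open>Trajectories are recorded as lists with the most recent state first.\<close>

definition trail :: "(int \<Rightarrow> 'b) \<Rightarrow> int \<Rightarrow> nat \<Rightarrow> 'b list" where
  "trail s a n = rev (map (\<lambda>i. s (a + int i)) [0..<Suc n])"

lemma trail_0 [simp]: "trail s a 0 = [s a]"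
  and trail_Suc [simp]: "trail s a (Suc n) = s (a + int n + 1) # trail s a n"
  by (simp_all add: trail_def algebra_simps)

lemma length_trail [simp]: "length (trail s a n) = Suc n"
  by (induction n) auto

lemma nth_trail: "i \<le> n \<Longrightarrow> trail s a n ! i = s (a + int n - int i)"
proof -
  assume i: "i \<le> n"
  have "[0..<Suc n] ! (n - i) = n - i" using nth_upt[of 0 "n - i" "Suc n"] by simp
  then show ?thesis using i
    by (simp add: trail_def rev_nth of_nat_diff add_diff_eq del: upt_Suc)
qed

lemma hd_trail [simp]: "hd (trail s a n) = s (a + int n)"
  by (cases n) (auto simp: algebra_simps)

lemma last_trail [simp]: "last (trail s a n) = s a"
  by (induction n) (auto simp: trail_def)

lemma trail_neq_Nil [simp]: "trail s a n \<noteq> []"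
  by (cases n) auto

lemma trail_eq_iff: "trail s a n = trail t a n \<longleftrightarrow> (\<forall>i\<in>{a..a + int n}. s i = t i)"
proof (induction n)
  case (Suc n)
  have "{a..a + int (Suc n)} = insert (a + int n + 1) {a..a + int n}" by auto
  then show ?case by (simp add: Suc.IH)
qed auto

lemma take_trail: "n \<le> n' \<Longrightarrow> take (Suc n) (trail s (m - int n') n') = trail s (m - int n) n"
  by (rule nth_equalityI) (auto simp: nth_trail)

lemma drop_trail: "n \<le> n' \<Longrightarrow> drop (n' - n) (trail s m n') = trail s m n"
  by (rule nth_equalityI) (auto simp: nth_trail of_nat_diff add_diff_eq)

section \<open>Path laws and tilted operators of a reversible kernel\<close>

context reversible_kernel
begin

lemma bind_kernel: "bind_pmf \<mu> K = \<mu>"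
proof (rule pmf_eqI)
  fix y
  have "ennreal (pmf (bind_pmf \<mu> K) y) = (\<integral>\<^sup>+x. ennreal (pmf \<mu> x) * ennreal (pmf (K x) y) \<partial>count_space UNIV)"
    by (simp add: ennreal_pmf_bind nn_integral_measure_pmf)
  also have "\<dots> = (\<integral>\<^sup>+x. ennreal (pmf \<mu> y) * ennreal (pmf (K y) x) \<partial>count_space UNIV)"
    by (simp only: ennreal_mult'[symmetric] pmf_nonneg detailed_balance[of _ y])
  also have "\<dots> = ennreal (pmf \<mu> y)"
    by (simp add: nn_integral_cmult nn_integral_pmf)
  finally show "pmf (bind_pmf \<mu> K) y = pmf \<mu> y" by simp
qed

primrec path_pmf :: "nat \<Rightarrow> int list pmf" where
  "path_pmf 0 = map_pmf (\<lambda>z. [z]) \<mu>"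
| "path_pmf (Suc n) = bind_pmf (path_pmf n) (\<lambda>l. map_pmf (\<lambda>y. y # l) (K (hd l)))"

lemma pmf_path_pmf: "pmf (path_pmf n) (trail s a n) = path_weight s a n"
proof (induction n)
  case 0
  have "pmf (map_pmf (\<lambda>z. [z]) \<mu>) [s a] = pmf \<mu> (s a)"
    by (rule pmf_map_inj') (auto simp: inj_on_def)
  then show ?case by (simp add: path_weight_def)
next
  case (Suc n)
  have *: "pmf (map_pmf (\<lambda>y. y # l) p) (y # l') = indicator {l'} l * pmf p y" for l l' y and p :: "int pmf"
  proof (cases "l = l'")
    case True
    then show ?thesis using pmf_map_inj'[of "\<lambda>y. y # l'" p y] by (simp add: inj_on_def)
  next
    case False
    then have "y # l' \<notin> set_pmf (map_pmf (\<lambda>y. y # l) p)" by auto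
    then show ?thesis using False by (simp add: pmf_eq_0_set_pmf)
  qed
  have "pmf (path_pmf (Suc n)) (trail s a (Suc n)) =
      (LINT l|measure_pmf (path_pmf n). indicator {trail s a n} l * pmf (K (hd l)) (s (a + int n + 1)))"
    by (simp add: pmf_bind *)
  also have "\<dots> = pmf (path_pmf n) (trail s a n) * pmf (K (s (a + int n))) (s (a + int n + 1))"
    by (subst integral_measure_pmf_real[where A = "{trail s a n}"]) (auto simp: indicator_def)
  finally show ?case by (simp add: Suc.IH path_weight_Suc)
qed

lemma set_path_pmf: "l \<in> set_pmf (path_pmf n) \<Longrightarrow> \<exists>s. l = trail s a n"
proof (induction n arbitrary: l)
  case 0
  then obtain z where "l = [z]" by auto
  then show ?case by (intro exI[of _ "\<lambda>_. z"]) simp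
next
  case (Suc n)
  then obtain l' y where l: "l = y # l'" and "l' \<in> set_pmf (path_pmf n)" by auto
  with Suc.IH obtain s where "l' = trail s a n" by blast
  then have "l = trail (s(a + int n + 1 := y)) a (Suc n)"
    using l by (auto simp: trail_eq_iff)
  then show ?case by blast
qed

primrec step_pow :: "nat \<Rightarrow> int \<Rightarrow> int pmf" where
  "step_pow 0 x = return_pmf x"
| "step_pow (Suc n) x = bind_pmf (step_pow n x) K"

lemma endpoints_path_pmf:
  "map_pmf (\<lambda>l. (last l, hd l)) (path_pmf n) = bind_pmf \<mu> (\<lambda>x. map_pmf (Pair x) (step_pow n x))"
proof (induction n)
  case 0
  show ?case by (simp add: map_pmf_comp) (simp add: map_pmf_def)
next
  case (Suc n)
  have "map_pmf (\<lambda>l. (last l, hd l)) (path_pmf (Suc n)) =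
      bind_pmf (path_pmf n) (\<lambda>l. map_pmf (Pair (last l)) (K (hd l)))"
    unfolding path_pmf.simps map_bind_pmf map_pmf_comp
  proof (rule bind_pmf_cong[OF refl], rule map_pmf_cong[OF refl])
    fix l z assume "l \<in> set_pmf (path_pmf n)"
    then have "l \<noteq> []" using set_path_pmf[of l n 0] by auto
    then show "(last (z # l), hd (z # l)) = (last l, z)" by simp
  qed
  also have "\<dots> = bind_pmf (map_pmf (\<lambda>l. (last l, hd l)) (path_pmf n)) (\<lambda>(x, y). map_pmf (Pair x) (K y))"
    by (simp add: bind_map_pmf)
  also have "\<dots> = bind_pmf \<mu> (\<lambda>x. map_pmf (Pair x) (step_pow (Suc n) x))"
    by (simp add: Suc.IH bind_assoc_pmf bind_map_pmf map_bind_pmf)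
  finally show ?case .
qed

primrec path_fun :: "(int \<Rightarrow> complex) \<Rightarrow> (int \<Rightarrow> complex) \<Rightarrow> int list \<Rightarrow> complex" where
  "path_fun f u [] = 0"
| "path_fun f u (y # l) = (if l = [] then f y else u y * path_fun f u l)"

lemma path_fun_trail: "path_fun f u (trail s a n) = f (s a) * (\<Prod>i=1..n. u (s (a + int i)))"
  by (induction n) (auto simp: algebra_simps)

text \<open>The Feynman-Kac operator: multiply by \<open>u\<close>, then apply \<open>K\<close>.
  With \<open>u = cis (t * val)\<close> the stationary mean of its \<open>n\<close>-th power at the
  constant 1 is the characteristic function of the \<open>n\<close>-th partial sum.\<close>

definition tilt :: "(int \<Rightarrow> complex) \<Rightarrow> (int \<Rightarrow> complex) \<Rightarrow> int \<Rightarrow> complex" where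
  "tilt u h x = (LINT y|measure_pmf (K x). u y * h y)"

lemma norm_tilt_le:
  assumes "\<And>x. norm (u x) \<le> 1" "\<And>x. norm (h x) \<le> B"
  shows "norm (tilt u h x) \<le> B"
  unfolding tilt_def
proof (rule norm_integral_pmf_le)
  fix y
  have "norm (u y) * norm (h y) \<le> 1 * B" using assms by (intro mult_mono) auto
  then show "norm (u y * h y) \<le> B" by (simp add: norm_mult)
qed

lemma norm_tilt_pow_le:
  assumes "\<And>x. norm (u x) \<le> 1" "\<And>x. norm (h x) \<le> B"
  shows "norm ((tilt u ^^ n) h x) \<le> B"
  using assms by (induction n arbitrary: x) (auto intro!: norm_tilt_le)

text \<open>The induction peels off the most recent state and absorbs it into \<open>h\<close>,
  which is why \<open>h\<close> is general.\<close>

lemma integral_path_pmf: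
  assumes f: "\<And>x. norm (f x) \<le> B" and u: "\<And>x. norm (u x) \<le> 1" and h: "\<And>x. norm (h x) \<le> B'"
  shows "(LINT l|measure_pmf (path_pmf n). path_fun f u l * h (hd l)) = (LINT x|measure_pmf \<mu>. f x * (tilt u ^^ n) h x)"
  using h
proof (induction n arbitrary: h)
  case 0
  then show ?case by simp
next
  case (Suc n)
  have B0: "0 \<le> B" "0 \<le> B'" using f[of 0] Suc.prems[of 0] norm_ge_zero order_trans by blast+
  have pf: "norm (path_fun f u l) \<le> B" for l
  proof (induction l)
    case (Cons y l)
    have "norm (u y) * norm (path_fun f u l) \<le> 1 * B" using Cons u by (intro mult_mono) auto
    then show ?case using f by (auto simp: norm_mult)
  qed (use B0 in simp)
  have "(LINT l|measure_pmf (path_pmf (Suc n)). path_fun f u l * h (hd l)) =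
      (LINT l|measure_pmf (path_pmf n). LINT y|measure_pmf (K (hd l)). path_fun f u (y # l) * h y)"
    unfolding path_pmf.simps
    by (subst integral_bind_pmf_complex[where B = "B * B'"])
       (auto simp: norm_mult intro!: mult_mono pf Suc.prems B0)
  also have "\<dots> = (LINT l|measure_pmf (path_pmf n). path_fun f u l * tilt u h (hd l))"
  proof (intro integral_cong_AE AE_pmfI)
    fix l assume "l \<in> set_pmf (path_pmf n)"
    then have "l \<noteq> []" using set_path_pmf[of l n 0] by auto
    then show "(LINT y|measure_pmf (K (hd l)). path_fun f u (y # l) * h y) = path_fun f u l * tilt u h (hd l)"
      by (simp add: tilt_def mult_ac flip: integral_mult_right_zero)
  qed auto
  also have "\<dots> = (LINT x|measure_pmf \<mu>. f x * (tilt u ^^ n) (tilt u h) x)"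
    by (rule Suc.IH) (rule norm_tilt_le[OF u Suc.prems])
  finally show ?case by (simp only: funpow_Suc_right comp_apply)
qed

text \<open>As \<open>u\<close> has modulus at most 1 and \<open>\<mu>\<close> is invariant, tilting
  contracts the \<open>L1\<close> norm under \<open>\<mu>\<close>. An error made in one step
  therefore does not grow in the later ones.\<close>

lemma integral_norm_tilt_pow_le:
  assumes u: "\<And>x. norm (u x) \<le> 1" and h: "\<And>x. norm (h x) \<le> B"
  shows "(LINT x|measure_pmf \<mu>. norm ((tilt u ^^ n) h x)) \<le> (LINT x|measure_pmf \<mu>. norm (h x))"
proof (induction n)
  case (Suc n)
  define g where "g = (tilt u ^^ n) h"
  have g: "norm (g x) \<le> B" for x unfolding g_def by (rule norm_tilt_pow_le[OF u h])
  have i: "integrable (measure_pmf p) (\<lambda>x. norm (g x))" for p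
    by (rule integrable_pmf_bounded[where B = B]) (use g in auto)
  have t: "norm (tilt u g x) \<le> (LINT y|measure_pmf (K x). norm (g y))" for x
  proof -
    have "norm (tilt u g x) \<le> (LINT y|measure_pmf (K x). norm (u y * g y))"
      unfolding tilt_def by (rule integral_norm_bound)
    also have "\<dots> \<le> (LINT y|measure_pmf (K x). norm (g y))"
    proof (rule integral_mono_AE)
      have "norm (u y * g y) \<le> 1 * norm (g y)" for y
        unfolding norm_mult using u by (intro mult_right_mono) auto
      moreover from this have "norm (norm (u y * g y)) \<le> B" for y
        using g[of y] order_trans by fastforce
      ultimately show "AE y in measure_pmf (K x). norm (u y * g y) \<le> norm (g y)"
        "integrable (measure_pmf (K x)) (\<lambda>y. norm (u y * g y))"
        by (auto intro: integrable_pmf_bounded[where B = B])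
    qed (rule i)
    finally show ?thesis .
  qed
  have "(LINT x|measure_pmf \<mu>. norm (tilt u g x)) \<le> (LINT x|measure_pmf \<mu>. LINT y|measure_pmf (K x). norm (g y))"
  proof (rule integral_mono_AE)
    show "integrable (measure_pmf \<mu>) (\<lambda>x. norm (tilt u g x))"
      by (rule integrable_pmf_bounded[where B = B]) (use norm_tilt_le[OF u g] in auto)
    show "integrable (measure_pmf \<mu>) (\<lambda>x. LINT y|measure_pmf (K x). norm (g y))"
      by (rule integrable_pmf_bounded[where B = B], rule norm_integral_pmf_le) (use g in auto)
  qed (use t in auto)
  also have "\<dots> = (LINT y|measure_pmf (bind_pmf \<mu> K). norm (g y))"
    by (rule integral_bind_pmf_real[symmetric, where B = B]) (use g in auto)
  also have "\<dots> \<le> (LINT x|measure_pmf \<mu>. norm (h x))"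
    using Suc.IH unfolding bind_kernel g_def .
  finally show ?case unfolding g_def by simp
qed simp

end

section \<open>Conditional independence of past and future\<close>

lemma ball_image_iff: "(\<forall>x\<in>f ` A. P x) \<longleftrightarrow> (\<forall>x\<in>A. P (f x))"
  by blast

context reversible_kernel
begin

text \<open>The Markov property as an identity of products, free of division by a possibly null
  weight.\<close>

lemma path_weight_split:
  "path_weight s a (n + k) * pmf \<mu> (s (a + int n)) = path_weight s a n * path_weight s (a + int n) k"
proof -
  have "(\<Prod>i<n + k. pmf (K (s (a + int i))) (s (a + int i + 1))) =
      (\<Prod>i<n. pmf (K (s (a + int i))) (s (a + int i + 1))) *
      (\<Prod>i<k. pmf (K (s (a + int n + int i))) (s (a + int n + int i + 1)))"
    by (induction k) (auto simp: algebra_simps)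
  then show ?thesis by (simp add: path_weight_def)
qed

lemma path_weight_shift: "path_weight (\<lambda>i. s (i + m)) a n = path_weight s (a + m) n"
  by (simp add: path_weight_def algebra_simps)

lemma path_weight_reverse: "path_weight (\<lambda>i. s (- i)) (- a - int n) n = path_weight s a n"
proof (induction n)
  case (Suc n)
  have "path_weight (\<lambda>i. s (- i)) (- a - int n - 1) (Suc n) =
      pmf (K (s (a + int n))) (s (a + int n + 1)) * path_weight (\<lambda>i. s (- i)) (- a - int n) n"
    by (subst path_weight_extend_left) (simp add: algebra_simps)
  moreover have "- a - int (Suc n) = - a - int n - 1" by simp
  ultimately show ?case by (simp only: Suc.IH path_weight_Suc mult.commute)
qed (simp add: path_weight_def)

end

section \<open>Laws of observed trajectories\<close>

context stationary_chain
begin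

abbreviation "obs a n \<omega> \<equiv> trail (\<lambda>i. Z i \<omega>) a n"

lemma obs_event_eq: "{\<omega> \<in> space M. obs a n \<omega> = trail s a n} = {\<omega> \<in> space M. \<forall>i\<in>{a..a + int n}. Z i \<omega> = s i}"
  by (simp only: trail_eq_iff)

lemma ex_trail_eq: "length l = Suc n \<Longrightarrow> \<exists>s. l = trail s a n"
  by (intro exI[of _ "\<lambda>i. l ! nat (a + int n - i)"] nth_equalityI) (auto simp: nth_trail)

lemma measurable_obs [measurable]: "obs a n \<in> measurable M (count_space UNIV)"
proof (subst measurable_count_space_eq2_countable, intro conjI ballI)
  fix l :: "int list"
  have "{\<omega> \<in> space M. obs a n \<omega> = l} \<in> sets M"
  proof (cases "length l = Suc n")
    case True
    then obtain s where l: "l = trail s a n" using ex_trail_eq by blast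
    show ?thesis unfolding l obs_event_eq by measurable
  next
    case False
    then have "obs a n \<omega> \<noteq> l" for \<omega> by auto
    then show ?thesis by simp
  qed
  then show "obs a n -` {l} \<inter> space M \<in> sets M"
    by (simp add: vimage_def Int_def conj_commute)
qed auto

lemma distr_obs: "distr M (count_space UNIV) (obs a n) = measure_pmf (path_pmf n)"
proof (rule measure_eqI_countable[where A = UNIV])
  fix l :: "int list"
  have "emeasure (distr M (count_space UNIV) (obs a n)) {l} = prob {\<omega> \<in> space M. obs a n \<omega> = l}"
    by (subst emeasure_distr) (auto simp: emeasure_eq_measure vimage_def Int_def conj_commute)
  also have "prob {\<omega> \<in> space M. obs a n \<omega> = l} = pmf (path_pmf n) l"
  proof (cases "length l = Suc n")
    case True
    then obtain s where l: "l = trail s a n" using ex_trail_eq by blast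
    show ?thesis unfolding l obs_event_eq prob_cylinder pmf_path_pmf ..
  next
    case False
    then have "obs a n \<omega> \<noteq> l" for \<omega> by auto
    moreover have "l \<notin> set_pmf (path_pmf n)" using False set_path_pmf[of l n 0] by auto
    ultimately show ?thesis by (simp add: pmf_eq_0_set_pmf)
  qed
  finally show "emeasure (distr M (count_space UNIV) (obs a n)) {l} = emeasure (measure_pmf (path_pmf n)) {l}"
    by (simp add: emeasure_pmf_single)
qed auto

lemma expectation_obs:
  fixes F :: "int list \<Rightarrow> 'b::{banach, second_countable_topology}"
  shows "integral\<^sup>L M (\<lambda>\<omega>. F (obs a n \<omega>)) = integral\<^sup>L (measure_pmf (path_pmf n)) F"
  unfolding distr_obs[of a n, symmetric] by (subst integral_distr) auto

lemma prob_obs: "prob {\<omega> \<in> space M. obs a n \<omega> \<in> B} = measure (measure_pmf (path_pmf n)) B"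
  unfolding distr_obs[of a n, symmetric]
  by (subst measure_distr) (auto simp: vimage_def Int_def conj_commute)

lemma distr_Z: "distr M (count_space UNIV) (Z k) = measure_pmf \<mu>"
proof -
  have "distr M (count_space UNIV) (Z k) = distr (distr M (count_space UNIV) (obs k 0)) (count_space UNIV) hd"
    by (subst distr_distr) (auto simp: comp_def)
  also have "\<dots> = measure_pmf \<mu>"
    unfolding distr_obs by (simp add: map_pmf_rep_eq[symmetric] map_pmf_comp)
  finally show ?thesis .
qed

lemma expectation_Z:
  fixes f :: "int \<Rightarrow> 'b::{banach, second_countable_topology}"
  shows "integral\<^sup>L M (\<lambda>\<omega>. f (Z k \<omega>)) = integral\<^sup>L (measure_pmf \<mu>) f"
  unfolding distr_Z[of k, symmetric] by (subst integral_distr) auto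

lemma integrable_Z_iff:
  fixes f :: "int \<Rightarrow> 'b::{banach, second_countable_topology}"
  shows "integrable M (\<lambda>\<omega>. f (Z k \<omega>)) \<longleftrightarrow> integrable (measure_pmf \<mu>) f"
  unfolding distr_Z[of k, symmetric] by (subst integrable_distr_eq) auto

lemma prob_Z: "prob {\<omega> \<in> space M. Z k \<omega> \<in> B} = measure (measure_pmf \<mu>) B"
  unfolding distr_Z[of k, symmetric]
  by (subst measure_distr) (auto simp: vimage_def Int_def conj_commute)

lemma expectation_product:
  assumes "\<And>x. norm (f x) \<le> B" "\<And>x. norm (u x) \<le> 1" "\<And>x. norm (h x) \<le> B'"
  shows "integral\<^sup>L M (\<lambda>\<omega>. f (Z a \<omega>) * (\<Prod>i=1..n. u (Z (a + int i) \<omega>)) * h (Z (a + int n) \<omega>)) =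
    (LINT x|measure_pmf \<mu>. f x * (tilt u ^^ n) h x)"
  using expectation_obs[of "\<lambda>l. path_fun f u l * h (hd l)" a n] integral_path_pmf[OF assms, of n]
  unfolding path_fun_trail hd_trail by (rule trans)

lemma prob_endpoints:
  "prob {\<omega> \<in> space M. Z a \<omega> = x \<and> Z (a + int n) \<omega> = y} =
     pmf (bind_pmf \<mu> (\<lambda>x. map_pmf (Pair x) (step_pow n x))) (x, y)"
proof -
  have "{\<omega> \<in> space M. Z a \<omega> = x \<and> Z (a + int n) \<omega> = y} =
      {\<omega> \<in> space M. obs a n \<omega> \<in> (\<lambda>l. (last l, hd l)) -` {(x, y)}}" by auto
  also have "prob \<dots> = pmf (map_pmf (\<lambda>l. (last l, hd l)) (path_pmf n)) (x, y)"
    unfolding prob_obs by (simp add: pmf_map)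
  finally show ?thesis unfolding endpoints_path_pmf .
qed

lemma stationary_chain_shift: "stationary_chain \<mu> K M (\<lambda>k. Z (k + m))"
proof unfold_locales
  fix s a n
  have "(\<forall>i\<in>{a..a + int n}. Z (i + m) \<omega> = s i) \<longleftrightarrow> (\<forall>i\<in>{a + m..a + m + int n}. Z i \<omega> = s (i - m))" for \<omega>
  proof -
    have "{a + m..a + m + int n} = (\<lambda>i. i + m) ` {a..a + int n}" by (simp add: algebra_simps)
    then show ?thesis by (simp only: ball_image_iff add_diff_cancel)
  qed
  then show "prob {\<omega> \<in> space M. \<forall>i\<in>{a..a + int n}. Z (i + m) \<omega> = s i} = path_weight s a n"
    using prob_cylinder[of "a + m" n "\<lambda>i. s (i - m)"] path_weight_shift[of "\<lambda>i. s (i - m)" m a n] by simp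
qed simp

lemma stationary_chain_reverse: "stationary_chain \<mu> K M (\<lambda>k. Z (- k))"
proof unfold_locales
  fix s a n
  have "(\<forall>i\<in>{a..a + int n}. Z (- i) \<omega> = s i) \<longleftrightarrow> (\<forall>i\<in>{- a - int n..- a - int n + int n}. Z i \<omega> = s (- i))" for \<omega>
  proof -
    have "{- a - int n..- a - int n + int n} = uminus ` {a..a + int n}" by simp
    then show ?thesis by (simp only: ball_image_iff minus_minus)
  qed
  then show "prob {\<omega> \<in> space M. \<forall>i\<in>{a..a + int n}. Z (- i) \<omega> = s i} = path_weight s a n"
    using prob_cylinder[of "- a - int n" n "\<lambda>i. s (- i)"] path_weight_reverse[of s a n] by simp
qed simp

end

text \<open>A finite-dimensional event is an event of some finite trail, and the law
  \<open>path_pmf\<close> of trails depends on \<open>\<mu>\<close> and \<open>K\<close> alone.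
  Stationarity and reversibility follow by comparing \<open>Z\<close> with its shift and its
  reflection.\<close>

lemma process_law_unique:
  assumes "stationary_chain \<mu> K M Z" "stationary_chain \<mu> K M Z'"
  shows "process_law M (\<lambda>k \<omega>. v (Z k \<omega>)) = process_law M (\<lambda>k \<omega>. v (Z' k \<omega>))"
proof -
  interpret Z: stationary_chain \<mu> K M Z by fact
  interpret Z': stationary_chain \<mu> K M Z' by fact
  have meas: "(\<lambda>\<omega> k. v (Y k \<omega>)) \<in> measurable M (PiM UNIV (\<lambda>_. borel))"
    if "\<And>k. Y k \<in> measurable M (count_space UNIV)" for Y :: "int \<Rightarrow> 'a \<Rightarrow> int" and v :: "int \<Rightarrow> real"
    using that by (intro measurable_PiM_single') (auto intro: measurable_compose[OF that])
  have mZ: "(\<lambda>\<omega> k. v (Z k \<omega>)) \<in> measurable M (PiM UNIV (\<lambda>_. borel))"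
    and mZ': "(\<lambda>\<omega> k. v (Z' k \<omega>)) \<in> measurable M (PiM UNIV (\<lambda>_. borel))"
    by (intro meas Z.measurable_Z Z'.measurable_Z)+
  show ?thesis
    unfolding process_law_def
  proof (rule measure_eqI_PiM_infinite)
    fix A :: "int \<Rightarrow> real set" and J :: "int set"
    assume J: "finite J" and A: "\<And>i. i \<in> J \<Longrightarrow> A i \<in> sets borel"
    define E where "E = prod_emb UNIV (\<lambda>_. borel) J (Pi\<^sub>E J A)"
    have E: "E \<in> sets (PiM UNIV (\<lambda>_. borel))"
      unfolding E_def using J A by (intro sets_PiM_I) auto
    obtain a n where an: "J \<subseteq> {a..a + int n}"
    proof (cases "J = {}")
      case False
      then have "J \<subseteq> {Min J..Min J + int (nat (Max J - Min J))}" using J by auto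
      then show ?thesis by (rule that)
    qed (use that in auto)
    define B where "B = {trail s a n |s. \<forall>j\<in>J. v (s j) \<in> A j}"
    have ev: "(\<lambda>\<omega> k. v (Y k \<omega>)) -` E \<inter> space M = {\<omega> \<in> space M. trail (\<lambda>i. Y i \<omega>) a n \<in> B}" for Y :: "int \<Rightarrow> 'a \<Rightarrow> int"
    proof -
      have "(\<lambda>k. v (Y k \<omega>)) \<in> E \<longleftrightarrow> trail (\<lambda>i. Y i \<omega>) a n \<in> B" for \<omega>
      proof -
        have "(\<lambda>k. v (Y k \<omega>)) \<in> E \<longleftrightarrow> (\<forall>j\<in>J. v (Y j \<omega>) \<in> A j)"
          by (auto simp: E_def prod_emb_def restrict_PiE_iff)
        also have "\<dots> \<longleftrightarrow> trail (\<lambda>i. Y i \<omega>) a n \<in> B"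
        proof
          assume "trail (\<lambda>i. Y i \<omega>) a n \<in> B"
          then obtain s where s: "trail (\<lambda>i. Y i \<omega>) a n = trail s a n" "\<forall>j\<in>J. v (s j) \<in> A j"
            unfolding B_def by blast
          show "\<forall>j\<in>J. v (Y j \<omega>) \<in> A j"
          proof
            fix j assume j: "j \<in> J"
            then have "Y j \<omega> = s j" using s(1) an unfolding trail_eq_iff by blast
            then show "v (Y j \<omega>) \<in> A j" using s(2) j by simp
          qed
        qed (auto simp: B_def)
        finally show ?thesis .
      qed
      then show ?thesis by auto
    qed
    show "emeasure (distr M (PiM UNIV (\<lambda>_. borel)) (\<lambda>\<omega> k. v (Z k \<omega>))) (prod_emb UNIV (\<lambda>_. borel) J (Pi\<^sub>E J A)) =
        emeasure (distr M (PiM UNIV (\<lambda>_. borel)) (\<lambda>\<omega> k. v (Z' k \<omega>))) (prod_emb UNIV (\<lambda>_. borel) J (Pi\<^sub>E J A))"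
      unfolding E_def[symmetric]
      by (subst (1 2) emeasure_distr)
         (use mZ mZ' E in \<open>auto simp: ev Z.emeasure_eq_measure Z.prob_obs Z'.prob_obs\<close>)
  next
    show "finite_measure (distr M (PiM UNIV (\<lambda>_. borel)) (\<lambda>\<omega> k. v (Z k \<omega>)))"
      by (rule Z.finite_measure_distr[OF mZ])
  qed simp_all
qed

section \<open>Conditional independence of the past and the future sigma-algebra given the
  present\<close>

context stationary_chain
begin

text \<open>Cylinders over windows that all end at \<open>m\<close>: two of them are nested or
  disjoint, so they form an intersection-stable generator of the past. The windows of
  \<open>future_events\<close> all begin at \<open>m\<close> for the same reason.\<close>

definition past_events :: "int \<Rightarrow> 'a set set" where
  "past_events m = {{\<omega> \<in> space M. obs (m - int n) n \<omega> = l} | n l. True}"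

definition future_events :: "int \<Rightarrow> 'a set set" where
  "future_events m = {{\<omega> \<in> space M. obs m n \<omega> = l} | n l. True}"

lemma past_events_subset: "past_events m \<subseteq> events"
  and future_events_subset: "future_events m \<subseteq> events"
proof -
  have "{\<omega> \<in> space M. obs a n \<omega> = l} \<in> events" for a n l by measurable
  then show "past_events m \<subseteq> events" "future_events m \<subseteq> events"
    by (auto simp: past_events_def future_events_def)
qed

lemma sigma_past_events_subset: "sigma_sets (space M) (past_events m) \<subseteq> events"
  and sigma_future_events_subset: "sigma_sets (space M) (future_events m) \<subseteq> events"
  by (intro sets.sigma_sets_subset past_events_subset future_events_subset)+

lemma Int_stable_past_events: "Int_stable (past_events m)"
proof (rule Int_stableI)
  fix A B assume "A \<in> past_events m" "B \<in> past_events m"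
  then obtain n l n' l' where AB: "A = {\<omega> \<in> space M. obs (m - int n) n \<omega> = l}"
    "B = {\<omega> \<in> space M. obs (m - int n') n' \<omega> = l'}" unfolding past_events_def by blast
  have *: "{\<omega> \<in> space M. obs (m - int n) n \<omega> = l} \<inter> {\<omega> \<in> space M. obs (m - int n') n' \<omega> = l'} \<in> past_events m"
    if le: "n \<le> n'" for n n' l l'
  proof -
    have t: "take (Suc n) (obs (m - int n') n' \<omega>) = obs (m - int n) n \<omega>" for \<omega>
      by (rule take_trail[OF le])
    show ?thesis
  proof (cases "take (Suc n) l' = l")
    case True
    then have "{\<omega> \<in> space M. obs (m - int n) n \<omega> = l} \<inter> {\<omega> \<in> space M. obs (m - int n') n' \<omega> = l'} =
        {\<omega> \<in> space M. obs (m - int n') n' \<omega> = l'}"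
      using t by auto
    then show ?thesis unfolding past_events_def by blast
  next
    case False
    \<comment> \<open>Two incompatible cylinders have empty intersection; since no trail is the
      empty list, the right-hand side writes the empty set as a member of the generator.\<close>
    then have "{\<omega> \<in> space M. obs (m - int n) n \<omega> = l} \<inter> {\<omega> \<in> space M. obs (m - int n') n' \<omega> = l'} =
        {\<omega> \<in> space M. obs (m - int 0) 0 \<omega> = []}"
      using t by auto
    then show ?thesis unfolding past_events_def by blast
  qed
  qed
  show "A \<inter> B \<in> past_events m"
    unfolding AB by (cases "n \<le> n'") (rule *, simp, subst Int_commute, rule *, simp)
qed

lemma Int_stable_future_events: "Int_stable (future_events m)"
proof (rule Int_stableI)
  fix A B assume "A \<in> future_events m" "B \<in> future_events m"
  then obtain n l n' l' where AB: "A = {\<omega> \<in> space M. obs m n \<omega> = l}"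
    "B = {\<omega> \<in> space M. obs m n' \<omega> = l'}" unfolding future_events_def by blast
  have *: "{\<omega> \<in> space M. obs m n \<omega> = l} \<inter> {\<omega> \<in> space M. obs m n' \<omega> = l'} \<in> future_events m"
    if le: "n \<le> n'" for n n' l l'
  proof -
    have t: "drop (n' - n) (obs m n' \<omega>) = obs m n \<omega>" for \<omega>
      by (rule drop_trail[OF le])
    show ?thesis
  proof (cases "drop (n' - n) l' = l")
    case True
    then have "{\<omega> \<in> space M. obs m n \<omega> = l} \<inter> {\<omega> \<in> space M. obs m n' \<omega> = l'} =
        {\<omega> \<in> space M. obs m n' \<omega> = l'}"
      using t by auto
    then show ?thesis unfolding future_events_def by blast
  next
    case False
    then have "{\<omega> \<in> space M. obs m n \<omega> = l} \<inter> {\<omega> \<in> space M. obs m n' \<omega> = l'} =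
        {\<omega> \<in> space M. obs m 0 \<omega> = []}"
      using t by auto
    then show ?thesis unfolding future_events_def by blast
  qed
  qed
  show "A \<inter> B \<in> future_events m"
    unfolding AB by (cases "n \<le> n'") (rule *, simp, subst Int_commute, rule *, simp)
qed

lemma gen_sigma_past: "gen_sigma M (\<lambda>k \<omega>. v (Z k \<omega>)) {..m} \<subseteq> sigma_sets (space M) (past_events m)"
  unfolding gen_sigma_def
proof (rule sigma_sets_mono, safe)
  fix k B assume "k \<le> m"
  then have "k = m - int (nat (m - k))" by simp
  then obtain n where k: "k = m - int n" by (rule that)
  have "(\<lambda>\<omega>. v (Z k \<omega>)) -` B \<inter> space M =
      (\<Union>l\<in>{l. v (last l) \<in> B}. {\<omega> \<in> space M. obs (m - int n) n \<omega> = l})"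
    unfolding k by auto
  also have "\<dots> \<in> sigma_sets (space M) (past_events m)"
    by (rule sigma_sets_UNION) (auto simp: past_events_def)
  finally show "(\<lambda>\<omega>. v (Z k \<omega>)) -` B \<inter> space M \<in> sigma_sets (space M) (past_events m)" .
qed

lemma gen_sigma_future: "gen_sigma M (\<lambda>k \<omega>. v (Z k \<omega>)) {m..} \<subseteq> sigma_sets (space M) (future_events m)"
  unfolding gen_sigma_def
proof (rule sigma_sets_mono, safe)
  fix k B assume "m \<le> k"
  then have "k = m + int (nat (k - m))" by simp
  then obtain n where k: "k = m + int n" by (rule that)
  have "(\<lambda>\<omega>. v (Z k \<omega>)) -` B \<inter> space M =
      (\<Union>l\<in>{l. v (hd l) \<in> B}. {\<omega> \<in> space M. obs m n \<omega> = l})"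
    unfolding k by auto
  also have "\<dots> \<in> sigma_sets (space M) (future_events m)"
    by (rule sigma_sets_UNION) (auto simp: future_events_def)
  finally show "(\<lambda>\<omega>. v (Z k \<omega>)) -` B \<inter> space M \<in> sigma_sets (space M) (future_events m)" .
qed

text \<open>Compatible past and future trails meet at \<open>m\<close> and merge into one path,
  whose weight factors by \<open>path_weight_split\<close>; in all other cases both sides
  vanish.\<close>

lemma prob_past_future:
  assumes "A \<in> past_events m" "B \<in> future_events m"
  shows "prob ({\<omega> \<in> space M. Z m \<omega> = x} \<inter> (A \<inter> B)) * pmf \<mu> x =
    prob ({\<omega> \<in> space M. Z m \<omega> = x} \<inter> A) * prob ({\<omega> \<in> space M. Z m \<omega> = x} \<inter> B)"
proof -
  obtain n l k l' where AB: "A = {\<omega> \<in> space M. obs (m - int n) n \<omega> = l}"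
    "B = {\<omega> \<in> space M. obs m k \<omega> = l'}"
    using assms unfolding past_events_def future_events_def by blast
  let ?E = "{\<omega> \<in> space M. Z m \<omega> = x}"
  show ?thesis
  proof (cases "length l = Suc n \<and> length l' = Suc k \<and> hd l = x \<and> last l' = x")
    case False
    have "?E \<inter> A = {} \<or> ?E \<inter> B = {}"
      using False unfolding AB by auto
    then show ?thesis
    proof
      assume "?E \<inter> A = {}"
      then have "?E \<inter> (A \<inter> B) = {}" by blast
      with \<open>?E \<inter> A = {}\<close> show ?thesis by simp
    next
      assume "?E \<inter> B = {}"
      then have "?E \<inter> (A \<inter> B) = {}" by blast
      with \<open>?E \<inter> B = {}\<close> show ?thesis by simp
    qed
  next
    case True
    then obtain s t where l: "l = trail s (m - int n) n" and l': "l' = trail t m k"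
      using ex_trail_eq[of l n "m - int n"] ex_trail_eq[of l' k m] by blast
    have sm: "s m = x" "t m = x" using True l l' by auto
    define r where "r = (\<lambda>i. if i \<le> m then s i else t i)"
    have merge: "{\<omega> \<in> space M. Z m \<omega> = x} \<inter> {\<omega> \<in> space M. \<forall>i\<in>I. Z i \<omega> = q i} =
        {\<omega> \<in> space M. \<forall>i\<in>I. Z i \<omega> = r i}"
      if "m \<in> I" "q m = x" "\<forall>i\<in>I. r i = q i" for I q
    proof -
      have "(\<forall>i\<in>I. Z i \<omega> = q i) \<longleftrightarrow> (\<forall>i\<in>I. Z i \<omega> = r i)" for \<omega>
        using that(3) by (intro ball_cong) simp_all
      moreover have "(\<forall>i\<in>I. Z i \<omega> = q i) \<Longrightarrow> Z m \<omega> = x" for \<omega>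
        using that by (metis (full_types))
      ultimately show ?thesis by blast
    qed
    have A: "?E \<inter> A = {\<omega> \<in> space M. \<forall>i\<in>{m - int n..m - int n + int n}. Z i \<omega> = r i}"
      unfolding AB l trail_eq_iff by (rule merge) (use sm in \<open>auto simp: r_def\<close>)
    have B: "?E \<inter> B = {\<omega> \<in> space M. \<forall>i\<in>{m..m + int k}. Z i \<omega> = r i}"
      unfolding AB l' trail_eq_iff by (rule merge) (use sm in \<open>auto simp: r_def\<close>)
    have U: "{m - int n..m - int n + int (n + k)} = {m - int n..m - int n + int n} \<union> {m..m + int k}"
      by auto
    have "?E \<inter> (A \<inter> B) = (?E \<inter> A) \<inter> (?E \<inter> B)" by blast
    also have "\<dots> = {\<omega> \<in> space M. \<forall>i\<in>{m - int n..m - int n + int (n + k)}. Z i \<omega> = r i}"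
      unfolding A B U ball_Un by blast
    finally have AB': "?E \<inter> (A \<inter> B) = \<dots>" .
    have "r m = x" using sm by (simp add: r_def)
    then show ?thesis
      unfolding A B AB' prob_cylinder using path_weight_split[of r "m - int n" n k] by simp
  qed
qed

text \<open>Under the law conditioned on \<open>Z m = x\<close> the two generators are independent
  and intersection-stable, so the sigma-algebras they generate are independent as well. A null state
  makes both sides 0.\<close>

lemma prob_past_future_sigma:
  assumes A: "A \<in> sigma_sets (space M) (past_events m)" and B: "B \<in> sigma_sets (space M) (future_events m)"
  shows "prob ({\<omega> \<in> space M. Z m \<omega> = x} \<inter> (A \<inter> B)) * pmf \<mu> x =
    prob ({\<omega> \<in> space M. Z m \<omega> = x} \<inter> A) * prob ({\<omega> \<in> space M. Z m \<omega> = x} \<inter> B)"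
proof -
  define E where "E = {\<omega> \<in> space M. Z m \<omega> = x}"
  have Eev: "E \<in> events" unfolding E_def by measurable
  have PE: "prob E = pmf \<mu> x"
    using prob_Z[of m "{x}"] by (simp add: E_def pmf.rep_eq)
  show ?thesis
  proof (cases "pmf \<mu> x = 0")
    case True
    have "prob (E \<inter> A) \<le> prob E"
      using Eev A sigma_past_events_subset by (intro finite_measure_mono) auto
    with PE True have "prob (E \<inter> A) = 0" by (simp add: measure_le_0_iff)
    with True show ?thesis unfolding E_def[symmetric] by simp
  next
    case False
    have E0: "emeasure M E \<noteq> 0" "emeasure M E \<noteq> \<infinity>"
      using False PE by (auto simp: emeasure_eq_measure)
    define N where "N = uniform_measure M E"
    interpret N: prob_space N
      unfolding N_def using E0 by (rule prob_space_uniform_measure)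
    have N: "N.prob A = prob (E \<inter> A) / prob E" if "A \<in> events" for A
      unfolding N_def using that E0 by (subst measure_uniform_measure) auto
    have sp: "space N = space M" "sets N = sets M" by (simp_all add: N_def)
    have "N.indep_set (past_events m) (future_events m)"
    proof (rule N.indep_setI)
      fix A B assume AB: "A \<in> past_events m" "B \<in> future_events m"
      then have ev: "A \<in> events" "B \<in> events" using past_events_subset future_events_subset by blast+
      show "N.prob (A \<inter> B) = N.prob A * N.prob B"
        using prob_past_future[OF AB, of x] False PE ev unfolding E_def[symmetric]
        by (simp add: N divide_simps mult_ac)
    qed (use sp past_events_subset future_events_subset in auto)
    then have "N.indep_set (sigma_sets (space N) (past_events m)) (sigma_sets (space N) (future_events m))"
      by (rule N.indep_set_sigma_sets[OF _ Int_stable_past_events Int_stable_future_events])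
    from N.indep_setD[OF this] have "N.prob (A \<inter> B) = N.prob A * N.prob B" using A B sp by simp
    moreover have "A \<in> events" "B \<in> events"
      using A B sigma_past_events_subset sigma_future_events_subset by blast+
    ultimately show ?thesis using False PE unfolding E_def[symmetric]
      by (simp add: N divide_simps mult_ac)
  qed
qed

text \<open>\<open>cond m A x\<close> is the conditional probability of \<open>A\<close> given \<open>Z m = x\<close>, and \<open>0\<close> if that event is null.\<close>

definition cond :: "int \<Rightarrow> 'a set \<Rightarrow> int \<Rightarrow> real" where
  "cond m A x = prob ({\<omega> \<in> space M. Z m \<omega> = x} \<inter> A) / pmf \<mu> x"

lemma cond_mult: "A \<in> events \<Longrightarrow> cond m A x * pmf \<mu> x = prob ({\<omega> \<in> space M. Z m \<omega> = x} \<inter> A)"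
proof (cases "pmf \<mu> x = 0")
  case True
  assume A: "A \<in> events"
  have "prob ({\<omega> \<in> space M. Z m \<omega> = x} \<inter> A) \<le> prob {\<omega> \<in> space M. Z m \<omega> \<in> {x}}"
    by (rule finite_measure_mono) auto
  also have "\<dots> = 0" using True unfolding prob_Z by (simp add: pmf.rep_eq)
  finally show ?thesis using True by (simp add: measure_le_0_iff)
qed (simp add: cond_def)

lemma cond_nonneg: "cond m A x \<ge> 0"
  by (simp add: cond_def)

lemma cond_le_1: "cond m A x \<le> 1"
proof (cases "pmf \<mu> x = 0")
  case False
  have "prob ({\<omega> \<in> space M. Z m \<omega> = x} \<inter> A) \<le> prob {\<omega> \<in> space M. Z m \<omega> \<in> {x}}"
    by (rule finite_measure_mono) (auto, measurable)
  also have "\<dots> = pmf \<mu> x" unfolding prob_Z by (simp add: pmf.rep_eq)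
  finally show ?thesis using False by (simp add: cond_def divide_le_eq_1 pmf_pos)
qed (simp add: cond_def)

lemma prob_eq_integral_cond: "A \<in> events \<Longrightarrow> prob A = (LINT x|measure_pmf \<mu>. cond m A x)"
proof -
  assume A: "A \<in> events"
  have "ennreal (prob A) = emeasure M (\<Union>x. {\<omega> \<in> space M. Z m \<omega> = x} \<inter> A)"
    unfolding emeasure_eq_measure[symmetric]
    using sets.sets_into_space[OF A] by (intro arg_cong[where f = "emeasure M"]) auto
  also have "\<dots> = (\<integral>\<^sup>+x. emeasure M ({\<omega> \<in> space M. Z m \<omega> = x} \<inter> A) \<partial>count_space UNIV)"
    using A by (intro emeasure_UN_countable) (auto simp: disjoint_family_on_def)
  also have "\<dots> = (\<integral>\<^sup>+x. ennreal (pmf \<mu> x) * ennreal (cond m A x) \<partial>count_space UNIV)"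
    using A by (simp add: emeasure_eq_measure cond_mult[symmetric] ennreal_mult' mult.commute cond_nonneg)
  also have "\<dots> = (\<integral>\<^sup>+x. ennreal (cond m A x) \<partial>measure_pmf \<mu>)"
    by (simp add: nn_integral_measure_pmf)
  also have "\<dots> = ennreal (LINT x|measure_pmf \<mu>. cond m A x)"
    by (intro nn_integral_eq_integral integrable_pmf_bounded[where B = 1])
       (auto simp: cond_nonneg cond_le_1)
  finally show ?thesis
    by (simp add: integral_nonneg_AE cond_nonneg)
qed

lemma prob_past_future_cond:
  assumes A: "A \<in> sigma_sets (space M) (past_events m)" and B: "B \<in> sigma_sets (space M) (future_events m)"
  shows "prob ({\<omega> \<in> space M. Z m \<omega> = x} \<inter> (A \<inter> B)) = cond m A x * prob ({\<omega> \<in> space M. Z m \<omega> = x} \<inter> B)" (is ?left)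
    and "prob ({\<omega> \<in> space M. Z m \<omega> = x} \<inter> (A \<inter> B)) = prob ({\<omega> \<in> space M. Z m \<omega> = x} \<inter> A) * cond m B x" (is ?right)
proof -
  have ev: "A \<inter> B \<in> events"
    using A B sigma_past_events_subset sigma_future_events_subset by blast
  have "?left \<and> ?right"
  proof (cases "pmf \<mu> x = 0")
    case True
    then show ?thesis using cond_mult[OF ev, of m x] by (simp add: cond_def)
  next
    case False
    then show ?thesis using prob_past_future_sigma[OF A B, of x]
      by (simp add: cond_def field_simps)
  qed
  then show ?left ?right by simp_all
qed

lemma sigma_past_events_mono: "sigma_sets (space M) (past_events m) \<subseteq> sigma_sets (space M) (past_events (m + int n))"
proof (rule sigma_sets_mono, safe)
  fix A assume "A \<in> past_events m"
  then obtain k l where A: "A = {\<omega> \<in> space M. obs (m - int k) k \<omega> = l}" unfolding past_events_def by blast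
  have "A = (\<Union>l'\<in>{l'. drop n l' = l}. {\<omega> \<in> space M. obs (m + int n - int (n + k)) (n + k) \<omega> = l'})"
    unfolding A using drop_trail[of k "n + k" _ "m - int k"] by auto
  also have "\<dots> \<in> sigma_sets (space M) (past_events (m + int n))"
  proof (rule sigma_sets_UNION)
    show "b \<in> sigma_sets (space M) (past_events (m + int n))"
      if "b \<in> (\<lambda>l'. {\<omega> \<in> space M. obs (m + int n - int (n + k)) (n + k) \<omega> = l'}) ` {l'. drop n l' = l}" for b
      using that unfolding past_events_def by blast
  qed simp
  finally show "A \<in> sigma_sets (space M) (past_events (m + int n))" .
qed

lemma sigma_future_events_antimono: "sigma_sets (space M) (future_events (m + int n)) \<subseteq> sigma_sets (space M) (future_events m)"
proof (rule sigma_sets_mono, safe)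
  fix A assume "A \<in> future_events (m + int n)"
  then obtain k l where A: "A = {\<omega> \<in> space M. obs (m + int n) k \<omega> = l}" unfolding future_events_def by blast
  have "take (Suc k) (obs m (n + k) \<omega>) = obs (m + int n) k \<omega>" for \<omega>
    using take_trail[of k "n + k" _ "m + int (n + k)"] by simp
  then have "A = (\<Union>l'\<in>{l'. take (Suc k) l' = l}. {\<omega> \<in> space M. obs m (n + k) \<omega> = l'})"
    unfolding A by auto
  also have "\<dots> \<in> sigma_sets (space M) (future_events m)"
    by (rule sigma_sets_UNION) (auto simp: future_events_def)
  finally show "A \<in> sigma_sets (space M) (future_events m)" .
qed

text \<open>Decomposing over the pair of states at times 0 and \<open>n\<close> reduces the
  dependence between past and future to that between two states, which \<open>step_pow\<close>
  describes.\<close>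

lemma prob_Int_eq_integral_cond:
  assumes A: "A \<in> sigma_sets (space M) (past_events 0)" and B: "B \<in> sigma_sets (space M) (future_events (int n))"
  shows "prob (A \<inter> B) =
    (LINT x|measure_pmf \<mu>. cond 0 A x * (LINT y|measure_pmf (step_pow n x). cond (int n) B y))"
proof -
  have Aev: "A \<in> events" and Bev: "B \<in> events"
    using A B sigma_past_events_subset sigma_future_events_subset by blast+
  define J where "J = bind_pmf \<mu> (\<lambda>x. map_pmf (Pair x) (step_pow n x))"
  define E where "E = (\<lambda>p. {\<omega> \<in> space M. Z 0 \<omega> = fst p \<and> Z (int n) \<omega> = snd p})"
  have Eev: "E p \<in> events" for p unfolding E_def by measurable
  have PE: "prob (E p) = pmf J p" for p
    using prob_endpoints[of 0 "fst p" n "snd p"] by (simp add: E_def J_def)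
  have *: "prob (E p \<inter> (A \<inter> B)) = pmf J p * (cond 0 A (fst p) * cond (int n) B (snd p))" for p
  proof -
    obtain x y where p: "p = (x, y)" by (cases p)
    define Ex where "Ex = {\<omega> \<in> space M. Z 0 \<omega> = x}"
    define Ey where "Ey = {\<omega> \<in> space M. Z (int n) \<omega> = y}"
    have "Ex = {\<omega> \<in> space M. obs (0 - int 0) 0 \<omega> = [x]}" by (simp add: Ex_def)
    then have Ex: "Ex \<in> sigma_sets (space M) (past_events 0)"
      unfolding past_events_def by blast
    have "Ey = {\<omega> \<in> space M. obs (int n) 0 \<omega> = [y]}" by (simp add: Ey_def)
    then have "Ey \<in> sigma_sets (space M) (future_events (int n))"
      unfolding future_events_def by blast
    then have Ey: "Ey \<in> sigma_sets (space M) (future_events 0)"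
      using sigma_future_events_antimono[of 0 n] by auto
    interpret P: sigma_algebra "space M" "sigma_sets (space M) (past_events 0)"
      using past_events_subset sets.space_closed by (intro sigma_algebra_sigma_sets) blast
    have "Ex \<inter> A \<in> sigma_sets (space M) (past_events 0)" using Ex A by (rule P.Int)
    then have ExA: "Ex \<inter> A \<in> sigma_sets (space M) (past_events (int n))"
      using sigma_past_events_mono[of 0 n] by auto
    \<comment> \<open>Conditional independence is used twice: at time \<open>n\<close> to detach
      \<open>B\<close>, then at time 0 to detach \<open>A\<close>.\<close>
    have "E p \<inter> (A \<inter> B) = Ey \<inter> ((Ex \<inter> A) \<inter> B)" by (auto simp: E_def Ex_def Ey_def p)
    also have "prob \<dots> = prob (Ey \<inter> (Ex \<inter> A)) * cond (int n) B y"
      unfolding Ey_def by (rule prob_past_future_cond(2)[OF ExA B])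
    also have "Ey \<inter> (Ex \<inter> A) = Ex \<inter> (A \<inter> Ey)" by auto
    also have "prob \<dots> = cond 0 A x * prob (Ex \<inter> Ey)"
      unfolding Ex_def by (rule prob_past_future_cond(1)[OF A Ey])
    also have "Ex \<inter> Ey = E p" by (auto simp: E_def Ex_def Ey_def p)
    finally show ?thesis by (simp add: PE p)
  qed
  have "ennreal (prob (A \<inter> B)) = emeasure M (\<Union>p. E p \<inter> (A \<inter> B))"
    unfolding emeasure_eq_measure[symmetric]
    using sets.sets_into_space[OF Aev] by (intro arg_cong[where f = "emeasure M"]) (auto simp: E_def)
  also have "\<dots> = (\<integral>\<^sup>+p. emeasure M (E p \<inter> (A \<inter> B)) \<partial>count_space UNIV)"
    using Aev Bev Eev by (intro emeasure_UN_countable) (auto simp: disjoint_family_on_def E_def)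
  also have "\<dots> = (\<integral>\<^sup>+p. ennreal (pmf J p) * ennreal (cond 0 A (fst p) * cond (int n) B (snd p)) \<partial>count_space UNIV)"
    by (simp add: emeasure_eq_measure * ennreal_mult' cond_nonneg)
  also have "\<dots> = (\<integral>\<^sup>+p. ennreal (cond 0 A (fst p) * cond (int n) B (snd p)) \<partial>measure_pmf J)"
    by (simp add: nn_integral_measure_pmf)
  also have "\<dots> = ennreal (LINT p|measure_pmf J. cond 0 A (fst p) * cond (int n) B (snd p))"
    by (intro nn_integral_eq_integral integrable_pmf_bounded[where B = 1])
       (auto simp: cond_nonneg cond_le_1 abs_mult intro!: mult_le_one)
  finally have "prob (A \<inter> B) = (LINT p|measure_pmf J. cond 0 A (fst p) * cond (int n) B (snd p))"
    by (simp add: integral_nonneg_AE cond_nonneg)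
  also have "\<dots> = (LINT x|measure_pmf \<mu>. cond 0 A x * (LINT y|measure_pmf (step_pow n x). cond (int n) B y))"
    unfolding J_def
    by (subst integral_bind_pmf_real[where B = 1])
       (auto simp: cond_nonneg cond_le_1 abs_mult intro!: mult_le_one)
  finally show ?thesis .
qed

end

section \<open>The hierarchical kernel\<close>

lemma sum_abs_integral_diff_le:
  fixes f :: "'b \<Rightarrow> 'a \<Rightarrow> real"
  assumes "finite Q" "\<And>i x. i \<in> Q \<Longrightarrow> 0 \<le> f i x" "\<And>x. (\<Sum>i\<in>Q. f i x) \<le> 1"
  shows "(\<Sum>i\<in>Q. \<bar>integral\<^sup>L (measure_pmf p) (f i) - integral\<^sup>L (measure_pmf q) (f i)\<bar>) \<le> 2"
proof -
  have le1: "f i x \<le> 1" if "i \<in> Q" for i x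
    using assms(3)[of x] member_le_sum[OF that, of "\<lambda>i. f i x"] assms(1,2) by force
  have int: "integrable (measure_pmf r) (f i)" if "i \<in> Q" for i and r :: "'a pmf"
    using le1[OF that] assms(2)[OF that] by (intro integrable_pmf_bounded[where B = 1]) auto
  have nn: "0 \<le> integral\<^sup>L (measure_pmf r) (f i)" if "i \<in> Q" for i and r :: "'a pmf"
    using assms(2)[OF that] by (simp add: integral_nonneg_AE)
  have s: "(\<Sum>i\<in>Q. integral\<^sup>L (measure_pmf r) (f i)) \<le> 1" for r :: "'a pmf"
  proof -
    have "(\<Sum>i\<in>Q. integral\<^sup>L (measure_pmf r) (f i)) = (LINT x|measure_pmf r. (\<Sum>i\<in>Q. f i x))"
      using int by (subst Bochner_Integration.integral_sum) auto
    also have "\<dots> \<le> 1"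
      using norm_integral_pmf_le[of r "\<lambda>x. \<Sum>i\<in>Q. f i x" 1] assms by (simp add: sum_nonneg abs_le_iff)
    finally show ?thesis .
  qed
  have "(\<Sum>i\<in>Q. \<bar>integral\<^sup>L (measure_pmf p) (f i) - integral\<^sup>L (measure_pmf q) (f i)\<bar>) \<le>
      (\<Sum>i\<in>Q. integral\<^sup>L (measure_pmf p) (f i) + integral\<^sup>L (measure_pmf q) (f i))"
    using nn by (intro sum_mono) (smt (verit))
  also have "\<dots> \<le> 2" using s[of p] s[of q] by (simp add: sum.distrib)
  finally show ?thesis .
qed

lemma integral_cond_pmf:
  fixes f :: "'a \<Rightarrow> 'b::{banach, second_countable_topology}"
  assumes "set_pmf p \<inter> C \<noteq> {}"
  shows "integral\<^sup>L (measure_pmf (cond_pmf p C)) f = (LINT x|measure_pmf p. (indicator C x / measure (measure_pmf p) C) *\<^sub>R f x)"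
proof -
  have m: "measure (measure_pmf p) C > 0"
    using assms measure_pmf_posI by fastforce
  have "measure_pmf (cond_pmf p C) = density (count_space UNIV) (\<lambda>x. ennreal (pmf p x * (indicator C x / measure (measure_pmf p) C)))"
    unfolding measure_pmf_eq_density[of "cond_pmf p C"]
    by (intro density_cong) (auto simp: pmf_cond[OF assms] indicator_def)
  then have "integral\<^sup>L (measure_pmf (cond_pmf p C)) f =
      integral\<^sup>L (density (count_space UNIV) (\<lambda>x. ennreal (pmf p x * (indicator C x / measure (measure_pmf p) C)))) f"
    by simp
  also have "\<dots> = (\<integral>x. (pmf p x * (indicator C x / measure (measure_pmf p) C)) *\<^sub>R f x \<partial>count_space UNIV)"
    using m by (intro integral_density) (auto simp: divide_nonneg_pos)
  also have "\<dots> = (\<integral>x. pmf p x *\<^sub>R ((indicator C x / measure (measure_pmf p) C) *\<^sub>R f x) \<partial>count_space UNIV)"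
    by simp
  also have "\<dots> = (LINT x|measure_pmf p. (indicator C x / measure (measure_pmf p) C) *\<^sub>R f x)"
    unfolding measure_pmf_eq_density[of p] by (subst integral_density) auto
  finally show ?thesis .
qed

text \<open>Conditioning on \<open>C\<close> rescales the mass \<open>m\<close> inside by
  \<open>1 / m\<close>, which gains \<open>1 - m\<close> in total, and discards the mass
  \<open>1 - m\<close> outside. The sets of a partition are replaced by functions \<open>f i\<close>
  with values between 0 and 1, because conditional probabilities given the present state take their
  place.\<close>

lemma sum_abs_integral_cond_pmf_diff_le:
  fixes f :: "'b \<Rightarrow> 'a \<Rightarrow> real"
  assumes Q: "finite Q" "\<And>i x. i \<in> Q \<Longrightarrow> 0 \<le> f i x" "\<And>x. (\<Sum>i\<in>Q. f i x) \<le> 1"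
    and C: "set_pmf p \<inter> C \<noteq> {}"
  shows "(\<Sum>i\<in>Q. \<bar>integral\<^sup>L (measure_pmf (cond_pmf p C)) (f i) - integral\<^sup>L (measure_pmf p) (f i)\<bar>) \<le> 2 * measure (measure_pmf p) (- C)"
proof -
  define m where "m = measure (measure_pmf p) C"
  have m: "m > 0" unfolding m_def using C measure_pmf_posI by fastforce
  have m1: "m \<le> 1" by (simp add: m_def)
  have mC: "measure (measure_pmf p) (- C) = 1 - m"
    using measure_pmf.prob_compl[of C p] by (simp add: m_def Compl_eq_Diff_UNIV)
  have le1: "f i x \<le> 1" if "i \<in> Q" for i x
    using Q(3)[of x] member_le_sum[OF that, of "\<lambda>i. f i x"] Q(1,2) by force
  have int: "integrable (measure_pmf p) (\<lambda>x. indicator D x * f i x)" if "i \<in> Q" for i D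
    using le1[OF that] Q(2)[OF that] by (intro integrable_pmf_bounded[where B = 1]) (auto simp: indicator_def)
  define a where "a = (\<lambda>i. LINT x|measure_pmf p. indicator C x * f i x)"
  define b where "b = (\<lambda>i. LINT x|measure_pmf p. indicator (- C) x * f i x)"
  have ab: "0 \<le> a i" "0 \<le> b i" if "i \<in> Q" for i
    unfolding a_def b_def using Q(2)[OF that] by (auto intro!: integral_nonneg_AE)
  have s: "(\<Sum>i\<in>Q. LINT x|measure_pmf p. indicator D x * f i x) \<le> measure (measure_pmf p) D" for D
  proof -
    have "(\<Sum>i\<in>Q. LINT x|measure_pmf p. indicator D x * f i x) = (LINT x|measure_pmf p. indicator D x * (\<Sum>i\<in>Q. f i x))"
      using int by (subst Bochner_Integration.integral_sum[symmetric]) (auto simp: sum_distrib_left)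
    also have "\<dots> \<le> (LINT x|measure_pmf p. indicator D x)"
      using Q by (intro integral_mono integrable_pmf_bounded[where B = 1])
        (auto simp: indicator_def sum_nonneg)
    finally show ?thesis by simp
  qed
  have "\<bar>integral\<^sup>L (measure_pmf (cond_pmf p C)) (f i) - integral\<^sup>L (measure_pmf p) (f i)\<bar> \<le> (1 - m) / m * a i + b i"
    if i: "i \<in> Q" for i
  proof -
    have "integral\<^sup>L (measure_pmf (cond_pmf p C)) (f i) = a i / m"
    proof -
      have "integral\<^sup>L (measure_pmf (cond_pmf p C)) (f i) = (LINT x|measure_pmf p. indicator C x * f i x / m)"
        unfolding integral_cond_pmf[OF C] m_def by simp
      then show ?thesis by (simp add: a_def)
    qed
    moreover have "integral\<^sup>L (measure_pmf p) (f i) = a i + b i"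
    proof -
      have "a i + b i = (LINT x|measure_pmf p. indicator C x * f i x + indicator (- C) x * f i x)"
        unfolding a_def b_def by (rule Bochner_Integration.integral_add[symmetric]) (rule int[OF i])+
      also have "\<dots> = integral\<^sup>L (measure_pmf p) (f i)"
        by (intro Bochner_Integration.integral_cong) (auto simp: indicator_def)
      finally show ?thesis by simp
    qed
    ultimately have "integral\<^sup>L (measure_pmf (cond_pmf p C)) (f i) - integral\<^sup>L (measure_pmf p) (f i) = (1 - m) / m * a i - b i"
      using m by (simp add: field_simps)
    then show ?thesis using ab[OF i] m m1 by (simp add: abs_le_iff)
  qed
  then have "(\<Sum>i\<in>Q. \<bar>integral\<^sup>L (measure_pmf (cond_pmf p C)) (f i) - integral\<^sup>L (measure_pmf p) (f i)\<bar>) \<le>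
      (\<Sum>i\<in>Q. (1 - m) / m * a i + b i)" by (intro sum_mono)
  also have "\<dots> = (1 - m) / m * (\<Sum>i\<in>Q. a i) + (\<Sum>i\<in>Q. b i)"
    by (simp add: sum.distrib sum_distrib_left)
  also have "\<dots> \<le> (1 - m) / m * m + (1 - m)"
    using s[of C] s[of "- C"] m m1 unfolding mC a_def b_def m_def
    by (intro add_mono mult_left_mono) auto
  also have "\<dots> = 2 * measure (measure_pmf p) (- C)"
    using m by (simp add: mC)
  finally show ?thesis .
qed

lemma integral_pmf_indicator: "(LINT x|measure_pmf p. indicator A x :: real) = measure (measure_pmf p) A"
  by simp

lemma integral_pmf_commute:
  fixes f :: "'a \<Rightarrow> 'b \<Rightarrow> real"
  assumes "\<And>x y. \<bar>f x y\<bar> \<le> B"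
  shows "(LINT x|measure_pmf p. LINT y|measure_pmf q. f x y) = (LINT y|measure_pmf q. LINT x|measure_pmf p. f x y)"
proof -
  have "(LINT x|measure_pmf p. LINT y|measure_pmf q. f x y) =
      (LINT r|measure_pmf (bind_pmf p (\<lambda>x. bind_pmf q (\<lambda>y. return_pmf (x, y)))). f (fst r) (snd r))"
    using assms by (simp add: integral_bind_pmf_real[where B = B])
  also have "bind_pmf p (\<lambda>x. bind_pmf q (\<lambda>y. return_pmf (x, y))) = bind_pmf q (\<lambda>y. bind_pmf p (\<lambda>x. return_pmf (x, y)))"
    by (rule bind_commute_pmf)
  also have "(LINT r|measure_pmf \<dots>. f (fst r) (snd r)) = (LINT y|measure_pmf q. LINT x|measure_pmf p. f x y)"
    using assms by (simp add: integral_bind_pmf_real[where B = B])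
  finally show ?thesis .
qed

text \<open>One step of the chain draws a level \<open>j\<close> from \<open>w\<close>; if the current state lies in the cell
  \<open>{-j..j}\<close>, it is redrawn from the stationary law \<open>\<mu>\<close> conditioned on that cell, otherwise
  it stays.  These conditional expectations are nested, so \<open>n\<close> steps amount to a single one with the
  maximum of \<open>n\<close> levels.\<close>

locale hierarchy =
  fixes \<mu> :: "int pmf" and w :: "nat pmf"
  assumes symmetric: "pmf \<mu> (- z) = pmf \<mu> z"
    and pmf_\<mu>_pos: "pmf \<mu> z > 0"
    and pmf_w_pos: "pmf w j > 0"
begin

definition cell :: "nat \<Rightarrow> int set" where
  "cell j = {- int j..int j}"

definition redraw :: "nat \<Rightarrow> int \<Rightarrow> int pmf" where
  "redraw j z = (if z \<in> cell j then cond_pmf \<mu> (cell j) else return_pmf z)"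

definition kernel :: "int \<Rightarrow> int pmf" where
  "kernel z = bind_pmf w (\<lambda>j. redraw j z)"

definition \<theta> :: "nat \<Rightarrow> real" where
  "\<theta> k = measure (measure_pmf w) {..<k}"

abbreviation lev :: "int \<Rightarrow> nat" where
  "lev z \<equiv> nat \<bar>z\<bar>"

lemma mem_cell_iff: "z \<in> cell j \<longleftrightarrow> lev z \<le> j"
  by (auto simp: cell_def)

lemma cell_mono: "i \<le> j \<Longrightarrow> cell i \<subseteq> cell j"
  by (auto simp: mem_cell_iff)

lemma zero_in_cell: "0 \<in> cell j"
  by (simp add: mem_cell_iff)

lemma cell_nonnull: "set_pmf \<mu> \<inter> cell j \<noteq> {}"
proof -
  have "0 \<in> set_pmf \<mu>" using pmf_\<mu>_pos[of 0] by (simp add: set_pmf_iff)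
  then show ?thesis using zero_in_cell[of j] by blast
qed

lemma detailed_balance_redraw: "pmf \<mu> x * pmf (redraw j x) y = pmf \<mu> y * pmf (redraw j y) x"
  by (auto simp: redraw_def pmf_cond[OF cell_nonnull] indicator_def)

sublocale reversible_kernel \<mu> kernel
proof
  fix x y
  have "pmf \<mu> x * pmf (kernel x) y = (LINT j|measure_pmf w. pmf \<mu> x * pmf (redraw j x) y)"
    by (simp add: kernel_def pmf_bind)
  also have "\<dots> = pmf \<mu> y * pmf (kernel y) x"
    by (simp add: kernel_def pmf_bind detailed_balance_redraw[of x])
  finally show "pmf \<mu> x * pmf (kernel x) y = pmf \<mu> y * pmf (kernel y) x" .
qed

text \<open>Redrawing in a smaller cell is reversible for the law on the larger one: a move stays
  inside \<open>cell j\<close>, so it never crosses the boundary of \<open>cell i\<close>.\<close>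

lemma bind_cond_redraw:
  assumes "j \<le> i"
  shows "bind_pmf (cond_pmf \<mu> (cell i)) (redraw j) = cond_pmf \<mu> (cell i)"
proof (rule pmf_eqI)
  fix y
  define m where "m = measure (measure_pmf \<mu>) (cell i)"
  have m: "m > 0" unfolding m_def using measure_pmf_posI[of 0 \<mu> "cell i"] zero_in_cell pmf_\<mu>_pos[of 0]
    by (auto simp: set_pmf_iff)
  have *: "pmf (cond_pmf \<mu> (cell i)) x * pmf (redraw j x) y = pmf (cond_pmf \<mu> (cell i)) y * pmf (redraw j y) x" for x
  proof (cases "x \<in> cell i \<longleftrightarrow> y \<in> cell i")
    case True
    then show ?thesis using detailed_balance_redraw[of x j y]
      by (auto simp: pmf_cond[OF cell_nonnull] field_simps)
  next
    case False
    then have "pmf (redraw j x) y = 0" "pmf (redraw j y) x = 0"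
      using cell_mono[OF assms] by (auto simp: redraw_def pmf_cond[OF cell_nonnull] indicator_def)
    then show ?thesis by simp
  qed
  have "ennreal (pmf (bind_pmf (cond_pmf \<mu> (cell i)) (redraw j)) y) =
      (\<integral>\<^sup>+x. ennreal (pmf (cond_pmf \<mu> (cell i)) x) * ennreal (pmf (redraw j x) y) \<partial>count_space UNIV)"
    by (simp add: ennreal_pmf_bind nn_integral_measure_pmf)
  also have "\<dots> = (\<integral>\<^sup>+x. ennreal (pmf (cond_pmf \<mu> (cell i)) y) * ennreal (pmf (redraw j y) x) \<partial>count_space UNIV)"
    by (simp only: ennreal_mult'[symmetric] pmf_nonneg *)
  also have "\<dots> = ennreal (pmf (cond_pmf \<mu> (cell i)) y)"
    by (simp add: nn_integral_cmult nn_integral_pmf)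
  finally show "pmf (bind_pmf (cond_pmf \<mu> (cell i)) (redraw j)) y = pmf (cond_pmf \<mu> (cell i)) y" by simp
qed

text \<open>The tower property of nested conditional expectations: the coarser of the two redraws
  decides.\<close>

lemma bind_redraw_redraw: "bind_pmf (redraw i x) (redraw j) = redraw (max i j) x"
proof (cases "x \<in> cell i")
  case False
  then show ?thesis using cell_mono[of j i]
    by (auto simp: redraw_def bind_return_pmf max_def)
next
  case True
  show ?thesis
  proof (cases "j \<le> i")
    case True
    then show ?thesis using \<open>x \<in> cell i\<close> bind_cond_redraw[OF True] by (simp add: redraw_def max_absorb1)
  next
    case False
    have "bind_pmf (redraw i x) (redraw j) = bind_pmf (redraw i x) (\<lambda>_. cond_pmf \<mu> (cell j))"
    proof (rule bind_pmf_cong[OF refl])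
      fix y assume "y \<in> set_pmf (redraw i x)"
      then have "y \<in> cell j" using True False cell_mono[of i j]
        by (auto simp: redraw_def set_cond_pmf[OF cell_nonnull])
      then show "redraw j y = cond_pmf \<mu> (cell j)" by (simp add: redraw_def)
    qed
    then show ?thesis using True False cell_mono[of i j] by (auto simp: redraw_def max_def)
  qed
qed

primrec max_level :: "nat \<Rightarrow> nat pmf" where
  "max_level 0 = return_pmf 0"
| "max_level (Suc n) = bind_pmf (max_level n) (\<lambda>i. map_pmf (max i) w)"

text \<open>The cell of level 0 is a single state, so redrawing it changes nothing; hence 0 is the
  neutral initial value in \<open>max_level\<close>.\<close>

lemma redraw_0: "redraw 0 x = return_pmf x"
proof (cases "x = 0")
  case True
  have "cell 0 = {0}" by (auto simp: cell_def)
  moreover have "pmf (cond_pmf \<mu> {0}) y = pmf (return_pmf 0) y" for y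
    using cell_nonnull[of 0] pmf_\<mu>_pos[of 0] unfolding \<open>cell 0 = {0}\<close>
    by (subst pmf_cond) (auto simp: measure_pmf_single)
  ultimately show ?thesis using True by (auto simp: redraw_def intro!: pmf_eqI)
qed (simp add: redraw_def cell_def)

lemma step_pow_eq: "step_pow n x = bind_pmf (max_level n) (\<lambda>j. redraw j x)"
proof (induction n)
  case 0
  show ?case by (simp add: redraw_0 bind_return_pmf)
next
  case (Suc n)
  have "step_pow (Suc n) x = bind_pmf (max_level n) (\<lambda>i. bind_pmf (redraw i x) kernel)"
    by (simp add: Suc.IH bind_assoc_pmf)
  also have "\<dots> = bind_pmf (max_level n) (\<lambda>i. bind_pmf w (\<lambda>j. bind_pmf (redraw i x) (\<lambda>y. redraw j y)))"
    unfolding kernel_def[abs_def] by (subst bind_commute_pmf) simp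
  also have "\<dots> = bind_pmf (max_level (Suc n)) (\<lambda>j. redraw j x)"
    by (simp add: bind_redraw_redraw bind_assoc_pmf bind_map_pmf)
  finally show ?case .
qed

lemma max_level_less: "k > 0 \<Longrightarrow> measure (measure_pmf (max_level n)) {..<k} = \<theta> k ^ n"
proof (induction n)
  case (Suc n)
  have "measure (measure_pmf (max_level (Suc n))) {..<k} =
      (LINT i|measure_pmf (max_level n). measure (measure_pmf w) {j. max i j < k})"
  proof -
    have "measure (measure_pmf (max_level (Suc n))) {..<k} = (LINT j|measure_pmf (max_level (Suc n)). indicator {..<k} j)"
      by (simp del: max_level.simps)
    also have "\<dots> = (LINT i|measure_pmf (max_level n). LINT j|measure_pmf w. indicator {..<k} (max i j))"
      unfolding max_level.simps
      by (subst integral_bind_pmf_real[where B = 1]) (simp_all only: integral_map_pmf, auto simp: indicator_def)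
    also have "\<dots> = (LINT i|measure_pmf (max_level n). LINT j|measure_pmf w. indicator {j. max i j < k} j)"
      by (intro Bochner_Integration.integral_cong) (auto simp: indicator_def)
    also have "\<dots> = (LINT i|measure_pmf (max_level n). measure (measure_pmf w) {j. max i j < k})"
      by (simp only: integral_pmf_indicator)
    finally show ?thesis .
  qed
  also have "\<dots> = (LINT i|measure_pmf (max_level n). \<theta> k * indicator {..<k} i)"
    by (intro Bochner_Integration.integral_cong)
       (auto simp: indicator_def \<theta>_def lessThan_def intro!: arg_cong[where f = "measure (measure_pmf w)"])
  finally show ?case using Suc by simp
qed (simp add: indicator_def)

text \<open>An odd function has mean 0 on every symmetric cell, so one redraw erases it. Only frozen
  states carry correlation.\<close>

lemma integral_redraw_odd:
  fixes f :: "int \<Rightarrow> real"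
  assumes "\<And>z. f (- z) = - f z"
  shows "integral\<^sup>L (measure_pmf (redraw j x)) f = (if x \<in> cell j then 0 else f x)"
proof (cases "x \<in> cell j")
  case True
  have "map_pmf uminus (cond_pmf \<mu> (cell j)) = cond_pmf \<mu> (cell j)"
  proof (rule pmf_eqI)
    fix z :: int
    have "pmf (map_pmf uminus (cond_pmf \<mu> (cell j))) (- (- z)) = pmf (cond_pmf \<mu> (cell j)) (- z)"
      by (rule pmf_map_inj') (auto simp: inj_on_def)
    also have "\<dots> = pmf (cond_pmf \<mu> (cell j)) z"
      by (simp add: pmf_cond[OF cell_nonnull] symmetric mem_cell_iff)
    finally show "pmf (map_pmf uminus (cond_pmf \<mu> (cell j))) z = pmf (cond_pmf \<mu> (cell j)) z" by simp
  qed
  then have "integral\<^sup>L (measure_pmf (cond_pmf \<mu> (cell j))) f = integral\<^sup>L (measure_pmf (map_pmf uminus (cond_pmf \<mu> (cell j)))) f"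
    by simp
  also have "\<dots> = - integral\<^sup>L (measure_pmf (cond_pmf \<mu> (cell j))) f"
    by (simp add: assms)
  finally show ?thesis using True by (simp add: redraw_def)
qed (simp add: redraw_def)

end

section \<open>Mixing coefficients of the hierarchical chain\<close>

locale hierarchy_chain = hierarchy \<mu> w + stationary_chain \<mu> "hierarchy.kernel \<mu> w" M Z
  for \<mu> w and M :: "'a measure" and Z
begin

text \<open>Given the initial state \<open>x\<close> and the maximal level \<open>j\<close> of the
  \<open>n\<close> steps, the later state has law \<open>redraw j x\<close>. If \<open>x\<close>
  lies in \<open>cell j\<close>, this is at distance \<open>2 * measure \<mu> (- cell j)\<close>
  from \<open>\<mu>\<close>, otherwise at distance at most 2.\<close>

lemma beta_sum_le:
  assumes P: "P \<in> finite_partitions M (gen_sigma M (\<lambda>k \<omega>. v (Z k \<omega>)) {..0})"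
    and Q: "Q \<in> finite_partitions M (gen_sigma M (\<lambda>k \<omega>. v (Z k \<omega>)) {int n..})" and n: "n \<ge> 1"
  shows "1 / 2 * (\<Sum>A\<in>P. \<Sum>B\<in>Q. \<bar>prob (A \<inter> B) - prob A * prob B\<bar>) \<le>
    2 * (LINT z|measure_pmf \<mu>. \<theta> (lev z) ^ n)"
proof -
  have Pp: "finite P" "partition_on (space M) P" and PA: "\<And>A. A \<in> P \<Longrightarrow> A \<in> sigma_sets (space M) (past_events 0)"
    and Qp: "finite Q" "partition_on (space M) Q" and QB: "\<And>B. B \<in> Q \<Longrightarrow> B \<in> sigma_sets (space M) (future_events (int n))"
    using P Q gen_sigma_past[of v 0] gen_sigma_future[of v "int n"] unfolding finite_partitions_def by blast+
  have PAe: "A \<in> P \<Longrightarrow> A \<in> events" for A using PA sigma_past_events_subset by blast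
  have QBe: "B \<in> Q \<Longrightarrow> B \<in> events" for B using QB sigma_future_events_subset by blast
  have cond_sum: "(\<Sum>A\<in>R. cond m A x) \<le> 1" if "finite R" "partition_on (space M) R" "R \<subseteq> events" for R m x
  proof (cases "pmf \<mu> x = 0")
    case False
    have "(\<Sum>A\<in>R. prob ({\<omega> \<in> space M. Z m \<omega> = x} \<inter> A)) = prob (\<Union>A\<in>R. {\<omega> \<in> space M. Z m \<omega> = x} \<inter> A)"
      using that partition_onD2[OF that(2)]
      by (intro finite_measure_finite_Union[symmetric]) (auto simp: disjoint_family_on_def disjoint_def)
    also have "\<dots> \<le> prob {\<omega> \<in> space M. Z m \<omega> \<in> {x}}"
      by (rule finite_measure_mono) (auto, measurable)
    also have "\<dots> = pmf \<mu> x" unfolding prob_Z by (simp add: pmf.rep_eq)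
    finally show ?thesis using False
      by (simp add: cond_def sum_divide_distrib[symmetric] divide_le_eq_1 pmf_pos)
  qed (simp add: cond_def)
  have cond_sum_P: "(\<Sum>A\<in>P. cond 0 A x) \<le> 1" for x using cond_sum[OF Pp] PAe by blast
  have cond_sum_Q: "(\<Sum>B\<in>Q. cond (int n) B x) \<le> 1" for x using cond_sum[OF Qp] QBe by blast
  define d where "d = (\<lambda>B x. integral\<^sup>L (measure_pmf (step_pow n x)) (cond (int n) B) - integral\<^sup>L (measure_pmf \<mu>) (cond (int n) B))"
  define e where "e = (\<lambda>B j x. integral\<^sup>L (measure_pmf (redraw j x)) (cond (int n) B) - integral\<^sup>L (measure_pmf \<mu>) (cond (int n) B))"
  have int01: "0 \<le> integral\<^sup>L (measure_pmf q) (cond m B)" "integral\<^sup>L (measure_pmf q) (cond m B) \<le> 1" for q m B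
    using norm_integral_pmf_le[of q "cond m B" 1] by (auto simp: cond_nonneg cond_le_1 integral_nonneg_AE abs_le_iff)
  have d1: "\<bar>d B x\<bar> \<le> 1" and e1: "\<bar>e B j x\<bar> \<le> 1" for B j x
    unfolding d_def e_def using int01 by (smt (verit))+
  have d_eq: "d B x = (LINT j|measure_pmf (max_level n). e B j x)" for B x
  proof -
    have i: "integrable (measure_pmf (max_level n)) (\<lambda>j. integral\<^sup>L (measure_pmf (redraw j x)) (cond (int n) B))"
      using int01 by (intro integrable_pmf_bounded[where B = 1]) auto
    have "integral\<^sup>L (measure_pmf (step_pow n x)) (cond (int n) B) =
        (LINT j|measure_pmf (max_level n). integral\<^sup>L (measure_pmf (redraw j x)) (cond (int n) B))"
      unfolding step_pow_eq by (rule integral_bind_pmf_real[where B = 1]) (simp add: cond_nonneg cond_le_1)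
    then show ?thesis
      unfolding d_def e_def by (subst Bochner_Integration.integral_diff[OF i]) auto
  qed
  have diff: "\<bar>prob (A \<inter> B) - prob A * prob B\<bar> \<le> (LINT x|measure_pmf \<mu>. cond 0 A x * \<bar>d B x\<bar>)"
    if A: "A \<in> P" and B: "B \<in> Q" for A B
  proof -
    have "prob (A \<inter> B) - prob A * prob B = (LINT x|measure_pmf \<mu>. cond 0 A x * d B x)"
    proof -
      have i: "integrable (measure_pmf \<mu>) (\<lambda>x. cond 0 A x * (LINT y|measure_pmf (step_pow n x). cond (int n) B y))"
        "integrable (measure_pmf \<mu>) (\<lambda>x. cond 0 A x * integral\<^sup>L (measure_pmf \<mu>) (cond (int n) B))"
        using int01 by (auto simp: abs_mult cond_nonneg cond_le_1 intro!: integrable_pmf_bounded[where B = 1] mult_le_one)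
      have "prob A * prob B = (LINT x|measure_pmf \<mu>. cond 0 A x * integral\<^sup>L (measure_pmf \<mu>) (cond (int n) B))"
        by (simp add: prob_eq_integral_cond[OF PAe[OF A], of 0] prob_eq_integral_cond[OF QBe[OF B], of "int n"])
      then show ?thesis
        unfolding prob_Int_eq_integral_cond[OF PA[OF A] QB[OF B]] d_def right_diff_distrib
        using Bochner_Integration.integral_diff[OF i] by simp
    qed
    also have "\<bar>\<dots>\<bar> \<le> (LINT x|measure_pmf \<mu>. \<bar>cond 0 A x * d B x\<bar>)"
      by (rule integral_abs_bound)
    finally show ?thesis by (simp add: abs_mult cond_nonneg)
  qed
  have "(\<Sum>A\<in>P. \<Sum>B\<in>Q. \<bar>prob (A \<inter> B) - prob A * prob B\<bar>) \<le>
      (\<Sum>A\<in>P. \<Sum>B\<in>Q. (LINT x|measure_pmf \<mu>. cond 0 A x * \<bar>d B x\<bar>))"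
    by (intro sum_mono diff)
  also have "\<dots> = (LINT x|measure_pmf \<mu>. (\<Sum>A\<in>P. \<Sum>B\<in>Q. cond 0 A x * \<bar>d B x\<bar>))"
    using d1 by (simp add: Bochner_Integration.integral_sum Bochner_Integration.integrable_sum
        integrable_pmf_bounded[where B = 1] abs_mult cond_nonneg cond_le_1 mult_le_one)
  also have "\<dots> \<le> (LINT x|measure_pmf \<mu>. (\<Sum>B\<in>Q. \<bar>d B x\<bar>))"
  proof (rule integral_mono)
    have db: "(\<Sum>B\<in>Q. \<bar>d B x\<bar>) \<le> card Q" for x
      using sum_bounded_above[of Q "\<lambda>B. \<bar>d B x\<bar>" 1] d1 by simp
    show "integrable (measure_pmf \<mu>) (\<lambda>x. \<Sum>B\<in>Q. \<bar>d B x\<bar>)"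
      by (rule integrable_pmf_bounded[where B = "card Q"]) (use db in \<open>auto simp: abs_sum_abs\<close>)
    have *: "(\<Sum>A\<in>P. \<Sum>B\<in>Q. cond 0 A x * \<bar>d B x\<bar>) = (\<Sum>A\<in>P. cond 0 A x) * (\<Sum>B\<in>Q. \<bar>d B x\<bar>)" for x
      by (simp add: sum_product)
    have nn: "0 \<le> (\<Sum>A\<in>P. cond 0 A x)" for x by (simp add: sum_nonneg cond_nonneg)
    show "(\<Sum>A\<in>P. \<Sum>B\<in>Q. cond 0 A x * \<bar>d B x\<bar>) \<le> (\<Sum>B\<in>Q. \<bar>d B x\<bar>)" for x
      unfolding * using cond_sum_P[of x] by (intro mult_left_le_one_le) (auto simp: sum_nonneg cond_nonneg)
    then show "integrable (measure_pmf \<mu>) (\<lambda>x. \<Sum>A\<in>P. \<Sum>B\<in>Q. cond 0 A x * \<bar>d B x\<bar>)"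
      by (intro integrable_pmf_bounded[where B = "card Q"])
         (use db in \<open>fastforce simp: sum_nonneg cond_nonneg intro: order_trans\<close>)
  qed
  also have "\<dots> \<le> (LINT x|measure_pmf \<mu>. LINT j|measure_pmf (max_level n). 2 * measure (measure_pmf \<mu>) (- cell j) + 2 * indicator (- cell j) x)"
  proof (rule integral_mono)
    have db: "(\<Sum>B\<in>Q. \<bar>d B x\<bar>) \<le> card Q" for x
      using sum_bounded_above[of Q "\<lambda>B. \<bar>d B x\<bar>" 1] d1 by simp
    show "integrable (measure_pmf \<mu>) (\<lambda>x. \<Sum>B\<in>Q. \<bar>d B x\<bar>)"
      by (rule integrable_pmf_bounded[where B = "card Q"]) (use db in \<open>auto simp: abs_sum_abs\<close>)
    have b4: "norm (2 * measure (measure_pmf \<mu>) (- cell j) + 2 * indicator (- cell j) x) \<le> (4::real)" for j x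
      using measure_pmf.prob_le_1[of \<mu> "- cell j"] by (auto simp: indicator_def simp del: measure_pmf.prob_le_1)
    then show "integrable (measure_pmf \<mu>) (\<lambda>x. LINT j|measure_pmf (max_level n). 2 * measure (measure_pmf \<mu>) (- cell j) + 2 * indicator (- cell j) x)"
      by (intro integrable_pmf_bounded[where B = 4] norm_integral_pmf_le)
    fix x
    have "(\<Sum>B\<in>Q. \<bar>d B x\<bar>) \<le> (\<Sum>B\<in>Q. LINT j|measure_pmf (max_level n). \<bar>e B j x\<bar>)"
      unfolding d_eq by (intro sum_mono integral_abs_bound)
    also have "\<dots> = (LINT j|measure_pmf (max_level n). (\<Sum>B\<in>Q. \<bar>e B j x\<bar>))"
      using e1 by (simp add: Bochner_Integration.integral_sum integrable_pmf_bounded[where B = 1])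
    also have "\<dots> \<le> (LINT j|measure_pmf (max_level n). 2 * measure (measure_pmf \<mu>) (- cell j) + 2 * indicator (- cell j) x)"
    proof (rule integral_mono)
      have "(\<Sum>B\<in>Q. \<bar>e B j x\<bar>) \<le> card Q" for j
        using sum_bounded_above[of Q "\<lambda>B. \<bar>e B j x\<bar>" 1] e1 by simp
      then show "integrable (measure_pmf (max_level n)) (\<lambda>j. \<Sum>B\<in>Q. \<bar>e B j x\<bar>)"
        by (intro integrable_pmf_bounded[where B = "card Q"]) (auto simp: abs_sum_abs)
      show "integrable (measure_pmf (max_level n)) (\<lambda>j. 2 * measure (measure_pmf \<mu>) (- cell j) + 2 * indicator (- cell j) x)"
        by (rule integrable_pmf_bounded[where B = 4]) (rule b4)
      fix j
      show "(\<Sum>B\<in>Q. \<bar>e B j x\<bar>) \<le> 2 * measure (measure_pmf \<mu>) (- cell j) + 2 * indicator (- cell j) x"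
      proof (cases "x \<in> cell j")
        case True
        then show ?thesis
          using sum_abs_integral_cond_pmf_diff_le[OF Qp(1), of "cond (int n)" \<mu> "cell j"] cond_sum_Q cell_nonnull
          by (simp add: e_def redraw_def cond_nonneg)
      next
        case False
        have "(\<Sum>B\<in>Q. \<bar>e B j x\<bar>) \<le> 2"
          unfolding e_def by (rule sum_abs_integral_diff_le) (use Qp cond_sum_Q in \<open>auto simp: cond_nonneg\<close>)
        then show ?thesis using False by (simp add: add_increasing)
      qed
    qed
    finally show "(\<Sum>B\<in>Q. \<bar>d B x\<bar>) \<le> (LINT j|measure_pmf (max_level n). 2 * measure (measure_pmf \<mu>) (- cell j) + 2 * indicator (- cell j) x)" .
  qed
  \<comment> \<open>Both terms have the same mean: exchanging the integrals turns the measure of the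
    complement of \<open>cell j\<close> into the probability that a stationary state is still
    frozen.\<close>
  also have "\<dots> = 4 * (LINT x|measure_pmf \<mu>. LINT j|measure_pmf (max_level n). indicator (- cell j) x)"
  proof -
    have i: "integrable (measure_pmf p) (\<lambda>j. indicator (A j) (f j) :: real)" for p :: "'d pmf" and A :: "'d \<Rightarrow> int set" and f
      by (rule integrable_pmf_bounded[where B = 1]) (auto simp: indicator_def)
    have i': "integrable (measure_pmf p) (\<lambda>j. measure (measure_pmf \<mu>) (A j))" for p :: "'d pmf" and A :: "'d \<Rightarrow> int set"
      by (rule integrable_pmf_bounded[where B = 1]) auto
    have i'': "integrable (measure_pmf \<mu>) (\<lambda>x. LINT j|measure_pmf (max_level n). indicator (- cell j) x :: real)"
      by (intro integrable_pmf_bounded[where B = 1] norm_integral_pmf_le) (auto simp: indicator_def)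
    have "(LINT x|measure_pmf \<mu>. LINT j|measure_pmf (max_level n). indicator (- cell j) x :: real) =
        (LINT j|measure_pmf (max_level n). LINT x|measure_pmf \<mu>. indicator (- cell j) x)"
      by (rule integral_pmf_commute[where B = 1]) (auto simp: indicator_def)
    also have "\<dots> = (LINT j|measure_pmf (max_level n). measure (measure_pmf \<mu>) (- cell j))" by simp
    finally have eq: "(LINT x|measure_pmf \<mu>. LINT j|measure_pmf (max_level n). indicator (- cell j) x) =
        (LINT j|measure_pmf (max_level n). measure (measure_pmf \<mu>) (- cell j))" .
    have "(LINT x|measure_pmf \<mu>. LINT j|measure_pmf (max_level n). 2 * measure (measure_pmf \<mu>) (- cell j) + 2 * indicator (- cell j) x) =
        (LINT x|measure_pmf \<mu>. 2 * (LINT j|measure_pmf (max_level n). measure (measure_pmf \<mu>) (- cell j)) +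
           2 * (LINT j|measure_pmf (max_level n). indicator (- cell j) x))"
      by (intro Bochner_Integration.integral_cong refl, subst Bochner_Integration.integral_add)
         (use i' i in \<open>simp_all del: integral_indicator\<close>)
    also have "\<dots> = 2 * (LINT j|measure_pmf (max_level n). measure (measure_pmf \<mu>) (- cell j)) +
        2 * (LINT x|measure_pmf \<mu>. LINT j|measure_pmf (max_level n). indicator (- cell j) x)"
      using i'' by (subst Bochner_Integration.integral_add) auto
    finally show ?thesis unfolding eq by simp
  qed
  also have "(LINT x|measure_pmf \<mu>. LINT j|measure_pmf (max_level n). indicator (- cell j) x) =
      (LINT z|measure_pmf \<mu>. \<theta> (lev z) ^ n)"
  proof (intro Bochner_Integration.integral_cong refl)
    fix z
    have "(LINT j|measure_pmf (max_level n). indicator (- cell j) z) = (LINT j|measure_pmf (max_level n). indicator {..<lev z} j)"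
      by (intro Bochner_Integration.integral_cong) (auto simp: indicator_def mem_cell_iff)
    also have "\<dots> = measure (measure_pmf (max_level n)) {..<lev z}" by simp
    \<comment> \<open>For level 0 the left side is 0 and \<open>\<theta> 0 = 0\<close>, so the
      identity rests on \<open>n \<ge> 1\<close> there.\<close>
    also have "\<dots> = \<theta> (lev z) ^ n"
      using max_level_less[of "lev z" n] n by (cases "lev z = 0") (auto simp: \<theta>_def)
    finally show "(LINT j|measure_pmf (max_level n). indicator (- cell j) z) = \<theta> (lev z) ^ n" .
  qed
  finally show ?thesis by simp
qed

lemma beta_mix_le:
  assumes n: "n \<ge> 1"
  shows "beta_mix M (\<lambda>k \<omega>. v (Z k \<omega>)) n \<le> 2 * (LINT z|measure_pmf \<mu>. \<theta> (lev z) ^ n)"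
  unfolding beta_mix_def beta_coeff_def
proof (rule cSUP_least)
  have "{space M} \<in> finite_partitions M (gen_sigma M (\<lambda>k \<omega>. v (Z k \<omega>)) I)" for I
    using not_empty by (auto simp: finite_partitions_def gen_sigma_def sigma_sets_top intro!: partition_on_space)
  then show "finite_partitions M (gen_sigma M (\<lambda>k \<omega>. v (Z k \<omega>)) {..0}) \<times>
      finite_partitions M (gen_sigma M (\<lambda>k \<omega>. v (Z k \<omega>)) {int n..}) \<noteq> {}" by blast
qed (use beta_sum_le[OF _ _ n] in auto)

text \<open>Test the supremum on the partitions of the space by \<open>A\<close> and by
  \<open>B\<close>. Trivial sets are treated apart, since their complements would be empty blocks;
  \<open>beta_sum_le\<close> supplies the boundedness that makes the real supremum
  meaningful.\<close>

lemma alpha_mix_le_beta_mix: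
  assumes n: "n \<ge> 1"
  shows "alpha_mix M (\<lambda>k \<omega>. v (Z k \<omega>)) n \<le> beta_mix M (\<lambda>k \<omega>. v (Z k \<omega>)) n"
proof -
  define FA where "FA = gen_sigma M (\<lambda>k \<omega>. v (Z k \<omega>)) {..0}"
  define FB where "FB = gen_sigma M (\<lambda>k \<omega>. v (Z k \<omega>)) {int n..}"
  have FAe: "FA \<subseteq> events" and FBe: "FB \<subseteq> events"
    unfolding FA_def FB_def
    using gen_sigma_past[of v 0] gen_sigma_future[of v "int n"] sigma_past_events_subset sigma_future_events_subset by blast+
  define F where "F = (\<lambda>(P, Q). 1 / 2 * (\<Sum>A\<in>P. \<Sum>B\<in>Q. \<bar>prob (A \<inter> B) - prob A * prob B\<bar>))"
  have bdd: "bdd_above (F ` (finite_partitions M FA \<times> finite_partitions M FB))"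
    by (rule bdd_aboveI[where M = "2 * (LINT z|measure_pmf \<mu>. \<theta> (lev z) ^ n)"])
       (use beta_sum_le[OF _ _ n] in \<open>auto simp: F_def FA_def FB_def\<close>)
  have F_le: "F PQ \<le> beta_mix M (\<lambda>k \<omega>. v (Z k \<omega>)) n" if "PQ \<in> finite_partitions M FA \<times> finite_partitions M FB" for PQ
    unfolding beta_mix_def beta_coeff_def FA_def[symmetric] FB_def[symmetric] F_def[symmetric]
    by (rule cSUP_upper[OF that bdd])
  have compl: "space M - A \<in> FA" "space M \<in> FA" if "A \<in> FA" for A
    using that unfolding FA_def gen_sigma_def by (auto intro: sigma_sets.Compl sigma_sets_top)
  have compl': "space M - A \<in> FB" "space M \<in> FB" if "A \<in> FB" for A
    using that unfolding FB_def gen_sigma_def by (auto intro: sigma_sets.Compl sigma_sets_top)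
  have ne: "{} \<in> FA" "{} \<in> FB" unfolding FA_def FB_def gen_sigma_def by (auto intro: sigma_sets.Empty)
  have part2: "partition_on (space M) {A, space M - A}" if "A \<noteq> {}" "A \<subset> space M" for A
    using that by (auto simp: partition_on_def disjoint_def)
  have space_part: "{space M} \<in> finite_partitions M FA" "{space M} \<in> finite_partitions M FB"
    using not_empty compl(2)[OF ne(1)] compl'(2)[OF ne(2)] by (auto simp: finite_partitions_def intro!: partition_on_space)
  have "0 \<le> F ({space M}, {space M})" by (simp add: F_def)
  also have "\<dots> \<le> beta_mix M (\<lambda>k \<omega>. v (Z k \<omega>)) n" using space_part by (intro F_le) auto
  finally have beta0: "0 \<le> beta_mix M (\<lambda>k \<omega>. v (Z k \<omega>)) n" .
  show ?thesis
    unfolding alpha_mix_def alpha_coeff_def FA_def[symmetric] FB_def[symmetric]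
  proof (rule cSUP_least, use ne in blast, clarify)
    fix A B assume A: "A \<in> FA" and B: "B \<in> FB"
    have ev: "A \<in> events" "B \<in> events" using A B FAe FBe by auto
    then have sub: "A \<subseteq> space M" "B \<subseteq> space M" using sets.sets_into_space by blast+
    show "\<bar>prob (A \<inter> B) - prob A * prob B\<bar> \<le> beta_mix M (\<lambda>k \<omega>. v (Z k \<omega>)) n"
    proof (cases "A = {} \<or> B = {} \<or> A = space M \<or> B = space M")
      case True
      have "prob (A \<inter> B) = prob A * prob B"
        using True sub by (auto simp: prob_space Int_absorb1 Int_absorb2)
      then show ?thesis using beta0 by simp
    next
      case False
      then have "partition_on (space M) {A, space M - A}" "partition_on (space M) {B, space M - B}"
        using sub by (auto intro!: part2)
      then have P: "{A, space M - A} \<in> finite_partitions M FA" and Q: "{B, space M - B} \<in> finite_partitions M FB"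
        using A B compl(1)[OF A] compl'(1)[OF B] by (auto simp: finite_partitions_def)
      have neq: "A \<noteq> space M - A" "B \<noteq> space M - B" using False sub by auto
      \<comment> \<open>Two of the four terms, which coincide in absolute value, already cancel the
        factor 1/2.\<close>
      have "\<bar>prob (A \<inter> B) - prob A * prob B\<bar> + \<bar>prob ((space M - A) \<inter> (space M - B)) - prob (space M - A) * prob (space M - B)\<bar> \<le>
          2 * F ({A, space M - A}, {B, space M - B})"
        using neq by (simp add: F_def)
      moreover have "prob ((space M - A) \<inter> (space M - B)) - prob (space M - A) * prob (space M - B) = prob (A \<inter> B) - prob A * prob B"
      proof -
        have "(space M - A) \<inter> (space M - B) = space M - (A \<union> B)" by auto
        moreover have "prob (A \<union> B) = prob A + prob B - prob (A \<inter> B)"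
          using finite_measure_Union'[OF ev] finite_measure_Diff'[OF ev(2,1)] by (simp add: Int_commute)
        ultimately show ?thesis using ev by (simp add: prob_compl algebra_simps)
      qed
      ultimately have "\<bar>prob (A \<inter> B) - prob A * prob B\<bar> \<le> F ({A, space M - A}, {B, space M - B})" by simp
      also have "\<dots> \<le> beta_mix M (\<lambda>k \<omega>. v (Z k \<omega>)) n" using P Q by (intro F_le) auto
      finally show ?thesis .
    qed
  qed
qed

end

text \<open>The variance of the sum of \<open>n\<close> consecutive members of a centred,
  unit-variance stationary sequence with autocorrelation \<open>t ^ m\<close> at lag
  \<open>m\<close>.\<close>

definition toeplitz_sum :: "real \<Rightarrow> nat \<Rightarrow> real" where
  "toeplitz_sum t n = (\<Sum>i=1..n. \<Sum>j=1..n. t ^ nat \<bar>int i - int j\<bar>)"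

section \<open>Covariances and second moments of odd observables\<close>

context hierarchy_chain
begin

text \<open>By oddness, the product has nonzero conditional mean only as long as the initial state
  has not been redrawn, an event of probability \<open>\<theta> (lev z) ^ n\<close>.\<close>

lemma covariance_bounded:
  fixes f :: "int \<Rightarrow> real"
  assumes odd: "\<And>z. f (- z) = - f z" and bdd: "\<And>z. \<bar>f z\<bar> \<le> B"
  shows "expectation (\<lambda>\<omega>. f (Z a \<omega>) * f (Z (a + int n) \<omega>)) = (LINT z|measure_pmf \<mu>. (f z)\<^sup>2 * \<theta> (lev z) ^ n)"
proof -
  have B: "B \<ge> 0" using bdd[of 0] by linarith
  have ff: "\<bar>f x * f y\<bar> \<le> B * B" for x y
    unfolding abs_mult using bdd B by (intro mult_mono) auto
  have "expectation (\<lambda>\<omega>. f (Z a \<omega>) * f (Z (a + int n) \<omega>)) = (LINT l|measure_pmf (path_pmf n). f (last l) * f (hd l))"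
    using expectation_obs[of "\<lambda>l. f (last l) * f (hd l)" a n] by simp
  also have "\<dots> = (LINT p|measure_pmf (map_pmf (\<lambda>l. (last l, hd l)) (path_pmf n)). f (fst p) * f (snd p))"
    by simp
  also have "\<dots> = (LINT x|measure_pmf \<mu>. LINT y|measure_pmf (step_pow n x). f x * f y)"
    unfolding endpoints_path_pmf by (subst integral_bind_pmf_real[where B = "B * B"]) (use ff in auto)
  also have "\<dots> = (LINT x|measure_pmf \<mu>. LINT j|measure_pmf (max_level n). f x * (if x \<in> cell j then 0 else f x))"
    unfolding step_pow_eq
    by (subst integral_bind_pmf_real[where B = "B * B"]) (use ff in \<open>auto simp: integral_redraw_odd[where f = f, OF odd]\<close>)
  also have "\<dots> = (LINT x|measure_pmf \<mu>. (f x)\<^sup>2 * \<theta> (lev x) ^ n)"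
  proof (intro Bochner_Integration.integral_cong refl)
    fix x
    have "(LINT j|measure_pmf (max_level n). f x * (if x \<in> cell j then 0 else f x)) =
        (LINT j|measure_pmf (max_level n). (f x)\<^sup>2 * indicator {..<lev x} j)"
      by (intro Bochner_Integration.integral_cong) (auto simp: indicator_def mem_cell_iff power2_eq_square)
    also have "\<dots> = (f x)\<^sup>2 * measure (measure_pmf (max_level n)) {..<lev x}" by simp
    also have "\<dots> = (f x)\<^sup>2 * \<theta> (lev x) ^ n"
    proof (cases "x = 0")
      case True
      then show ?thesis using odd[of 0] by simp
    next
      case False
      then show ?thesis by (subst max_level_less) auto
    qed
    finally show "(LINT j|measure_pmf (max_level n). f x * (if x \<in> cell j then 0 else f x)) = (f x)\<^sup>2 * \<theta> (lev x) ^ n" .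
  qed
  finally show ?thesis .
qed

lemma \<theta>_nonneg: "0 \<le> \<theta> k" and \<theta>_le_1: "\<theta> k \<le> 1"
  by (auto simp: \<theta>_def)

lemma toeplitz_sum_nonneg: "0 \<le> toeplitz_sum (\<theta> k) n"
  unfolding toeplitz_sum_def by (intro sum_nonneg) (simp add: \<theta>_nonneg)

lemma toeplitz_sum_le_square: "toeplitz_sum (\<theta> k) n \<le> (real n)\<^sup>2"
proof -
  have "toeplitz_sum (\<theta> k) n \<le> (\<Sum>i=1..n. \<Sum>j=1..n. 1)"
    unfolding toeplitz_sum_def by (intro sum_mono power_le_one \<theta>_nonneg \<theta>_le_1)
  then show ?thesis by (simp add: power2_eq_square)
qed

lemma second_moment_bounded:
  fixes f :: "int \<Rightarrow> real"
  assumes odd: "\<And>z. f (- z) = - f z" and bdd: "\<And>z. \<bar>f z\<bar> \<le> B"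
  shows "expectation (\<lambda>\<omega>. (\<Sum>i=1..n. f (Z (int i) \<omega>))\<^sup>2) = (LINT z|measure_pmf \<mu>. (f z)\<^sup>2 * toeplitz_sum (\<theta> (lev z)) n)"
proof -
  have B: "B \<ge> 0" using bdd[of 0] by linarith
  have ff: "\<bar>f x * f y\<bar> \<le> B * B" for x y
    unfolding abs_mult using bdd B by (intro mult_mono) auto
  have i1: "integrable M (\<lambda>\<omega>. f (Z a \<omega>) * f (Z b \<omega>))" for a b
    by (rule integrable_const_bound[where B = "B * B"]) (use ff in auto)
  have i2: "integrable (measure_pmf \<mu>) (\<lambda>z. (f z)\<^sup>2 * \<theta> (lev z) ^ m)" for m
  proof (rule integrable_pmf_bounded)
    fix z
    have "\<bar>(f z)\<^sup>2 * \<theta> (lev z) ^ m\<bar> \<le> B * B * 1"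
      unfolding abs_mult using ff[of z z] by (intro mult_mono) (auto simp: power2_eq_square \<theta>_nonneg \<theta>_le_1 power_le_one B)
    then show "norm ((f z)\<^sup>2 * \<theta> (lev z) ^ m) \<le> B * B" by simp
  qed
  have cov: "expectation (\<lambda>\<omega>. f (Z (int i) \<omega>) * f (Z (int j) \<omega>)) = (LINT z|measure_pmf \<mu>. (f z)\<^sup>2 * \<theta> (lev z) ^ nat \<bar>int i - int j\<bar>)" for i j
  proof (cases "i \<le> j")
    case True
    then show ?thesis using covariance_bounded[where f = f, OF odd bdd, of "int i" "j - i"] by (simp add: of_nat_diff nat_diff_distrib')
  next
    case False
    then show ?thesis using covariance_bounded[where f = f, OF odd bdd, of "int j" "i - j"] by (simp add: of_nat_diff nat_diff_distrib' mult.commute)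
  qed
  have "expectation (\<lambda>\<omega>. (\<Sum>i=1..n. f (Z (int i) \<omega>))\<^sup>2) = (\<Sum>i=1..n. \<Sum>j=1..n. expectation (\<lambda>\<omega>. f (Z (int i) \<omega>) * f (Z (int j) \<omega>)))"
    unfolding power2_eq_square sum_product using i1 by (simp add: Bochner_Integration.integral_sum Bochner_Integration.integrable_sum)
  also have "\<dots> = (LINT z|measure_pmf \<mu>. (f z)\<^sup>2 * toeplitz_sum (\<theta> (lev z)) n)"
    unfolding cov toeplitz_sum_def sum_distrib_left using i2
    by (simp add: Bochner_Integration.integral_sum Bochner_Integration.integrable_sum)
  finally show ?thesis .
qed

text \<open>Truncation to finitely many levels keeps \<open>f\<close> odd and makes it bounded;
  dominated convergence then removes the truncation on both sides. The dominating function comes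
  from the Cauchy-Schwarz inequality for the sum.\<close>

lemma
  fixes f :: "int \<Rightarrow> real"
  assumes odd: "\<And>z. f (- z) = - f z" and sq: "integrable (measure_pmf \<mu>) (\<lambda>z. (f z)\<^sup>2)"
  shows second_moment: "expectation (\<lambda>\<omega>. (\<Sum>i=1..n. f (Z (int i) \<omega>))\<^sup>2) = (LINT z|measure_pmf \<mu>. (f z)\<^sup>2 * toeplitz_sum (\<theta> (lev z)) n)"
    and integrable_square_sum: "integrable M (\<lambda>\<omega>. (\<Sum>i=1..n. f (Z (int i) \<omega>))\<^sup>2)"
    and integrable_toeplitz: "integrable (measure_pmf \<mu>) (\<lambda>z. (f z)\<^sup>2 * toeplitz_sum (\<theta> (lev z)) n)"
proof -
  define F where "F = (\<lambda>K z. if lev z \<le> K then f z else 0)"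
  have Fodd: "F K (- z) = - F K z" for K z by (simp add: F_def odd)
  have Fbdd: "\<bar>F K z\<bar> \<le> Max (insert 0 ((\<lambda>z. \<bar>f z\<bar>) ` cell K))" for K z
  proof (rule Max_ge)
    show "\<bar>F K z\<bar> \<in> insert 0 ((\<lambda>z. \<bar>f z\<bar>) ` cell K)"
      by (cases "z \<in> cell K") (auto simp: F_def mem_cell_iff)
  qed (simp add: cell_def)
  have Fle: "\<bar>F K z\<bar> \<le> \<bar>f z\<bar>" for K z by (simp add: F_def)
  have Flim: "(\<lambda>K. F K z) \<longlonglongrightarrow> f z" for z
    by (rule tendsto_eventually) (auto simp: F_def eventually_sequentially intro: exI[of _ "lev z"])
  have sqZ: "integrable M (\<lambda>\<omega>. (f (Z k \<omega>))\<^sup>2)" for k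
    using sq by (subst integrable_Z_iff)
  have dom: "(\<Sum>i=1..n. g i)\<^sup>2 \<le> real n * (\<Sum>i=1..n. (h i)\<^sup>2)" if "\<And>i. \<bar>g i\<bar> \<le> \<bar>h i\<bar>" for g h :: "nat \<Rightarrow> real"
  proof -
    have "(\<Sum>i=1..n. g i)\<^sup>2 \<le> (\<Sum>i=1..n. (g i)\<^sup>2) * (\<Sum>i=1..n. 1\<^sup>2)"
      using Cauchy_Schwarz_ineq_sum[of g "\<lambda>_. 1" "{1..n}"] by simp
    also have "\<dots> \<le> (\<Sum>i=1..n. (h i)\<^sup>2) * (\<Sum>i=1..n. 1\<^sup>2)"
      using that by (intro mult_right_mono sum_mono) (auto simp: abs_le_square_iff)
    finally show ?thesis by (simp add: mult.commute)
  qed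
  have domint: "integrable M (\<lambda>\<omega>. real n * (\<Sum>i=1..n. (f (Z (int i) \<omega>))\<^sup>2))"
    using sqZ by auto
  show isq: "integrable M (\<lambda>\<omega>. (\<Sum>i=1..n. f (Z (int i) \<omega>))\<^sup>2)"
    by (rule Bochner_Integration.integrable_bound[OF domint])
       (use dom[of "\<lambda>i. f (Z (int i) \<omega>)" "\<lambda>i. f (Z (int i) \<omega>)" for \<omega>] in \<open>auto simp: sum_nonneg\<close>)
  have domV: "integrable (measure_pmf \<mu>) (\<lambda>z. (f z)\<^sup>2 * (real n)\<^sup>2)" using sq by auto
  show "integrable (measure_pmf \<mu>) (\<lambda>z. (f z)\<^sup>2 * toeplitz_sum (\<theta> (lev z)) n)"
    by (rule Bochner_Integration.integrable_bound[OF domV])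
       (auto simp: abs_mult toeplitz_sum_nonneg intro!: mult_left_mono toeplitz_sum_le_square)
  have L: "(\<lambda>K. expectation (\<lambda>\<omega>. (\<Sum>i=1..n. F K (Z (int i) \<omega>))\<^sup>2)) \<longlonglongrightarrow> expectation (\<lambda>\<omega>. (\<Sum>i=1..n. f (Z (int i) \<omega>))\<^sup>2)"
  proof (rule integral_dominated_convergence[OF _ _ domint])
    show "AE \<omega> in M. (\<lambda>K. (\<Sum>i=1..n. F K (Z (int i) \<omega>))\<^sup>2) \<longlonglongrightarrow> (\<Sum>i=1..n. f (Z (int i) \<omega>))\<^sup>2"
      by (intro AE_I2 tendsto_intros Flim)
    show "AE \<omega> in M. norm ((\<Sum>i=1..n. F K (Z (int i) \<omega>))\<^sup>2) \<le> real n * (\<Sum>i=1..n. (f (Z (int i) \<omega>))\<^sup>2)" for K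
      using dom[of "\<lambda>i. F K (Z (int i) \<omega>)" "\<lambda>i. f (Z (int i) \<omega>)" for \<omega>] Fle by auto
  qed auto
  have R: "(\<lambda>K. LINT z|measure_pmf \<mu>. (F K z)\<^sup>2 * toeplitz_sum (\<theta> (lev z)) n) \<longlonglongrightarrow> (LINT z|measure_pmf \<mu>. (f z)\<^sup>2 * toeplitz_sum (\<theta> (lev z)) n)"
  proof (rule integral_dominated_convergence[OF _ _ domV])
    show "AE z in measure_pmf \<mu>. (\<lambda>K. (F K z)\<^sup>2 * toeplitz_sum (\<theta> (lev z)) n) \<longlonglongrightarrow> (f z)\<^sup>2 * toeplitz_sum (\<theta> (lev z)) n"
      by (intro AE_I2 tendsto_intros Flim)
    show "AE z in measure_pmf \<mu>. norm ((F K z)\<^sup>2 * toeplitz_sum (\<theta> (lev z)) n) \<le> (f z)\<^sup>2 * (real n)\<^sup>2" for K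
      using Fle by (auto simp: abs_mult toeplitz_sum_nonneg abs_le_square_iff intro!: mult_mono toeplitz_sum_le_square)
  qed auto
  show "expectation (\<lambda>\<omega>. (\<Sum>i=1..n. f (Z (int i) \<omega>))\<^sup>2) = (LINT z|measure_pmf \<mu>. (f z)\<^sup>2 * toeplitz_sum (\<theta> (lev z)) n)"
    using LIMSEQ_unique[OF L] R unfolding second_moment_bounded[where f = "F K" for K, OF Fodd Fbdd] by blast
qed

end

section \<open>Characteristic functions of partial sums\<close>

context reversible_kernel
begin

lemma integrable_tilt_arg:
  fixes u h :: "int \<Rightarrow> complex"
  assumes "\<And>x. norm (u x) \<le> 1" "\<And>x. norm (h x) \<le> B"
  shows "integrable (measure_pmf p) (\<lambda>y. u y * h y)"
proof (rule integrable_pmf_bounded[where B = B])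
  fix y
  have "norm (u y) * norm (h y) \<le> 1 * B" using assms by (intro mult_mono) auto
  then show "norm (u y * h y) \<le> B" by (simp add: norm_mult)
qed

lemma tilt_pow_linear:
  assumes u: "\<And>x. norm (u x) \<le> 1" and f: "\<And>x. norm (f x) \<le> B" and g: "\<And>x. norm (g x) \<le> B'"
  shows "(tilt u ^^ n) (\<lambda>x. f x - c * g x) = (\<lambda>x. (tilt u ^^ n) f x - c * (tilt u ^^ n) g x)"
proof (induction n)
  case (Suc n)
  define F where "F = (tilt u ^^ n) f"
  define G where "G = (tilt u ^^ n) g"
  have "tilt u (\<lambda>x. F x - c * G x) x = tilt u F x - c * tilt u G x" for x
  proof -
    have 1: "integrable (measure_pmf (K x)) (\<lambda>y. u y * F y)"
      unfolding F_def by (rule integrable_tilt_arg[where B = B]) (rule u norm_tilt_pow_le[where u = u and h = f, OF u f])+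
    have 2: "integrable (measure_pmf (K x)) (\<lambda>y. u y * G y)"
      unfolding G_def by (rule integrable_tilt_arg[where B = B']) (rule u norm_tilt_pow_le[where u = u and h = g, OF u g])+
    have "tilt u (\<lambda>x. F x - c * G x) x = (LINT y|measure_pmf (K x). u y * F y - c * (u y * G y))"
      unfolding tilt_def by (simp add: algebra_simps)
    also have "\<dots> = tilt u F x - c * tilt u G x"
      unfolding tilt_def using 1 2 by (subst Bochner_Integration.integral_diff) auto
    finally show ?thesis .
  qed
  then show ?case unfolding funpow.simps comp_apply Suc.IH F_def[symmetric] G_def[symmetric] by (rule ext)
qed simp

lemma norm_integral_tilt_pow_le:
  assumes u: "\<And>x. norm (u x) \<le> 1" and h: "\<And>x. norm (h x) \<le> B"
  shows "norm (LINT x|measure_pmf \<mu>. (tilt u ^^ n) h x) \<le> (LINT x|measure_pmf \<mu>. norm (h x))"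
  using integral_norm_bound[of "measure_pmf \<mu>" "(tilt u ^^ n) h"] integral_norm_tilt_pow_le[where u = u and h = h, OF u h, of n] by linarith

text \<open>Since tilting contracts \<open>L1\<close>, the defects of the \<open>n\<close> steps
  merely add up. The distance from \<open>h\<close> to 1 enters twice: when the constant 1 is
  replaced by \<open>h\<close>, and when the mean of \<open>h\<close> is replaced by 1.\<close>

lemma approximate_eigenfunction:
  fixes \<kappa> :: real and u h :: "int \<Rightarrow> complex"
  assumes u: "\<And>x. norm (u x) \<le> 1" and h: "\<And>x. norm (h x) \<le> 1" and \<kappa>: "0 \<le> \<kappa>" "\<kappa> \<le> 1"
  shows "norm ((LINT x|measure_pmf \<mu>. (tilt u ^^ n) (\<lambda>_. 1) x) - \<kappa> ^ n) \<le>
    2 * (LINT x|measure_pmf \<mu>. norm (1 - h x)) + n * (LINT x|measure_pmf \<mu>. norm (tilt u h x - \<kappa> * h x))"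
proof -
  let ?I = "\<lambda>f. LINT x|measure_pmf \<mu>. f x"
  define \<epsilon> where "\<epsilon> = ?I (\<lambda>x. norm (tilt u h x - \<kappa> * h x))"
  have int: "integrable (measure_pmf \<mu>) (\<lambda>x. (tilt u ^^ m) f x)" if "\<And>x. norm (f x) \<le> B" for m f B
    by (rule integrable_pmf_bounded, rule norm_tilt_pow_le[where u = u and h = f, OF u that])
  have Th: "norm (tilt u h x) \<le> 1" for x by (rule norm_tilt_le[where u = u and h = h, OF u h])
  have step: "norm (?I ((tilt u ^^ Suc m) h) - \<kappa> * ?I ((tilt u ^^ m) h)) \<le> \<epsilon>" for m
  proof -
    have d: "norm (tilt u h x - \<kappa> * h x) \<le> 2" for x
    proof -
      have "norm (\<kappa> * h x) \<le> 1 * 1" unfolding norm_mult using \<kappa> h by (intro mult_mono) auto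
      then show ?thesis using Th[of x] norm_triangle_ineq4[of "tilt u h x" "\<kappa> * h x"] by linarith
    qed
    have "?I ((tilt u ^^ Suc m) h) - \<kappa> * ?I ((tilt u ^^ m) h) = ?I (\<lambda>x. (tilt u ^^ m) (tilt u h) x - \<kappa> * (tilt u ^^ m) h x)"
      using int[of "tilt u h" 1 m] int[of h 1 m] Th h
      by (subst Bochner_Integration.integral_diff) (auto simp: funpow_Suc_right simp del: funpow.simps)
    also have "\<dots> = ?I ((tilt u ^^ m) (\<lambda>x. tilt u h x - \<kappa> * h x))"
      by (simp only: tilt_pow_linear[where u = u and f = "tilt u h" and g = h, OF u Th h])
    also have "norm \<dots> \<le> \<epsilon>"
      unfolding \<epsilon>_def by (rule norm_integral_tilt_pow_le[where u = u, OF u d])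
    finally show ?thesis .
  qed
  have pow: "norm (?I ((tilt u ^^ n) h) - \<kappa> ^ n * ?I h) \<le> n * \<epsilon>" for n
  proof (induction n)
    case (Suc n)
    have "?I ((tilt u ^^ Suc n) h) - \<kappa> ^ Suc n * ?I h =
        (?I ((tilt u ^^ Suc n) h) - \<kappa> * ?I ((tilt u ^^ n) h)) + \<kappa> * (?I ((tilt u ^^ n) h) - \<kappa> ^ n * ?I h)"
      by (simp add: algebra_simps)
    also have "norm \<dots> \<le> \<epsilon> + 1 * (n * \<epsilon>)"
    proof (intro norm_triangle_mono step)
      show "norm (\<kappa> * (?I ((tilt u ^^ n) h) - \<kappa> ^ n * ?I h)) \<le> 1 * (n * \<epsilon>)"
        unfolding norm_mult using \<kappa> by (intro mult_mono Suc.IH) auto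
    qed
    finally show ?case by (simp add: algebra_simps)
  qed simp
  have 1: "norm (?I ((tilt u ^^ n) (\<lambda>_. 1)) - ?I ((tilt u ^^ n) h)) \<le> ?I (\<lambda>x. norm (1 - h x))"
  proof -
    have "?I ((tilt u ^^ n) (\<lambda>_. 1)) - ?I ((tilt u ^^ n) h) = ?I (\<lambda>x. (tilt u ^^ n) (\<lambda>_. 1) x - 1 * (tilt u ^^ n) h x)"
      using int[of "\<lambda>_. 1" 1 n] int[of h 1 n] h by (subst Bochner_Integration.integral_diff) auto
    also have "\<dots> = ?I ((tilt u ^^ n) (\<lambda>x. 1 - 1 * h x))"
      by (subst tilt_pow_linear[where u = u, OF u, of "\<lambda>_. 1" 1 h 1]) (use h in auto)
    also have "norm \<dots> \<le> ?I (\<lambda>x. norm (1 - 1 * h x))"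
      proof (rule norm_integral_tilt_pow_le[where u = u, OF u])
      fix x show "norm (1 - 1 * h x) \<le> 2" using h[of x] norm_triangle_ineq4[of 1 "h x"] by simp
    qed
    finally show ?thesis by simp
  qed
  have 2: "norm (?I h - 1) \<le> ?I (\<lambda>x. norm (1 - h x))"
  proof -
    have "?I (\<lambda>x. 1 - h x) = 1 - ?I h"
      using integrable_pmf_bounded[of \<mu> h 1] h by (subst Bochner_Integration.integral_diff) auto
    then show ?thesis using integral_norm_bound[of "measure_pmf \<mu>" "\<lambda>x. 1 - h x"] by (simp add: norm_minus_commute)
  qed
  have "?I ((tilt u ^^ n) (\<lambda>_. 1)) - \<kappa> ^ n = (?I ((tilt u ^^ n) (\<lambda>_. 1)) - ?I ((tilt u ^^ n) h)) +
      ((?I ((tilt u ^^ n) h) - \<kappa> ^ n * ?I h) + \<kappa> ^ n * (?I h - 1))"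
    by (simp add: algebra_simps)
  also have "norm \<dots> \<le> ?I (\<lambda>x. norm (1 - h x)) + (n * \<epsilon> + 1 * ?I (\<lambda>x. norm (1 - h x)))"
  proof (intro norm_triangle_mono 1 pow)
    show "norm (\<kappa> ^ n * (?I h - 1)) \<le> 1 * ?I (\<lambda>x. norm (1 - h x))"
      unfolding norm_mult by (intro mult_mono 2) (use \<kappa> in \<open>simp_all add: norm_power power_le_one\<close>)
  qed
  finally show ?thesis by (simp add: \<epsilon>_def)
qed

end

text \<open>From \<open>2 * c \<le> 1 + c ^ 2\<close> and the double angle formula. It trades the
  absolute value for a function whose geometric averages have a closed form.\<close>

lemma abs_cos_le: "\<bar>cos x\<bar> \<le> 3 / 4 + cos (2 * x) / 4" for x :: real
proof -
  have "0 \<le> (1 - \<bar>cos x\<bar>)\<^sup>2" by simp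
  then have "\<bar>cos x\<bar> \<le> (1 + (cos x)\<^sup>2) / 2" by (simp add: power2_eq_square algebra_simps)
  then show ?thesis unfolding cos_double_cos by (simp add: field_simps)
qed

text \<open>\<open>1 - damping t l x\<close> is the real part of \<open>(l - t) e\<^sup>i\<^sup>x / (l - t e\<^sup>i\<^sup>x)\<close>; for \<open>l = 1\<close> this is the
  characteristic function of a geometric distribution.\<close>

definition damping :: "real \<Rightarrow> real \<Rightarrow> real \<Rightarrow> real" where
  "damping t l x = l * (l + t) * (1 - cos x) / ((l - t)\<^sup>2 + 2 * l * t * (1 - cos x))"

lemma Re_geometric_cis:
  assumes "0 \<le> t" "t < l"
  shows "Re ((l - t) * cis x / (l - t * cis x)) = 1 - damping t l x"
proof -
  define d where "d = (l - t)\<^sup>2 + 2 * l * t * (1 - cos x)"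
  have d: "d > 0" unfolding d_def using assms cos_le_one[of x] by (intro add_pos_nonneg mult_nonneg_nonneg) auto
  have nz: "complex_of_real l - t * cis x \<noteq> 0"
  proof
    assume "complex_of_real l - t * cis x = 0"
    then have "norm (complex_of_real l) = norm (t * cis x)" by simp
    then show False using assms by (simp add: norm_mult)
  qed
  have dd: "(l - t * cos x)\<^sup>2 + (t * sin x)\<^sup>2 = d"
    unfolding d_def power_mult_distrib sin_squared_eq by (simp add: power2_eq_square algebra_simps)
  have "(l - t) * cis x / (l - t * cis x) = 1 - l * (1 - cis x) / (l - t * cis x)"
    using nz by (simp add: field_simps)
  moreover have "Re (l * (1 - cis x) / (l - t * cis x)) = damping t l x"
  proof -
    have "Re (l * (1 - cis x) / (l - t * cis x)) =
        (l * (1 - cos x) * (l - t * cos x) + l * sin x * (t * sin x)) / ((l - t * cos x)\<^sup>2 + (t * sin x)\<^sup>2)"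
      by (simp add: Re_divide)
    also have "\<dots> = l * (l + t) * (1 - cos x) / d"
      unfolding dd
    proof (rule arg_cong[where f = "\<lambda>y. y / d"])
      have "l * sin x * (t * sin x) = l * t * (1 - (cos x)\<^sup>2)"
        unfolding sin_squared_eq[symmetric] by (simp add: power2_eq_square)
      then show "l * (1 - cos x) * (l - t * cos x) + l * sin x * (t * sin x) = l * (l + t) * (1 - cos x)"
        by (simp add: power2_eq_square algebra_simps)
    qed
    finally show ?thesis by (simp add: damping_def d_def)
  qed
  ultimately show ?thesis by simp
qed

text \<open>After \<open>abs_cos_le\<close> the sum is dominated by a series with geometric weights,
  and the real part of its closed form is \<open>Re_geometric_cis\<close>. The parameter
  \<open>l\<close> is general because the decay estimate needs it both at 1 and at its own rate
  \<open>\<kappa>\<close>.\<close>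

lemma sum_geometric_abs_cos_le:
  fixes t l v :: real
  assumes "0 \<le> t" "t < l"
  shows "(l - t) * (\<Sum>m<n. t ^ m * \<bar>cos (real (Suc m) * v)\<bar> / l ^ Suc m) \<le> 1 - damping t l (2 * v) / 4"
proof -
  define r where "r = t / l"
  have r: "0 \<le> r" "r < 1" using assms by (auto simp: r_def)
  define F where "F = (\<lambda>m. (l - t) / l * r ^ m * (3 / 4 + cos (real (Suc m) * (2 * v)) / 4))"
  have 1: "(\<lambda>m. (l - t) / l * r ^ m * (3 / 4)) sums (3 / 4)"
  proof -
    have "(\<lambda>m. (l - t) / l * (3 / 4) * r ^ m) sums ((l - t) / l * (3 / 4) * (1 / (1 - r)))"
      using r by (intro sums_mult geometric_sums) auto
    moreover have "(l - t) / l * (3 / 4) * (1 / (1 - r)) = 3 / 4" using assms by (simp add: r_def field_simps)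
    moreover have "(l - t) / l * (3 / 4) * r ^ m = (l - t) / l * r ^ m * (3 / 4)" for m by simp
    ultimately show ?thesis by (simp only:)
  qed
  have 2: "(\<lambda>m. (l - t) / l * r ^ m * cos (real (Suc m) * (2 * v))) sums (1 - damping t l (2 * v))"
  proof -
    have "(\<lambda>m. (of_real ((l - t) / l) * cis (2 * v)) * (of_real r * cis (2 * v)) ^ m) sums
        ((of_real ((l - t) / l) * cis (2 * v)) * (1 / (1 - of_real r * cis (2 * v))))"
      using r by (intro sums_mult geometric_sums) (simp add: norm_mult)
    from sums_Re[OF this]
    have "(\<lambda>m. Re ((of_real ((l - t) / l) * cis (2 * v)) * (of_real r * cis (2 * v)) ^ m)) sums
        Re ((of_real ((l - t) / l) * cis (2 * v)) * (1 / (1 - of_real r * cis (2 * v))))" .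
    moreover have "Re ((of_real ((l - t) / l) * cis (2 * v)) * (of_real r * cis (2 * v)) ^ m) =
        (l - t) / l * r ^ m * cos (real (Suc m) * (2 * v))" for m
    proof -
      have "(of_real ((l - t) / l) * cis (2 * v)) * (of_real r * cis (2 * v)) ^ m =
          of_real ((l - t) / l * r ^ m) * cis (real (Suc m) * (2 * v))"
        unfolding power_mult_distrib Complex.DeMoivre
        by (simp add: cis_mult[symmetric] distrib_right)
      moreover have "Re (of_real a * cis b) = a * cos b" for a b by simp
      ultimately show ?thesis by (simp only:)
    qed
    moreover have "(of_real ((l - t) / l) * cis (2 * v)) * (1 / (1 - of_real r * cis (2 * v))) =
        (l - t) * cis (2 * v) / (l - t * cis (2 * v))"
    proof -
      have "1 - of_real r * cis (2 * v) = (l - t * cis (2 * v)) / l"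
        using assms by (simp add: r_def field_simps)
      then show ?thesis using assms by simp
    qed
    ultimately show ?thesis using Re_geometric_cis[OF assms, of "2 * v"] by (simp only: of_real_diff)
  qed
  have F: "F sums (1 - damping t l (2 * v) / 4)"
  proof -
    have "(\<lambda>m. (l - t) / l * r ^ m * (3 / 4) + 1 / 4 * ((l - t) / l * r ^ m * cos (real (Suc m) * (2 * v)))) sums
        (3 / 4 + 1 / 4 * (1 - damping t l (2 * v)))"
      by (intro sums_add 1 sums_mult 2)
    moreover have "(l - t) / l * r ^ m * (3 / 4) + 1 / 4 * ((l - t) / l * r ^ m * cos (real (Suc m) * (2 * v))) = F m" for m
      unfolding F_def by (simp add: distrib_left)
    moreover have "3 / 4 + 1 / 4 * (1 - damping t l (2 * v)) = 1 - damping t l (2 * v) / 4" by (simp add: field_simps)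
    ultimately show ?thesis by (simp only:)
  qed
  have F0: "0 \<le> F m" for m
  proof -
    have "0 \<le> 3 / 4 + cos (real (Suc m) * (2 * v)) / 4"
      using cos_ge_minus_one[of "real (Suc m) * (2 * v)"] by linarith
    then show ?thesis unfolding F_def using assms r by (intro mult_nonneg_nonneg) auto
  qed
  have "(l - t) * (\<Sum>m<n. t ^ m * \<bar>cos (real (Suc m) * v)\<bar> / l ^ Suc m) = (\<Sum>m<n. (l - t) / l * r ^ m * \<bar>cos (real (Suc m) * v)\<bar>)"
    by (simp add: sum_distrib_left r_def power_divide field_simps)
  also have "\<dots> \<le> (\<Sum>m<n. F m)"
    unfolding F_def using assms r abs_cos_le[of "real (Suc m) * v" for m]
    by (intro sum_mono mult_left_mono) (auto simp: mult_ac)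
  also have "\<dots> \<le> 1 - damping t l (2 * v) / 4"
    using sum_le_suminf[of F "{..<n}"] F F0 by (simp add: sums_iff)
  finally show ?thesis .
qed

section \<open>Averages over cells; entry and exit rates of a level\<close>

context hierarchy
begin

definition level_prob :: "nat \<Rightarrow> real" where
  "level_prob k = measure (measure_pmf \<mu>) {z. lev z = k}"

definition cell_prob :: "nat \<Rightarrow> real" where
  "cell_prob j = measure (measure_pmf \<mu>) (cell j)"

definition cell_avg :: "nat \<Rightarrow> (int \<Rightarrow> complex) \<Rightarrow> complex" where
  "cell_avg j g = integral\<^sup>L (measure_pmf (cond_pmf \<mu> (cell j))) g"

definition redraw_avg :: "nat \<Rightarrow> (int \<Rightarrow> complex) \<Rightarrow> complex" where
  "redraw_avg k g = (LINT j|measure_pmf w. indicator {k..} j *\<^sub>R cell_avg j g)"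

text \<open>The probabilities, in one step from a state of level below \<open>k\<close>, of moving to level \<open>k\<close> and to a level
  above \<open>k\<close>.\<close>

definition entry_rate :: "nat \<Rightarrow> real" where
  "entry_rate k = (LINT j|measure_pmf w. indicator {k..} j * (level_prob k / cell_prob j))"

definition exit_rate :: "nat \<Rightarrow> real" where
  "exit_rate k = (LINT j|measure_pmf w. indicator {k..} j * (measure (measure_pmf \<mu>) (cell j - cell k) / cell_prob j))"

lemma cell_prob_pos: "cell_prob j > 0"
  unfolding cell_prob_def using cell_nonnull measure_pmf_posI by fastforce

lemma cell_prob_le_1: "cell_prob j \<le> 1"
  by (simp add: cell_prob_def)

lemma level_prob_eq: "k > 0 \<Longrightarrow> level_prob k = 2 * pmf \<mu> (int k)"
proof -
  assume k: "k > 0"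
  have "{z. lev z = k} = {int k, - int k}" using k by auto
  then have "level_prob k = (\<Sum>z\<in>{int k, - int k}. pmf \<mu> z)"
    unfolding level_prob_def by (simp add: measure_measure_pmf_finite)
  then show ?thesis using k by (simp add: symmetric)
qed

lemma level_prob_pos: "level_prob k > 0"
  unfolding level_prob_def
  using measure_pmf_posI[of "int k" \<mu> "{z. lev z = k}"] pmf_\<mu>_pos[of "int k"] by (auto simp: set_pmf_iff)

lemma level_prob_le_cell_prob: "k \<le> j \<Longrightarrow> level_prob k \<le> cell_prob j"
  unfolding level_prob_def cell_prob_def
  by (intro measure_pmf.finite_measure_mono) (auto simp: mem_cell_iff)

lemma norm_cell_avg_le: "(\<And>z. z \<in> cell j \<Longrightarrow> norm (g z) \<le> B) \<Longrightarrow> norm (cell_avg j g) \<le> B"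
  unfolding cell_avg_def by (rule norm_integral_pmf_le) (auto simp: set_cond_pmf[OF cell_nonnull])

lemma measure_w_atLeast: "measure (measure_pmf w) {k..} = 1 - \<theta> k"
proof -
  have "{k..} = UNIV - {..<k}" by auto
  then show ?thesis using measure_pmf.prob_compl[of "{..<k}" w] by (simp add: \<theta>_def)
qed

lemma \<theta>_less_1: "\<theta> k < 1"
proof -
  have "measure (measure_pmf w) {k..} > 0"
    by (rule measure_pmf_posI[of k]) (use pmf_w_pos[of k] in \<open>auto simp: set_pmf_iff\<close>)
  then show ?thesis by (simp add: measure_w_atLeast)
qed

text \<open>Sorts the drawn level into below \<open>lev z\<close> (the state stays), between
  \<open>lev z\<close> and \<open>k\<close>, and at least \<open>k\<close>. The last part is the
  same for all \<open>z\<close> up to level \<open>k\<close>, which is what makes recursions in a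
  single unknown possible.\<close>

lemma integral_kernel:
  fixes g :: "int \<Rightarrow> complex"
  assumes g: "\<And>z. norm (g z) \<le> B" and z: "lev z \<le> k"
  shows "integral\<^sup>L (measure_pmf (kernel z)) g =
    \<theta> (lev z) * g z + (LINT j|measure_pmf w. indicator {lev z..<k} j *\<^sub>R cell_avg j g) + redraw_avg k g"
proof -
  have B: "B \<ge> 0" using g[of 0] norm_ge_zero order_trans by blast
  have i: "integrable (measure_pmf w) (\<lambda>j. indicator A j *\<^sub>R cell_avg j g)" for A
    by (rule integrable_pmf_bounded[where B = B]) (use norm_cell_avg_le[of _ g B] g B in \<open>auto simp: indicator_def\<close>)
  have i': "integrable (measure_pmf w) (\<lambda>j. indicator A j *\<^sub>R g z)" for A
    by (rule integrable_pmf_bounded[where B = B]) (use g B in \<open>auto simp: indicator_def\<close>)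
  have "integral\<^sup>L (measure_pmf (kernel z)) g = (LINT j|measure_pmf w. integral\<^sup>L (measure_pmf (redraw j z)) g)"
    unfolding kernel_def by (rule integral_bind_pmf_complex[OF g])
  also have "\<dots> = (LINT j|measure_pmf w. (indicator {..<lev z} j *\<^sub>R g z + indicator {lev z..<k} j *\<^sub>R cell_avg j g) + indicator {k..} j *\<^sub>R cell_avg j g)"
    using z by (intro Bochner_Integration.integral_cong refl)
      (auto simp: redraw_def mem_cell_iff cell_avg_def indicator_def)
  also have "\<dots> = (LINT j|measure_pmf w. indicator {..<lev z} j *\<^sub>R g z) + (LINT j|measure_pmf w. indicator {lev z..<k} j *\<^sub>R cell_avg j g) + redraw_avg k g"
    unfolding redraw_avg_def using i i' by (subst Bochner_Integration.integral_add, simp, simp)+ simp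
  also have "(LINT j|measure_pmf w. indicator {..<lev z} j *\<^sub>R g z) = \<theta> (lev z) * g z"
    by (subst integral_scaleR_left) (auto simp: \<theta>_def scaleR_conv_of_real intro: integrable_pmf_bounded[where B = 1])
  finally show ?thesis .
qed

lemma entry_rate_nonneg: "0 \<le> entry_rate k"
  unfolding entry_rate_def using level_prob_pos[of k] cell_prob_pos
  by (intro integral_nonneg_AE) (auto simp: less_imp_le)

lemma exit_rate_nonneg: "0 \<le> exit_rate k"
  unfolding exit_rate_def using cell_prob_pos
  by (intro integral_nonneg_AE) (auto simp: less_imp_le)

lemma integrable_entry: "integrable (measure_pmf w) (\<lambda>j. indicator {k..} j * (level_prob k / cell_prob j))"
  by (rule integrable_pmf_bounded[where B = 1])
     (use level_prob_le_cell_prob[of k] level_prob_pos[of k] cell_prob_pos in \<open>auto simp: indicator_def less_imp_le\<close>)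

lemma integrable_exit: "integrable (measure_pmf w) (\<lambda>j. indicator {k..} j * (measure (measure_pmf \<mu>) (cell j - cell k) / cell_prob j))"
proof (rule integrable_pmf_bounded[where B = 1])
  fix j
  have "measure (measure_pmf \<mu>) (cell j - cell k) \<le> cell_prob j"
    unfolding cell_prob_def by (intro measure_pmf.finite_measure_mono) auto
  then show "norm (indicator {k..} j * (measure (measure_pmf \<mu>) (cell j - cell k) / cell_prob j)) \<le> 1"
    using cell_prob_pos[of j] by (auto simp: indicator_def)
qed

lemma integrable_w_indicator: "integrable (measure_pmf w) (\<lambda>j. indicator A j :: real)"
  by (rule integrable_pmf_bounded[where B = 1]) (auto simp: indicator_def)

lemma entry_rate_ge: "level_prob k * (1 - \<theta> k) \<le> entry_rate k"
proof -
  have "level_prob k * (1 - \<theta> k) = (LINT j|measure_pmf w. indicator {k..} j * level_prob k)"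
    by (simp add: measure_w_atLeast mult.commute)
  also have "\<dots> \<le> entry_rate k"
    unfolding entry_rate_def
  proof (intro integral_mono integrable_entry integrable_mult_left integrable_w_indicator)
    fix j
    show "indicator {k..} j * level_prob k \<le> indicator {k..} j * (level_prob k / cell_prob j)"
      using level_prob_pos[of k] cell_prob_pos[of j] cell_prob_le_1[of j]
      by (auto simp: indicator_def le_divide_eq intro!: mult_left_le)
  qed
  finally show ?thesis .
qed

lemma entry_rate_le: "entry_rate k \<le> level_prob k * (1 - \<theta> k) / cell_prob k"
proof -
  have "entry_rate k \<le> (LINT j|measure_pmf w. indicator {k..} j * (level_prob k / cell_prob k))"
    unfolding entry_rate_def
  proof (intro integral_mono integrable_entry)
    show "integrable (measure_pmf w) (\<lambda>j. indicator {k..} j * (level_prob k / cell_prob k))"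
      using integrable_w_indicator by auto
    fix j
    show "indicator {k..} j * (level_prob k / cell_prob j) \<le> indicator {k..} j * (level_prob k / cell_prob k)"
    proof (cases "k \<le> j")
      case True
      then have "cell_prob k \<le> cell_prob j"
        unfolding cell_prob_def by (intro measure_pmf.finite_measure_mono cell_mono) auto
      then show ?thesis using True level_prob_pos[of k] cell_prob_pos[of k]
        by (auto intro!: divide_left_mono mult_pos_pos cell_prob_pos simp: less_imp_le)
    qed simp
  qed
  also have "\<dots> = level_prob k * (1 - \<theta> k) / cell_prob k"
    by (simp add: measure_w_atLeast mult.commute)
  finally show ?thesis .
qed

text \<open>The draw \<open>j = k\<close> contributes nothing, as \<open>cell k - cell k\<close> is
  empty; this replaces the factor \<open>1 - \<theta> k\<close> by the much smaller
  \<open>1 - \<theta> (Suc k)\<close>.\<close>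

lemma exit_rate_le: "exit_rate k \<le> (1 - \<theta> (Suc k)) * measure (measure_pmf \<mu>) (- cell k) / cell_prob k"
proof -
  have "exit_rate k \<le> (LINT j|measure_pmf w. indicator {Suc k..} j * (measure (measure_pmf \<mu>) (- cell k) / cell_prob k))"
    unfolding exit_rate_def
  proof (intro integral_mono integrable_exit)
    show "integrable (measure_pmf w) (\<lambda>j. indicator {Suc k..} j * (measure (measure_pmf \<mu>) (- cell k) / cell_prob k))"
      using integrable_w_indicator by auto
    fix j
    show "indicator {k..} j * (measure (measure_pmf \<mu>) (cell j - cell k) / cell_prob j) \<le>
        indicator {Suc k..} j * (measure (measure_pmf \<mu>) (- cell k) / cell_prob k)"
    proof (cases "Suc k \<le> j")
      case True
      then have "cell_prob k \<le> cell_prob j"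
        unfolding cell_prob_def by (intro measure_pmf.finite_measure_mono cell_mono) auto
      moreover have "measure (measure_pmf \<mu>) (cell j - cell k) \<le> measure (measure_pmf \<mu>) (- cell k)"
        by (intro measure_pmf.finite_measure_mono) auto
      ultimately show ?thesis using True cell_prob_pos by (auto intro!: frac_le)
    next
      case False
      then show ?thesis by (cases "j = k") (auto simp: indicator_def)
    qed
  qed
  also have "\<dots> = (1 - \<theta> (Suc k)) * measure (measure_pmf \<mu>) (- cell k) / cell_prob k"
    by (simp add: measure_w_atLeast)
  finally show ?thesis .
qed

end

lemma cis_Suc_mult: "cis (real (Suc m) * y) = cis y * cis (real m * y)"
  by (simp add: cis_mult distrib_right)

lemma damping_nonneg: "0 \<le> t \<Longrightarrow> t < l \<Longrightarrow> 0 \<le> damping t l x"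
  unfolding damping_def by (intro divide_nonneg_nonneg mult_nonneg_nonneg add_nonneg_nonneg) auto

section \<open>Characteristic functions governed by a single level\<close>

context hierarchy
begin

lemma tilt_kernel: "tilt u h z = integral\<^sup>L (measure_pmf (kernel z)) (\<lambda>y. u y * h y)"
  by (simp add: tilt_def)

lemma cell_avg_one_off_level:
  fixes g :: "int \<Rightarrow> complex"
  assumes k: "k > 0" "k \<le> j" and g: "\<And>z. lev z \<noteq> k \<Longrightarrow> g z = 1"
  shows "cell_avg j g = 1 - (level_prob k / cell_prob j) * (1 - (g (int k) + g (- int k)) / 2)"
proof -
  have int: "integrable (measure_pmf p) g" for p
  proof (rule integrable_pmf_bounded)
    fix z
    show "norm (g z) \<le> 1 + norm (g (int k)) + norm (g (- int k))"
      using g[of z] by (cases "z = int k"; cases "z = - int k") (auto intro: order_trans[of _ 1])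
  qed
  have sub: "{int k, - int k} \<subseteq> cell j" using k by (auto simp: mem_cell_iff)
  have "cell_avg j g - 1 = integral\<^sup>L (measure_pmf (cond_pmf \<mu> (cell j))) (\<lambda>z. g z - 1)"
    unfolding cell_avg_def using int by (subst Bochner_Integration.integral_diff) auto
  also have "\<dots> = (\<Sum>z\<in>{int k, - int k}. pmf (cond_pmf \<mu> (cell j)) z *\<^sub>R (g z - 1))"
  proof (rule integral_measure_pmf)
    fix z assume "g z - 1 \<noteq> 0"
    then have "lev z = k" using g[of z] by auto
    then show "z \<in> {int k, - int k}" by auto
  qed simp
  also have "\<dots> = (level_prob k / cell_prob j) * ((g (int k) + g (- int k)) / 2 - 1)"
  proof -
    define c where "c = pmf \<mu> (int k) / cell_prob j"
    have "pmf (cond_pmf \<mu> (cell j)) (int k) = c" "pmf (cond_pmf \<mu> (cell j)) (- int k) = c"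
      using sub by (simp_all add: pmf_cond[OF cell_nonnull] symmetric cell_prob_def c_def)
    moreover have "level_prob k / cell_prob j = 2 * c" using k by (simp add: level_prob_eq c_def)
    moreover have "int k \<noteq> - int k" using k by simp
    ultimately show ?thesis by (simp add: scaleR_conv_of_real algebra_simps)
  qed
  finally show ?thesis by (simp add: algebra_simps)
qed

lemma integral_lev_eq: "integral\<^sup>L (measure_pmf \<mu>) (\<lambda>z. if lev z = k then c else 0 :: real) = c * level_prob k"
proof -
  have "(\<lambda>z. if lev z = k then c else 0 :: real) = (\<lambda>z. c * indicator {z. lev z = k} z)"
    by (auto simp: indicator_def)
  then show ?thesis by (simp add: level_prob_def)
qed

text \<open>The function \<open>h\<close> below is an approximate eigenfunction with eigenvalue
  \<open>\<kappa>\<close>: exact below level \<open>k\<close>, with a defect of the order of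
  \<open>entry_rate k\<close> on level \<open>k\<close>, and only trivially bounded above. Weighting
  the defects by \<open>\<mu>\<close> gives the error.\<close>

lemma compound_poisson_approximation:
  fixes v :: real
  assumes k: "k > 0" and half: "entry_rate k \<le> 1 / 2"
  defines "u \<equiv> (\<lambda>z. if z = int k then cis v else if z = - int k then cis (- v) else 1)"
  shows "norm ((LINT x|measure_pmf \<mu>. (tilt u ^^ n) (\<lambda>_. 1) x) - complex_of_real (1 - entry_rate k * damping (\<theta> k) 1 v) ^ n)
    \<le> 4 * level_prob k + n * (4 * entry_rate k * level_prob k + 2 * measure (measure_pmf \<mu>) (- cell k))"
proof -
  define t where "t = \<theta> k"
  define D where "D = damping t 1 v"
  define \<kappa> where "\<kappa> = 1 - entry_rate k * D"
  \<comment> \<open>At the states of level \<open>k\<close>, \<open>h\<close> is the characteristic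
    function of the phase still to be collected before that level is left: the remaining holding
    time is geometric with parameter \<open>t\<close>.\<close>
  define h where "h = (\<lambda>z. if z = int k then (1 - t) / (1 - t * cis v) else if z = - int k then (1 - t) / (1 - t * cis (- v)) else 1 :: complex)"
  have t: "0 \<le> t" "t < 1" using \<theta>_less_1 by (auto simp: t_def \<theta>_def)
  have den: "norm (1 - t * cis x) \<ge> 1 - t" "1 - t * cis x \<noteq> 0" for x
  proof -
    show "norm (1 - t * cis x) \<ge> 1 - t"
      using norm_triangle_ineq2[of 1 "t * cis x"] t by (simp add: norm_mult)
    then show "1 - t * cis x \<noteq> 0" using t by auto
  qed
  have hq: "norm ((1 - t) / (1 - t * cis x)) \<le> 1" for x
  proof -
    have "norm (complex_of_real (1 - t)) = 1 - t"
      using t unfolding norm_of_real by simp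
    then have "norm (1 - complex_of_real t) = 1 - t" by simp
    then show ?thesis using den[of x] t by (simp add: norm_divide divide_le_eq_1)
  qed
  have u1: "norm (u z) \<le> 1" for z by (simp add: u_def)
  have h1: "norm (h z) \<le> 1" for z using hq by (simp add: h_def)
  have uh1: "norm (u z * h z) \<le> 1" for z
    unfolding norm_mult using mult_mono[OF u1[of z] h1[of z]] by simp
  have neg: "- int k \<noteq> int k" using k by simp
  have g_off: "u z * h z = 1" if "lev z \<noteq> k" for z using that by (auto simp: u_def h_def)
  have gk: "u (int k) * h (int k) = (1 - t) * cis v / (1 - t * cis v)"
    and gk': "u (- int k) * h (- int k) = (1 - t) * cis (- v) / (1 - t * cis (- v))"
    using neg by (auto simp: u_def h_def)
  have cnj_eq: "(1 - t) * cis (- v) / (1 - t * cis (- v)) = cnj ((1 - t) * cis v / (1 - t * cis v))"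
    by (simp add: cis_cnj)
  have Re_g: "Re ((1 - t) * cis v / (1 - t * cis v)) = 1 - D"
    using Re_geometric_cis[of t 1 v] t by (simp add: D_def)
  have defect: "1 - (u (int k) * h (int k) + u (- int k) * h (- int k)) / 2 = D"
    unfolding gk gk' cnj_eq complex_add_cnj Re_g by (simp add: field_simps)
  have D: "0 \<le> D" "D \<le> 2"
  proof -
    show "0 \<le> D" unfolding D_def using t by (intro damping_nonneg) auto
    have "\<bar>1 - D\<bar> \<le> norm (u (int k) * h (int k))"
      unfolding gk Re_g[symmetric] by (rule abs_Re_le_cmod)
    then show "D \<le> 2" using uh1[of "int k"] by linarith
  qed
  have avg_lt: "cell_avg j (\<lambda>y. u y * h y) = 1" if "j < k" for j
  proof -
    have "cell_avg j (\<lambda>y. u y * h y) = integral\<^sup>L (measure_pmf (cond_pmf \<mu> (cell j))) (\<lambda>_. 1)"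
      unfolding cell_avg_def using that
      by (intro integral_cong_AE AE_pmfI) (auto simp: set_cond_pmf[OF cell_nonnull] mem_cell_iff intro!: g_off)
    then show ?thesis by simp
  qed
  have avg_ge: "cell_avg j (\<lambda>y. u y * h y) = of_real (1 - level_prob k / cell_prob j * D)" if "k \<le> j" for j
    using cell_avg_one_off_level[OF k that g_off] defect by simp
  have R: "redraw_avg k (\<lambda>y. u y * h y) = of_real (1 - t - entry_rate k * D)"
  proof -
    have "redraw_avg k (\<lambda>y. u y * h y) = (LINT j|measure_pmf w. complex_of_real (indicator {k..} j - indicator {k..} j * (level_prob k / cell_prob j) * D))"
      unfolding redraw_avg_def using avg_ge
      by (intro Bochner_Integration.integral_cong refl) (auto simp: indicator_def)
    also have "\<dots> = of_real (LINT j|measure_pmf w. indicator {k..} j - indicator {k..} j * (level_prob k / cell_prob j) * D)"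
      by (rule integral_complex_of_real)
    also have "(LINT j|measure_pmf w. indicator {k..} j - indicator {k..} j * (level_prob k / cell_prob j) * D) = 1 - t - entry_rate k * D"
    proof -
      have "integrable (measure_pmf w) (\<lambda>j. indicator {k..} j * (level_prob k / cell_prob j) * D)"
        by (intro integrable_mult_left integrable_entry)
      then have "(LINT j|measure_pmf w. indicator {k..} j - indicator {k..} j * (level_prob k / cell_prob j) * D) =
          (LINT j|measure_pmf w. indicator {k..} j) - (LINT j|measure_pmf w. indicator {k..} j * (level_prob k / cell_prob j) * D)"
        by (rule Bochner_Integration.integral_diff[OF integrable_w_indicator])
      then show ?thesis
        by (simp only: integral_mult_left_zero entry_rate_def integral_pmf_indicator measure_w_atLeast t_def)
    qed
    finally show ?thesis .
  qed
  have T: "tilt u h z = \<theta> (lev z) * (u z * h z) + of_real (\<theta> k - \<theta> (lev z)) + of_real (1 - t - entry_rate k * D)"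
    if "lev z \<le> k" for z
  proof -
    have "(LINT j|measure_pmf w. indicator {lev z..<k} j *\<^sub>R cell_avg j (\<lambda>y. u y * h y)) =
        (LINT j|measure_pmf w. complex_of_real (indicator {..<k} j - indicator {..<lev z} j))"
      using that avg_lt by (intro Bochner_Integration.integral_cong refl) (auto simp: indicator_def)
    also have "\<dots> = of_real (\<theta> k - \<theta> (lev z))"
      using integrable_w_indicator
      by (simp only: integral_complex_of_real Bochner_Integration.integral_diff integral_pmf_indicator \<theta>_def)
    finally show ?thesis
      unfolding tilt_kernel integral_kernel[where g = "\<lambda>y. u y * h y", OF uh1 that] R by simp
  qed
  have \<kappa>: "0 \<le> \<kappa>" "\<kappa> \<le> 1"
  proof -
    show "\<kappa> \<le> 1" using entry_rate_nonneg[of k] D by (simp add: \<kappa>_def)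
    have "entry_rate k * D \<le> 1 / 2 * 2" using half D entry_rate_nonneg[of k] by (intro mult_mono) auto
    then show "0 \<le> \<kappa>" by (simp add: \<kappa>_def)
  qed
  have err: "norm (tilt u h z - \<kappa> * h z) \<le> (if lev z = k then 4 * entry_rate k else 0) + 2 * indicator (- cell k) z" for z
  proof -
    consider "lev z < k" | "lev z = k" | "lev z > k" by linarith
    then show ?thesis
    proof cases
      case 1
      then have "h z = 1" by (auto simp: h_def)
      moreover have "tilt u h z = \<kappa>"
        using T[of z] 1 g_off[of z] by (simp add: \<kappa>_def t_def)
      ultimately show ?thesis using 1 by (simp add: mem_cell_iff)
    next
      case 2
      \<comment> \<open>The first-step equation of the holding time: stay with probability
        \<open>t\<close> and collect one more factor, otherwise leave with value 1.\<close>
      have fp: "t * (u z * h z) + (1 - t) = h z"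
      proof -
        have "z = int k \<or> z = - int k" using 2 by linarith
        moreover have "t * (cis x * ((1 - t) / (1 - t * cis x))) + (1 - t) = (1 - t) / (1 - t * cis x)" for x
          using den(2)[of x] by (simp add: field_simps)
        ultimately show ?thesis using neg by (auto simp: u_def h_def)
      qed
      have "tilt u h z = t * (u z * h z) + (1 - t) - entry_rate k * D"
        using T[of z] 2 by (simp add: t_def)
      then have "tilt u h z - \<kappa> * h z = entry_rate k * D * (h z - 1)"
        unfolding fp by (simp add: \<kappa>_def algebra_simps)
      also have "norm \<dots> \<le> (entry_rate k * 2) * 2"
      proof -
        have "norm (h z - 1) \<le> 2" using h1[of z] norm_triangle_ineq4[of "h z" 1] by simp
        moreover have "norm (complex_of_real (entry_rate k * D)) \<le> entry_rate k * 2"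
          using D entry_rate_nonneg[of k] by (simp only: norm_of_real) (simp add: mult_left_mono)
        ultimately show ?thesis unfolding norm_mult of_real_mult[symmetric] 
          using entry_rate_nonneg[of k] by (intro mult_mono) auto
      qed
      finally show ?thesis using 2 by (simp add: indicator_def)
    next
      case 3
      have "norm (tilt u h z) \<le> 1" by (rule norm_tilt_le[where u = u and h = h, OF u1 h1])
      moreover have "norm (\<kappa> * h z) \<le> 1 * 1" unfolding norm_mult using \<kappa> h1 by (intro mult_mono) auto
      ultimately have "norm (tilt u h z - \<kappa> * h z) \<le> 2"
        using norm_triangle_ineq4[of "tilt u h z" "\<kappa> * h z"] by linarith
      then show ?thesis using 3 by (simp add: mem_cell_iff)
    qed
  qed
  have i1: "integrable (measure_pmf \<mu>) (\<lambda>z. if lev z = k then c else 0 :: real)" for c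
    by (rule integrable_pmf_bounded[where B = "\<bar>c\<bar>"]) auto
  have i2: "integrable (measure_pmf \<mu>) (\<lambda>z. indicator (- cell k) z :: real)"
    by (rule integrable_pmf_bounded[where B = 1]) (auto simp: indicator_def)
  have "(LINT z|measure_pmf \<mu>. norm (tilt u h z - \<kappa> * h z)) \<le>
      (LINT z|measure_pmf \<mu>. (if lev z = k then 4 * entry_rate k else 0) + 2 * indicator (- cell k) z)"
    using err i1 i2 by (intro integral_mono_AE' AE_I2) (auto simp: entry_rate_nonneg)
  also have "\<dots> = 4 * entry_rate k * level_prob k + 2 * measure (measure_pmf \<mu>) (- cell k)"
    using i1 i2 by (subst Bochner_Integration.integral_add) (auto simp: integral_lev_eq)
  finally have E1: "(LINT z|measure_pmf \<mu>. norm (tilt u h z - \<kappa> * h z)) \<le> 4 * entry_rate k * level_prob k + 2 * measure (measure_pmf \<mu>) (- cell k)" .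
  have "norm (1 - h z) \<le> (if lev z = k then 2 else 0)" for z
    using h1[of z] norm_triangle_ineq4[of 1 "h z"] by (auto simp: h_def)
  then have "(LINT z|measure_pmf \<mu>. norm (1 - h z)) \<le> (LINT z|measure_pmf \<mu>. (if lev z = k then 2 else 0))"
    using i1 by (intro integral_mono_AE' AE_I2) auto
  then have E2: "(LINT z|measure_pmf \<mu>. norm (1 - h z)) \<le> 2 * level_prob k" by (simp only: integral_lev_eq)
  have "norm ((LINT x|measure_pmf \<mu>. (tilt u ^^ n) (\<lambda>_. 1) x) - \<kappa> ^ n) \<le>
      2 * (LINT x|measure_pmf \<mu>. norm (1 - h x)) + n * (LINT x|measure_pmf \<mu>. norm (tilt u h x - \<kappa> * h x))"
    by (rule approximate_eigenfunction[where u = u and h = h, OF u1 h1 \<kappa>])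
  also have "\<dots> \<le> 2 * (2 * level_prob k) + n * (4 * entry_rate k * level_prob k + 2 * measure (measure_pmf \<mu>) (- cell k))"
    using E1 E2 by (intro add_mono mult_left_mono) auto
  finally show ?thesis by (simp add: \<kappa>_def D_def t_def)
qed

text \<open>The redrawn state is below, at or above level \<open>k\<close>, where \<open>g\<close>
  is bounded by \<open>F\<close>, by its average over the two states, and by 1. Keeping the average
  of the two states intact preserves the cancellation of their opposite phases.\<close>

lemma norm_redraw_avg_le:
  assumes k: "k > 0" and g: "\<And>z. norm (g z) \<le> 1" and F: "\<And>z. lev z < k \<Longrightarrow> norm (g z) \<le> F" "0 \<le> F"
  shows "norm (redraw_avg k g) \<le>
    (1 - \<theta> k) * F + entry_rate k * (norm ((g (int k) + g (- int k)) / 2) - F) + exit_rate k * (1 - F)"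
proof -
  define G where "G = (g (int k) + g (- int k)) / 2"
  define A where "A = {z. lev z < k}"
  have int: "integrable (measure_pmf \<mu>) (\<lambda>z. indicator B z *\<^sub>R g z)" for B
    by (rule integrable_pmf_bounded[where B = 1]) (use g in \<open>auto simp: indicator_def\<close>)
  have nrm: "norm (LINT z|measure_pmf \<mu>. indicator B z *\<^sub>R g z) \<le> measure (measure_pmf \<mu>) B * b"
    if "\<And>z. z \<in> B \<Longrightarrow> norm (g z) \<le> b" for B b
  proof -
    have "norm (LINT z|measure_pmf \<mu>. indicator B z *\<^sub>R g z) \<le> (LINT z|measure_pmf \<mu>. norm (indicator B z *\<^sub>R g z))"
      by (rule integral_norm_bound)
    also have "\<dots> \<le> (LINT z|measure_pmf \<mu>. indicator B z * b)"
      by (intro integral_mono integrable_norm int integrable_mult_left integrable_pmf_bounded[where B = 1])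
         (use that in \<open>auto simp: indicator_def\<close>)
    finally show ?thesis by simp
  qed
  define o_j where "o_j = (\<lambda>j. measure (measure_pmf \<mu>) (cell j - cell k) / cell_prob j)"
  define e_j where "e_j = (\<lambda>j. level_prob k / cell_prob j)"
  have avg: "norm (cell_avg j g) \<le> (1 - e_j j - o_j j) * F + e_j j * norm G + o_j j" if j: "k \<le> j" for j
  proof -
    have split: "indicator (cell j) z = indicator A z + indicator {z. lev z = k} z + (indicator (cell j - cell k) z :: real)" for z
      using j by (auto simp: indicator_def A_def mem_cell_iff)
    have m: "cell_prob j = measure (measure_pmf \<mu>) A + level_prob k + measure (measure_pmf \<mu>) (cell j - cell k)"
    proof -
      have "cell_prob j = (LINT z|measure_pmf \<mu>. indicator A z + indicator {z. lev z = k} z + indicator (cell j - cell k) z)"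
        unfolding cell_prob_def split[symmetric] by simp
      also have "\<dots> = measure (measure_pmf \<mu>) A + level_prob k + measure (measure_pmf \<mu>) (cell j - cell k)"
      proof -
        have i: "integrable (measure_pmf \<mu>) (\<lambda>z. indicator B z :: real)" for B
          by (rule integrable_pmf_bounded[where B = 1]) (auto simp: indicator_def)
        show ?thesis
          unfolding level_prob_def
          by (simp only: Bochner_Integration.integral_add[OF Bochner_Integration.integrable_add[OF i i] i]
              Bochner_Integration.integral_add[OF i i] integral_pmf_indicator)
      qed
      finally show ?thesis .
    qed
    have lv: "(LINT z|measure_pmf \<mu>. indicator {z. lev z = k} z *\<^sub>R g z) = level_prob k * G"
    proof -
      have "(LINT z|measure_pmf \<mu>. indicator {z. lev z = k} z *\<^sub>R g z) =
          (\<Sum>z\<in>{int k, - int k}. pmf \<mu> z *\<^sub>R (indicator {z. lev z = k} z *\<^sub>R g z))"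
        by (rule integral_measure_pmf) (auto simp: indicator_def split: if_splits)
      also have "\<dots> = level_prob k * G"
      proof -
        have "int k \<noteq> - int k" using k by simp
        then show ?thesis using k by (simp add: level_prob_eq symmetric G_def scaleR_conv_of_real algebra_simps)
      qed
      finally show ?thesis .
    qed
    have "cell_avg j g = (LINT z|measure_pmf \<mu>. (1 / cell_prob j) *\<^sub>R (indicator A z *\<^sub>R g z + indicator {z. lev z = k} z *\<^sub>R g z + indicator (cell j - cell k) z *\<^sub>R g z))"
      unfolding cell_avg_def integral_cond_pmf[OF cell_nonnull] split cell_prob_def[symmetric]
      by (intro Bochner_Integration.integral_cong refl) (simp add: scaleR_add_left[symmetric])
    also have "\<dots> = (1 / cell_prob j) *\<^sub>R ((LINT z|measure_pmf \<mu>. indicator A z *\<^sub>R g z) + level_prob k * G + (LINT z|measure_pmf \<mu>. indicator (cell j - cell k) z *\<^sub>R g z))"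
      using int lv by (simp add: Bochner_Integration.integral_add)
    also have "norm \<dots> \<le> (1 / cell_prob j) * (measure (measure_pmf \<mu>) A * F + level_prob k * norm G + measure (measure_pmf \<mu>) (cell j - cell k) * 1)"
    proof -
      have "norm (complex_of_real (level_prob k) * G) \<le> level_prob k * norm G"
        using level_prob_pos[of k] by (simp add: norm_mult)
      then show ?thesis using cell_prob_pos[of j]
        unfolding norm_scaleR
        by (intro mult_mono norm_triangle_mono nrm) (use F g level_prob_pos[of k] in \<open>auto simp: A_def less_imp_le\<close>)
    qed
    also have "\<dots> = (1 - e_j j - o_j j) * F + e_j j * norm G + o_j j"
    proof -
      have "measure (measure_pmf \<mu>) A = cell_prob j - level_prob k - measure (measure_pmf \<mu>) (cell j - cell k)"
        using m by simp
      show ?thesis unfolding \<open>measure (measure_pmf \<mu>) A = _\<close> e_j_def o_j_def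
        using cell_prob_pos[of j] by (simp add: field_simps)
    qed
    finally show ?thesis .
  qed
  have ie: "integrable (measure_pmf w) (\<lambda>j. indicator {k..} j * e_j j)" and io: "integrable (measure_pmf w) (\<lambda>j. indicator {k..} j * o_j j)"
    unfolding e_j_def o_j_def by (rule integrable_entry integrable_exit)+
  have "norm (redraw_avg k g) \<le> (LINT j|measure_pmf w. norm (indicator {k..} j *\<^sub>R cell_avg j g))"
    unfolding redraw_avg_def by (rule integral_norm_bound)
  also have "\<dots> \<le> (LINT j|measure_pmf w. indicator {k..} j * F + (indicator {k..} j * e_j j) * (norm G - F) + (indicator {k..} j * o_j j) * (1 - F))"
  proof (rule integral_mono)
    show "integrable (measure_pmf w) (\<lambda>j. norm (indicator {k..} j *\<^sub>R cell_avg j g))"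
      by (rule integrable_pmf_bounded[where B = 1]) (use norm_cell_avg_le[of _ g 1] g in \<open>auto simp: indicator_def\<close>)
    show "integrable (measure_pmf w) (\<lambda>j. indicator {k..} j * F + (indicator {k..} j * e_j j) * (norm G - F) + (indicator {k..} j * o_j j) * (1 - F))"
      by (intro Bochner_Integration.integrable_add integrable_mult_left integrable_w_indicator ie io)
    show "norm (indicator {k..} j *\<^sub>R cell_avg j g) \<le> indicator {k..} j * F + (indicator {k..} j * e_j j) * (norm G - F) + (indicator {k..} j * o_j j) * (1 - F)" for j
      using avg[of j] by (auto simp: indicator_def algebra_simps)
  qed
  also have "\<dots> = (LINT j|measure_pmf w. indicator {k..} j * F) + (LINT j|measure_pmf w. (indicator {k..} j * e_j j) * (norm G - F)) + (LINT j|measure_pmf w. (indicator {k..} j * o_j j) * (1 - F))"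
    using Bochner_Integration.integrable_add[OF integrable_mult_left[OF integrable_w_indicator] integrable_mult_left[OF ie]]
      integrable_mult_left[OF io] integrable_mult_left[OF integrable_w_indicator] integrable_mult_left[OF ie]
    by (simp only: Bochner_Integration.integral_add)
  also have "\<dots> = (1 - \<theta> k) * F + entry_rate k * (norm G - F) + exit_rate k * (1 - F)"
    unfolding integral_mult_left_zero integral_pmf_indicator measure_w_atLeast entry_rate_def exit_rate_def e_j_def o_j_def ..
  finally show ?thesis unfolding G_def .
qed

text \<open>A lower bound that no longer contains \<open>l\<close>, so that one constant
  \<open>q\<close> serves for \<open>l = 1\<close> and \<open>l = \<kappa>\<close>.\<close>

lemma damping_ge:
  assumes "1 / 2 \<le> t" "t < l" "l \<le> 1"
  shows "(1 - cos x) / (2 * ((1 - t)\<^sup>2 + 2 * (1 - cos x))) \<le> damping t l x"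
proof (cases "cos x = 1")
  case False
  then have y: "1 - cos x > 0" using cos_le_one[of x] by linarith
  have "(1 - cos x) / (2 * ((1 - t)\<^sup>2 + 2 * (1 - cos x))) = (1 / 2 * (1 - cos x)) / ((1 - t)\<^sup>2 + 2 * (1 - cos x))"
    by simp
  also have "\<dots> \<le> (l * (l + t) * (1 - cos x)) / ((l - t)\<^sup>2 + 2 * l * t * (1 - cos x))"
  proof (rule frac_le)
    have "1 / 2 * 1 \<le> l * (l + t)" using assms by (intro mult_mono) auto
    then show "1 / 2 * (1 - cos x) \<le> l * (l + t) * (1 - cos x)" using y by (intro mult_right_mono) auto
    show "0 < (l - t)\<^sup>2 + 2 * l * t * (1 - cos x)" using assms y by (intro add_nonneg_pos mult_pos_pos) auto
    have "l * t \<le> 1 * 1" using assms by (intro mult_mono) auto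
    then have "2 * (l * t) * (1 - cos x) \<le> 2 * (1 - cos x)" using y by (intro mult_right_mono) auto
    moreover have "(l - t)\<^sup>2 \<le> (1 - t)\<^sup>2" using assms by (intro power_mono) auto
    ultimately show "(l - t)\<^sup>2 + 2 * l * t * (1 - cos x) \<le> (1 - t)\<^sup>2 + 2 * (1 - cos x)" by (simp add: mult_ac)
    show "0 \<le> l * (l + t) * (1 - cos x)" using assms y by (intro mult_nonneg_nonneg) auto
  qed
  finally show ?thesis by (simp add: damping_def)
qed (simp add: damping_def)

text \<open>On the states below level \<open>k\<close> the bound \<open>s + \<kappa>\<^sup>n\<close> propagates: the oscillation of level \<open>k\<close> makes up for the
  loss \<open>1 - \<kappa>\<close>, and the constant \<open>s\<close> absorbs the excursions above level \<open>k\<close>.\<close>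

lemma norm_integral_tilt_pow_decay:
  fixes s :: real and val :: "int \<Rightarrow> real"
  assumes k: "k > 0" and odd: "\<And>z. val (- z) = - val z"
    and half: "1 / 2 \<le> \<theta> k" and entry: "entry_rate k \<le> 1 - \<theta> k"
    and x: "x = 1 - cos (2 * (s * val (int k)))" "x > 0"
    and q: "q = x / (8 * ((1 - \<theta> k)\<^sup>2 + 2 * x))"
  shows "norm (LINT z|measure_pmf \<mu>. (tilt (\<lambda>z. cis (s * val z)) ^^ n) (\<lambda>_. 1) z) \<le>
    exit_rate k / (entry_rate k * q) + (1 - entry_rate k * q) ^ n + 2 * measure (measure_pmf \<mu>) {z. k \<le> lev z}"
proof -
  define u where "u = (\<lambda>z. cis (s * val z))"
  define v where "v = s * val (int k)"
  define t where "t = \<theta> k"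
  define \<eta> where "\<eta> = entry_rate k"
  define s0 where "s0 = exit_rate k / (\<eta> * q)"
  define \<kappa> where "\<kappa> = 1 - \<eta> * q"
  have t: "1 / 2 \<le> t" "t < 1" using half \<theta>_less_1 by (auto simp: t_def)
  have \<eta>: "\<eta> > 0" "\<eta> \<le> 1 - t"
    using less_le_trans[OF mult_pos_pos[OF level_prob_pos] entry_rate_ge, of k] \<theta>_less_1[of k] entry
    by (auto simp: \<eta>_def t_def)
  have q0: "q > 0" unfolding q using x by (intro divide_pos_pos mult_pos_pos add_nonneg_pos) auto
  have q1: "q \<le> 1 / 16"
    unfolding q using x by (simp add: divide_le_eq add_nonneg_pos)
  have \<kappa>: "t < \<kappa>" "\<kappa> \<le> 1"
  proof -
    have "\<eta> * q < (1 - t) * 1" using \<eta> q0 q1 t by (intro mult_le_less_imp_less) auto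
    then show "t < \<kappa>" by (simp add: \<kappa>_def)
    show "\<kappa> \<le> 1" using \<eta> q0 by (simp add: \<kappa>_def)
  qed
  have s0: "0 \<le> s0" "s0 * \<eta> * q = exit_rate k"
    using exit_rate_nonneg[of k] \<eta> q0 by (auto simp: s0_def)
  define Q where "Q = (\<lambda>l. 1 - damping t l (2 * v) / 4)"
  have Q: "Q l \<le> 1 - q" if "t < l" "l \<le> 1" for l
  proof -
    have "4 * q = (1 - cos (2 * v)) / (2 * ((1 - t)\<^sup>2 + 2 * (1 - cos (2 * v))))"
    proof -
      have "4 * (a / (8 * b)) = a / (2 * b)" for a b :: real by simp
      then show ?thesis unfolding q x v_def t_def by (simp only:)
    qed
    then show ?thesis using damping_ge[OF t(1) that, of "2 * v"] by (simp add: Q_def)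
  qed
  have u1: "norm (u z) \<le> 1" for z by (simp add: u_def)
  \<comment> \<open>Starting from 0 at level \<open>k\<close> and above removes the boundary term
    when the recursion on level \<open>k\<close> is unrolled; the price is one of the two measures
    of levels \<open>k\<close> and above in the conclusion.\<close>
  define f0 where "f0 = (\<lambda>z. if lev z < k then 1 else 0 :: complex)"
  define f where "f = (\<lambda>n. (tilt u ^^ n) f0)"
  have f1: "norm (f n z) \<le> 1" for n z
    unfolding f_def by (rule norm_tilt_pow_le[where u = u, OF u1]) (simp add: f0_def)
  define g where "g = (\<lambda>n z. u z * f n z)"
  have ng: "norm (g n z) = norm (f n z)" for n z by (simp add: g_def norm_mult u_def)
  have g1: "norm (g n z) \<le> 1" for n z using f1 by (simp add: ng)
  define c where "c = (\<lambda>n. redraw_avg k (g n))"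
  have fS: "f (Suc n) z = \<theta> (lev z) * g n z + (LINT j|measure_pmf w. indicator {lev z..<k} j *\<^sub>R cell_avg j (g n)) + c n"
    if "lev z \<le> k" for n z
  proof -
    have "f (Suc n) z = integral\<^sup>L (measure_pmf (kernel z)) (g n)"
      by (simp add: f_def g_def[abs_def] tilt_kernel)
    then show ?thesis using integral_kernel[where g = "g n", OF g1 that] by (simp add: c_def)
  qed
  \<comment> \<open>Unrolling the recursion on level \<open>k\<close>: the values there are a
    convolution of the averages \<open>c\<close> with the geometric holding time.\<close>
  have f_level: "f n z = (\<Sum>m<n. t ^ m * cis (real m * (s * val z)) * c (n - 1 - m))" if "lev z = k" for n z
  proof (induction n)
    case 0
    show ?case using that by (simp add: f_def f0_def)
  next
    case (Suc n)
    have "f (Suc n) z = t * (u z * f n z) + c n"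
      using fS[of z n] that by (simp add: t_def g_def)
    also have "t * (u z * f n z) = (\<Sum>m<n. t ^ Suc m * cis (real (Suc m) * (s * val z)) * c (Suc n - 1 - Suc m))"
      unfolding Suc.IH u_def sum_distrib_left cis_Suc_mult
      by (intro sum.cong refl) (simp add: mult_ac)
    finally show ?case by (subst sum.lessThan_Suc_shift) simp
  qed
  \<comment> \<open>Averaging over the two signs turns the phases into cosines; this is the source
    of the damping.\<close>
  have G: "(g n (int k) + g n (- int k)) / 2 = (\<Sum>m<n. t ^ m * cos (real (Suc m) * v) * c (n - 1 - m))" for n
  proof -
    have e: "g n z = (\<Sum>m<n. t ^ m * cis (real (Suc m) * (s * val z)) * c (n - 1 - m))" if "lev z = k" for z
      unfolding g_def f_level[OF that] u_def sum_distrib_left cis_Suc_mult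
      by (intro sum.cong refl) (simp add: mult_ac)
    have "cis y + cis (- y) = of_real (2 * cos y)" for y
      by (simp add: complex_eq_iff)
    then have "t ^ m * cis y * d + t ^ m * cis (- y) * d = 2 * (t ^ m * cos y * d)" for m y and d :: complex
      by (simp add: distrib_left[symmetric] distrib_right[symmetric])
    then have "g n (int k) + g n (- int k) = 2 * (\<Sum>m<n. t ^ m * cos (real (Suc m) * v) * c (n - 1 - m))"
      using e[of "int k"] e[of "- int k"]
      by (simp add: sum.distrib[symmetric] sum_distrib_left odd v_def del: of_nat_Suc)
    then show ?thesis by simp
  qed
  \<comment> \<open>Both bounds are carried together: those on earlier \<open>c\<close> control
    level \<open>k\<close>, hence \<open>c n\<close>, and \<open>c n\<close> controls the next step
    below \<open>k\<close>. The bound for \<open>c\<close> is the one that closes the step: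
    \<open>t * (s0 + \<kappa> ^ n)\<close> plus it equals
    \<open>s0 + \<kappa> ^ Suc n\<close>.\<close>
  have main: "(\<forall>z. lev z < k \<longrightarrow> norm (f n z) \<le> s0 + \<kappa> ^ n) \<and> (\<forall>m<n. norm (c m) \<le> (\<kappa> - t) * \<kappa> ^ m + (1 - t) * s0)" for n
  proof (induction n)
    case 0
    show ?case using s0 by (simp add: f_def f0_def)
  next
    case (Suc n)
    have Fb: "norm (f n z) \<le> s0 + \<kappa> ^ n" if "lev z < k" for z using Suc.IH that by blast
    have cb: "norm (c m) \<le> (\<kappa> - t) * \<kappa> ^ m + (1 - t) * s0" if "m < n" for m using Suc.IH that by blast
    have \<kappa>0: "\<kappa> > 0" using t \<kappa> by linarith
    have Gb: "norm ((g n (int k) + g n (- int k)) / 2) \<le> \<kappa> ^ n * Q \<kappa> + s0 * Q 1"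
    proof -
      have "norm ((g n (int k) + g n (- int k)) / 2) \<le> (\<Sum>m<n. norm (t ^ m * cos (real (Suc m) * v) * c (n - 1 - m)))"
        unfolding G by (rule norm_sum)
      also have "\<dots> \<le> (\<Sum>m<n. t ^ m * \<bar>cos (real (Suc m) * v)\<bar> * ((\<kappa> - t) * \<kappa> ^ (n - 1 - m) + (1 - t) * s0))"
        unfolding norm_mult norm_power norm_of_real using t
        by (intro sum_mono mult_mono cb) (auto simp: abs_mult)
      also have "\<dots> = (\<Sum>m<n. \<kappa> ^ n * ((\<kappa> - t) * (t ^ m * \<bar>cos (real (Suc m) * v)\<bar> / \<kappa> ^ Suc m)) +
          s0 * ((1 - t) * (t ^ m * \<bar>cos (real (Suc m) * v)\<bar> / 1 ^ Suc m)))"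
      proof (intro sum.cong refl)
        fix m assume "m \<in> {..<n}"
        then have "\<kappa> ^ n = \<kappa> ^ (n - 1 - m) * \<kappa> ^ Suc m" by (simp add: power_add[symmetric] del: power_Suc)
        then have "\<kappa> ^ (n - 1 - m) = \<kappa> ^ n / \<kappa> ^ Suc m" using \<kappa>0 by simp
        then show "t ^ m * \<bar>cos (real (Suc m) * v)\<bar> * ((\<kappa> - t) * \<kappa> ^ (n - 1 - m) + (1 - t) * s0) =
            \<kappa> ^ n * ((\<kappa> - t) * (t ^ m * \<bar>cos (real (Suc m) * v)\<bar> / \<kappa> ^ Suc m)) +
            s0 * ((1 - t) * (t ^ m * \<bar>cos (real (Suc m) * v)\<bar> / 1 ^ Suc m))"
          by (simp only: power_one div_by_1) (simp add: algebra_simps del: power_Suc of_nat_Suc)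
      qed
      also have "\<dots> = \<kappa> ^ n * ((\<kappa> - t) * (\<Sum>m<n. t ^ m * \<bar>cos (real (Suc m) * v)\<bar> / \<kappa> ^ Suc m)) +
          s0 * ((1 - t) * (\<Sum>m<n. t ^ m * \<bar>cos (real (Suc m) * v)\<bar> / 1 ^ Suc m))"
        unfolding sum.distrib sum_distrib_left ..
      also have "\<dots> \<le> \<kappa> ^ n * Q \<kappa> + s0 * Q 1"
        unfolding Q_def using t \<kappa> \<kappa>0 s0
        by (intro add_mono mult_left_mono sum_geometric_abs_cos_le) auto
      finally show ?thesis .
    qed
    have "norm (c n) \<le> (1 - t) * (s0 + \<kappa> ^ n) + \<eta> * (norm ((g n (int k) + g n (- int k)) / 2) - (s0 + \<kappa> ^ n)) + exit_rate k * (1 - (s0 + \<kappa> ^ n))"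
      unfolding c_def t_def \<eta>_def
      by (rule norm_redraw_avg_le[OF k g1]) (use Fb s0 \<kappa>0 in \<open>auto simp: ng\<close>)
    also have "\<dots> \<le> (1 - t) * (s0 + \<kappa> ^ n) + \<eta> * ((\<kappa> ^ n * (1 - q) + s0 * (1 - q)) - (s0 + \<kappa> ^ n)) + exit_rate k * 1"
    proof (intro add_mono mult_left_mono diff_right_mono)
      have "\<kappa> ^ n * Q \<kappa> + s0 * Q 1 \<le> \<kappa> ^ n * (1 - q) + s0 * (1 - q)"
        using \<kappa> t \<kappa>0 s0 by (intro add_mono mult_left_mono Q) auto
      with Gb show "norm ((g n (int k) + g n (- int k)) / 2) \<le> \<kappa> ^ n * (1 - q) + s0 * (1 - q)" by linarith
    qed (use \<eta> exit_rate_nonneg[of k] s0(1) zero_less_power[OF \<kappa>0, of n] in auto)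
    \<comment> \<open>Here \<open>s0 * \<eta> * q = exit_rate k\<close> is used: the gain at level
      \<open>k\<close> on the constant part pays exactly for the excursions upwards.\<close>
    also have "\<dots> = (\<kappa> - t) * \<kappa> ^ n + (1 - t) * s0"
      using s0(2) by (simp add: \<kappa>_def algebra_simps)
    finally have cn: "norm (c n) \<le> (\<kappa> - t) * \<kappa> ^ n + (1 - t) * s0" .
    have "norm (f (Suc n) z) \<le> s0 + \<kappa> ^ Suc n" if z: "lev z < k" for z
    proof -
      define F where "F = s0 + \<kappa> ^ n"
      have F0: "0 \<le> F" using s0 \<kappa>0 by (simp add: F_def)
      have 1: "norm (\<theta> (lev z) * g n z) \<le> \<theta> (lev z) * F"
        using Fb[OF z] by (simp add: norm_mult ng F_def \<theta>_def mult_left_mono)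
      have 2: "norm (LINT j|measure_pmf w. indicator {lev z..<k} j *\<^sub>R cell_avg j (g n)) \<le> (t - \<theta> (lev z)) * F"
      proof -
        have "norm (LINT j|measure_pmf w. indicator {lev z..<k} j *\<^sub>R cell_avg j (g n)) \<le>
            (LINT j|measure_pmf w. norm (indicator {lev z..<k} j *\<^sub>R cell_avg j (g n)))"
          by (rule integral_norm_bound)
        also have "\<dots> \<le> (LINT j|measure_pmf w. indicator {lev z..<k} j * F)"
        proof (rule integral_mono)
          show "integrable (measure_pmf w) (\<lambda>j. norm (indicator {lev z..<k} j *\<^sub>R cell_avg j (g n)))"
            by (rule integrable_pmf_bounded[where B = 1]) (use norm_cell_avg_le[of _ "g n" 1] g1 in \<open>auto simp: indicator_def\<close>)
          show "norm (indicator {lev z..<k} j *\<^sub>R cell_avg j (g n)) \<le> indicator {lev z..<k} j * F" for j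
            using norm_cell_avg_le[of j "g n" F] Fb by (auto simp: indicator_def mem_cell_iff ng F_def)
        qed (intro integrable_mult_left integrable_w_indicator)
        also have "\<dots> = measure (measure_pmf w) ({..<k} - {..<lev z}) * F"
        proof -
          have "{lev z..<k} = {..<k} - {..<lev z}" by auto
          then show ?thesis by (simp only: integral_mult_left_zero integral_pmf_indicator)
        qed
        also have "\<dots> = (t - \<theta> (lev z)) * F"
          using z by (subst measure_pmf.finite_measure_Diff) (auto simp: t_def \<theta>_def)
        finally show ?thesis .
      qed
      have "norm (f (Suc n) z) \<le> (\<theta> (lev z) * F + (t - \<theta> (lev z)) * F) + ((\<kappa> - t) * \<kappa> ^ n + (1 - t) * s0)"
        unfolding fS[OF less_imp_le[OF z]] by (intro norm_triangle_mono 1 2 cn)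
      also have "\<dots> = s0 + \<kappa> ^ Suc n" by (simp add: F_def algebra_simps)
      finally show ?thesis .
    qed
    then show ?case using cn cb less_Suc_eq by auto
  qed
  define R where "R = measure (measure_pmf \<mu>) {z. k \<le> lev z}"
  have i: "integrable (measure_pmf \<mu>) (\<lambda>x. (tilt u ^^ n) h x)" if "\<And>x. norm (h x) \<le> B" for h B
    by (rule integrable_pmf_bounded, rule norm_tilt_pow_le[where u = u and h = h, OF u1 that])
  have 1: "norm (LINT z|measure_pmf \<mu>. f n z) \<le> s0 + \<kappa> ^ n + R"
  proof -
    have "norm (LINT z|measure_pmf \<mu>. f n z) \<le> (LINT z|measure_pmf \<mu>. norm (f n z))" by (rule integral_norm_bound)
    also have "\<dots> \<le> (LINT z|measure_pmf \<mu>. (s0 + \<kappa> ^ n) + indicator {z. k \<le> lev z} z)"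
    proof (rule integral_mono)
      show "integrable (measure_pmf \<mu>) (\<lambda>z. norm (f n z))" by (rule integrable_pmf_bounded[where B = 1]) (use f1 in auto)
      show "integrable (measure_pmf \<mu>) (\<lambda>z. (s0 + \<kappa> ^ n) + indicator {z. k \<le> lev z} z)"
        by (intro Bochner_Integration.integrable_add measure_pmf.integrable_const integrable_pmf_bounded[where B = 1]) (auto simp: indicator_def)
      show "norm (f n z) \<le> (s0 + \<kappa> ^ n) + indicator {z. k \<le> lev z} z" for z
        using main[of n] f1[of n z] s0 \<kappa> t by (cases "lev z < k") (auto intro: order_trans[OF f1])
    qed
    also have "\<dots> = s0 + \<kappa> ^ n + R"
      by (subst Bochner_Integration.integral_add)
         (auto simp: R_def intro!: integrable_pmf_bounded[where B = 1])
    finally show ?thesis .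
  qed
  have 2: "norm (LINT z|measure_pmf \<mu>. (tilt u ^^ n) (\<lambda>x. 1 - 1 * f0 x) z) \<le> R"
  proof -
    have "norm (LINT z|measure_pmf \<mu>. (tilt u ^^ n) (\<lambda>x. 1 - 1 * f0 x) z) \<le> (LINT z|measure_pmf \<mu>. norm (1 - 1 * f0 z))"
      by (rule norm_integral_tilt_pow_le[where u = u and B = 1, OF u1]) (simp add: f0_def)
    also have "\<dots> = (LINT z|measure_pmf \<mu>. indicator {z. k \<le> lev z} z)"
      by (intro Bochner_Integration.integral_cong) (auto simp: f0_def indicator_def)
    finally show ?thesis by (simp add: R_def)
  qed
  have "(LINT z|measure_pmf \<mu>. (tilt u ^^ n) (\<lambda>x. 1 - 1 * f0 x) z) = (LINT z|measure_pmf \<mu>. (tilt u ^^ n) (\<lambda>_. 1) z - 1 * (tilt u ^^ n) f0 z)"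
    by (subst tilt_pow_linear[where u = u, OF u1, of "\<lambda>_. 1" 1 f0 1]) (auto simp: f0_def)
  also have "\<dots> = (LINT z|measure_pmf \<mu>. (tilt u ^^ n) (\<lambda>_. 1) z) - (LINT z|measure_pmf \<mu>. f n z)"
    using i[of "\<lambda>_. 1" 1] i[of f0 1] by (subst Bochner_Integration.integral_diff) (auto simp: f_def f0_def)
  finally have "(LINT z|measure_pmf \<mu>. (tilt u ^^ n) (\<lambda>_. 1) z) =
      (LINT z|measure_pmf \<mu>. (tilt u ^^ n) (\<lambda>x. 1 - 1 * f0 x) z) + (LINT z|measure_pmf \<mu>. f n z)" by simp
  then have "norm (LINT z|measure_pmf \<mu>. (tilt u ^^ n) (\<lambda>_. 1) z) \<le> R + (s0 + \<kappa> ^ n + R)"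
    using norm_triangle_mono[OF 2 1] by simp
  then show ?thesis by (simp add: u_def R_def s0_def \<kappa>_def \<eta>_def)
qed

end

section \<open>Concentration and the limit law\<close>

lemma cmod_char_le_1: "prob_space M \<Longrightarrow> norm (char M t) \<le> 1"
  for M :: "real measure"
proof -
  assume "prob_space M"
  then interpret prob_space M .
  have "norm (char M t) \<le> (LINT x|M. norm (iexp (t * x)))"
    unfolding char_def by (rule integral_norm_bound)
  then show ?thesis by (simp add: prob_space)
qed

text \<open>The indicator of \<open>{r-c<..<r+c}\<close> is dominated by a multiple of the Gaussian \<open>exp (-((y - r) / c)\<^sup>2 / 2)\<close>, which is
  itself a characteristic function.\<close>

lemma (in prob_space) prob_interval_le_char:
  assumes Y [measurable]: "Y \<in> borel_measurable M" and c: "c > 0"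
  shows "prob {\<omega> \<in> space M. r - c < Y \<omega> \<and> Y \<omega> < r + c} \<le>
    exp (1 / 2) * (LINT x|std_normal_distribution. norm (char (distr M borel Y) (x / c)))"
proof -
  define D where "D = distr M borel Y"
  interpret D: real_distribution D unfolding D_def by simp
  interpret N: real_distribution std_normal_distribution by (rule real_dist_normal_dist)
  interpret DN: pair_prob_space D std_normal_distribution ..
  define f where "f = (\<lambda>y x. iexp (x * ((y - r) / c)) :: complex)"
  have fm [measurable]: "case_prod f \<in> borel_measurable (D \<Otimes>\<^sub>M std_normal_distribution)"
    unfolding f_def by measurable
  have fint: "integrable (D \<Otimes>\<^sub>M std_normal_distribution) (case_prod f)"
    by (rule DN.P.integrable_const_bound[where B = 1]) (auto simp: f_def)
  have gauss: "(LINT x|std_normal_distribution. f y x) = complex_of_real (exp (- ((y - r) / c)\<^sup>2 / 2))" for y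
    using fun_cong[OF char_std_normal_distribution, of "(y - r) / c"] by (simp add: char_def f_def mult.commute)
  have gi: "integrable D (\<lambda>y. exp (- ((y - r) / c)\<^sup>2 / 2))"
    by (rule D.integrable_const_bound[where B = 1]) auto
  have "prob {\<omega> \<in> space M. r - c < Y \<omega> \<and> Y \<omega> < r + c} = measure D {r - c<..<r + c}"
    unfolding D_def by (subst measure_distr) (auto intro!: arg_cong[where f = prob])
  also have "\<dots> = (LINT y|D. indicator {r - c<..<r + c} y)" by simp
  also have "\<dots> \<le> (LINT y|D. exp (1 / 2) * exp (- ((y - r) / c)\<^sup>2 / 2))"
  proof (rule integral_mono)
    show "indicator {r - c<..<r + c} y \<le> exp (1 / 2) * exp (- ((y - r) / c)\<^sup>2 / 2)" for y
    proof (cases "y \<in> {r - c<..<r + c}")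
      case True
      then have "\<bar>(y - r) / c\<bar> \<le> 1" using c by (auto simp: abs_le_iff field_simps)
      then have "((y - r) / c)\<^sup>2 \<le> 1" by (simp only: abs_square_le_1)
      then have "0 \<le> 1 / 2 + - ((y - r) / c)\<^sup>2 / 2" by linarith
      then show ?thesis using True by (simp add: exp_add[symmetric])
    qed simp
    show "integrable D (\<lambda>y. indicator {r - c<..<r + c} y :: real)"
      by (rule D.integrable_const_bound[where B = 1]) (auto simp: indicator_def)
  qed (use gi in auto)
  also have "\<dots> = exp (1 / 2) * (LINT y|D. exp (- ((y - r) / c)\<^sup>2 / 2))" by simp
  also have "(LINT y|D. exp (- ((y - r) / c)\<^sup>2 / 2)) \<le> (LINT x|std_normal_distribution. norm (char D (x / c)))"
  proof -
    have "(LINT y|D. exp (- ((y - r) / c)\<^sup>2 / 2)) = norm (complex_of_real (LINT y|D. exp (- ((y - r) / c)\<^sup>2 / 2)))"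
      by (simp add: integral_nonneg_AE)
    also have "\<dots> = norm (LINT y|D. LINT x|std_normal_distribution. f y x)"
      unfolding gauss by (simp only: integral_complex_of_real)
    also have "\<dots> = norm (LINT x|std_normal_distribution. LINT y|D. f y x)"
      using DN.Fubini_integral[OF fint] by simp
    also have "\<dots> \<le> (LINT x|std_normal_distribution. norm (LINT y|D. f y x))"
      by (rule integral_norm_bound)
    also have "\<dots> = (LINT x|std_normal_distribution. norm (char D (x / c)))"
    proof (intro Bochner_Integration.integral_cong refl)
      fix x
      have "(LINT y|D. f y x) = (LINT y|D. iexp (- x * r / c) * iexp (x / c * y))"
        unfolding f_def using c by (intro Bochner_Integration.integral_cong refl)
          (simp add: exp_add[symmetric] field_simps)
      also have "\<dots> = iexp (- x * r / c) * char D (x / c)"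
        by (simp add: char_def)
      finally show "norm (LINT y|D. f y x) = norm (char D (x / c))" by (simp add: norm_mult)
    qed
    finally show ?thesis .
  qed
  finally show ?thesis unfolding D_def by simp
qed

text \<open>The preceding bound does not depend on \<open>r\<close>, and its right-hand side tends
  to 0 by dominated convergence: the normal law does not charge 0, the only point where the
  characteristic functions need not converge to 0.\<close>

lemma (in prob_space) concentration_tendsto_0:
  assumes Y: "\<And>n. Y n \<in> borel_measurable M" and c: "c > 0"
    and lim: "\<And>t. t \<noteq> 0 \<Longrightarrow> (\<lambda>n. char (distr M borel (Y n)) t) \<longlonglongrightarrow> 0"
  shows "(\<lambda>n. SUP r. prob {\<omega> \<in> space M. r - c < Y n \<omega> \<and> Y n \<omega> < r + c}) \<longlonglongrightarrow> 0"
proof -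
  interpret N: real_distribution std_normal_distribution by (rule real_dist_normal_dist)
  have ps: "prob_space (distr M borel (Y n))" for n by (rule prob_space_distr) (rule Y)
  define I where "I = (\<lambda>n. LINT x|std_normal_distribution. norm (char (distr M borel (Y n)) (x / c)))"
  have "I \<longlonglongrightarrow> (LINT x|std_normal_distribution. 0)"
    unfolding I_def
  proof (rule integral_dominated_convergence[where w = "\<lambda>_. 1"])
    show "(\<lambda>x. norm (char (distr M borel (Y n)) (x / c))) \<in> borel_measurable std_normal_distribution" for n
    proof -
      interpret D: real_distribution "distr M borel (Y n)" using Y by simp
      have "char (distr M borel (Y n)) \<in> borel_measurable borel"
        by (intro borel_measurable_continuous_onI continuous_at_imp_continuous_on ballI D.isCont_char)
      then show ?thesis by measurable
    qed
    have "AE x in lborel. x \<noteq> (0::real)" by (rule AE_lborel_singleton)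
    then have "AE x in std_normal_distribution. x \<noteq> (0::real)"
      by (subst AE_density) auto
    then show "AE x in std_normal_distribution. (\<lambda>n. norm (char (distr M borel (Y n)) (x / c))) \<longlonglongrightarrow> 0"
    proof eventually_elim
      case (elim x)
      then have "x / c \<noteq> 0" using c by simp
      from tendsto_norm[OF lim[OF this]] show ?case by simp
    qed
    show "AE x in std_normal_distribution. norm (norm (char (distr M borel (Y n)) (x / c))) \<le> 1" for n
      using cmod_char_le_1[OF ps] by simp
  qed auto
  then have I0: "I \<longlonglongrightarrow> 0" by simp
  show ?thesis
  proof (rule tendsto_sandwich)
    have bdd: "bdd_above (range (\<lambda>r. prob {\<omega> \<in> space M. r - c < Y n \<omega> \<and> Y n \<omega> < r + c}))" for n
      by (rule bdd_aboveI[where M = 1]) auto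
    show "\<forall>\<^sub>F n in sequentially. 0 \<le> (SUP r. prob {\<omega> \<in> space M. r - c < Y n \<omega> \<and> Y n \<omega> < r + c})"
      by (intro always_eventually allI order_trans[OF _ cSUP_upper[OF UNIV_I bdd, of 0]]) simp
    show "\<forall>\<^sub>F n in sequentially. (SUP r. prob {\<omega> \<in> space M. r - c < Y n \<omega> \<and> Y n \<omega> < r + c}) \<le> exp (1 / 2) * I n"
      unfolding I_def by (intro always_eventually allI cSUP_least prob_interval_le_char Y c) simp
    show "(\<lambda>n. exp (1 / 2) * I n) \<longlonglongrightarrow> 0" using tendsto_mult_left[OF I0, of "exp (1 / 2)"] by simp
  qed simp
qed

section \<open>Characteristic functions of the Laplace law and of its compound Poisson sum\<close>

lemma integrable_half_line_exp_cos:
  "integrable lborel (\<lambda>x. indicator {0<..} x * (exp (- x) * cos (t * x)) :: real)"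
proof (rule Bochner_Integration.integrable_bound)
  show "integrable lborel (\<lambda>x. x ^ 0 * exp (- x) * indicator {0<..} x :: real)"
    using has_bochner_integral_I0i_power_exp_m[of 0] by (rule integrable.intros)
  show "AE x in lborel. norm (indicator {0<..} x * (exp (- x) * cos (t * x))) \<le> norm (x ^ 0 * exp (- x) * indicator {0<..} x :: real)"
    by (auto simp: indicator_def abs_mult)
qed simp

lemma integral_half_line_exp_cos:
  fixes t :: real
  shows "(LINT x|lborel. indicator {0<..} x * (exp (- x) * cos (t * x))) = 1 / (1 + t\<^sup>2)"
proof -
  define F where "F = (\<lambda>x. exp (- x) * (t * sin (t * x) - cos (t * x)) / (1 + t\<^sup>2))"
  have p: "1 + t\<^sup>2 > 0" using zero_le_power2[of t] by linarith
  have "(LBINT x=0..\<infinity>. exp (- x) * cos (t * x)) = 0 - (- 1 / (1 + t\<^sup>2))"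
  proof (rule interval_integral_FTC_integrable[where F = F])
    show "(F has_vector_derivative exp (- x) * cos (t * x)) (at x)" for x
    proof -
      have "((\<lambda>x. exp (- x) * (t * sin (t * x) - cos (t * x))) has_real_derivative exp (- x) * cos (t * x) * (1 + t\<^sup>2)) (at x)"
        by (auto intro!: derivative_eq_intros simp: algebra_simps power2_eq_square)
      from DERIV_cdivide[OF this, of "1 + t\<^sup>2"] show ?thesis
        unfolding F_def has_real_derivative_iff_has_vector_derivative[symmetric] using p by simp
    qed
    show "set_integrable lborel (einterval 0 \<infinity>) (\<lambda>x. exp (- x) * cos (t * x))"
      using integrable_half_line_exp_cos[of t]
      by (simp add: set_integrable_def einterval_def zero_ereal_def greaterThan_def)
    have "(F \<longlongrightarrow> F 0) (at_right 0)"
      unfolding F_def using p by (intro tendsto_intros) auto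
    then show "((F \<circ> real_of_ereal) \<longlongrightarrow> - 1 / (1 + t\<^sup>2)) (at_right 0)"
      unfolding zero_ereal_def by (simp add: ereal_tendsto_simps F_def)
    have "(F \<longlongrightarrow> 0) at_top"
    proof (rule Lim_null_comparison)
      show "\<forall>\<^sub>F x in at_top. norm (F x) \<le> exp (- x) * (\<bar>t\<bar> + 1)"
      proof (intro always_eventually allI)
        fix x
        have "\<bar>t * sin (t * x) - cos (t * x)\<bar> \<le> \<bar>t\<bar> * 1 + 1"
        proof -
          have "\<bar>t * sin (t * x)\<bar> \<le> \<bar>t\<bar> * 1" unfolding abs_mult by (intro mult_left_mono) auto
          then show ?thesis using abs_cos_le_one[of "t * x"] by linarith
        qed
        then have "\<bar>t * sin (t * x) - cos (t * x)\<bar> / (1 + t\<^sup>2) \<le> (\<bar>t\<bar> + 1) / 1"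
          by (intro frac_le) auto
        then have "exp (- x) * (\<bar>t * sin (t * x) - cos (t * x)\<bar> / (1 + t\<^sup>2)) \<le> exp (- x) * (\<bar>t\<bar> + 1)"
          by (intro mult_left_mono) auto
        then show "norm (F x) \<le> exp (- x) * (\<bar>t\<bar> + 1)"
          unfolding F_def using p by (simp add: abs_mult abs_divide)
      qed
      have "((\<lambda>x. exp (- x) :: real) \<longlongrightarrow> 0) at_top"
        using exp_at_bot filterlim_compose filterlim_uminus_at_bot_at_top by blast
      from tendsto_mult_right[OF this, of "\<bar>t\<bar> + 1"] show "((\<lambda>x. exp (- x) * (\<bar>t\<bar> + 1)) \<longlongrightarrow> 0) at_top" by simp
    qed
    then show "((F \<circ> real_of_ereal) \<longlongrightarrow> 0) (at_left \<infinity>)"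
      by (simp add: ereal_tendsto_simps)
  qed (auto intro!: continuous_intros)
  moreover have "(LBINT x=0..\<infinity>. exp (- x) * cos (t * x)) = (LINT x|lborel. indicator {0<..} x * (exp (- x) * cos (t * x)))"
    by (simp add: interval_lebesgue_integral_0_infty set_lebesgue_integral_def)
  ultimately show ?thesis by simp
qed

lemma
  shows integrable_laplace_cos: "integrable lborel (\<lambda>x. 1 / 2 * exp (- \<bar>x\<bar>) * cos (t * x) :: real)"
    and integral_laplace_cos: "(LINT x|lborel. 1 / 2 * exp (- \<bar>x\<bar>) * cos (t * x)) = 1 / (1 + t\<^sup>2)"
proof -
  define h where "h = (\<lambda>x. indicator {0<..} x * (exp (- x) * cos (t * x)) :: real)"
  have hb: "has_bochner_integral lborel h (1 / (1 + t\<^sup>2))"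
    unfolding h_def using integral_half_line_exp_cos[of t] integrable_half_line_exp_cos[of t]
    by (simp add: has_bochner_integral_iff)
  then have hb': "has_bochner_integral lborel (\<lambda>x. h (- x)) (1 / (1 + t\<^sup>2))"
    using lborel_has_bochner_integral_real_affine_iff[of "- 1" h "1 / (1 + t\<^sup>2)" 0] by simp
  have "has_bochner_integral lborel (\<lambda>x. 1 / 2 * (h x + h (- x))) (1 / 2 * (1 / (1 + t\<^sup>2) + 1 / (1 + t\<^sup>2)))"
    by (intro has_bochner_integral_mult_right has_bochner_integral_add hb hb')
  moreover have "AE x in lborel. 1 / 2 * (h x + h (- x)) = 1 / 2 * exp (- \<bar>x\<bar>) * cos (t * x)"
    using AE_lborel_singleton[of 0] by eventually_elim (auto simp: h_def indicator_def)
  moreover have "1 / 2 * (a + a) = a" for a :: real by simp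
  ultimately have "has_bochner_integral lborel (\<lambda>x. 1 / 2 * exp (- \<bar>x\<bar>) * cos (t * x)) (1 / (1 + t\<^sup>2))"
    by (subst (asm) has_bochner_integral_cong_AE) (auto simp: h_def)
  then show "integrable lborel (\<lambda>x. 1 / 2 * exp (- \<bar>x\<bar>) * cos (t * x) :: real)"
    "(LINT x|lborel. 1 / 2 * exp (- \<bar>x\<bar>) * cos (t * x)) = 1 / (1 + t\<^sup>2)"
    by (rule integrable.intros, rule has_bochner_integral_integral_eq)
qed

lemma real_distribution_laplace: "real_distribution laplace_measure"
proof -
  have "emeasure laplace_measure UNIV = (\<integral>\<^sup>+x. ennreal (1 / 2 * exp (- \<bar>x\<bar>)) \<partial>lborel)"
    unfolding laplace_measure_def by (subst emeasure_density) auto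
  also have "\<dots> = ennreal (LINT x|lborel. 1 / 2 * exp (- \<bar>x\<bar>))"
    using integrable_laplace_cos[of 0] by (intro nn_integral_eq_integral) auto
  also have "\<dots> = 1" using integral_laplace_cos[of 0] by simp
  finally show ?thesis
    by (intro real_distribution.intro prob_spaceI real_distribution_axioms.intro)
       (auto simp: laplace_measure_def)
qed

lemma char_laplace: "char laplace_measure t = complex_of_real (1 / (1 + t\<^sup>2))"
proof -
  have i: "integrable lborel (\<lambda>x. (1 / 2 * exp (- \<bar>x\<bar>)) *\<^sub>R iexp (t * x))"
    using integrable_laplace_cos[of 0]
    by (rule Bochner_Integration.integrable_bound) auto
  have m: "(LINT x|lborel. (1 / 2 * exp (- \<bar>x\<bar>)) *\<^sub>R iexp (t * x)) = char laplace_measure t"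
    unfolding char_def laplace_measure_def by (subst integral_density) auto
  have "Re (char laplace_measure t) = 1 / (1 + t\<^sup>2)"
    unfolding m[symmetric] integral_laplace_cos[of t, symmetric]
    using i by (subst integral_Re[symmetric]) (auto simp: Re_exp)
  moreover have "Im (char laplace_measure t) = 0"
  proof -
    have e: "Im (char laplace_measure t) = (LINT x|lborel. 1 / 2 * exp (- \<bar>x\<bar>) * sin (t * x))"
      unfolding m[symmetric] using i by (subst integral_Im[symmetric]) (auto simp: Im_exp)
    also have "\<dots> = (LINT x|lborel. 1 / 2 * exp (- \<bar>- x\<bar>) * sin (t * - x))"
      by (subst lborel_integral_real_affine[where c = "- 1" and t = 0]) auto
    also have "\<dots> = - (LINT x|lborel. 1 / 2 * exp (- \<bar>x\<bar>) * sin (t * x))" by simp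
    finally show ?thesis using e by simp
  qed
  ultimately show ?thesis by (simp add: complex_eq_iff)
qed

lemma integral_poisson_power:
  fixes z :: complex
  assumes "norm z \<le> 1"
  shows "(LINT n|measure_pmf (poisson_pmf 1). z ^ n) = exp (z - 1)"
proof -
  have "(LINT n|measure_pmf (poisson_pmf 1). z ^ n) = (LINT n|count_space UNIV. pmf (poisson_pmf 1) n *\<^sub>R z ^ n)"
    unfolding measure_pmf_eq_density by (subst integral_density) auto
  also have "\<dots> = (\<Sum>n. pmf (poisson_pmf 1) n *\<^sub>R z ^ n)"
  proof (rule integral_count_space_nat, subst integrable_count_space_nat_iff)
    have "summable (\<lambda>n. exp (- 1) * (inverse (fact n) * norm z ^ n) :: real)"
      by (intro summable_mult summable_exp)
    then show "summable (\<lambda>n. norm (pmf (poisson_pmf 1) n *\<^sub>R z ^ n))"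
      by (simp add: norm_power field_simps)
  qed
  also have "\<dots> = (\<Sum>n. exp (- 1) * (inverse (fact n) * z ^ n))"
    by (intro suminf_cong) (simp add: scaleR_conv_of_real field_simps exp_of_real[symmetric])
  also have "\<dots> = exp (- 1) * exp z"
  proof -
    have "(\<lambda>n. inverse (fact n) * z ^ n) sums exp z"
      using exp_converges[of z] by (simp add: scaleR_conv_of_real)
    from sums_mult[OF this, of "exp (- 1)"] show ?thesis by (simp only: sums_iff)
  qed
  also have "\<dots> = exp (z - 1)" by (simp add: exp_add[symmetric])
  finally show ?thesis .
qed

text \<open>Given the number of summands the characteristic function is a power of that of the
  Laplace law; the Poisson generating function sums these powers.\<close>

lemma
  shows real_distribution_mu_P1sL: "real_distribution mu_P1sL"
    and char_mu_P1sL: "char mu_P1sL t = complex_of_real (exp (1 / (1 + t\<^sup>2) - 1))"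
proof -
  interpret L: real_distribution laplace_measure by (rule real_distribution_laplace)
  interpret PL: product_prob_space "\<lambda>_. laplace_measure" "UNIV :: nat set" ..
  define PiL where "PiL = PiM (UNIV :: nat set) (\<lambda>_. laplace_measure)"
  interpret PP: prob_space PiL unfolding PiL_def by (rule PL.P.prob_space_axioms)
  interpret Pr: pair_prob_space "measure_pmf (poisson_pmf 1)" PiL
    by (intro pair_prob_space.intro pair_sigma_finite.intro)
       (auto intro: measure_pmf.prob_space_axioms PP.prob_space_axioms prob_space_imp_sigma_finite)
  define Y :: "nat \<times> (nat \<Rightarrow> real) \<Rightarrow> real" where "Y = (\<lambda>(N, \<eta>). \<Sum>k=1..N. \<eta> k)"
  have Ym: "Y \<in> borel_measurable (measure_pmf (poisson_pmf 1) \<Otimes>\<^sub>M PiL)"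
  proof -
    have "Y \<in> borel_measurable (count_space UNIV \<Otimes>\<^sub>M PiL)"
    proof (rule measurable_pair_measure_countable1)
      fix N :: nat
      have "(\<lambda>\<eta>. \<eta> k) \<in> measurable PiL laplace_measure" for k unfolding PiL_def by simp
      then have "(\<lambda>\<eta>. \<eta> k) \<in> borel_measurable PiL" for k by (simp add: laplace_measure_def cong: measurable_cong_sets)
      then show "(\<lambda>\<eta>. Y (N, \<eta>)) \<in> borel_measurable PiL" unfolding Y_def by simp
    qed simp
    then show ?thesis by (simp cong: measurable_cong_sets sets_pair_measure_cong)
  qed
  have mu: "mu_P1sL = distr (measure_pmf (poisson_pmf 1) \<Otimes>\<^sub>M PiL) borel Y"
    unfolding mu_P1sL_def PiL_def Y_def ..
  show "real_distribution mu_P1sL" unfolding mu by (rule Pr.real_distribution_distr[OF Ym])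
  have prod: "(LINT \<eta>|PiL. (\<Prod>k=1..N. iexp (t * \<eta> k))) = char laplace_measure t ^ N" for N
  proof -
    interpret fp: finite_product_prob_space "\<lambda>_. laplace_measure" "{1..N}" by standard auto
    \<comment> \<open>The product formula for integrals concerns finite products, so the infinite
      product is first projected to the coordinates that occur.\<close>
    have "distr PiL (PiM {1..N} (\<lambda>_. laplace_measure)) (\<lambda>\<eta>. restrict \<eta> {1..N}) = PiM {1..N} (\<lambda>_. laplace_measure)"
      unfolding PiL_def by (rule PL.distr_PiM_restrict_finite) auto
    then have "(LINT \<eta>|PiM {1..N} (\<lambda>_. laplace_measure). (\<Prod>k=1..N. iexp (t * \<eta> k))) =
        (LINT \<eta>|distr PiL (PiM {1..N} (\<lambda>_. laplace_measure)) (\<lambda>\<eta>. restrict \<eta> {1..N}). (\<Prod>k=1..N. iexp (t * \<eta> k)))"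
      by simp
    also have "\<dots> = (LINT \<eta>|PiL. (\<Prod>k=1..N. iexp (t * \<eta> k)))"
    proof (subst integral_distr)
      show "(\<lambda>\<eta>. restrict \<eta> {1..N}) \<in> measurable PiL (PiM {1..N} (\<lambda>_. laplace_measure))"
        unfolding PiL_def by (rule measurable_restrict_subset) simp
      have "(\<lambda>\<eta>. \<eta> k) \<in> borel_measurable (PiM {1..N} (\<lambda>_. laplace_measure))" if "k \<in> {1..N}" for k
      proof -
        have "(\<lambda>\<eta>. \<eta> k) \<in> measurable (PiM {1..N} (\<lambda>_. laplace_measure)) laplace_measure" using that by simp
        then show ?thesis by (simp add: laplace_measure_def cong: measurable_cong_sets)
      qed
      then show "(\<lambda>\<eta>. \<Prod>k=1..N. iexp (t * \<eta> k)) \<in> borel_measurable (PiM {1..N} (\<lambda>_. laplace_measure))"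
        by (intro borel_measurable_prod) simp
    qed (auto intro!: Bochner_Integration.integral_cong prod.cong)
    also have "(LINT \<eta>|PiM {1..N} (\<lambda>_. laplace_measure). (\<Prod>k=1..N. iexp (t * \<eta> k))) = (\<Prod>k=1..N. LINT x|laplace_measure. iexp (t * x))"
      by (rule PL.product_integral_prod) (auto intro!: L.integrable_const_bound[where B = 1])
    finally show ?thesis by (simp add: char_def)
  qed
  have "char mu_P1sL t = (LINT p|(measure_pmf (poisson_pmf 1) \<Otimes>\<^sub>M PiL). iexp (t * Y p))"
    unfolding mu char_def using Ym by (subst integral_distr) auto
  also have "\<dots> = (LINT N|measure_pmf (poisson_pmf 1). LINT \<eta>|PiL. iexp (t * Y (N, \<eta>)))"
    using Ym by (intro Pr.integral_fst'[symmetric] Pr.P.integrable_const_bound[where B = 1]) auto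
  also have "\<dots> = (LINT N|measure_pmf (poisson_pmf 1). char laplace_measure t ^ N)"
  proof (intro Bochner_Integration.integral_cong refl)
    fix N
    have "iexp (t * Y (N, \<eta>)) = (\<Prod>k=1..N. iexp (t * \<eta> k))" for \<eta>
      by (simp add: Y_def exp_sum[symmetric] sum_distrib_left)
    then show "(LINT \<eta>|PiL. iexp (t * Y (N, \<eta>))) = char laplace_measure t ^ N" by (simp only: prod)
  qed
  also have "\<dots> = exp (char laplace_measure t - 1)"
    by (rule integral_poisson_power) (rule cmod_char_le_1[OF L.prob_space_axioms])
  finally show "char mu_P1sL t = complex_of_real (exp (1 / (1 + t\<^sup>2) - 1))"
    unfolding char_laplace by (simp add: exp_of_real[symmetric])
qed

section \<open>Partial sums of the hierarchical chain\<close>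

text \<open>Each row is at most two geometric series, one on either side of the diagonal.\<close>

lemma toeplitz_sum_le_mult:
  assumes "0 \<le> t" "t < 1"
  shows "toeplitz_sum t n \<le> 2 * real n / (1 - t)"
proof -
  have geo: "(\<Sum>m<k. t ^ m) \<le> 1 / (1 - t)" for k
    using assms sum_le_suminf[of "\<lambda>m. t ^ m" "{..<k}"] by (simp add: suminf_geometric summable_geometric)
  have row: "(\<Sum>j=1..n. t ^ nat \<bar>int i - int j\<bar>) \<le> 2 / (1 - t)" if i: "i \<in> {1..n}" for i
  proof -
    have "(\<Sum>j=1..n. t ^ nat \<bar>int i - int j\<bar>) \<le> (\<Sum>j=1..i. t ^ nat \<bar>int i - int j\<bar>) + (\<Sum>j=i..n. t ^ nat \<bar>int i - int j\<bar>)"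
    proof -
      have "{1..n} = {1..i} \<union> {i..n}" using i by auto
      then have "(\<Sum>j=1..n. t ^ nat \<bar>int i - int j\<bar>) = (\<Sum>j\<in>{1..i} \<union> {i..n}. t ^ nat \<bar>int i - int j\<bar>)" by simp
      also have "\<dots> \<le> (\<Sum>j=1..i. t ^ nat \<bar>int i - int j\<bar>) + (\<Sum>j=i..n. t ^ nat \<bar>int i - int j\<bar>)"
        using assms by (subst sum_Un) (auto intro!: sum_nonneg)
      finally show ?thesis .
    qed
    also have "(\<Sum>j=1..i. t ^ nat \<bar>int i - int j\<bar>) = (\<Sum>m<i. t ^ m)"
      by (rule sum.reindex_bij_witness[of _ "\<lambda>m. i - m" "\<lambda>j. i - j"]) (auto simp: nat_diff_distrib')
    also have "(\<Sum>j=i..n. t ^ nat \<bar>int i - int j\<bar>) = (\<Sum>m<Suc n - i. t ^ m)"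
      by (rule sum.reindex_bij_witness[of _ "\<lambda>m. i + m" "\<lambda>j. j - i"]) (auto simp: nat_diff_distrib' abs_if)
    finally show ?thesis using geo[of i] geo[of "Suc n - i"] by linarith
  qed
  have "toeplitz_sum t n \<le> (\<Sum>i=1..n. 2 / (1 - t))"
    unfolding toeplitz_sum_def by (rule sum_mono) (rule row)
  then show ?thesis by (simp add: mult.commute)
qed

text \<open>The regime of \<open>n\<close> far below the holding time \<open>1 / (1 - t)\<close>: by
  the Bernoulli inequality all entries are close to 1.\<close>

lemma toeplitz_sum_ge_square:
  assumes "0 \<le> t" "t \<le> 1"
  shows "(real n)\<^sup>2 * (1 - real n * (1 - t)) \<le> toeplitz_sum t n"
proof -
  have "(\<Sum>i=1..n. \<Sum>j=1..n. 1 - real n * (1 - t)) \<le> toeplitz_sum t n"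
    unfolding toeplitz_sum_def
  proof (intro sum_mono)
    fix i j assume "i \<in> {1..n}" "j \<in> {1..n}"
    have "1 + real n * (t - 1) \<le> (1 + (t - 1)) ^ n" using assms by (intro Bernoulli_inequality) auto
    also have "(1 + (t - 1)) ^ n \<le> t ^ nat \<bar>int i - int j\<bar>"
      using assms \<open>i \<in> _\<close> \<open>j \<in> _\<close> by (simp, intro power_decreasing) auto
    finally show "1 - real n * (1 - t) \<le> t ^ nat \<bar>int i - int j\<bar>" by (simp add: algebra_simps)
  qed
  then show ?thesis by (simp add: power2_eq_square mult.assoc)
qed

text \<open>The saturated regime: each row has about \<open>L / 2\<close> entries close enough to
  the diagonal to be at least 1/2.\<close>

lemma toeplitz_sum_ge_linear:
  assumes L: "L \<ge> 1" "L \<le> n"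
  shows "real n * real L / 4 \<le> toeplitz_sum (1 - 1 / real L) n"
proof -
  define t where "t = 1 - 1 / real L"
  define m where "m = L div 2"
  have t: "0 \<le> t" "t \<le> 1" using L by (auto simp: t_def)
  have m: "2 * m \<le> L" "L \<le> 2 * m + 1" by (auto simp: m_def)
  have pow: "1 / 2 \<le> t ^ d" if "d \<le> m" for d
  proof -
    have "real d * 2 \<le> real L" using that m by linarith
    then have "real d / real L \<le> 1 / 2" using L by (simp add: field_simps)
    then have "1 / 2 \<le> 1 + real d * (t - 1)" by (simp add: t_def)
    also have "\<dots> \<le> (1 + (t - 1)) ^ d" using t by (intro Bernoulli_inequality) auto
    finally show ?thesis by simp
  qed
  have row: "real L / 4 \<le> (\<Sum>j=1..n. t ^ nat \<bar>int i - int j\<bar>)" if i: "i \<in> {1..n}" for i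
  proof -
    \<comment> \<open>A one-sided stretch on whichever side has room; since
      \<open>2 * m \<le> L \<le> n\<close>, one of the two sides always has.\<close>
    define I where "I = (if i + m \<le> n then {i..i + m} else {i - m..i})"
    have card: "card I = m + 1" using m L i by (auto simp: I_def)
    have sub: "I \<subseteq> {1..n}" using m L i by (auto simp: I_def)
    have "real L / 4 \<le> (\<Sum>j\<in>I. 1 / 2)" using card m by simp
    also have "\<dots> \<le> (\<Sum>j\<in>I. t ^ nat \<bar>int i - int j\<bar>)"
    proof (intro sum_mono pow)
      fix j assume "j \<in> I"
      then show "nat \<bar>int i - int j\<bar> \<le> m" by (auto simp: I_def split: if_splits)
    qed
    also have "\<dots> \<le> (\<Sum>j=1..n. t ^ nat \<bar>int i - int j\<bar>)"
      using sub t by (intro sum_mono2) auto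
    finally show ?thesis .
  qed
  have "(\<Sum>i=1..n. real L / 4) \<le> toeplitz_sum t n"
    unfolding toeplitz_sum_def by (rule sum_mono) (rule row)
  then show ?thesis by (simp add: t_def)
qed

context hierarchy
begin

lemma integral_odd_eq_0:
  fixes f :: "int \<Rightarrow> real"
  assumes "\<And>z. f (- z) = - f z"
  shows "integral\<^sup>L (measure_pmf \<mu>) f = 0"
proof -
  have "map_pmf uminus \<mu> = \<mu>"
  proof (rule pmf_eqI)
    fix z :: int
    have "pmf (map_pmf uminus \<mu>) (- (- z)) = pmf \<mu> (- z)"
      by (rule pmf_map_inj') (auto simp: inj_on_def)
    then show "pmf (map_pmf uminus \<mu>) z = pmf \<mu> z" by (simp add: symmetric)
  qed
  then have "integral\<^sup>L (measure_pmf \<mu>) f = integral\<^sup>L (measure_pmf (map_pmf uminus \<mu>)) f" by simp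
  also have "\<dots> = - integral\<^sup>L (measure_pmf \<mu>) f" by (simp add: assms)
  finally show ?thesis by simp
qed

lemma pmf_kernel_pos: "pmf (kernel x) y > 0"
proof -
  define j where "j = max (lev x) (lev y)"
  have "x \<in> cell j" "y \<in> cell j" by (auto simp: j_def mem_cell_iff)
  then have "y \<in> set_pmf (redraw j x)"
    using pmf_\<mu>_pos[of y] by (auto simp: redraw_def set_cond_pmf[OF cell_nonnull] set_pmf_iff)
  moreover have "j \<in> set_pmf w" using pmf_w_pos[of j] by (auto simp: set_pmf_iff)
  ultimately have "y \<in> set_pmf (kernel x)" by (auto simp: kernel_def)
  then show ?thesis by (rule pmf_positive)
qed

end

section \<open>Chain properties of the observable and characteristic functions of its sums\<close>

context hierarchy_chain
begin

lemma prob_val_cylinder: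
  fixes val :: "int \<Rightarrow> real"
  assumes "inj val"
  shows "prob {\<omega> \<in> space M. \<forall>k\<in>{a..a + int m}. val (Z k \<omega>) = val (s k)} = path_weight s a m"
  using prob_cylinder[of a m s] by (simp add: inj_eq[OF assms])

lemma path_weight_pos: "path_weight s a n > 0"
  unfolding path_weight_def by (intro mult_pos_pos prod_pos pmf_\<mu>_pos pmf_kernel_pos)

lemma prob_val_two:
  fixes val :: "int \<Rightarrow> real"
  assumes "inj val"
  shows "\<P>(\<omega> in M. val (Z (n + 1) \<omega>) = val y \<bar> val (Z n \<omega>) = val x) = pmf (kernel x) y"
proof -
  define s where "s = (\<lambda>k. if k = n then x else y)"
  have e: "{n..n + int 1} = {n, n + 1}" by auto
  have "prob {\<omega> \<in> space M. val (Z (n + 1) \<omega>) = val y \<and> val (Z n \<omega>) = val x} = path_weight s n 1"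
    unfolding prob_val_cylinder[OF assms, of n 1 s, symmetric] e
    by (intro arg_cong[where f = prob]) (auto simp: s_def)
  also have "\<dots> = pmf \<mu> x * pmf (kernel x) y" by (simp add: path_weight_def s_def)
  finally have 1: "prob {\<omega> \<in> space M. val (Z (n + 1) \<omega>) = val y \<and> val (Z n \<omega>) = val x} = pmf \<mu> x * pmf (kernel x) y" .
  have "prob {\<omega> \<in> space M. val (Z n \<omega>) = val x} = pmf \<mu> x"
    using prob_val_cylinder[OF assms, of n 0 s] by (simp add: s_def path_weight_def)
  then show ?thesis using 1 pmf_\<mu>_pos[of x] by (simp add: cond_prob_def)
qed

lemma markov_chain:
  fixes val :: "int \<Rightarrow> real"
  assumes inj: "inj val"
  shows "countable_state_Markov_chain M (range val) (\<lambda>k \<omega>. val (Z k \<omega>))"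
  unfolding countable_state_Markov_chain_def
proof (intro conjI allI ballI impI)
  show "(\<lambda>\<omega>. val (Z k \<omega>)) \<in> borel_measurable M" for k
    by (rule measurable_compose[OF measurable_Z]) simp
  fix n m s j assume j: "j \<in> range val"
    and pos: "0 < prob {\<omega> \<in> space M. \<forall>k\<in>{n - int m..n}. val (Z k \<omega>) = s k}"
  obtain y where y: "j = val y" using j by blast
  \<comment> \<open>An event of positive probability has a point; its trajectory supplies integer
    states behind the real values \<open>s\<close>, and injectivity of \<open>val\<close> makes them
    unique.\<close>
  have "{\<omega> \<in> space M. \<forall>k\<in>{n - int m..n}. val (Z k \<omega>) = s k} \<noteq> {}"
    using pos by (metis less_irrefl measure_empty)
  then obtain \<omega>0 where \<omega>0: "\<forall>k\<in>{n - int m..n}. val (Z k \<omega>0) = s k" by blast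
  define \<sigma> where "\<sigma> = (\<lambda>k. if k \<le> n then Z k \<omega>0 else y)"
  have ev: "(\<forall>k\<in>{n - int m..n}. val (Z k \<omega>) = s k) \<longleftrightarrow> (\<forall>k\<in>{n - int m..n - int m + int m}. val (Z k \<omega>) = val (\<sigma> k))" for \<omega>
    using \<omega>0 by (auto simp: \<sigma>_def)
  have e: "{n - int m..n - int m + int (Suc m)} = insert (n + 1) {n - int m..n - int m + int m}" by auto
  have "prob {\<omega> \<in> space M. val (Z (n + 1) \<omega>) = j \<and> (\<forall>k\<in>{n - int m..n}. val (Z k \<omega>) = s k)} = path_weight \<sigma> (n - int m) (Suc m)"
    unfolding prob_val_cylinder[OF inj, of "n - int m" "Suc m" \<sigma>, symmetric] ev e y
    by (intro arg_cong[where f = prob]) (auto simp: \<sigma>_def)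
  moreover have "prob {\<omega> \<in> space M. \<forall>k\<in>{n - int m..n}. val (Z k \<omega>) = s k} = path_weight \<sigma> (n - int m) m"
    unfolding ev by (rule prob_val_cylinder[OF inj])
  ultimately have "\<P>(\<omega> in M. val (Z (n + 1) \<omega>) = j \<bar> \<forall>k\<in>{n - int m..n}. val (Z k \<omega>) = s k) = pmf (kernel (\<sigma> n)) y"
    using path_weight_pos[of \<sigma> "n - int m" m] by (simp add: cond_prob_def path_weight_Suc \<sigma>_def)
  moreover have "s n = val (\<sigma> n)" using \<omega>0 by (simp add: \<sigma>_def)
  ultimately show "\<P>(\<omega> in M. val (Z (n + 1) \<omega>) = j \<bar> \<forall>k\<in>{n - int m..n}. val (Z k \<omega>) = s k) =
      \<P>(\<omega> in M. val (Z (n + 1) \<omega>) = j \<bar> val (Z n \<omega>) = s n)"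
    using prob_val_two[OF inj] y by simp
qed (auto intro: prob_space_axioms)

lemma trans_prob_1:
  fixes val :: "int \<Rightarrow> real"
  assumes inj: "inj val"
  shows "trans_prob M (\<lambda>k \<omega>. val (Z k \<omega>)) 1 (val x) (val y) > 0"
  using prob_val_two[OF inj, of 0 y x] pmf_kernel_pos[of x y] by (simp add: trans_prob_def)

lemma irreducible:
  fixes val :: "int \<Rightarrow> real"
  shows "inj val \<Longrightarrow> irreducible_chain M (range val) (\<lambda>k \<omega>. val (Z k \<omega>))"
  unfolding irreducible_chain_def using trans_prob_1 by blast

lemma aperiodic:
  fixes val :: "int \<Rightarrow> real"
  assumes "inj val"
  shows "aperiodic_chain M (range val) (\<lambda>k \<omega>. val (Z k \<omega>))"
  unfolding aperiodic_chain_def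
proof
  fix i assume "i \<in> range val"
  then have "(1::nat) \<in> {n. n \<ge> 1 \<and> trans_prob M (\<lambda>k \<omega>. val (Z k \<omega>)) n i i > 0}"
    using trans_prob_1[OF assms] by auto
  then have "Gcd {n. n \<ge> 1 \<and> trans_prob M (\<lambda>k \<omega>. val (Z k \<omega>)) n i i > 0} dvd 1" by (rule Gcd_dvd)
  then show "Gcd {n. n \<ge> 1 \<and> trans_prob M (\<lambda>k \<omega>. val (Z k \<omega>)) n i i > 0} = 1" by simp
qed

lemma stationary: "strictly_stationary M (\<lambda>k \<omega>. val (Z k \<omega>))"
  unfolding strictly_stationary_def
  using process_law_unique[OF stationary_chain_shift stationary_chain_axioms] by blast

lemma reversible_val: "reversible M (\<lambda>k \<omega>. val (Z k \<omega>))"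
  unfolding reversible_def
  by (rule process_law_unique[OF stationary_chain_reverse stationary_chain_axioms])

lemma char_partial_sum:
  fixes val :: "int \<Rightarrow> real"
  shows "char (distr M borel (\<lambda>\<omega>. partial_sum (\<lambda>k \<omega>. val (Z k \<omega>)) n \<omega> / b)) t =
    (LINT z|measure_pmf \<mu>. (tilt (\<lambda>z. cis (t / b * val z)) ^^ n) (\<lambda>_. 1) z)"
proof -
  have m: "(\<lambda>\<omega>. val (Z k \<omega>)) \<in> borel_measurable M" for k
    by (rule measurable_compose[OF measurable_Z]) simp
  have "char (distr M borel (\<lambda>\<omega>. partial_sum (\<lambda>k \<omega>. val (Z k \<omega>)) n \<omega> / b)) t =
      expectation (\<lambda>\<omega>. iexp (t * (partial_sum (\<lambda>k \<omega>. val (Z k \<omega>)) n \<omega> / b)))"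
    unfolding char_def partial_sum_def using m by (subst integral_distr) auto
  also have "\<dots> = expectation (\<lambda>\<omega>. 1 * (\<Prod>i=1..n. cis (t / b * val (Z (0 + int i) \<omega>))) * 1)"
  proof (intro Bochner_Integration.integral_cong refl)
    fix \<omega>
    have "t * (partial_sum (\<lambda>k \<omega>. val (Z k \<omega>)) n \<omega> / b) = (\<Sum>i=1..n. t / b * val (Z (0 + int i) \<omega>))"
      by (simp add: partial_sum_def sum_distrib_left sum_divide_distrib mult.commute)
    moreover have "iexp (\<Sum>i\<in>I. x i) = (\<Prod>i\<in>I. cis (x i))" if "finite I" for I :: "nat set" and x
      using that by (induction I rule: finite_induct) (auto simp: cis_conv_exp exp_add distrib_left)
    ultimately show "iexp (t * (partial_sum (\<lambda>k \<omega>. val (Z k \<omega>)) n \<omega> / b)) =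
        1 * (\<Prod>i=1..n. cis (t / b * val (Z (0 + int i) \<omega>))) * 1" by (simp only: finite_atLeastAtMost mult_1 mult_1_right)
  qed
  also have "\<dots> = (LINT z|measure_pmf \<mu>. 1 * (tilt (\<lambda>z. cis (t / b * val z)) ^^ n) (\<lambda>_. 1) z)"
    by (rule expectation_product[where f = "\<lambda>_. 1" and h = "\<lambda>_. 1" and B = 1 and B' = 1]) auto
  finally show ?thesis by simp
qed

text \<open>Levels below \<open>k\<close> contribute through their variance only, levels above \<open>k\<close> through the probability of ever
  being visited.\<close>

lemma char_partial_sum_one_level:
  fixes val :: "int \<Rightarrow> real"
  assumes k: "k > 0" and odd: "\<And>z. val (- z) = - val z" and b: "b > 0" and entry: "entry_rate k \<le> 1 / 2"
    and low: "(LINT z|measure_pmf \<mu>. (if lev z < k then val z else 0)\<^sup>2 * toeplitz_sum (\<theta> (lev z)) n) \<le> (b * \<delta>)\<^sup>2" "\<delta> \<ge> 0"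
  shows "norm (char (distr M borel (\<lambda>\<omega>. partial_sum (\<lambda>k \<omega>. val (Z k \<omega>)) n \<omega> / b)) t -
      complex_of_real (1 - entry_rate k * damping (\<theta> k) 1 (t / b * val (int k))) ^ n) \<le>
    \<bar>t\<bar> * \<delta> + 4 * level_prob k + n * (4 * entry_rate k * level_prob k + 4 * measure (measure_pmf \<mu>) (- cell k))"
proof -
  define s where "s = t / b"
  define f where "f = (\<lambda>z. if lev z < k then val z else 0)"
  define y where "y = (\<lambda>z. if lev z = k then val z else 0)"
  define S where "S = (\<lambda>\<omega>. \<Sum>i=1..n. val (Z (int i) \<omega>))"
  define Sf where "Sf = (\<lambda>\<omega>. \<Sum>i=1..n. f (Z (int i) \<omega>))"
  define Sy where "Sy = (\<lambda>\<omega>. \<Sum>i=1..n. y (Z (int i) \<omega>))"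
  define A where "A = {\<omega> \<in> space M. \<exists>i\<in>{1..n}. Z (int i) \<omega> \<in> - cell k}"
  have m: "(\<lambda>\<omega>. h (Z k \<omega>)) \<in> borel_measurable M" for h :: "int \<Rightarrow> real" and k
    by (rule measurable_compose[OF measurable_Z]) simp
  have [measurable]: "S \<in> borel_measurable M" "Sf \<in> borel_measurable M" "Sy \<in> borel_measurable M"
    unfolding S_def Sf_def Sy_def using m by auto
  have Aev [measurable]: "A \<in> events" unfolding A_def by measurable
  have PA: "prob A \<le> n * measure (measure_pmf \<mu>) (- cell k)"
  proof -
    have "A = (\<Union>i\<in>{1..n}. {\<omega> \<in> space M. Z (int i) \<omega> \<in> - cell k})" by (auto simp: A_def)
    then have "prob A \<le> (\<Sum>i=1..n. prob {\<omega> \<in> space M. Z (int i) \<omega> \<in> - cell k})"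
      by (simp only:) (rule finite_measure_subadditive_finite, auto)
    also have "\<dots> = n * measure (measure_pmf \<mu>) (- cell k)" unfolding prob_Z by simp
    finally show ?thesis .
  qed
  have fodd: "f (- z) = - f z" for z by (simp add: f_def odd)
  have fbd: "\<bar>f z\<bar> \<le> Max (insert 0 ((\<lambda>z. \<bar>f z\<bar>) ` cell k))" for z
  proof (rule Max_ge)
    show "\<bar>f z\<bar> \<in> insert 0 ((\<lambda>z. \<bar>f z\<bar>) ` cell k)"
      by (cases "z \<in> cell k") (auto simp: f_def mem_cell_iff)
  qed (simp add: cell_def)
  have Sf2: "expectation (\<lambda>\<omega>. (Sf \<omega>)\<^sup>2) \<le> (b * \<delta>)\<^sup>2"
    using low(1) second_moment_bounded[where f = f, OF fodd fbd, of n] by (simp add: Sf_def f_def)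
  have fsq: "integrable (measure_pmf \<mu>) (\<lambda>z. (f z)\<^sup>2)"
    by (rule integrable_pmf_bounded[where B = "(Max (insert 0 ((\<lambda>z. \<bar>f z\<bar>) ` cell k)))\<^sup>2"])
       (use order_trans[OF fbd abs_ge_self] in \<open>simp add: abs_le_square_iff[symmetric]\<close>)
  have Sfi2: "integrable M (\<lambda>\<omega>. (Sf \<omega>)\<^sup>2)"
    unfolding Sf_def by (rule integrable_square_sum[where f = f, OF fodd fsq])
  have Sfi: "integrable M Sf" by (rule square_integrable_imp_integrable) (use Sfi2 in auto)
  \<comment> \<open>The first absolute moment is bounded by the root of the second, as the variance
    of the absolute value is nonnegative.\<close>
  have Ef: "expectation (\<lambda>\<omega>. \<bar>Sf \<omega>\<bar>) \<le> b * \<delta>"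
  proof -
    have "(expectation (\<lambda>\<omega>. \<bar>Sf \<omega>\<bar>))\<^sup>2 \<le> expectation (\<lambda>\<omega>. (Sf \<omega>)\<^sup>2)"
    proof -
      have "0 \<le> variance (\<lambda>\<omega>. \<bar>Sf \<omega>\<bar>)" by (rule variance_positive)
      also have "\<dots> = expectation (\<lambda>\<omega>. \<bar>Sf \<omega>\<bar>\<^sup>2) - (expectation (\<lambda>\<omega>. \<bar>Sf \<omega>\<bar>))\<^sup>2"
        by (rule variance_eq) (use Sfi Sfi2 in auto)
      finally show ?thesis by simp
    qed
    with Sf2 have "(expectation (\<lambda>\<omega>. \<bar>Sf \<omega>\<bar>))\<^sup>2 \<le> (b * \<delta>)\<^sup>2" by linarith
    then show ?thesis by (rule power2_le_imp_le) (use b low(2) in auto)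
  qed
  \<comment> \<open>Off the event \<open>A\<close> no level above \<open>k\<close> occurs, so the
    sum splits and the phases differ only by that of \<open>Sf\<close>; on \<open>A\<close> the
    trivial bound 2 is used.\<close>
  have pt: "norm (iexp (s * S \<omega>) - iexp (s * Sy \<omega>)) \<le> \<bar>s\<bar> * \<bar>Sf \<omega>\<bar> + 2 * indicator A \<omega>" if "\<omega> \<in> space M" for \<omega>
  proof (cases "\<omega> \<in> A")
    case True
    have "norm (iexp (s * S \<omega>) - iexp (s * Sy \<omega>)) \<le> norm (iexp (s * S \<omega>)) + norm (iexp (s * Sy \<omega>))"
      by (rule norm_triangle_ineq4)
    then have "norm (iexp (s * S \<omega>) - iexp (s * Sy \<omega>)) \<le> 2" by simp
    then show ?thesis using True by (simp add: add_increasing)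
  next
    case False
    then have "val (Z (int i) \<omega>) = f (Z (int i) \<omega>) + y (Z (int i) \<omega>)" if "i \<in> {1..n}" for i
    proof -
      have "lev (Z (int i) \<omega>) \<le> k" using False that \<open>\<omega> \<in> space M\<close> by (auto simp: A_def mem_cell_iff)
      then consider "lev (Z (int i) \<omega>) < k" | "lev (Z (int i) \<omega>) = k" by linarith
      then show ?thesis by cases (simp_all add: f_def y_def)
    qed
    then have "S \<omega> = Sf \<omega> + Sy \<omega>" unfolding S_def Sf_def Sy_def sum.distrib[symmetric] by (intro sum.cong) auto
    then have "iexp (s * S \<omega>) - iexp (s * Sy \<omega>) = iexp (s * Sy \<omega>) * (iexp (s * Sf \<omega>) - 1)"
      by (simp add: exp_add[symmetric] algebra_simps)
    then have "norm (iexp (s * S \<omega>) - iexp (s * Sy \<omega>)) = norm (iexp (s * Sf \<omega>) - 1)" by (simp add: norm_mult)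
    also have "\<dots> \<le> \<bar>s * Sf \<omega>\<bar>" using iexp_approx1[of "s * Sf \<omega>" 0] by simp
    finally show ?thesis using False by (simp add: abs_mult)
  qed
  have int1: "integrable M (\<lambda>\<omega>. iexp (s * T \<omega>))" if "T \<in> borel_measurable M" for T
    using that by (intro integrable_const_bound[where B = 1]) auto
  have "norm (expectation (\<lambda>\<omega>. iexp (s * S \<omega>)) - expectation (\<lambda>\<omega>. iexp (s * Sy \<omega>))) \<le>
      expectation (\<lambda>\<omega>. norm (iexp (s * S \<omega>) - iexp (s * Sy \<omega>)))"
    unfolding Bochner_Integration.integral_diff[OF int1[OF \<open>S \<in> borel_measurable M\<close>] int1[OF \<open>Sy \<in> borel_measurable M\<close>], symmetric]
    by (rule integral_norm_bound)
  also have "\<dots> \<le> expectation (\<lambda>\<omega>. \<bar>s\<bar> * \<bar>Sf \<omega>\<bar> + 2 * indicator A \<omega>)"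
  proof (rule integral_mono)
    show "integrable M (\<lambda>\<omega>. norm (iexp (s * S \<omega>) - iexp (s * Sy \<omega>)))"
      by (intro integrable_norm Bochner_Integration.integrable_diff int1) auto
    show "integrable M (\<lambda>\<omega>. \<bar>s\<bar> * \<bar>Sf \<omega>\<bar> + 2 * indicator A \<omega>)"
      using Sfi Aev by (intro Bochner_Integration.integrable_add integrable_mult_right integrable_abs integrable_real_indicator)
        (auto simp: emeasure_eq_measure)
  qed (rule pt)
  also have "\<dots> = \<bar>s\<bar> * expectation (\<lambda>\<omega>. \<bar>Sf \<omega>\<bar>) + 2 * prob A"
    using Sfi Aev by (subst Bochner_Integration.integral_add)
      (auto intro!: integrable_mult_right integrable_abs integrable_real_indicator simp: emeasure_eq_measure)
  also have "\<dots> \<le> \<bar>s\<bar> * (b * \<delta>) + 2 * (n * measure (measure_pmf \<mu>) (- cell k))"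
    using Ef PA by (intro add_mono mult_left_mono) auto
  also have "\<bar>s\<bar> * (b * \<delta>) = \<bar>t\<bar> * \<delta>" using b by (simp add: s_def abs_divide)
  finally have 1: "norm (expectation (\<lambda>\<omega>. iexp (s * S \<omega>)) - expectation (\<lambda>\<omega>. iexp (s * Sy \<omega>))) \<le>
      \<bar>t\<bar> * \<delta> + 2 * (n * measure (measure_pmf \<mu>) (- cell k))" .
  define u where "u = (\<lambda>z. if z = int k then cis (s * val (int k)) else if z = - int k then cis (- (s * val (int k))) else 1)"
  have uy: "cis (s * y z) = u z" for z
  proof -
    consider "z = int k" | "z = - int k" | "lev z \<noteq> k" by linarith
    then show ?thesis
      using k by cases (auto simp: u_def y_def odd)
  qed
  have e1: "expectation (\<lambda>\<omega>. iexp (s * S \<omega>)) = char (distr M borel (\<lambda>\<omega>. partial_sum (\<lambda>k \<omega>. val (Z k \<omega>)) n \<omega> / b)) t"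
    unfolding char_def partial_sum_def using m by (subst integral_distr) (auto simp: S_def s_def)
  have e2: "expectation (\<lambda>\<omega>. iexp (s * Sy \<omega>)) = (LINT z|measure_pmf \<mu>. (tilt u ^^ n) (\<lambda>_. 1) z)"
  proof -
    have "expectation (\<lambda>\<omega>. iexp (s * Sy \<omega>)) = char (distr M borel (\<lambda>\<omega>. partial_sum (\<lambda>k \<omega>. y (Z k \<omega>)) n \<omega> / 1)) s"
      unfolding char_def partial_sum_def using m by (subst integral_distr) (auto simp: Sy_def)
    then show ?thesis unfolding char_partial_sum by (simp add: uy)
  qed
  have 2: "norm ((LINT z|measure_pmf \<mu>. (tilt u ^^ n) (\<lambda>_. 1) z) - complex_of_real (1 - entry_rate k * damping (\<theta> k) 1 (s * val (int k))) ^ n)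
      \<le> 4 * level_prob k + n * (4 * entry_rate k * level_prob k + 2 * measure (measure_pmf \<mu>) (- cell k))"
    unfolding u_def by (rule compound_poisson_approximation[OF k entry])
  note norm_diff_triangle_le[OF 1[unfolded e1 e2] 2]
  also have "\<bar>t\<bar> * \<delta> + 2 * (n * measure (measure_pmf \<mu>) (- cell k)) +
      (4 * level_prob k + n * (4 * entry_rate k * level_prob k + 2 * measure (measure_pmf \<mu>) (- cell k))) =
      \<bar>t\<bar> * \<delta> + 4 * level_prob k + n * (4 * entry_rate k * level_prob k + 4 * measure (measure_pmf \<mu>) (- cell k))"
    by (simp add: algebra_simps)
  finally show ?thesis unfolding s_def .
qed

end

section \<open>Choice of the scales\<close>

lemma pmf_embed_nat:
  fixes f :: "nat \<Rightarrow> real"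
  assumes "\<And>k. 0 \<le> f k" "f sums 1"
  shows "pmf (embed_pmf f) k = f k"
proof (rule pmf_embed_pmf)
  have "(\<integral>\<^sup>+x. ennreal (f x) \<partial>count_space UNIV) = (\<Sum>k. ennreal (f k))"
    by (rule nn_integral_count_space_nat)
  also have "\<dots> = ennreal (\<Sum>k. f k)"
    using assms by (intro suminf_ennreal2) (auto simp: sums_iff)
  finally show "(\<integral>\<^sup>+x. ennreal (f x) \<partial>count_space UNIV) = 1" using assms by (simp add: sums_iff)
qed (rule assms)

lemma
  fixes F :: "nat \<Rightarrow> real"
  assumes "summable (\<lambda>k. pmf q k * \<bar>F k\<bar>)"
  shows integrable_pmf_nat: "integrable (measure_pmf q) F"
    and integral_pmf_nat: "integral\<^sup>L (measure_pmf q) F = (\<Sum>k. pmf q k * F k)"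
proof -
  have i: "integrable (count_space UNIV) (\<lambda>k. pmf q k *\<^sub>R F k)"
    using assms by (simp add: integrable_count_space_nat_iff abs_mult)
  show "integrable (measure_pmf q) F"
    unfolding measure_pmf_eq_density[of q] using i by (subst integrable_density) auto
  have "integral\<^sup>L (measure_pmf q) F = (LINT k|count_space UNIV. pmf q k *\<^sub>R F k)"
    unfolding measure_pmf_eq_density[of q] by (subst integral_density) auto
  also have "\<dots> = (\<Sum>k. pmf q k *\<^sub>R F k)" by (rule integral_count_space_nat[OF i])
  finally show "integral\<^sup>L (measure_pmf q) F = (\<Sum>k. pmf q k * F k)" by simp
qed

text \<open>Level \<open>k\<close> has stationary probability \<open>mass k\<close> and mean holding time \<open>L k\<close>; its contribution to
  \<open>Var S\<^sub>n / n\<close> grows linearly in \<open>n\<close> and saturates near \<open>2 * height k\<close> once \<open>n\<close> exceeds \<open>L k\<close>.\<close>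

locale scales =
  fixes p :: real and g :: "real \<Rightarrow> real" and L :: "nat \<Rightarrow> nat" and T :: "nat \<Rightarrow> real"
    and coef height mass :: "nat \<Rightarrow> real"
  defines "coef \<equiv> (\<lambda>k. (1 / 2) ^ k / (4 * p powr p))"
    and "height \<equiv> (\<lambda>k. 2 ^ (k\<^sup>2))"
    and "mass \<equiv> (\<lambda>k. coef k * real (L k) powr - p)"
  assumes p: "1 < p" and g_ge: "\<And>x. 1 \<le> x \<Longrightarrow> 1 \<le> g x"
    and g_T: "\<And>k x. T k \<le> x \<Longrightarrow> 1 + (\<Sum>i=1..k. height i / coef i) \<le> g x"
    and L_0: "L 0 = 1"
    and L_Suc: "\<And>k. 2 * L k \<le> L (Suc k)"
    and L_T: "\<And>k. 2 ^ Suc k * T (Suc k) * height (Suc k) \<le> real (L (Suc k))"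
    and L_mass: "\<And>k. 2 ^ k * (real (L k) / mass k) \<le> real (L (Suc k))"
    and L_height: "\<And>k. 2 ^ Suc k * height (Suc k) * real (L k) \<le> real (L (Suc k))"

text \<open>Neither \<open>coef\<close> nor \<open>height\<close> refers to \<open>L\<close>, so the
  thresholds \<open>T\<close> come from \<open>g\<close> alone; all conditions on \<open>L\<close>
  are then lower bounds on \<open>L (Suc k)\<close> in terms of \<open>L k\<close>. The one with
  \<open>T\<close> hides a level in the variance until \<open>g\<close> is large, the one with
  \<open>mass\<close> hides it during the active time of the level below, and the one with
  \<open>height\<close> makes its variance slope negligible against that of the level below.\<close>

lemma ex_scales:
  fixes p :: real and g :: "real \<Rightarrow> real"
  assumes p: "1 < p" and g: "\<And>x. 1 \<le> x \<Longrightarrow> 1 \<le> g x" and lim: "filterlim g at_top at_top"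
  shows "\<exists>L T. scales p g L T"
proof -
  define c where "c = (\<lambda>k::nat. (1 / 2) ^ k / (4 * p powr p))"
  define h where "h = (\<lambda>k::nat. 2 ^ (k\<^sup>2) :: real)"
  have "\<exists>t. \<forall>x\<ge>t. r \<le> g x" for r
    using lim unfolding filterlim_at_top eventually_at_top_linorder by blast
  then obtain t where t: "\<And>r x. t r \<le> x \<Longrightarrow> r \<le> g x" by metis
  define T where "T = (\<lambda>k. t (1 + (\<Sum>i=1..k. h i / c i)))"
  define Q where "Q = (\<lambda>k l l'. 2 * l \<le> l' \<and> 2 ^ Suc k * T (Suc k) * h (Suc k) \<le> real l' \<and>
      2 ^ k * (real l / (c k * real l powr - p)) \<le> real l' \<and> 2 ^ Suc k * h (Suc k) * real l \<le> real l')"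
  have "\<exists>L. \<forall>k. (k = 0 \<longrightarrow> L k = 1) \<and> Q k (L k) (L (Suc k))"
  proof (rule dependent_nat_choice)
    show "\<exists>l'. (Suc k = 0 \<longrightarrow> l' = 1) \<and> Q k l l'" for k l :: nat
    proof -
      define M where "M = Max {real (2 * l), 2 ^ Suc k * T (Suc k) * h (Suc k), 2 ^ k * (real l / (c k * real l powr - p)), 2 ^ Suc k * h (Suc k) * real l}"
      have "y \<le> real (nat \<lceil>M\<rceil>)" if "y \<in> {real (2 * l), 2 ^ Suc k * T (Suc k) * h (Suc k), 2 ^ k * (real l / (c k * real l powr - p)), 2 ^ Suc k * h (Suc k) * real l}" for y
      proof -
        have "y \<le> M" unfolding M_def using that by (intro Max_ge) auto
        then show ?thesis using real_nat_ceiling_ge[of M] by linarith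
      qed
      then have "Q k l (nat \<lceil>M\<rceil>)" unfolding Q_def by (intro conjI) (force simp flip: of_nat_le_iff[where 'a = real])+
      then show ?thesis by blast
    qed
  qed auto
  then obtain L where L: "L 0 = 1" "\<And>k. Q k (L k) (L (Suc k))" by blast
  have "scales p g L T"
  proof
    show "1 + (\<Sum>i=1..k. 2 ^ i\<^sup>2 / ((1 / 2) ^ i / (4 * p powr p))) \<le> g x" if "T k \<le> x" for k x
      using t that unfolding T_def c_def h_def by blast
  qed (use p g L in \<open>simp_all add: Q_def T_def c_def h_def\<close>)
  then show ?thesis by blast
qed

section \<open>Level masses, the stationary law and the observable\<close>

context scales
begin

lemma coef_pos: "coef k > 0" using p by (simp add: coef_def)

lemma powr_p_ge_1: "p powr p \<ge> 1" using p by (intro ge_one_powr_ge_zero) auto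

lemma coef_le: "coef k \<le> (1 / 2) ^ k / 4"
  unfolding coef_def using powr_p_ge_1 by (intro divide_left_mono) auto

lemma coef_le_1: "coef k \<le> 1"
proof -
  have "(1 / 2) ^ k \<le> (1 :: real)" by (intro power_le_one) auto
  then show ?thesis using coef_le[of k] by linarith
qed

lemma height_ge_1: "height k \<ge> 1" by (simp add: height_def)

lemma height_le_height_div_coef: "2 * height k \<le> height k / coef k"
proof -
  have "(1 / 2) ^ k \<le> (1 :: real)" by (intro power_le_one) auto
  then have "coef k \<le> 1 / 2" using coef_le[of k] by linarith
  then have "coef k * (2 * height k) \<le> 1 / 2 * (2 * height k)" using height_ge_1[of k] by (intro mult_right_mono) auto
  then show ?thesis using coef_pos[of k] by (simp add: le_divide_eq mult.commute)
qed

lemma L_ge: "2 ^ k \<le> L k"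
proof (induction k)
  case (Suc k)
  then show ?case using L_Suc[of k] by simp
qed (simp add: L_0)

lemma L_ge_real: "2 ^ k \<le> real (L k)"
proof -
  have "real (2 ^ k) \<le> real (L k)" using L_ge[of k] by (simp only: of_nat_le_iff)
  then show ?thesis by simp
qed

lemma L_ge_1: "1 \<le> real (L k)"
  using L_ge_real[of k] one_le_power[of "2::real" k] by linarith

lemma L_mono: "i \<le> j \<Longrightarrow> L i \<le> L j"
proof (rule lift_Suc_mono_le[of L])
  show "L n \<le> L (Suc n)" for n using L_Suc[of n] by linarith
qed

lemma mass_pos: "mass k > 0"
  unfolding mass_def using coef_pos L_ge_1[of k] by (intro mult_pos_pos) auto

lemma mass_le: "mass k \<le> coef k / real (L k)"
proof -
  have "real (L k) powr - p \<le> real (L k) powr - 1" using L_ge_1[of k] p by (intro powr_mono) auto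
  then have "mass k \<le> coef k * real (L k) powr - 1" unfolding mass_def using coef_pos[of k] by (intro mult_left_mono) auto
  then show ?thesis using L_ge_1[of k] by (simp add: powr_minus divide_inverse)
qed

lemma mass_le_coef: "mass k \<le> coef k"
proof -
  have "coef k / real (L k) \<le> coef k / 1"
    using L_ge_1[of k] coef_pos[of k] by (intro divide_left_mono) auto
  then show ?thesis using mass_le[of k] by simp
qed

lemma mass_Suc_le: "mass (Suc k) \<le> mass k / 2"
proof -
  have "real (L (Suc k)) powr - p \<le> real (L k) powr - p"
    using L_mono[of k "Suc k"] L_ge_1[of k] p by (intro powr_mono2') auto
  then have "mass (Suc k) \<le> coef (Suc k) * real (L k) powr - p"
    unfolding mass_def using coef_pos[of "Suc k"] by (intro mult_left_mono) auto
  then show ?thesis by (simp add: mass_def coef_def)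
qed

lemma mass_add_le: "mass (k + i) \<le> mass k * (1 / 2) ^ i"
proof (induction i)
  case (Suc i)
  then show ?case using mass_Suc_le[of "k + i"] by simp
qed simp

lemma summable_mass: "summable (\<lambda>i. mass (k + i))"
  by (rule summable_comparison_test'[where g = "\<lambda>i. mass k * (1 / 2) ^ i"])
     (use mass_add_le mass_pos in \<open>auto simp: less_imp_le intro!: summable_mult summable_geometric\<close>)

lemma suminf_mass_le: "(\<Sum>i. mass (k + i)) \<le> 2 * mass k"
proof -
  have "(\<Sum>i. mass (k + i)) \<le> (\<Sum>i. mass k * (1 / 2) ^ i)"
    by (intro suminf_le mass_add_le summable_mass summable_mult summable_geometric) auto
  also have "\<dots> = 2 * mass k" by (simp add: suminf_mult summable_geometric suminf_geometric)
  finally show ?thesis .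
qed

text \<open>\<open>nu k\<close> is, up to a factor tending to \<open>1\<close>, the rate of entering level \<open>k\<close>.\<close>

definition nu :: "nat \<Rightarrow> real" where
  "nu k = mass k / real (L k)"

lemma nu_pos: "nu k > 0" unfolding nu_def using mass_pos L_ge_1[of k] by (intro divide_pos_pos) auto

text \<open>Over \<open>1 / nu k\<close> steps, the natural time of level \<open>k\<close>, the
  expected time spent on level \<open>k + 1\<close> is at most \<open>(1 / 2) ^ k\<close>.\<close>

lemma mass_Suc_le_nu: "mass (Suc k) \<le> (1 / 2) ^ k * nu k"
proof -
  have "mass (Suc k) \<le> 1 / real (L (Suc k))"
    by (rule order_trans[OF mass_le]) (intro divide_right_mono coef_le_1, simp)
  also have "\<dots> \<le> 1 / (2 ^ k * (real (L k) / mass k))"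
    using L_mass[of k] L_ge_1[of k] mass_pos[of k] L_ge_1[of "Suc k"] by (intro divide_left_mono mult_pos_pos) auto
  also have "\<dots> = (1 / 2) ^ k * nu k" by (simp add: nu_def power_one_over)
  finally show ?thesis .
qed

lemma nu_le_mass: "nu k \<le> mass k"
  unfolding nu_def using mass_pos[of k] L_ge_1[of k] by (simp add: divide_le_eq mult_left_le less_imp_le)

lemma nu_Suc_le: "nu (Suc k) \<le> (1 / 2) ^ k * nu k"
  using nu_le_mass[of "Suc k"] mass_Suc_le_nu[of k] by linarith

text \<open>Level 0, where the observable vanishes, takes up the remaining probability.\<close>

definition level_weight :: "nat \<Rightarrow> real" where
  "level_weight k = (if k = 0 then 1 - (\<Sum>i. mass (1 + i)) else mass k)"

lemma level_weight_0_ge: "1 / 2 \<le> level_weight 0"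
proof -
  have "mass 1 \<le> 1 / 8" using mass_le_coef[of 1] coef_le[of 1] by simp
  then show ?thesis using suminf_mass_le[of 1] by (simp add: level_weight_def)
qed

lemma level_weight_pos: "level_weight k > 0"
  using level_weight_0_ge mass_pos[of k] by (cases "k = 0") (auto simp: level_weight_def)

lemma level_weight_sums: "level_weight sums 1"
proof -
  have "(\<lambda>i. level_weight (Suc i)) sums (\<Sum>i. mass (1 + i))"
    using summable_mass[of 1] by (simp add: level_weight_def summable_sums)
  then show ?thesis by (subst (asm) sums_Suc_iff) (simp add: level_weight_def)
qed

definition level_law :: "nat pmf" where
  "level_law = embed_pmf level_weight"

lemma pmf_level_law: "pmf level_law k = level_weight k"
  unfolding level_law_def by (rule pmf_embed_nat) (use level_weight_pos level_weight_sums in \<open>auto simp: less_imp_le\<close>)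

text \<open>Differences of \<open>1 / L\<close>, so that the probability of drawing a level at least
  \<open>k\<close> telescopes to \<open>1 / L k\<close>: a state of level \<open>k\<close> is held
  for \<open>L k\<close> steps on average.\<close>

definition refresh_law :: "nat pmf" where
  "refresh_law = embed_pmf (\<lambda>j. 1 / real (L j) - 1 / real (L (Suc j)))"

lemma L_at_top: "(\<lambda>k. 1 / real (L k)) \<longlonglongrightarrow> 0"
proof (rule tendsto_sandwich[of "\<lambda>_. 0"])
  show "(\<lambda>k. (1 / 2) ^ k :: real) \<longlonglongrightarrow> 0" by (rule LIMSEQ_power_zero) auto
  show "\<forall>\<^sub>F k in sequentially. 1 / real (L k) \<le> (1 / 2) ^ k"
  proof (intro always_eventually allI)
    fix k show "1 / real (L k) \<le> (1 / 2) ^ k"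
      using L_ge_real[of k] L_ge_1[of k] by (simp add: power_one_over frac_le)
  qed
qed auto

lemma pmf_refresh_law: "pmf refresh_law j = 1 / real (L j) - 1 / real (L (Suc j))"
  unfolding refresh_law_def
proof (rule pmf_embed_nat)
  show "0 \<le> 1 / real (L k) - 1 / real (L (Suc k))" for k
    using L_mono[of k "Suc k"] L_ge_1[of k] by (simp add: frac_le)
  show "(\<lambda>j. 1 / real (L j) - 1 / real (L (Suc j))) sums 1"
    using telescope_sums'[OF L_at_top] by (simp add: L_0)
qed

lemma pmf_refresh_law_pos: "pmf refresh_law j > 0"
proof -
  have "real (L j) < real (L (Suc j))" using L_Suc[of j] L_ge_1[of j] by linarith
  then show ?thesis unfolding pmf_refresh_law using L_ge_1[of j] by (simp add: frac_less2)
qed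

definition state_law :: "int pmf" where
  "state_law = map_pmf (\<lambda>(k, b). if b then int k else - int k) (pair_pmf level_law (bernoulli_pmf (1 / 2)))"

lemma level_of_state_law: "map_pmf (\<lambda>z. nat \<bar>z\<bar>) state_law = level_law"
proof -
  have "map_pmf (\<lambda>z. nat \<bar>z\<bar>) state_law = map_pmf fst (pair_pmf level_law (bernoulli_pmf (1 / 2)))"
    unfolding state_law_def map_pmf_comp by (rule map_pmf_cong) auto
  then show ?thesis by (simp add: map_fst_pair_pmf)
qed

lemma pmf_state_law: "pmf state_law z = (if z = 0 then level_weight 0 else level_weight (nat \<bar>z\<bar>) / 2)"
proof -
  define h where "h = (\<lambda>(k, b). if b then int k else - int k)"
  have "pmf state_law z = measure (measure_pmf (pair_pmf level_law (bernoulli_pmf (1 / 2)))) (h -` {z})"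
    unfolding state_law_def h_def[symmetric] by (rule pmf_map)
  also have "h -` {z} = (if z = 0 then {(0, True), (0, False)} else {(nat \<bar>z\<bar>, z > 0)})"
    by (auto simp: h_def split: if_splits)
  also have "measure (measure_pmf (pair_pmf level_law (bernoulli_pmf (1 / 2)))) \<dots> =
      (if z = 0 then level_weight 0 else level_weight (nat \<bar>z\<bar>) / 2)"
    by (auto simp: measure_measure_pmf_finite pmf_pair pmf_level_law measure_pmf_single)
  finally show ?thesis .
qed

sublocale hierarchy state_law refresh_law
proof
  show "pmf state_law z > 0" for z using level_weight_pos by (simp add: pmf_state_law)
qed (simp_all add: pmf_state_law pmf_refresh_law_pos)

lemma \<theta>_eq: "\<theta> k = 1 - 1 / real (L k)"
proof -
  have "\<theta> k = (\<Sum>j<k. 1 / real (L j) - 1 / real (L (Suc j)))"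
    unfolding \<theta>_def by (simp add: measure_measure_pmf_finite pmf_refresh_law)
  also have "\<dots> = 1 - 1 / real (L k)"
    by (subst sum_lessThan_telescope') (simp add: L_0)
  finally show ?thesis .
qed

lemma measure_state_law: "measure (measure_pmf state_law) {z. lev z \<in> A} = measure (measure_pmf level_law) A"
  unfolding level_of_state_law[symmetric] by (simp add: vimage_def)

lemma level_prob_eq_weight: "level_prob k = level_weight k"
  using measure_state_law[of "{k}"] by (simp add: level_prob_def pmf_level_law measure_pmf_single)

lemma level_prob_eq_mass: "k > 0 \<Longrightarrow> level_prob k = mass k"
  by (simp add: level_prob_eq_weight level_weight_def)

lemma
  fixes F :: "nat \<Rightarrow> real"
  assumes "summable (\<lambda>k. level_weight k * \<bar>F k\<bar>)"
  shows integrable_level: "integrable (measure_pmf state_law) (\<lambda>z. F (lev z))"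
    and integral_level: "(LINT z|measure_pmf state_law. F (lev z)) = (\<Sum>k. level_weight k * F k)"
proof -
  have s: "summable (\<lambda>k. pmf level_law k * \<bar>F k\<bar>)" using assms by (simp add: pmf_level_law)
  have "integrable (measure_pmf (map_pmf lev state_law)) F" unfolding level_of_state_law by (rule integrable_pmf_nat[OF s])
  then show "integrable (measure_pmf state_law) (\<lambda>z. F (lev z))" by simp
  have "(LINT z|measure_pmf state_law. F (lev z)) = integral\<^sup>L (measure_pmf (map_pmf lev state_law)) F" by simp
  also have "\<dots> = (\<Sum>k. level_weight k * F k)"
    unfolding level_of_state_law integral_pmf_nat[OF s] by (simp add: pmf_level_law)
  finally show "(LINT z|measure_pmf state_law. F (lev z)) = (\<Sum>k. level_weight k * F k)" .
qed

lemma measure_level_ge: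
  assumes "k > 0"
  shows "measure (measure_pmf state_law) {z. k \<le> lev z} = (\<Sum>i. mass (k + i))"
proof -
  have "summable level_weight" using level_weight_sums by (simp add: sums_iff)
  then have s: "summable (\<lambda>i. level_weight i * \<bar>indicator {k..} i\<bar>)"
    by (rule summable_comparison_test'[where N = 0]) (auto simp: indicator_def less_imp_le[OF level_weight_pos])
  have "measure (measure_pmf state_law) {z. k \<le> lev z} = (LINT z|measure_pmf state_law. indicator {k..} (lev z))"
  proof -
    have "(\<lambda>z. indicator {k..} (lev z) :: real) = indicator {z. k \<le> lev z}" by (auto simp: indicator_def)
    then show ?thesis by simp
  qed
  also have "\<dots> = (\<Sum>i. level_weight i * indicator {k..} i)" by (rule integral_level[OF s])
  also have "\<dots> = (\<Sum>i. level_weight (i + k) * indicator {k..} (i + k)) + (\<Sum>i<k. level_weight i * indicator {k..} i)"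
    using s by (intro suminf_split_initial_segment) (simp add: indicator_def)
  also have "\<dots> = (\<Sum>i. mass (k + i))"
    using assms by (simp add: indicator_def level_weight_def add.commute)
  finally show ?thesis .
qed

lemma measure_level_ge_le: "k > 0 \<Longrightarrow> measure (measure_pmf state_law) {z. k \<le> lev z} \<le> 2 * mass k"
  using measure_level_ge[of k] suminf_mass_le[of k] by simp

lemma measure_Compl_cell_le: "measure (measure_pmf state_law) (- cell k) \<le> 2 * mass (Suc k)"
proof -
  have "- cell k = {z. Suc k \<le> lev z}" by (auto simp: mem_cell_iff)
  then show ?thesis using measure_level_ge_le[of "Suc k"] by simp
qed

lemma cell_prob_ge: "1 - 2 * mass (Suc k) \<le> cell_prob k"
  using measure_Compl_cell_le[of k] measure_pmf.prob_compl[of "cell k" state_law]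
  by (simp add: cell_prob_def Compl_eq_Diff_UNIV)

lemma mass_le_eighth: "k > 0 \<Longrightarrow> mass k \<le> 1 / 8"
proof -
  assume "k > 0"
  then have "(1 / 2) ^ k \<le> (1 / 2 :: real) ^ 1" by (intro power_decreasing) auto
  then have "(1 / 2) ^ k \<le> (1 / 2 :: real)" by (simp only: power_one_right)
  then show ?thesis using mass_le_coef[of k] coef_le[of k] by linarith
qed

lemma cell_prob_ge_half: "1 / 2 \<le> cell_prob k"
  using cell_prob_ge[of k] mass_le_eighth[of "Suc k"] by simp

text \<open>Chosen so that \<open>amp ^ 2 * mass\<close>, the variance carried by level
  \<open>k\<close>, times the holding time \<open>L k\<close> is \<open>height k\<close>. The value
  0 at level 0 is forced by oddness.\<close>

definition amp :: "nat \<Rightarrow> real" where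
  "amp k = (if k = 0 then 0 else sqrt (height k / (real (L k) * mass k)))"

definition val :: "int \<Rightarrow> real" where
  "val z = (if z \<ge> 0 then amp (lev z) else - amp (lev z))"

lemma amp_sq: "k > 0 \<Longrightarrow> (amp k)\<^sup>2 = height k / (real (L k) * mass k)"
  unfolding amp_def using height_ge_1[of k] mass_pos[of k] L_ge_1[of k] by simp

lemma amp_sq_mass: "k > 0 \<Longrightarrow> (amp k)\<^sup>2 * mass k = height k / real (L k)"
  using mass_pos[of k] L_ge_1[of k] by (simp add: amp_sq)

text \<open>This product is \<open>coef k * L k powr (1 - p)\<close>, decreasing because
  \<open>p > 1\<close>. Hence the amplitudes increase strictly and \<open>val\<close> is injective,
  so the observed process inherits the Markov property of \<open>Z\<close>.\<close>

lemma L_mass_antimono: "real (L (Suc k)) * mass (Suc k) \<le> real (L k) * mass k"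
proof -
  have e: "real (L k) * mass k = coef k * real (L k) powr (1 - p)" for k
    using L_ge_1[of k] by (simp add: mass_def powr_diff powr_minus divide_inverse)
  have "real (L (Suc k)) powr (1 - p) \<le> real (L k) powr (1 - p)"
    using L_mono[of k "Suc k"] L_ge_1[of k] p by (intro powr_mono2') auto
  moreover have "coef (Suc k) \<le> coef k"
  proof -
    have "coef (Suc k) = coef k / 2" by (simp add: coef_def)
    then show ?thesis using coef_pos[of k] by simp
  qed
  ultimately show ?thesis unfolding e using coef_pos[of k] by (intro mult_mono) auto
qed

lemma amp_Suc_less: "amp k < amp (Suc k)"
proof -
  have pos: "height i / (real (L i) * mass i) > 0" for i
    using height_ge_1[of i] mass_pos[of i] L_ge_1[of i] by (intro divide_pos_pos mult_pos_pos) auto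
  have "height k < height (Suc k)" unfolding height_def by (intro power_strict_increasing power_strict_mono) auto
  then have "height k / (real (L k) * mass k) < height (Suc k) / (real (L (Suc k)) * mass (Suc k))"
    using L_mass_antimono[of k] height_ge_1[of k] mass_pos[of k] mass_pos[of "Suc k"] L_ge_1[of k] L_ge_1[of "Suc k"]
    by (intro frac_less mult_pos_pos) auto
  then show ?thesis using pos[of "Suc k"] by (auto simp: amp_def)
qed

lemma strict_mono_amp: "strict_mono amp"
  by (rule strict_mono_Suc_iff[THEN iffD2]) (simp add: amp_Suc_less)

lemma amp_nonneg: "0 \<le> amp k"
  using strict_mono_less_eq[OF strict_mono_amp, of 0 k] by (simp add: amp_def)

lemma amp_pos: "k > 0 \<Longrightarrow> 0 < amp k"
  using strict_monoD[OF strict_mono_amp, of 0 k] by (simp add: amp_def)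

lemma val_odd: "val (- z) = - val z"
  by (auto simp: val_def amp_def)

lemma abs_val: "\<bar>val z\<bar> = amp (lev z)"
  using amp_nonneg by (simp add: val_def)

lemma val_sq: "(val z)\<^sup>2 = (amp (lev z))\<^sup>2"
  by (simp add: val_def)

lemma inj_val: "inj val"
proof (rule injI)
  fix x y assume eq: "val x = val y"
  then have "amp (lev x) = amp (lev y)" by (simp flip: abs_val)
  then have l: "lev x = lev y" by (simp add: strict_mono_eq[OF strict_mono_amp])
  show "x = y"
  proof (rule ccontr)
    assume "x \<noteq> y"
    then have "y = - x" "x \<noteq> 0" using l by linarith+
    then have "val x = 0" using eq val_odd[of x] by simp
    then have "amp (lev x) = 0" using abs_val[of x] by simp
    then show False using amp_pos[of "lev x"] \<open>x \<noteq> 0\<close> by auto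
  qed
qed

text \<open>One majorant for two quantities: the share of level \<open>k\<close> in the variance per
  step, and \<open>x\<close> times its share in the quantile integral. Its cap is
  \<open>height k / coef k\<close> instead of \<open>2 * height k\<close> because the quantile part
  reaches that size. A single comparison with \<open>g\<close> then serves both claims.\<close>

definition envelope :: "nat \<Rightarrow> real \<Rightarrow> real" where
  "envelope k x = (if k = 0 then 0 else min (x * height k / real (L k)) (height k / coef k))"

lemma envelope_nonneg: "0 \<le> x \<Longrightarrow> 0 \<le> envelope k x"
  using height_ge_1[of k] coef_pos[of k] by (simp add: envelope_def less_imp_le)

text \<open>Levels beyond their threshold \<open>T\<close> are counted at full height, which
  \<open>g_T\<close> allows for; each remaining level is at most \<open>(1 / 2) ^ k\<close>, and
  together they use up the summand 1 in \<open>g_T\<close>.\<close>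

lemma sum_envelope_le:
  assumes x: "1 \<le> x"
  shows "(\<Sum>k<n. envelope k x) \<le> g x"
proof -
  define A where "A = {k \<in> {1..<n}. T k \<le> x}"
  have small: "envelope k x \<le> (1 / 2) ^ k" if "k > 0" "x < T k" for k
  proof -
    obtain j where k: "k = Suc j" using \<open>k > 0\<close> gr0_implies_Suc by blast
    have "envelope k x \<le> x * height k / real (L k)" using that by (simp add: envelope_def)
    also have "\<dots> \<le> T k * height k / real (L k)"
      using that height_ge_1[of k] L_ge_1[of k] by (intro divide_right_mono mult_right_mono) auto
    also have "\<dots> \<le> (1 / 2) ^ k"
      using L_T[of j] L_ge_1[of k] unfolding k by (simp add: divide_le_eq power_one_over field_simps)
    finally show ?thesis .
  qed
  have half: "(\<Sum>k\<in>B. (1 / 2) ^ k) \<le> (1 :: real)" if "B \<subseteq> {1..<n}" for B :: "nat set"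
  proof -
    have "(\<Sum>k\<in>B. (1 / 2) ^ k) \<le> (\<Sum>k\<in>{1..<n}. (1 / 2 :: real) ^ k)" using that by (intro sum_mono2) auto
    also have "\<dots> \<le> (\<Sum>k<n. (1 / 2) ^ Suc k)"
    proof -
      have "(\<Sum>k\<in>{1..<n}. (1 / 2 :: real) ^ k) = (\<Sum>k<n - 1. (1 / 2) ^ Suc k)"
        by (rule sum.reindex_bij_witness[of _ Suc "\<lambda>k. k - 1"]) auto
      also have "\<dots> \<le> (\<Sum>k<n. (1 / 2) ^ Suc k)" by (intro sum_mono2) auto
      finally show ?thesis .
    qed
    also have "\<dots> \<le> (\<Sum>k. (1 / 2) ^ Suc k)"
      using power_half_series by (intro sum_le_suminf) (auto simp: sums_iff)
    also have "\<dots> = 1" using power_half_series by (simp add: sums_iff)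
    finally show ?thesis .
  qed
  \<comment> \<open>Nothing makes \<open>T\<close> monotone; all levels up to the largest active one
    are therefore counted at full height, whether active or not.\<close>
  define m where "m = (if A = {} then 0 else Max A)"
  have Am: "k \<le> m" if "k \<in> A" for k
    using that Max_ge[of A k] by (auto simp: m_def A_def)
  have "(\<Sum>k<n. envelope k x) = (\<Sum>k\<in>{1..<n}. envelope k x)"
    by (rule sum.mono_neutral_right) (auto simp: envelope_def)
  also have "\<dots> = (\<Sum>k\<in>{1..<n} \<inter> {..m}. envelope k x) + (\<Sum>k\<in>{1..<n} - {..m}. envelope k x)"
    by (subst sum.union_disjoint[symmetric]) (auto intro!: sum.cong)
  also have "(\<Sum>k\<in>{1..<n} - {..m}. envelope k x) \<le> (\<Sum>k\<in>{1..<n} - {..m}. (1 / 2) ^ k)"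
    using Am by (intro sum_mono small) (auto simp: A_def not_le[symmetric])
  also have "\<dots> \<le> 1" by (rule half) auto
  also have "(\<Sum>k\<in>{1..<n} \<inter> {..m}. envelope k x) + 1 \<le> g x"
  proof (cases "A = {}")
    case True
    then have e: "{1..<n} \<inter> {..m} = {}" by (auto simp: m_def)
    show ?thesis unfolding e using g_ge[OF x] by simp
  next
    case False
    then have "m \<in> A" using Max_in[of A] by (auto simp: m_def A_def)
    then have "T m \<le> x" by (simp add: A_def)
    have "(\<Sum>k\<in>{1..<n} \<inter> {..m}. envelope k x) \<le> (\<Sum>k\<in>{1..<n} \<inter> {..m}. height k / coef k)"
      by (intro sum_mono) (auto simp: envelope_def)
    also have "\<dots> \<le> (\<Sum>k=1..m. height k / coef k)"
      using height_ge_1 coef_pos by (intro sum_mono2) (auto intro!: divide_nonneg_pos order_trans[OF _ height_ge_1])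
    finally show ?thesis using g_T[OF \<open>T m \<le> x\<close>] by linarith
  qed
  finally show ?thesis by simp
qed

lemma
  assumes "1 \<le> x"
  shows summable_envelope: "summable (\<lambda>k. envelope k x)"
    and suminf_envelope_le: "(\<Sum>k. envelope k x) \<le> g x"
proof -
  show s: "summable (\<lambda>k. envelope k x)"
    by (rule summableI_nonneg_bounded[where x = "g x"]) (use assms envelope_nonneg sum_envelope_le in auto)
  show "(\<Sum>k. envelope k x) \<le> g x"
    using s sum_envelope_le[OF assms] by (intro suminf_le_const) auto
qed

end

section \<open>Variance of the partial sums\<close>

context scales
begin

definition contrib :: "nat \<Rightarrow> nat \<Rightarrow> real" where
  "contrib k n = (if k = 0 then 0 else height k / real (L k) * (toeplitz_sum (\<theta> k) n / real n))"

lemma \<theta>_bounds: "0 \<le> \<theta> k" "\<theta> k < 1"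
  using \<theta>_less_1 by (auto simp: \<theta>_def)

lemma toeplitz_nonneg: "0 \<le> toeplitz_sum (\<theta> k) n"
  unfolding toeplitz_sum_def using \<theta>_bounds by (intro sum_nonneg) auto

lemma contrib_nonneg: "0 \<le> contrib k n"
  using height_ge_1[of k] toeplitz_nonneg[of k n] by (simp add: contrib_def)

lemma contrib_le:
  assumes "toeplitz_sum (\<theta> k) n / real n \<le> c" "k > 0"
  shows "contrib k n \<le> height k / real (L k) * c"
proof -
  have "height k / real (L k) * (toeplitz_sum (\<theta> k) n / real n) \<le> height k / real (L k) * c"
    using assms height_ge_1[of k] by (intro mult_left_mono) auto
  then show ?thesis using assms(2) by (simp only: contrib_def if_False neq0_conv[symmetric])
qed

lemma contrib_le_linear: "k > 0 \<Longrightarrow> contrib k n \<le> height k / real (L k) * real n"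
proof -
  assume k: "k > 0"
  have "toeplitz_sum (\<theta> k) n \<le> (\<Sum>i=1..n. \<Sum>j=1..n. 1)"
    unfolding toeplitz_sum_def using \<theta>_bounds[of k] by (intro sum_mono power_le_one) auto
  then have "toeplitz_sum (\<theta> k) n / real n \<le> real n" by (cases "n = 0") (auto simp: divide_le_eq)
  then show ?thesis using k by (rule contrib_le)
qed

lemma contrib_le_height: "contrib k n \<le> 2 * height k"
proof (cases "k = 0 \<or> n = 0")
  case False
  have "toeplitz_sum (\<theta> k) n \<le> 2 * real n / (1 - \<theta> k)" by (rule toeplitz_sum_le_mult[OF \<theta>_bounds])
  then have "toeplitz_sum (\<theta> k) n / real n \<le> 2 * real (L k)"
    using False L_ge_1[of k] by (simp add: \<theta>_eq divide_le_eq mult_ac)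
  then have "contrib k n \<le> height k / real (L k) * (2 * real (L k))"
    using False by (intro contrib_le) auto
  then show ?thesis using L_ge_1[of k] by simp
qed (use height_ge_1[of k] in \<open>auto simp: contrib_def\<close>)

lemma contrib_le_envelope: "contrib k n \<le> envelope k (real n)"
  using contrib_le_linear[of k n] contrib_le_height[of k n] height_le_height_div_coef[of k]
  by (auto simp: envelope_def contrib_def mult.commute)

lemma summable_contrib: "1 \<le> n \<Longrightarrow> summable (\<lambda>k. contrib k n)"
  by (rule summable_comparison_test'[OF summable_envelope[of "real n"]])
     (auto simp: contrib_nonneg contrib_le_envelope)

lemma weight_contrib: "1 \<le> n \<Longrightarrow> level_weight k * ((amp k)\<^sup>2 * toeplitz_sum (\<theta> k) n) = real n * contrib k n"
proof (cases "k = 0")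
  case False
  assume n: "1 \<le> n"
  have "level_weight k * ((amp k)\<^sup>2 * toeplitz_sum (\<theta> k) n) = ((amp k)\<^sup>2 * mass k) * toeplitz_sum (\<theta> k) n"
    using False by (simp add: level_weight_def)
  then show ?thesis using False n by (simp add: amp_sq_mass contrib_def)
qed (simp add: amp_def contrib_def)

lemma integrable_val_sq: "integrable (measure_pmf state_law) (\<lambda>z. (val z)\<^sup>2)"
  unfolding val_sq
proof (rule integrable_level)
  have "level_weight k * \<bar>(amp k)\<^sup>2\<bar> = contrib k 1" for k
    using weight_contrib[of 1 k] by (simp add: toeplitz_sum_def)
  then show "summable (\<lambda>k. level_weight k * \<bar>(amp k)\<^sup>2\<bar>)" using summable_contrib[of 1] by simp
qed

lemma integral_val_sq_toeplitz:
  assumes "1 \<le> n"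
  shows "(LINT z|measure_pmf state_law. (val z)\<^sup>2 * toeplitz_sum (\<theta> (lev z)) n) = real n * (\<Sum>k. contrib k n)"
proof -
  have "(LINT z|measure_pmf state_law. (val z)\<^sup>2 * toeplitz_sum (\<theta> (lev z)) n) =
      (\<Sum>k. level_weight k * ((amp k)\<^sup>2 * toeplitz_sum (\<theta> k) n))"
    unfolding val_sq
    by (rule integral_level) (use assms in \<open>simp add: abs_mult toeplitz_nonneg weight_contrib summable_contrib summable_mult\<close>)
  then show ?thesis using assms by (simp add: weight_contrib suminf_mult summable_contrib)
qed

lemma height_ratio: "height (Suc k) = height k * 2 ^ (2 * k + 1)"
  by (simp add: height_def power_add[symmetric] power2_eq_square del: power_Suc)

lemma height_mono: "i \<le> j \<Longrightarrow> height i \<le> height j"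
  unfolding height_def by (intro power_increasing power_mono) auto

lemma height_div_L_le: "height (Suc j) / real (L (Suc j)) \<le> (1 / 2) ^ Suc j / real (L j)"
proof -
  have "height (Suc j) * (2 ^ Suc j * real (L j)) \<le> real (L (Suc j))" using L_height[of j] by (simp add: mult_ac)
  then have "height (Suc j) / real (L (Suc j)) \<le> 1 / (2 ^ Suc j * real (L j))"
    using L_ge_1[of j] L_ge_1[of "Suc j"] by (simp add: field_simps del: power_Suc)
  then show ?thesis by (simp add: power_one_over)
qed

section \<open>Normalized variance of the chain\<close>

context
  fixes M :: "'a measure" and Z
  assumes chain: "hierarchy_chain state_law refresh_law M Z"
begin

interpretation C: hierarchy_chain state_law refresh_law M Z by (rule chain)

abbreviation "X \<equiv> \<lambda>k \<omega>. val (Z k \<omega>)"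

lemma integrable_X_sq: "integrable M (\<lambda>\<omega>. (X k \<omega>)\<^sup>2)"
  using integrable_val_sq C.integrable_Z_iff[of "\<lambda>z. (val z)\<^sup>2" k] by simp

lemma measurable_X: "X k \<in> borel_measurable M"
  by (rule measurable_compose[OF C.measurable_Z]) simp

lemma integrable_X: "integrable M (X k)"
  by (rule C.square_integrable_imp_integrable[OF measurable_X]) (rule integrable_X_sq)

lemma expectation_X: "integral\<^sup>L M (X k) = 0"
  using C.expectation_Z[of val k] integral_odd_eq_0[where f = val, OF val_odd] by simp

lemma measurable_partial_sum: "partial_sum X n \<in> borel_measurable M"
  unfolding partial_sum_def[abs_def] using measurable_X by measurable

text \<open>Stated for shifted blocks, by applying the moment formula to the shifted chain; this is
  what the splitting into blocks below needs.\<close>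

lemma integrable_partial_sum_sq: "integrable M (\<lambda>\<omega>. (\<Sum>i=1..n. X (int i + m) \<omega>)\<^sup>2)"
  and expectation_partial_sum_sq: "1 \<le> n \<Longrightarrow> integral\<^sup>L M (\<lambda>\<omega>. (\<Sum>i=1..n. X (int i + m) \<omega>)\<^sup>2) = real n * (\<Sum>k. contrib k n)"
proof -
  interpret S: hierarchy_chain state_law refresh_law M "\<lambda>k. Z (k + m)"
    using C.stationary_chain_shift by (intro hierarchy_chain.intro hierarchy_axioms)
  show "integrable M (\<lambda>\<omega>. (\<Sum>i=1..n. X (int i + m) \<omega>)\<^sup>2)"
    by (rule S.integrable_square_sum[where f = val, OF val_odd integrable_val_sq])
  show "1 \<le> n \<Longrightarrow> integral\<^sup>L M (\<lambda>\<omega>. (\<Sum>i=1..n. X (int i + m) \<omega>)\<^sup>2) = real n * (\<Sum>k. contrib k n)"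
    using S.second_moment[where f = val, OF val_odd integrable_val_sq, of n] by (simp add: integral_val_sq_toeplitz)
qed

lemma expectation_square_eq_variance: "C.variance (partial_sum X n) = integral\<^sup>L M (\<lambda>\<omega>. (partial_sum X n \<omega>)\<^sup>2)"
proof -
  have "integral\<^sup>L M (partial_sum X n) = 0"
    unfolding partial_sum_def[abs_def] using integrable_X expectation_X by simp
  then show ?thesis by simp
qed

lemma normalized_variance_eq: "1 \<le> n \<Longrightarrow> normalized_variance M X n = (\<Sum>k. contrib k n)"
proof -
  assume n: "1 \<le> n"
  have "integral\<^sup>L M (\<lambda>\<omega>. (partial_sum X n \<omega>)\<^sup>2) = real n * (\<Sum>k. contrib k n)"
    using expectation_partial_sum_sq[where n = n and m = 0] n by (simp add: partial_sum_def)
  then show ?thesis using n by (simp only: normalized_variance_def expectation_square_eq_variance) simp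
qed

lemma normalized_variance_le_g: "1 \<le> n \<Longrightarrow> normalized_variance M X n \<le> g (real n)"
proof -
  assume n: "1 \<le> n"
  have "(\<Sum>k. contrib k n) \<le> (\<Sum>k. envelope k (real n))"
    using n by (intro suminf_le contrib_le_envelope summable_contrib summable_envelope) auto
  then show ?thesis using suminf_envelope_le[of "real n"] n by (simp add: normalized_variance_eq)
qed

lemma contrib_le_normalized_variance: "1 \<le> n \<Longrightarrow> contrib k n \<le> normalized_variance M X n"
  using sum_le_suminf[OF summable_contrib, of n "{k}"] contrib_nonneg by (simp add: normalized_variance_eq)

lemma normalized_variance_at_top: "filterlim (\<lambda>n. normalized_variance M X n) at_top sequentially"
  unfolding filterlim_at_top
proof
  fix B :: real
  obtain k where k: "4 * B < 2 ^ k" using real_arch_pow[of 2 "4 * B"] by auto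
  have "(2::real) ^ k \<le> 2 ^ Suc k" by simp
  also have "\<dots> \<le> height (Suc k)" unfolding height_def by (intro power_increasing) (auto simp: power2_eq_square)
  finally have H: "B \<le> height (Suc k) / 4" using k by linarith
  show "\<forall>\<^sub>F n in sequentially. B \<le> normalized_variance M X n"
    unfolding eventually_sequentially
  proof (intro exI allI impI)
    fix n assume n: "L (Suc k) \<le> n"
    have L1: "1 \<le> L (Suc k)" using L_ge_1[of "Suc k"] by simp
    have n1: "1 \<le> n" using n L1 by simp
    have "real n * real (L (Suc k)) / 4 \<le> toeplitz_sum (\<theta> (Suc k)) n"
      unfolding \<theta>_eq by (rule toeplitz_sum_ge_linear[OF L1 n])
    then have "real (L (Suc k)) / 4 \<le> toeplitz_sum (\<theta> (Suc k)) n / real n" using n1 by (simp add: le_divide_eq mult.commute)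
    then have "height (Suc k) / real (L (Suc k)) * (real (L (Suc k)) / 4) \<le> height (Suc k) / real (L (Suc k)) * (toeplitz_sum (\<theta> (Suc k)) n / real n)"
      using height_ge_1[of "Suc k"] by (intro mult_left_mono) auto
    then have "height (Suc k) / real (L (Suc k)) * (real (L (Suc k)) / 4) \<le> contrib (Suc k) n"
      by (simp only: contrib_def nat.simps if_False)
    then have "height (Suc k) / 4 \<le> contrib (Suc k) n" using L1 by simp
    then show "B \<le> normalized_variance M X n" using H contrib_le_normalized_variance[OF n1, of "Suc k"] by linarith
  qed
qed

text \<open>Cut the sum into \<open>N\<close> blocks of length \<open>n\<close> with equal second
  moments; by the Cauchy-Schwarz inequality the second moment grows at most by
  \<open>N ^ 2\<close>.\<close>

lemma normalized_variance_mult_le: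
  assumes "1 \<le> N" "1 \<le> n"
  shows "normalized_variance M X (N * n) \<le> real N * normalized_variance M X n"
proof -
  define B where "B = (\<lambda>b \<omega>. \<Sum>i=1..n. X (int i + int (b * n)) \<omega>)"
  have blocks: "partial_sum X (N * n) \<omega> = (\<Sum>b<N. B b \<omega>)" for \<omega>
  proof (induction N)
    case (Suc N)
    have "partial_sum X (Suc N * n) \<omega> = partial_sum X (N * n) \<omega> + (\<Sum>k=N * n + 1..N * n + n. X (int k) \<omega>)"
      unfolding partial_sum_def by (subst sum.ub_add_nat[of 1 "N * n" _ n, symmetric]) (auto simp: add.commute)
    also have "(\<Sum>k=N * n + 1..N * n + n. X (int k) \<omega>) = B N \<omega>"
      unfolding B_def by (rule sum.reindex_bij_witness[of _ "\<lambda>i. i + N * n" "\<lambda>k. k - N * n"]) (auto simp: add.commute)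
    finally show ?case by (simp add: Suc.IH)
  qed (simp add: partial_sum_def)
  have iB: "integrable M (\<lambda>\<omega>. (B b \<omega>)\<^sup>2)" and eB: "integral\<^sup>L M (\<lambda>\<omega>. (B b \<omega>)\<^sup>2) = real n * normalized_variance M X n" for b
    unfolding B_def using assms integrable_partial_sum_sq[where n = n and m = "int (b * n)"] expectation_partial_sum_sq[where n = n and m = "int (b * n)"]
    by (simp_all add: normalized_variance_eq)
  have "integral\<^sup>L M (\<lambda>\<omega>. (partial_sum X (N * n) \<omega>)\<^sup>2) \<le> integral\<^sup>L M (\<lambda>\<omega>. real N * (\<Sum>b<N. (B b \<omega>)\<^sup>2))"
  proof (rule integral_mono)
    show "integrable M (\<lambda>\<omega>. (partial_sum X (N * n) \<omega>)\<^sup>2)"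
      using integrable_partial_sum_sq[where n = "N * n" and m = 0] by (simp add: partial_sum_def)
    show "(partial_sum X (N * n) \<omega>)\<^sup>2 \<le> real N * (\<Sum>b<N. (B b \<omega>)\<^sup>2)" for \<omega>
      unfolding blocks using Cauchy_Schwarz_ineq_sum[of "\<lambda>b. B b \<omega>" "\<lambda>_. 1" "{..<N}"] by (simp add: mult.commute)
  qed (use iB in auto)
  also have "\<dots> = real N * (real N * (real n * normalized_variance M X n))"
    using iB by (simp add: eB)
  finally have "real (N * n) * normalized_variance M X (N * n) \<le> real N * (real N * (real n * normalized_variance M X n))"
    using assms by (simp add: normalized_variance_def expectation_square_eq_variance)
  then have "(real N * real n) * normalized_variance M X (N * n) \<le> (real N * real n) * (real N * normalized_variance M X n)"
    by (simp add: mult_ac)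
  moreover have "0 < real N * real n" using assms by simp
  ultimately show ?thesis by (simp only: mult_le_cancel_left_pos)
qed

text \<open>From \<open>L k / 2 ^ k\<close> on, the linear bound for level \<open>k\<close> is at
  least \<open>height k / 2 ^ k\<close>, while the saturated lower levels total at most
  \<open>2 * k * height (k - 1)\<close>, smaller by the factor \<open>4 * k / 2 ^ k\<close>. Higher
  levels are bounded linearly, with slopes whose sum is at most \<open>(1 / 2) ^ k\<close> times
  that of level \<open>k\<close>.\<close>

lemma normalized_variance_upper:
  assumes n: "1 \<le> n" "real (L k) / 2 ^ k \<le> real n" and k: "1 \<le> k"
  shows "normalized_variance M X n \<le> real n * (height k / real (L k)) * (1 + 4 * real k / 2 ^ k + (1 / 2) ^ k)"
proof -
  define a where "a = height k / real (L k)"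
  have a: "a > 0" unfolding a_def using height_ge_1[of k] L_ge_1[of k] by (intro divide_pos_pos) auto
  have na: "height k / 2 ^ k \<le> real n * a"
  proof -
    have "real (L k) / 2 ^ k * a \<le> real n * a" using n(2) a by (intro mult_right_mono) auto
    then show ?thesis using L_ge_1[of k] by (simp add: a_def)
  qed
  obtain j where j: "k = Suc j" using k Suc_le_D[of 0 k] by auto
  have "(\<Sum>i<k. contrib i n) \<le> (\<Sum>i<k. 2 * height j)"
    using height_mono[of _ j] j by (intro sum_mono order_trans[OF contrib_le_height]) auto
  also have "\<dots> = 2 * real k * (height k / 2 ^ (2 * j + 1))"
    unfolding j height_ratio by simp
  also have "\<dots> = 4 * real k / 2 ^ k * (height k / 2 ^ k)"
  proof -
    have e: "2 ^ (2 * j + 1) = (2 :: real) ^ k * 2 ^ k / 2" unfolding j mult_2 power_add by simp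
    have "2 * c * (h / (P * P / 2)) = 4 * c / P * (h / P)" for c h P :: real by simp
    then show ?thesis unfolding e .
  qed
  also have "\<dots> \<le> 4 * real k / 2 ^ k * (real n * a)" using na by (intro mult_left_mono) auto
  finally have low: "(\<Sum>i<k. contrib i n) \<le> 4 * real k / 2 ^ k * (real n * a)" .
  have mid: "contrib k n \<le> real n * a" using contrib_le_linear[of k n] k by (simp add: a_def mult.commute)
  have hi: "(\<Sum>i. contrib (i + Suc k) n) \<le> (1 / 2) ^ k * (real n * a)"
  proof -
    have le: "contrib (i + Suc k) n \<le> real n * a * (1 / 2) ^ k * (1 / 2) ^ Suc i" for i
    proof -
      have "contrib (i + Suc k) n \<le> height (Suc (i + k)) / real (L (Suc (i + k))) * real n"
        using contrib_le_linear[of "i + Suc k" n] by simp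
      also have "\<dots> \<le> ((1 / 2) ^ Suc (i + k) / real (L (i + k))) * real n"
        by (intro mult_right_mono height_div_L_le) auto
      also have "\<dots> \<le> ((1 / 2) ^ Suc (i + k) * (height k / real (L k))) * real n"
      proof (intro mult_right_mono)
        have "1 / real (L (i + k)) \<le> height k / real (L k)"
          using height_ge_1[of k] L_mono[of k "i + k"] L_ge_1[of k] by (intro frac_le) auto
        then have "(1 / 2) ^ Suc (i + k) * (1 / real (L (i + k))) \<le> (1 / 2) ^ Suc (i + k) * (height k / real (L k))"
          by (intro mult_left_mono) auto
        then show "(1 / 2) ^ Suc (i + k) / real (L (i + k)) \<le> (1 / 2) ^ Suc (i + k) * (height k / real (L k))" by simp
      qed auto
      also have "\<dots> = real n * a * (1 / 2) ^ k * (1 / 2) ^ Suc i"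
        by (simp add: a_def power_add mult_ac)
      finally show ?thesis .
    qed
    have s: "(\<lambda>i. real n * a * (1 / 2) ^ k * (1 / 2) ^ Suc i) sums (real n * a * (1 / 2) ^ k * 1)"
      by (intro sums_mult power_half_series)
    have "(\<Sum>i. contrib (i + Suc k) n) \<le> (\<Sum>i. real n * a * (1 / 2) ^ k * (1 / 2) ^ Suc i)"
      using summable_contrib[OF n(1)] s by (intro suminf_le le summable_ignore_initial_segment) (auto simp: sums_iff)
    then show ?thesis using s by (simp add: sums_iff mult_ac)
  qed
  have "normalized_variance M X n = (\<Sum>i. contrib (i + Suc k) n) + (\<Sum>i<Suc k. contrib i n)"
    unfolding normalized_variance_eq[OF n(1)] by (rule suminf_split_initial_segment[OF summable_contrib[OF n(1)]])
  also have "\<dots> \<le> (1 / 2) ^ k * (real n * a) + (4 * real k / 2 ^ k * (real n * a) + real n * a)"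
    using low mid hi by simp
  finally show ?thesis by (simp add: a_def algebra_simps)
qed

lemma normalized_variance_lower:
  assumes n: "1 \<le> n" and k: "1 \<le> k"
  shows "real n * (height k / real (L k)) * (1 - real n / real (L k)) \<le> normalized_variance M X n"
proof -
  have "(real n)\<^sup>2 * (1 - real n * (1 - \<theta> k)) \<le> toeplitz_sum (\<theta> k) n"
    using \<theta>_bounds[of k] by (intro toeplitz_sum_ge_square) auto
  then have "real n * (1 - real n / real (L k)) \<le> toeplitz_sum (\<theta> k) n / real n"
    using n by (simp add: \<theta>_eq le_divide_eq power2_eq_square mult_ac)
  then have "height k / real (L k) * (real n * (1 - real n / real (L k))) \<le> height k / real (L k) * (toeplitz_sum (\<theta> k) n / real n)"
    using height_ge_1[of k] by (intro mult_left_mono divide_nonneg_nonneg) auto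
  then have "height k / real (L k) * (real n * (1 - real n / real (L k))) \<le> contrib k n"
    using k by (simp add: contrib_def)
  then show ?thesis using contrib_le_normalized_variance[OF n, of k] by (simp add: mult_ac)
qed

lemma normalized_variance_pos: "1 \<le> n \<Longrightarrow> 0 < normalized_variance M X n"
proof -
  assume n: "1 \<le> n"
  have "(\<Sum>i=1..n. 1) \<le> toeplitz_sum (\<theta> 1) n"
    unfolding toeplitz_sum_def
  proof (rule sum_mono)
    fix i assume "i \<in> {1..n}"
    then have "\<theta> 1 ^ nat \<bar>int i - int i\<bar> \<le> (\<Sum>j=1..n. \<theta> 1 ^ nat \<bar>int i - int j\<bar>)"
      using \<theta>_bounds by (intro member_le_sum) auto
    then show "1 \<le> (\<Sum>j=1..n. \<theta> 1 ^ nat \<bar>int i - int j\<bar>)" by simp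
  qed
  then have "0 < toeplitz_sum (\<theta> 1) n / real n" using n by simp
  then have "0 < height 1 / real (L 1) * (toeplitz_sum (\<theta> 1) n / real n)"
  proof -
    have "0 < height 1 / real (L 1)" using height_ge_1[of 1] L_ge_1[of 1] by (intro divide_pos_pos) auto
    then show ?thesis using \<open>0 < toeplitz_sum (\<theta> 1) n / real n\<close> by (rule mult_pos_pos)
  qed
  then have "0 < contrib 1 n" by (simp only: contrib_def one_neq_zero if_False)
  then show ?thesis using contrib_le_normalized_variance[OF n, of 1] by linarith
qed

text \<open>The block inequality gives the upper bound. For the lower one it suffices to find times
  tending to infinity at which the normalized variance is nearly linear between \<open>n\<close> and
  \<open>N * n\<close>.\<close>

lemma limsup_normalized_variance:
  assumes N: "1 \<le> N"
  shows "limsup (\<lambda>n. ereal (normalized_variance M X (N * n) / normalized_variance M X n)) = ereal (real N)"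
proof (rule antisym)
  define R where "R = (\<lambda>n. normalized_variance M X (N * n) / normalized_variance M X n)"
  have "\<forall>\<^sub>F n in sequentially. ereal (R n) \<le> ereal (real N)"
    unfolding eventually_sequentially
  proof (intro exI allI impI)
    fix n :: nat assume "1 \<le> n"
    then show "ereal (R n) \<le> ereal (real N)"
      using normalized_variance_mult_le[OF N, of n] normalized_variance_pos[of n] by (simp add: R_def divide_le_eq)
  qed
  then show "limsup (\<lambda>n. ereal (R n)) \<le> ereal (real N)" by (rule Limsup_bounded)
  show "ereal (real N) \<le> limsup (\<lambda>n. ereal (R n))"
  proof (rule ccontr)
    assume "\<not> ?thesis"
    then have "limsup (\<lambda>n. ereal (R n)) < ereal (real N)" by simp
    then obtain y where y: "limsup (\<lambda>n. ereal (R n)) < ereal y" "ereal y < ereal (real N)"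
      using ereal_dense2 by blast
    have ev: "\<forall>\<^sub>F n in sequentially. R n < y"
      using Limsup_lessD[OF y(1)] by simp
    \<comment> \<open>At about \<open>L k / 2 ^ k\<close> all lower levels are negligible, while
      both this time and \<open>N\<close> times it are still far below \<open>L k\<close> once
      \<open>k\<close> is large, so level \<open>k\<close> is in its linear regime at both.\<close>
    define m where "m = (\<lambda>k. nat \<lceil>real (L k) / 2 ^ k\<rceil>)"
    have m1: "real (L k) / 2 ^ k \<le> real (m k)" "real (m k) \<le> real (L k) / 2 ^ k + 1" for k
    proof -
      have "0 \<le> real (L k) / 2 ^ k" by simp
      then have "real (m k) = of_int \<lceil>real (L k) / 2 ^ k\<rceil>" unfolding m_def by (simp only: of_nat_nat zero_le_ceiling)
      then show "real (L k) / 2 ^ k \<le> real (m k)" "real (m k) \<le> real (L k) / 2 ^ k + 1"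
        using ceiling_correct[of "real (L k) / 2 ^ k"] by linarith+
    qed
    have m2: "1 \<le> m k" for k
    proof -
      have "0 < real (L k) / 2 ^ k" using L_ge_1[of k] by (intro divide_pos_pos) auto
      then show ?thesis using m1(1)[of k] by (simp add: Suc_le_eq flip: of_nat_0_less_iff)
    qed
    have m_top: "filterlim m sequentially sequentially"
      unfolding filterlim_at_top
    proof
      fix b
      show "\<forall>\<^sub>F k in sequentially. b \<le> m k"
        unfolding eventually_sequentially
      proof (intro exI allI impI)
        fix k assume "Suc b \<le> k"
        then obtain j where j: "k = Suc j" "b \<le> j" by (cases k) auto
        have "real k \<le> 2 ^ k" using of_nat_less_two_power[of k, where 'a = real] by simp
        also have "\<dots> \<le> height k" unfolding height_def by (intro power_increasing) (auto simp: power2_eq_square)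
        also have "\<dots> \<le> real (L k) / 2 ^ k"
        proof -
          have "2 ^ k * height k * 1 \<le> 2 ^ k * height k * real (L j)"
            using height_ge_1[of k] L_ge_1[of j] by (intro mult_left_mono) auto
          also have "\<dots> \<le> real (L k)" using L_height[of j] unfolding j(1)[symmetric] .
          finally have "2 ^ k * height k \<le> real (L k)" by simp
          then show ?thesis by (simp add: le_divide_eq mult.commute)
        qed
        also have "\<dots> \<le> real (m k)" by (rule m1)
        finally show "b \<le> m k" using j by simp
      qed
    qed
    \<comment> \<open>The quotient of the lower bound at \<open>N * m k\<close> and the upper bound
      at \<open>m k\<close>, after the common slope has cancelled.\<close>
    define \<rho> where "\<rho> = (\<lambda>k. real N * (1 - 2 * real N / 2 ^ k) / (1 + 4 * real k / 2 ^ k + (1 / 2) ^ k))"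
    have \<rho>: "\<rho> \<longlonglongrightarrow> real N * (1 - 0) / (1 + 0 + 0)"
    proof -
      have 1: "(\<lambda>k. (1 / 2) ^ k :: real) \<longlonglongrightarrow> 0" by (rule LIMSEQ_power_zero) auto
      have 2: "(\<lambda>k. 2 * real N / 2 ^ k) \<longlonglongrightarrow> 0"
        using tendsto_mult_left[OF 1, of "2 * real N"] by (simp add: power_one_over)
      have "(\<lambda>k. real k / 2 ^ k) \<longlonglongrightarrow> 0" by (rule lim_n_over_pown) simp
      from tendsto_mult_left[OF this, of 4] have 3: "(\<lambda>k. 4 * real k / 2 ^ k) \<longlonglongrightarrow> 0" by simp
      show ?thesis unfolding \<rho>_def by (intro tendsto_intros 1 2 3) simp
    qed
    have "\<forall>\<^sub>F k in sequentially. \<rho> k \<le> R (m k)"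
    proof -
      have "\<forall>\<^sub>F k in sequentially. 0 < \<rho> k" using \<rho> N by (intro order_tendstoD(1)) auto
      then show ?thesis using eventually_ge_at_top[of 1]
      proof eventually_elim
        case (elim k)
        define a where "a = height k / real (L k)"
        define D where "D = 1 + 4 * real k / 2 ^ k + (1 / 2) ^ k"
        have D: "0 < D" unfolding D_def by (intro add_pos_nonneg) auto
        have a: "0 \<le> a" unfolding a_def using height_ge_1[of k] by simp
        have up: "normalized_variance M X (m k) \<le> real (m k) * a * D"
          unfolding a_def D_def by (rule normalized_variance_upper[OF m2 m1(1) elim(2)])
        have "real (N * m k) / real (L k) \<le> 2 * real N / 2 ^ k"
        proof -
          have "real (m k) / real (L k) \<le> (real (L k) / 2 ^ k + 1) / real (L k)"
            using m1(2)[of k] by (intro divide_right_mono) auto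
          also have "\<dots> = 1 / 2 ^ k + 1 / real (L k)" using L_ge_1[of k] by (simp add: add_divide_distrib)
          also have "1 / real (L k) \<le> 1 / 2 ^ k" using L_ge_real[of k] by (intro divide_left_mono) (use L_ge_1[of k] in auto)
          finally have "real (m k) / real (L k) \<le> 2 / 2 ^ k" by simp
          then have "real N * (real (m k) / real (L k)) \<le> real N * (2 / 2 ^ k)" by (rule mult_left_mono) simp
          then show ?thesis by (simp add: mult.commute)
        qed
        then have "real (N * m k) * a * (1 - 2 * real N / 2 ^ k) \<le> real (N * m k) * a * (1 - real (N * m k) / real (L k))"
          using a by (intro mult_left_mono) auto
        also have "\<dots> \<le> normalized_variance M X (N * m k)"
          unfolding a_def by (rule normalized_variance_lower) (use N m2[of k] elim in auto)
        finally have low: "real (N * m k) * a * (1 - 2 * real N / 2 ^ k) \<le> normalized_variance M X (N * m k)" .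
        have "\<rho> k * normalized_variance M X (m k) \<le> \<rho> k * (real (m k) * a * D)"
          using up elim by (intro mult_left_mono) auto
        also have "\<dots> = real (N * m k) * a * (1 - 2 * real N / 2 ^ k)"
        proof -
          have "\<rho> k * D = real N * (1 - 2 * real N / 2 ^ k)" using D by (simp add: \<rho>_def D_def)
          then show ?thesis by (simp add: mult_ac)
        qed
        finally show "\<rho> k \<le> R (m k)"
          unfolding R_def using low normalized_variance_pos[OF m2[of k]] by (simp add: le_divide_eq)
      qed
    qed
    moreover have "\<forall>\<^sub>F k in sequentially. R (m k) < y" using ev m_top by (rule eventually_compose_filterlim)
    moreover have "\<forall>\<^sub>F k in sequentially. y < \<rho> k" using \<rho> y(2) by (intro order_tendstoD(1)) auto
    ultimately have "\<forall>\<^sub>F k in sequentially. False" by eventually_elim linarith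
    then show False by simp
  qed
qed

end

end

section \<open>Quantiles, mixing rates and limit theorems\<close>

text \<open>By the half-angle formula it is enough that \<open>sin z \<ge> z / 2\<close> near 0; the
  constant 1/8 is not sharp.\<close>

lemma one_minus_cos_ge:
  fixes y :: real
  assumes "\<bar>y\<bar> \<le> 1"
  shows "y\<^sup>2 / 8 \<le> 1 - cos y"
proof -
  have cos_half: "1 - cos z = 2 * (sin (z / 2))\<^sup>2" for z :: real
    using cos_double_sin[of "z / 2"] by simp
  have sin_ge: "z / 2 \<le> sin z" if "0 \<le> z" "z \<le> 1 / 2" for z :: real
  proof -
    have "sin 0 - 0 / 2 \<le> sin z - z / 2"
    proof (rule DERIV_nonneg_imp_nondecreasing[OF that(1)])
      fix x assume x: "0 \<le> x" "x \<le> z"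
      have "1 - cos x \<le> 2 * (x / 2)\<^sup>2"
        unfolding cos_half using abs_sin_x_le_abs_x[of "x / 2"] unfolding abs_le_square_iff by linarith
      also have "\<dots> = x\<^sup>2 / 2" by (simp add: power2_eq_square)
      also have "\<dots> \<le> (1 / 2)\<^sup>2 / 2" using x that by (intro divide_right_mono power_mono) auto
      finally have "0 \<le> cos x - 1 / 2" by (simp add: power2_eq_square)
      moreover have "((\<lambda>x. sin x - x / 2) has_real_derivative cos x - 1 / 2) (at x)"
        by (auto intro!: derivative_eq_intros)
      ultimately show "\<exists>d. ((\<lambda>x. sin x - x / 2) has_real_derivative d) (at x) \<and> 0 \<le> d" by blast
    qed
    then show ?thesis by simp
  qed
  have "\<bar>y / 4\<bar> \<le> \<bar>sin (y / 2)\<bar>"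
    using sin_ge[of "\<bar>y\<bar> / 2"] assms by (cases "0 \<le> y") auto
  then have "(y / 4)\<^sup>2 \<le> (sin (y / 2))\<^sup>2" by (simp only: abs_le_square_iff)
  then show ?thesis unfolding cos_half by (simp add: power2_eq_square)
qed

text \<open>Both bounds come from \<open>1 + y \<le> exp y\<close>, at \<open>y = - x\<close> above
  and at \<open>y = x / (1 - x)\<close> below.\<close>

lemma power_one_minus_tendsto_exp:
  fixes x :: "nat \<Rightarrow> real" and J :: "nat \<Rightarrow> nat"
  assumes x: "\<And>k. 0 \<le> x k" "x \<longlonglongrightarrow> 0" and Jx: "(\<lambda>k. real (J k) * x k) \<longlonglongrightarrow> c"
  shows "(\<lambda>k. (1 - x k) ^ J k) \<longlonglongrightarrow> exp (- c)"
proof (rule tendsto_sandwich[of "\<lambda>k. exp (- (real (J k) * x k / (1 - x k)))" _ _ "\<lambda>k. exp (- (real (J k) * x k))"])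
  have ev: "\<forall>\<^sub>F k in sequentially. x k < 1" using x(2) by (rule order_tendstoD) simp
  show "\<forall>\<^sub>F k in sequentially. exp (- (real (J k) * x k / (1 - x k))) \<le> (1 - x k) ^ J k"
    using ev
  proof eventually_elim
    case (elim k)
    have "1 / (1 - x k) = 1 + x k / (1 - x k)" using elim by (simp add: field_simps)
    also have "\<dots> \<le> exp (x k / (1 - x k))" by (rule exp_ge_add_one_self)
    finally have "exp (- (x k / (1 - x k))) \<le> 1 - x k"
      using elim by (simp add: exp_minus field_simps)
    then have "exp (- (x k / (1 - x k))) ^ J k \<le> (1 - x k) ^ J k" by (intro power_mono) auto
    then show ?case by (simp add: exp_of_nat_mult[symmetric])
  qed
  show "\<forall>\<^sub>F k in sequentially. (1 - x k) ^ J k \<le> exp (- (real (J k) * x k))"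
    using ev
  proof eventually_elim
    case (elim k)
    have "(1 - x k) ^ J k \<le> exp (- x k) ^ J k"
      using elim exp_ge_add_one_self[of "- x k"] by (intro power_mono) auto
    then show ?case by (simp add: exp_of_nat_mult[symmetric])
  qed
  have "(\<lambda>k. real (J k) * x k / (1 - x k)) \<longlonglongrightarrow> c / (1 - 0)"
    by (intro tendsto_intros Jx x) simp
  then show "(\<lambda>k. exp (- (real (J k) * x k / (1 - x k)))) \<longlonglongrightarrow> exp (- c)"
    by (intro tendsto_intros) simp
  show "(\<lambda>k. exp (- (real (J k) * x k))) \<longlonglongrightarrow> exp (- c)" by (intro tendsto_intros Jx)
qed

section \<open>Tails, mixing rate and the time scales of the levels\<close>

context scales
begin

definition tail :: "nat \<Rightarrow> real" where
  "tail k = measure (measure_pmf state_law) {z. k \<le> lev z}"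

lemma tail_0: "tail 0 = 1" by (simp add: tail_def)

lemma tail_Suc: "tail k - tail (Suc k) = level_weight k"
proof -
  have "measure (measure_pmf state_law) ({z. lev z = k} \<union> {z. Suc k \<le> lev z}) =
      measure (measure_pmf state_law) {z. lev z = k} + measure (measure_pmf state_law) {z. Suc k \<le> lev z}"
    by (rule measure_pmf.finite_measure_Union) auto
  moreover have "{z. lev z = k} \<union> {z. Suc k \<le> lev z} = {z. k \<le> lev z}" by auto
  ultimately have "tail k = level_prob k + tail (Suc k)" by (simp only: tail_def level_prob_def)
  then show ?thesis by (simp add: level_prob_eq_weight)
qed

lemma mass_le_half_power: "mass k \<le> (1 / 2) ^ k"
proof -
  have "(1 / 2) ^ k / 4 \<le> (1 / 2 :: real) ^ k" by simp
  then show ?thesis using mass_le_coef[of k] coef_le[of k] by linarith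
qed

lemma half_power_tendsto: "(\<lambda>k. (1 / 2) ^ k :: real) \<longlonglongrightarrow> 0"
  by (rule LIMSEQ_power_zero) simp

lemma mass_tendsto: "mass \<longlonglongrightarrow> 0"
  by (rule tendsto_sandwich[OF _ _ tendsto_const half_power_tendsto])
     (use mass_pos mass_le_half_power in \<open>auto intro!: always_eventually less_imp_le\<close>)

lemma ex_tail_interval:
  assumes "0 < u" "u < 1"
  shows "\<exists>k. tail (Suc k) \<le> u \<and> u < tail k"
proof -
  have "(\<lambda>k. 2 * mass k) \<longlonglongrightarrow> 2 * 0" by (intro tendsto_intros mass_tendsto)
  then have "\<forall>\<^sub>F k in sequentially. 2 * mass k < u" using assms by (intro order_tendstoD) auto
  then obtain N where N: "\<And>k. N \<le> k \<Longrightarrow> 2 * mass k < u" by (auto simp: eventually_sequentially)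
  have "tail (Suc N) \<le> u" using measure_level_ge_le[of "Suc N"] N[of "Suc N"] by (simp add: tail_def)
  define k where "k = (LEAST k. tail (Suc k) \<le> u)"
  have 1: "tail (Suc k) \<le> u" unfolding k_def by (rule LeastI) fact
  have 2: "u < tail k"
  proof (cases k)
    case (Suc j)
    then have "\<not> tail (Suc j) \<le> u" unfolding k_def by (intro not_less_Least) simp
    then show ?thesis using Suc by simp
  qed (use assms tail_0 in simp)
  from 1 2 show ?thesis by blast
qed

lemma L_mass_eq: "real (L k) * mass k = coef k * real (L k) powr (1 - p)"
  using L_ge_1[of k] by (simp add: mass_def powr_diff powr_minus divide_inverse)

text \<open>The minimum bounds the length of the part of the interval up to
  \<open>(1 / x) powr p\<close> on which the quantile function is at most \<open>amp k\<close>. For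
  \<open>x \<le> L k\<close> the mass is the useful bound; for \<open>x > L k\<close> it is the
  power, and \<open>x powr (1 - p)\<close> decreases, which brings in
  \<open>amp ^ 2 * L powr (1 - p) = height / coef\<close>.\<close>

lemma amp_sq_min_le:
  assumes x: "1 \<le> x"
  shows "(amp k)\<^sup>2 * min (level_weight k) ((1 / x) powr p) \<le> envelope k x / x"
proof (cases "k = 0")
  case False
  then have k: "k > 0" by simp
  have lw: "level_weight k = mass k" using k by (simp add: level_weight_def)
  define m where "m = min (mass k) ((1 / x) powr p)"
  have 1: "(amp k)\<^sup>2 * m \<le> height k / real (L k)"
  proof -
    have "(amp k)\<^sup>2 * m \<le> (amp k)\<^sup>2 * mass k" unfolding m_def by (intro mult_left_mono) auto
    then show ?thesis using k by (simp add: amp_sq_mass)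
  qed
  have 2: "(amp k)\<^sup>2 * m * x \<le> height k / coef k"
  proof (cases "x \<le> real (L k)")
    case True
    have "(amp k)\<^sup>2 * m * x \<le> height k / real (L k) * real (L k)"
      using 1 True x height_ge_1[of k] by (intro mult_mono) auto
    also have "\<dots> \<le> height k / coef k"
      using L_ge_1[of k] height_le_height_div_coef[of k] height_ge_1[of k] by simp
    finally show ?thesis .
  next
    case False
    have "(amp k)\<^sup>2 * m * x \<le> (amp k)\<^sup>2 * (1 / x) powr p * x"
      using x unfolding m_def by (intro mult_right_mono mult_left_mono) auto
    also have "(1 / x) powr p * x = x powr (1 - p)"
      using x by (simp add: powr_diff powr_divide)
    then have "(amp k)\<^sup>2 * (1 / x) powr p * x = (amp k)\<^sup>2 * x powr (1 - p)" by (simp only: mult.assoc)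
    also have "\<dots> \<le> (amp k)\<^sup>2 * real (L k) powr (1 - p)"
      using False L_ge_1[of k] p by (intro mult_left_mono powr_mono2') auto
    also have "\<dots> = height k / coef k"
      unfolding amp_sq[OF k] L_mass_eq using L_ge_1[of k] by simp
    finally show ?thesis .
  qed
  have "(amp k)\<^sup>2 * m * x \<le> envelope k x"
    unfolding envelope_def using k 2 mult_right_mono[OF 1, of x] x by (simp add: mult.commute)
  then show ?thesis unfolding lw m_def[symmetric] using x by (simp add: le_divide_eq)
qed (simp add: amp_def envelope_def)

text \<open>With \<open>y = n / L k\<close> the power is at most exp (- y), hence at most
  \<open>(p / y) powr p\<close>. Its factor \<open>L k powr p\<close> cancels that of
  \<open>mass k\<close>, and \<open>p powr p\<close> cancels against \<open>coef k\<close>.\<close>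

lemma \<theta>_power_mass_le:
  assumes n: "1 \<le> n" and k: "k > 0"
  shows "mass k * \<theta> k ^ n \<le> (1 / 2) ^ k / 4 * (1 / real n) powr p"
proof -
  define y where "y = real n / real (L k)"
  have y: "y > 0" unfolding y_def using n L_ge_1[of k] by (intro divide_pos_pos) auto
  have "\<theta> k ^ n \<le> exp (- (1 / real (L k))) ^ n"
    using \<theta>_bounds[of k] exp_ge_add_one_self[of "- (1 / real (L k))"] by (intro power_mono) (auto simp: \<theta>_eq)
  also have "\<dots> = exp (- y)" by (simp add: exp_of_nat_mult[symmetric] y_def)
  also have "\<dots> \<le> (p / y) powr p"
  proof -
    have "y / p \<le> exp (y / p)" using exp_ge_add_one_self[of "y / p"] by linarith
    then have "(y / p) powr p \<le> exp (y / p) powr p" using y p by (intro powr_mono2) auto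
    also have "\<dots> = exp y" using p by (simp add: exp_powr_real)
    finally have "1 / exp y \<le> 1 / (y / p) powr p" using y p by (intro divide_left_mono) auto
    moreover have "1 / (y / p) powr p = (p / y) powr p" using y p by (simp add: powr_divide)
    ultimately show ?thesis by (simp add: exp_minus divide_inverse)
  qed
  also have "\<dots> = p powr p * (1 / real n) powr p * real (L k) powr p"
    using n L_ge_1[of k] p by (simp add: y_def powr_mult powr_divide)
  finally have "mass k * \<theta> k ^ n \<le> mass k * (p powr p * (1 / real n) powr p * real (L k) powr p)"
    using mass_pos[of k] by (intro mult_left_mono) auto
  also have "\<dots> = (coef k * p powr p) * (1 / real n) powr p"
    unfolding mass_def using L_ge_1[of k] by (simp add: powr_minus field_simps)
  also have "coef k * p powr p = (1 / 2) ^ k / 4"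
    unfolding coef_def using p by simp
  finally show ?thesis .
qed

text \<open>Level 0 drops out because \<open>\<theta> 0 = 0\<close>; the other levels sum to a
  quarter of the target, which leaves room for the factor 2 of the mixing bound.\<close>

lemma integral_\<theta>_power_le:
  assumes n: "1 \<le> n"
  shows "2 * (LINT z|measure_pmf state_law. \<theta> (lev z) ^ n) \<le> (1 / real n) powr p"
proof -
  define F where "F = (\<lambda>k. level_weight k * \<theta> k ^ n)"
  define c where "c = (1 / real n) powr p"
  have c: "c \<ge> 0" by (simp add: c_def)
  have F0: "F 0 = 0" using n by (simp add: F_def \<theta>_def)
  have Fs: "F (Suc k) \<le> c / 4 * (1 / 2) ^ Suc k" for k
    using \<theta>_power_mass_le[OF n, of "Suc k"] by (simp add: F_def level_weight_def c_def mult.commute)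
  have Fnn: "0 \<le> F k" for k using level_weight_pos[of k] \<theta>_bounds[of k] by (simp add: F_def)
  have s: "(\<lambda>k. c / 4 * (1 / 2) ^ Suc k) sums (c / 4 * 1)" by (intro sums_mult power_half_series)
  have sF: "summable (\<lambda>k. F (Suc k))"
  proof (rule summable_comparison_test'[where N = 0])
    show "summable (\<lambda>k. c / 4 * (1 / 2) ^ Suc k)" by (rule sums_summable[OF s])
    show "norm (F (Suc k)) \<le> c / 4 * (1 / 2) ^ Suc k" for k
      unfolding real_norm_def abs_of_nonneg[OF Fnn] by (rule Fs)
  qed
  then have sF': "summable F" by (simp only: summable_Suc_iff)
  have nonneg: "0 \<le> \<theta> k ^ n" for k using \<theta>_bounds[of k] by simp
  have "(LINT z|measure_pmf state_law. \<theta> (lev z) ^ n) = (\<Sum>k. F k)"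
    unfolding F_def by (rule integral_level) (use sF' in \<open>simp only: F_def abs_of_nonneg[OF nonneg]\<close>)
  also have "\<dots> = (\<Sum>k. F (Suc k))" using suminf_split_head[OF sF'] F0 by (simp only: diff_0_right)
  also have "\<dots> \<le> (\<Sum>k. c / 4 * (1 / 2) ^ Suc k)" by (intro suminf_le Fs sF sums_summable[OF s])
  also have "\<dots> = c / 4" using sums_unique[OF s] by (simp only: mult_1_right)
  finally show ?thesis unfolding c_def[symmetric] using c by linarith
qed

lemma amp_sq_nu: "k > 0 \<Longrightarrow> (amp k)\<^sup>2 * nu k * (real (L k))\<^sup>2 = height k"
  using amp_sq_mass[of k] L_ge_1[of k] by (simp add: nu_def power2_eq_square field_simps)

lemma nu_le_entry_rate: "k > 0 \<Longrightarrow> nu k \<le> entry_rate k"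
  using entry_rate_ge[of k] by (simp add: level_prob_eq_mass \<theta>_eq nu_def)

lemma entry_rate_le_nu: "k > 0 \<Longrightarrow> entry_rate k \<le> nu k / cell_prob k"
  using entry_rate_le[of k] by (simp add: level_prob_eq_mass \<theta>_eq nu_def)

lemma entry_rate_le_2_nu: "k > 0 \<Longrightarrow> entry_rate k \<le> 2 * nu k"
proof -
  assume k: "k > 0"
  have "nu k / cell_prob k \<le> nu k / (1 / 2)"
    using cell_prob_ge_half[of k] nu_pos[of k] by (intro divide_left_mono) auto
  then show ?thesis using entry_rate_le_nu[OF k] by simp
qed

lemma exit_rate_le_nu: "exit_rate k \<le> 4 * nu (Suc k)"
proof -
  have "exit_rate k \<le> (1 / real (L (Suc k))) * measure (measure_pmf state_law) (- cell k) / cell_prob k"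
    using exit_rate_le[of k] by (simp add: \<theta>_eq)
  also have "\<dots> \<le> (1 / real (L (Suc k))) * (2 * mass (Suc k)) / (1 / 2)"
    using cell_prob_ge_half[of k] measure_Compl_cell_le[of k] mass_pos[of "Suc k"]
    by (intro frac_le mult_left_mono mult_nonneg_nonneg) auto
  also have "\<dots> = 4 * nu (Suc k)" by (simp add: nu_def)
  finally show ?thesis .
qed

lemma two_power_le_height: "2 ^ k \<le> height k"
  unfolding height_def by (intro power_increasing) (auto simp: power2_eq_square)

text \<open>For \<open>n\<close> between \<open>k / nu k\<close> and \<open>(k + 1) / nu (k + 1)\<close> the jumps of level \<open>k\<close> spread the partial sum out.\<close>

lemma norm_integral_tilt_pow_window:
  assumes k: "1 \<le> k" and t: "t \<noteq> 0" "4 * t\<^sup>2 \<le> 2 ^ k"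
    and n: "real k / nu k \<le> real n" "real n \<le> real (Suc k) / nu (Suc k)"
  shows "norm (LINT z|measure_pmf state_law. (tilt (\<lambda>z. cis (t / sqrt (real n) * val z)) ^^ n) (\<lambda>_. 1) z) \<le>
    (240 * real (Suc k) / t\<^sup>2) / 2 ^ k + 100 * (1 / 2) ^ k + 24 / real k"
proof -
  have k0: "k > 0" using k by simp
  define W where "W = 1 / real (L k)"
  define h where "h = height k"
  define \<nu> where "\<nu> = nu k"
  define \<eta> where "\<eta> = entry_rate k"
  \<comment> \<open>The doubled angle is the one in which the decay estimate is stated, a trace of
    \<open>abs_cos_le\<close>.\<close>
  define y where "y = 2 * (t / sqrt (real n) * val (int k))"
  define x where "x = 1 - cos y"
  define q where "q = x / (8 * ((1 - \<theta> k)\<^sup>2 + 2 * x))"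
  have "2 \<le> (2::real) ^ k" using power_increasing[OF k, of "2::real"] by simp
  then have L2: "2 \<le> real (L k)" using L_ge_real[of k] by linarith
  have W: "0 < W" "W \<le> 1 / 2" "1 - \<theta> k = W" using L2 by (auto simp: W_def \<theta>_eq field_simps)
  have h1: "1 \<le> h" "2 ^ k \<le> h" using height_ge_1 two_power_le_height by (auto simp: h_def)
  have \<nu>: "0 < \<nu>" "\<nu> \<le> 1" "\<nu> \<le> \<eta>" "\<eta> \<le> 2 * \<nu>"
    using nu_pos[of k] nu_le_mass[of k] mass_le_eighth[OF k0] nu_le_entry_rate[OF k0] entry_rate_le_2_nu[OF k0] by (auto simp: \<nu>_def \<eta>_def)
  have npos: "real n > 0"
  proof -
    have "0 < real k / \<nu>" using k \<nu> by simp
    then show ?thesis using n(1) by (simp add: \<nu>_def)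
  qed
  have n\<nu>: "real k \<le> real n * \<nu>" using n(1) \<nu> by (simp add: \<nu>_def divide_le_eq)
  have val_k: "val (int k) = amp k" by (simp add: val_def)
  have ysq: "y\<^sup>2 = 4 * t\<^sup>2 * (amp k)\<^sup>2 / real n"
    using npos by (simp add: y_def val_k power_mult_distrib power_divide)
  have amp\<nu>: "(amp k)\<^sup>2 * \<nu> = h * W\<^sup>2"
    using amp_sq_nu[OF k0] L2 by (simp add: \<nu>_def h_def W_def power_divide field_simps)
  have hW: "h * W \<le> 1"
  proof -
    obtain j where j: "k = Suc j" using k0 gr0_implies_Suc by blast
    have "1 * h * 1 \<le> 2 ^ k * h * real (L j)"
      using h1 L_ge_1[of j] by (intro mult_mono) auto
    also have "\<dots> \<le> real (L k)" using L_height[of j] unfolding j(1)[symmetric] h_def .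
    finally show ?thesis using L2 by (simp add: W_def divide_le_eq)
  qed
  \<comment> \<open>The phase is kept small so that \<open>1 - cos y\<close> is comparable to its
    square: \<open>n * nu k \<ge> 1\<close> bounds it by \<open>4 * t ^ 2 * h * W ^ 2\<close>, and
    then \<open>h * W \<le> 1\<close> and \<open>4 * t ^ 2 \<le> 2 ^ k\<close> suffice.\<close>
  have y1: "\<bar>y\<bar> \<le> 1"
  proof -
    have "y\<^sup>2 \<le> 4 * t\<^sup>2 * (amp k)\<^sup>2 * \<nu>"
    proof -
      have "1 / real n \<le> \<nu>"
      proof -
        have "1 \<le> real n * \<nu>" using n\<nu> k by linarith
        then show ?thesis using npos by (simp add: divide_le_eq mult.commute)
      qed
      then have "4 * t\<^sup>2 * (amp k)\<^sup>2 * (1 / real n) \<le> 4 * t\<^sup>2 * (amp k)\<^sup>2 * \<nu>" by (intro mult_left_mono) auto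
      then show ?thesis by (simp add: ysq)
    qed
    also have "\<dots> = 4 * t\<^sup>2 * W * (h * W)" using amp\<nu> by (simp add: power2_eq_square mult_ac)
    also have "\<dots> \<le> 2 ^ k * W * 1" using t W hW h1 by (intro mult_mono) auto
    also have "\<dots> \<le> 1" using L_ge_real[of k] L2 by (simp add: W_def divide_le_eq)
    finally have "y\<^sup>2 \<le> 1" .
    then show ?thesis by (simp only: abs_square_le_1)
  qed
  have x_ge: "y\<^sup>2 / 8 \<le> x" unfolding x_def by (rule one_minus_cos_ge[OF y1])
  have "0 < y\<^sup>2" unfolding ysq using t amp_pos[OF k0] npos by simp
  then have x0: "0 < x" using x_ge by linarith
  \<comment> \<open>Up to a constant, \<open>r\<close> is the squared doubled phase collected during
    a mean holding time \<open>L k\<close>; the damping per visit saturates when it reaches order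
    1.\<close>
  define r where "r = x / W\<^sup>2"
  have r0: "0 < r" using x0 W by (simp add: r_def)
  have r_ge: "t\<^sup>2 * h / (2 * (real n * \<nu>)) \<le> r"
  proof -
    have "t\<^sup>2 * h / (2 * (real n * \<nu>)) = (y\<^sup>2 / 8) / W\<^sup>2"
    proof -
      have "(amp k)\<^sup>2 / W\<^sup>2 = h / \<nu>" using amp\<nu> \<nu> W by (simp add: frac_eq_eq)
      moreover have "(y\<^sup>2 / 8) / W\<^sup>2 = t\<^sup>2 * ((amp k)\<^sup>2 / W\<^sup>2) / (2 * real n)" by (simp add: ysq)
      ultimately show ?thesis by (simp add: mult_ac)
    qed
    also have "\<dots> \<le> r" unfolding r_def using x_ge by (intro divide_right_mono) auto
    finally show ?thesis .
  qed
  \<comment> \<open>For \<open>r \<le> 1\<close> the denominator \<open>8 * (1 + 2 * r)\<close> is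
    at most 24; for \<open>r > 1\<close> it is less than \<open>24 * r\<close>.\<close>
  have q_ge: "min r 1 / 24 \<le> q"
  proof -
    have qr: "q = r / (8 * (1 + 2 * r))"
      using W x0 by (simp add: q_def r_def field_simps)
    show ?thesis
    proof (cases "r \<le> 1")
      case True
      then have "r / 24 \<le> r / (8 * (1 + 2 * r))" using r0 by (intro divide_left_mono) auto
      then show ?thesis unfolding qr using True by (simp only: min_absorb1)
    next
      case False
      then show ?thesis unfolding qr by (simp add: le_divide_eq)
    qed
  qed
  have q0: "0 < q" using q_ge r0 by (simp add: min_def split: if_splits)
  have q1: "q \<le> 1 / 16"
    unfolding q_def using x0 by (simp add: divide_le_eq add_nonneg_pos)
  have main: "norm (LINT z|measure_pmf state_law. (tilt (\<lambda>z. cis (t / sqrt (real n) * val z)) ^^ n) (\<lambda>_. 1) z) \<le>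
      exit_rate k / (\<eta> * q) + (1 - \<eta> * q) ^ n + 2 * measure (measure_pmf state_law) {z. k \<le> lev z}"
    unfolding \<eta>_def
  proof (rule norm_integral_tilt_pow_decay[where k = k and val = val and x = x, OF k0 val_odd _ _ _ x0 q_def])
    show "1 / 2 \<le> \<theta> k" using W by linarith
    have "level_prob k / cell_prob k \<le> 1"
      using level_prob_le_cell_prob[of k k] cell_prob_pos[of k] by simp
    then have "level_prob k / cell_prob k * (1 - \<theta> k) \<le> 1 * (1 - \<theta> k)" using W by (intro mult_right_mono) auto
    then show "entry_rate k \<le> 1 - \<theta> k" using entry_rate_le[of k] by simp
  qed (simp add: x_def y_def)
  have tail_le: "2 * measure (measure_pmf state_law) {z. k \<le> lev z} \<le> 4 * (1 / 2) ^ k"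
    using measure_level_ge_le[OF k0] mass_le_half_power[of k] by linarith
  have \<eta>q: "\<nu> * (min r 1 / 24) \<le> \<eta> * q" using \<nu> q_ge r0 by (intro mult_mono) auto
  have inv_min: "1 / min r 1 \<le> 1 / r + 1" using r0 by (auto simp: min_def)
  \<comment> \<open>If \<open>r\<close> is small, the upper end of the window,
    \<open>n * nu (Suc k) \<le> k + 1\<close>, is set against the height; otherwise the ratio of
    consecutive entry rates is small by itself.\<close>
  have exit_le: "exit_rate k / (\<eta> * q) \<le> 192 * real (Suc k) / (t\<^sup>2 * h) + 96 * (1 / 2) ^ k"
  proof -
    define \<nu>' where "\<nu>' = nu (Suc k)"
    have \<nu>'0: "0 < \<nu>'" by (simp add: \<nu>'_def nu_pos)
    have "exit_rate k / (\<eta> * q) \<le> 4 * \<nu>' / (\<nu> * (min r 1 / 24))"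
      using exit_rate_le_nu[of k] exit_rate_nonneg[of k] \<eta>q \<nu> r0 by (intro frac_le) (auto simp: \<nu>'_def)
    also have "\<dots> = 96 * (\<nu>' / \<nu>) * (1 / min r 1)" by (simp add: field_simps)
    also have "\<dots> \<le> 96 * (\<nu>' / \<nu>) * (1 / r + 1)" using inv_min \<nu> \<nu>'0 by (intro mult_left_mono) auto
    also have "\<dots> = 96 * (\<nu>' / (\<nu> * r)) + 96 * (\<nu>' / \<nu>)" by (simp add: distrib_left)
    also have "\<dots> \<le> 96 * (2 * real (Suc k) / (t\<^sup>2 * h)) + 96 * (1 / 2) ^ k"
    proof (intro add_mono mult_left_mono)
      have "\<nu>' \<le> (1 / 2) ^ k * \<nu>" unfolding \<nu>'_def \<nu>_def by (rule nu_Suc_le)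
      then show "\<nu>' / \<nu> \<le> (1 / 2) ^ k" using \<nu> by (simp add: divide_le_eq)
      have "\<nu>' / (\<nu> * r) \<le> \<nu>' / (\<nu> * (t\<^sup>2 * h / (2 * (real n * \<nu>))))"
        using r_ge \<nu> \<nu>'0 r0 t h1 npos by (intro divide_left_mono mult_left_mono mult_pos_pos divide_pos_pos) auto
      also have "\<dots> = 2 * (real n * \<nu>') / (t\<^sup>2 * h)" using \<nu> by simp
      also have "\<dots> \<le> 2 * real (Suc k) / (t\<^sup>2 * h)"
      proof -
        have "real n * \<nu>' \<le> real (Suc k)" using n(2) \<nu>'0 by (simp add: \<nu>'_def le_divide_eq)
        then show ?thesis using h1 by (intro divide_right_mono) auto
      qed
      finally show "\<nu>' / (\<nu> * r) \<le> 2 * real (Suc k) / (t\<^sup>2 * h)" .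
    qed auto
    finally show ?thesis by simp
  qed
  \<comment> \<open>The lower end of the window, \<open>n * nu k \<ge> k\<close>, makes the exponent
    large; the crude bound exp (- z) \<le> 1 / z is enough.\<close>
  have pow_le: "(1 - \<eta> * q) ^ n \<le> 48 / (t\<^sup>2 * h) + 24 / real k"
  proof -
    have "\<eta> * q \<le> 1"
    proof -
      have "\<eta> * q \<le> 2 * (1 / 16)" using \<nu> q1 q0 by (intro mult_mono) auto
      then show ?thesis by simp
    qed
    then have "(1 - \<eta> * q) ^ n \<le> exp (- (\<eta> * q)) ^ n"
      using exp_ge_add_one_self[of "- (\<eta> * q)"] by (intro power_mono) auto
    also have "\<dots> = exp (- (real n * (\<eta> * q)))" by (simp add: exp_of_nat_mult[symmetric])
    also have "\<dots> \<le> exp (- (real n * (\<nu> * (min r 1 / 24))))"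
      using mult_left_mono[OF \<eta>q, of "real n"] by simp
    also have "\<dots> \<le> 1 / (real n * (\<nu> * (min r 1 / 24)))"
    proof -
      define z where "z = real n * (\<nu> * (min r 1 / 24))"
      have z: "0 < z" unfolding z_def using npos \<nu> r0 by (intro mult_pos_pos) auto
      have "z \<le> exp z" using exp_ge_add_one_self[of z] by linarith
      then have "1 / exp z \<le> 1 / z" using z by (intro divide_left_mono) auto
      then show ?thesis unfolding z_def[symmetric] by (simp add: exp_minus divide_inverse)
    qed
    also have "\<dots> = 24 / (real n * \<nu>) * (1 / min r 1)" by simp
    also have "\<dots> \<le> 24 / (real n * \<nu>) * (1 / r + 1)" using inv_min npos \<nu> by (intro mult_left_mono) auto
    also have "\<dots> = 24 / (real n * \<nu> * r) + 24 / (real n * \<nu>)" by (simp add: distrib_left)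
    also have "\<dots> \<le> 48 / (t\<^sup>2 * h) + 24 / real k"
    proof (intro add_mono)
      have "24 / (real n * \<nu> * r) \<le> 24 / (real n * \<nu> * (t\<^sup>2 * h / (2 * (real n * \<nu>))))"
        using r_ge npos \<nu> r0 t h1 by (intro divide_left_mono mult_left_mono mult_pos_pos divide_pos_pos) auto
      also have "\<dots> = 48 / (t\<^sup>2 * h)" using npos \<nu> by simp
      finally show "24 / (real n * \<nu> * r) \<le> 48 / (t\<^sup>2 * h)" .
      show "24 / (real n * \<nu>) \<le> 24 / real k" using n\<nu> k npos \<nu> by (intro divide_left_mono mult_pos_pos) auto
    qed
    finally show ?thesis .
  qed
  have "192 * real (Suc k) / (t\<^sup>2 * h) + 48 / (t\<^sup>2 * h) \<le> 240 * real (Suc k) / (t\<^sup>2 * h)"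
  proof -
    have "192 * real (Suc k) / (t\<^sup>2 * h) + 48 / (t\<^sup>2 * h) = (192 * real (Suc k) + 48) / (t\<^sup>2 * h)" by (simp add: add_divide_distrib)
    also have "\<dots> \<le> 240 * real (Suc k) / (t\<^sup>2 * h)" using h1 by (intro divide_right_mono) auto
    finally show ?thesis .
  qed
  also have "\<dots> \<le> 240 * real (Suc k) / (t\<^sup>2 * 2 ^ k)"
    using h1 t by (intro divide_left_mono mult_left_mono mult_pos_pos) auto
  finally have "192 * real (Suc k) / (t\<^sup>2 * h) + 48 / (t\<^sup>2 * h) \<le> (240 * real (Suc k) / t\<^sup>2) / 2 ^ k" by simp
  then show ?thesis using main tail_le exit_le pow_le by linarith
qed

lemma tail_interval_le: "emeasure lborel ({tail (Suc k)..<tail k} \<inter> {0<..<t}) \<le> ennreal (min (level_weight k) t)"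
proof (cases "0 \<le> t")
  case True
  have "emeasure lborel ({tail (Suc k)..<tail k} \<inter> {0<..<t}) \<le> emeasure lborel {tail (Suc k)..<tail k}"
    by (rule emeasure_mono) auto
  also have "\<dots> = ennreal (level_weight k)"
    using tail_Suc[of k] level_weight_pos[of k] by simp
  finally have 1: "emeasure lborel ({tail (Suc k)..<tail k} \<inter> {0<..<t}) \<le> ennreal (level_weight k)" .
  have "emeasure lborel ({tail (Suc k)..<tail k} \<inter> {0<..<t}) \<le> emeasure lborel {0<..<t}"
    by (rule emeasure_mono) auto
  also have "\<dots> = ennreal t" using True by simp
  finally show ?thesis using 1 by (simp add: min_def)
qed simp

text \<open>The limit is 1 minus the characteristic function of the Laplace law: a geometric holding
  time divided by its mean becomes exponential, and the symmetric sign makes it Laplace. Writing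
  \<open>1 - cos\<close> through sin y / y lets the common factor \<open>W ^ 2\<close> cancel before
  the limit is taken.\<close>

lemma damping_tendsto: "(\<lambda>j. damping (\<theta> (Suc j)) 1 (t / real (L (Suc j)))) \<longlonglongrightarrow> t\<^sup>2 / (1 + t\<^sup>2)"
proof -
  define W where "W = (\<lambda>j. 1 / real (L (Suc j)))"
  define s :: "real \<Rightarrow> real" where "s = (\<lambda>y. if y = 0 then 1 else sin y / y)"
  define c where "c = (\<lambda>j. t\<^sup>2 / 2 * (s (t * W j / 2))\<^sup>2)"
  have W0: "W \<longlonglongrightarrow> 0" unfolding W_def by (rule LIMSEQ_Suc[OF L_at_top])
  have W: "0 < W j" for j using L_ge_1[of "Suc j"] by (simp add: W_def)
  have "(\<lambda>j. t * W j / 2) \<longlonglongrightarrow> t * 0 / 2" by (intro tendsto_intros W0) simp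
  then have lim0: "(\<lambda>j. t * W j / 2) \<longlonglongrightarrow> 0" by (simp only: mult_zero_right div_0)
  have "isCont s 0" unfolding s_def by (rule isCont_sinc)
  then have "(\<lambda>j. s (t * W j / 2)) \<longlonglongrightarrow> s 0" by (rule isCont_tendsto_compose) (rule lim0)
  moreover have "s 0 = 1" by (simp add: s_def)
  ultimately have s1: "(\<lambda>j. s (t * W j / 2)) \<longlonglongrightarrow> 1" by (simp only:)
  have c: "c \<longlonglongrightarrow> t\<^sup>2 / 2 * 1\<^sup>2"
    unfolding c_def by (intro tendsto_mult tendsto_const tendsto_power s1)
  have cos_eq: "1 - cos (t * W j) = (W j)\<^sup>2 * c j" for j
  proof -
    have "1 - cos (t * W j) = 2 * (sin (t * W j / 2))\<^sup>2"
      using cos_double_sin[of "t * W j / 2"] by simp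
    also have "sin (t * W j / 2) = s (t * W j / 2) * (t * W j / 2)" by (simp add: s_def)
    finally show ?thesis by (simp add: c_def power_mult_distrib power_divide)
  qed
  have "damping (\<theta> (Suc j)) 1 (t / real (L (Suc j))) = (2 - W j) * c j / (1 + 2 * (1 - W j) * c j)" for j
  proof -
    have "damping (\<theta> (Suc j)) 1 (t / real (L (Suc j))) =
        (2 - W j) * ((W j)\<^sup>2 * c j) / ((W j)\<^sup>2 + 2 * (1 - W j) * ((W j)\<^sup>2 * c j))"
    proof -
      have e: "t / real (L (Suc j)) = t * W j" "\<theta> (Suc j) = 1 - W j" by (simp_all add: W_def \<theta>_eq)
      show ?thesis unfolding damping_def e cos_eq by simp
    qed
    also have "\<dots> = ((W j)\<^sup>2 * ((2 - W j) * c j)) / ((W j)\<^sup>2 * (1 + 2 * (1 - W j) * c j))"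
      by (simp only: distrib_left mult_1_right mult.assoc mult.left_commute)
    also have "\<dots> = (2 - W j) * c j / (1 + 2 * (1 - W j) * c j)"
      using W[of j] by (intro mult_divide_mult_cancel_left) simp
    finally show ?thesis .
  qed
  moreover have "(\<lambda>j. (2 - W j) * c j / (1 + 2 * (1 - W j) * c j)) \<longlonglongrightarrow>
      (2 - 0) * (t\<^sup>2 / 2 * 1\<^sup>2) / (1 + 2 * (1 - 0) * (t\<^sup>2 / 2 * 1\<^sup>2))"
  proof (intro tendsto_intros W0 c)
    have "0 < 1 + t\<^sup>2" by (intro add_pos_nonneg) auto
    then show "1 + 2 * (1 - 0) * (t\<^sup>2 / 2 * 1\<^sup>2) \<noteq> 0" by simp
  qed
  ultimately show ?thesis by simp
qed

text \<open>The number of steps in which level \<open>k\<close> is entered about once on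
  average.\<close>

definition jump_time :: "nat \<Rightarrow> nat" where
  "jump_time k = nat \<lceil>1 / nu k\<rceil>"

text \<open>The typical size of the sum over a single visit: amplitude times mean holding
  time.\<close>

definition jump_scale :: "nat \<Rightarrow> real" where
  "jump_scale k = amp k * real (L k)"

lemma nu_le_1: "nu k \<le> 1"
proof -
  have "(1 / 2 :: real) ^ k \<le> 1" by (rule power_le_one) auto
  then show ?thesis using nu_le_mass[of k] mass_le_half_power[of k] by linarith
qed

lemma jump_time_bounds: "1 / nu k \<le> real (jump_time k)" "real (jump_time k) < 1 / nu k + 1"
proof -
  have "0 < 1 / nu k" using nu_pos by simp
  then have "real (jump_time k) = of_int \<lceil>1 / nu k\<rceil>" by (simp add: jump_time_def)
  then show "1 / nu k \<le> real (jump_time k)" "real (jump_time k) < 1 / nu k + 1" by linarith+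
qed

lemma jump_time_nu: "1 \<le> real (jump_time k) * nu k" "real (jump_time k) * nu k \<le> 1 + nu k"
proof -
  have "1 / nu k * nu k \<le> real (jump_time k) * nu k"
    using jump_time_bounds(1)[of k] nu_pos[of k] by (intro mult_right_mono) auto
  then show "1 \<le> real (jump_time k) * nu k" using nu_pos[of k] by simp
  have "real (jump_time k) * nu k \<le> (1 / nu k + 1) * nu k"
    using jump_time_bounds(2)[of k] nu_pos[of k] by (intro mult_right_mono) auto
  also have "\<dots> = 1 + nu k" using nu_pos[of k] by (simp add: distrib_right)
  finally show "real (jump_time k) * nu k \<le> 1 + nu k" .
qed

lemma jump_time_pos: "0 < jump_time k"
proof -
  have "0 < 1 / nu k" using nu_pos by simp
  then show ?thesis using jump_time_bounds(1)[of k] by linarith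
qed

text \<open>From level 1 on \<open>1 / nu\<close> at least doubles and is at least 1, so a strict
  gap survives rounding up.\<close>

lemma strict_mono_jump_time: "strict_mono (\<lambda>j. jump_time (Suc j))"
  unfolding strict_mono_Suc_iff
proof
  fix j
  have "(1 / 2 :: real) ^ Suc j \<le> 1 / 2" using power_le_one[of "1 / 2 :: real" j] by simp
  then have "(1 / 2) ^ Suc j * nu (Suc j) \<le> 1 / 2 * nu (Suc j)"
    using nu_pos[of "Suc j"] by (intro mult_right_mono) auto
  then have "nu (Suc (Suc j)) \<le> nu (Suc j) / 2" using nu_Suc_le[of "Suc j"] by linarith
  then have "1 / (nu (Suc j) / 2) \<le> 1 / nu (Suc (Suc j))"
    using nu_pos[of "Suc (Suc j)"] nu_pos[of "Suc j"] by (intro divide_left_mono mult_pos_pos) auto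
  then have "1 / nu (Suc j) + 1 / nu (Suc j) \<le> 1 / nu (Suc (Suc j))" by simp
  moreover have "1 \<le> 1 / nu (Suc j)" using nu_le_1[of "Suc j"] nu_pos[of "Suc j"] by simp
  ultimately have "real (jump_time (Suc j)) < real (jump_time (Suc (Suc j)))"
    using jump_time_bounds(2)[of "Suc j"] jump_time_bounds(1)[of "Suc (Suc j)"] by linarith
  then show "jump_time (Suc j) < jump_time (Suc (Suc j))" by simp
qed

lemma jump_scale_pos: "0 < jump_scale (Suc j)"
  unfolding jump_scale_def using amp_pos[of "Suc j"] L_ge_1[of "Suc j"] by (intro mult_pos_pos) auto

lemma jump_scale_sq: "k > 0 \<Longrightarrow> (jump_scale k)\<^sup>2 = height k / nu k"
  using amp_sq_nu[of k] nu_pos[of k] by (simp add: jump_scale_def power_mult_distrib eq_divide_eq mult_ac)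

lemma jump_scale_at_top: "filterlim (\<lambda>j. jump_scale (Suc j)) at_top sequentially"
proof (rule filterlim_at_top_mono)
  show "filterlim (\<lambda>j. amp 1 * real (Suc j)) at_top sequentially"
    using amp_pos[of 1] filterlim_Suc filterlim_real_sequentially
    by (intro filterlim_tendsto_pos_mult_at_top[OF tendsto_const] filterlim_compose[OF filterlim_real_sequentially]) auto
  show "\<forall>\<^sub>F j in sequentially. amp 1 * real (Suc j) \<le> jump_scale (Suc j)"
  proof (rule always_eventually, rule allI)
    fix j
    have "amp 1 \<le> amp (Suc j)" using strict_mono_mono[OF strict_mono_amp] by (rule monoD) simp
    moreover have "real (Suc j) \<le> real (L (Suc j))"
      using less_exp[of "Suc j"] L_ge[of "Suc j"] by linarith
    ultimately show "amp 1 * real (Suc j) \<le> jump_scale (Suc j)"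
      unfolding jump_scale_def using amp_nonneg by (intro mult_mono) auto
  qed
qed

lemma low_level_integral_le:
  assumes n: "1 \<le> n"
  shows "(LINT z|measure_pmf state_law. (if lev z < Suc j then val z else 0)\<^sup>2 * toeplitz_sum (\<theta> (lev z)) n) \<le>
    real n * (real (Suc j) * (2 * height j))"
proof -
  define F where "F = (\<lambda>i. if i < Suc j then (amp i)\<^sup>2 * toeplitz_sum (\<theta> i) n else 0)"
  have wF: "level_weight i * F i = (if i < Suc j then real n * contrib i n else 0)" for i
    using weight_contrib[OF n] by (simp add: F_def)
  have Fnn: "0 \<le> F i" for i by (simp add: F_def toeplitz_nonneg)
  have sF: "(\<lambda>i. level_weight i * F i) sums (\<Sum>i<Suc j. real n * contrib i n)"
    unfolding wF using sums_If_finite_set[of "{..<Suc j}" "\<lambda>i. real n * contrib i n"] by simp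
  have "(LINT z|measure_pmf state_law. (if lev z < Suc j then val z else 0)\<^sup>2 * toeplitz_sum (\<theta> (lev z)) n) =
      (LINT z|measure_pmf state_law. F (lev z))"
    by (intro Bochner_Integration.integral_cong) (auto simp: F_def val_sq)
  also have "\<dots> = (\<Sum>i. level_weight i * F i)"
    by (rule integral_level) (simp only: abs_of_nonneg[OF Fnn] sums_summable[OF sF])
  also have "\<dots> = (\<Sum>i<Suc j. real n * contrib i n)" by (rule sums_unique[OF sF, symmetric])
  also have "\<dots> \<le> (\<Sum>i<Suc j. real n * (2 * height j))"
  proof (intro sum_mono mult_left_mono)
    fix i assume "i \<in> {..<Suc j}"
    then have "height i \<le> height j" by (intro height_mono) simp
    then show "contrib i n \<le> 2 * height j" using contrib_le_height[of i n] by linarith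
  qed simp
  also have "\<dots> = real n * (real (Suc j) * (2 * height j))" by (simp del: of_nat_Suc)
  finally show ?thesis .
qed

definition "low_level_error j = 2 * real (Suc j) / 2 ^ j"

text \<open>Up to \<open>jump_time (Suc j)\<close> the levels up to \<open>j\<close> have variance
  of the order \<open>j * height j / nu (Suc j)\<close>, while the squared scale is
  \<open>height (Suc j) / nu (Suc j)\<close>; the ratio of the heights is
  \<open>2 ^ (2 * j + 1)\<close>.\<close>

lemma low_level_le_jump_scale:
  "(LINT z|measure_pmf state_law. (if lev z < Suc j then val z else 0)\<^sup>2 * toeplitz_sum (\<theta> (lev z)) (jump_time (Suc j))) \<le>
    (jump_scale (Suc j) * low_level_error j)\<^sup>2"
proof -
  define m where "m = real (Suc j)"
  define n where "n = jump_time (Suc j)"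
  define v where "v = nu (Suc j)"
  have m: "1 \<le> m" by (simp add: m_def)
  have v: "0 < v" using nu_pos by (simp add: v_def)
  have h: "0 < height j" using height_ge_1[of j] by simp
  have n: "real n \<le> 2 / v"
  proof -
    have "real n * v \<le> 2" using jump_time_nu(2)[of "Suc j"] nu_le_1[of "Suc j"] by (simp add: n_def v_def)
    then show ?thesis using v by (simp add: le_divide_eq)
  qed
  have "1 \<le> n" using jump_time_pos[of "Suc j"] by (simp add: n_def)
  then have "(LINT z|measure_pmf state_law. (if lev z < Suc j then val z else 0)\<^sup>2 * toeplitz_sum (\<theta> (lev z)) n) \<le>
      real n * (m * (2 * height j))"
    unfolding m_def by (rule low_level_integral_le)
  also have "\<dots> \<le> 2 / v * (m * (2 * height j))" using n m h by (intro mult_right_mono) auto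
  also have "\<dots> = 4 * m * (height j / v)" by simp
  also have "\<dots> \<le> 8 * m\<^sup>2 * (height j / v)"
  proof (rule mult_right_mono)
    have "4 * m * 1 \<le> 4 * m * (2 * m)" using m by (intro mult_left_mono) auto
    then show "4 * m \<le> 8 * m\<^sup>2" by (simp add: power2_eq_square)
  qed (use h v in simp)
  also have "\<dots> = (jump_scale (Suc j) * low_level_error j)\<^sup>2"
  proof -
    have "(2 ^ j :: real)\<^sup>2 = 2 ^ (2 * j)" by (simp only: power_mult[symmetric] mult.commute)
    then show ?thesis
      unfolding power_mult_distrib jump_scale_sq[OF zero_less_Suc] height_ratio low_level_error_def
        m_def[symmetric] v_def[symmetric] power_divide
      by simp
  qed
  finally show ?thesis by (simp add: n_def)
qed

text \<open>The entry rate lies between \<open>nu\<close> and \<open>nu / cell_prob\<close>, and the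
  cells exhaust the stationary law.\<close>

lemma jump_probability_tendsto:
  "(\<lambda>j. real (jump_time (Suc j)) * entry_rate (Suc j)) \<longlonglongrightarrow> 1" "(\<lambda>j. entry_rate (Suc j)) \<longlonglongrightarrow> 0"
proof -
  have mass0: "(\<lambda>j. mass (Suc j)) \<longlonglongrightarrow> 0" by (rule LIMSEQ_Suc[OF mass_tendsto])
  have nu0: "(\<lambda>j. nu (Suc j)) \<longlonglongrightarrow> 0"
    by (rule tendsto_sandwich[OF _ _ tendsto_const mass0])
       (use nu_pos nu_le_mass in \<open>auto intro!: always_eventually less_imp_le\<close>)
  have cell1: "(\<lambda>j. cell_prob (Suc j)) \<longlonglongrightarrow> 1"
  proof (rule tendsto_sandwich[of "\<lambda>j. 1 - 2 * mass (Suc (Suc j))" _ _ "\<lambda>_. 1"])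
    have "(\<lambda>j. 1 - 2 * mass (Suc (Suc j))) \<longlonglongrightarrow> 1 - 2 * 0" by (intro tendsto_intros LIMSEQ_Suc[OF mass0])
    then show "(\<lambda>j. 1 - 2 * mass (Suc (Suc j))) \<longlonglongrightarrow> 1" by simp
  qed (auto intro!: always_eventually cell_prob_ge cell_prob_le_1)
  have "(\<lambda>j. 2 * nu (Suc j)) \<longlonglongrightarrow> 2 * 0" by (intro tendsto_intros nu0)
  then have nu2: "(\<lambda>j. 2 * nu (Suc j)) \<longlonglongrightarrow> 0" by simp
  show "(\<lambda>j. entry_rate (Suc j)) \<longlonglongrightarrow> 0"
    by (rule tendsto_sandwich[OF _ _ tendsto_const nu2])
       (auto intro!: always_eventually entry_rate_nonneg entry_rate_le_2_nu)
  show "(\<lambda>j. real (jump_time (Suc j)) * entry_rate (Suc j)) \<longlonglongrightarrow> 1"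
  proof (rule tendsto_sandwich[of "\<lambda>_. 1" _ _ "\<lambda>j. (1 + nu (Suc j)) / cell_prob (Suc j)"])
    have "(\<lambda>j. (1 + nu (Suc j)) / cell_prob (Suc j)) \<longlonglongrightarrow> (1 + 0) / 1" by (intro tendsto_intros nu0 cell1) simp
    then show "(\<lambda>j. (1 + nu (Suc j)) / cell_prob (Suc j)) \<longlonglongrightarrow> 1" by simp
    have "1 \<le> real (jump_time (Suc j)) * entry_rate (Suc j)" for j
    proof -
      have "real (jump_time (Suc j)) * nu (Suc j) \<le> real (jump_time (Suc j)) * entry_rate (Suc j)"
        using nu_le_entry_rate[of "Suc j"] by (intro mult_left_mono) auto
      then show ?thesis using jump_time_nu(1)[of "Suc j"] by linarith
    qed
    then show "\<forall>\<^sub>F j in sequentially. 1 \<le> real (jump_time (Suc j)) * entry_rate (Suc j)" by simp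
    have "real (jump_time (Suc j)) * entry_rate (Suc j) \<le> (1 + nu (Suc j)) / cell_prob (Suc j)" for j
    proof -
      have "real (jump_time (Suc j)) * entry_rate (Suc j) \<le> real (jump_time (Suc j)) * (nu (Suc j) / cell_prob (Suc j))"
        using entry_rate_le_nu[of "Suc j"] by (intro mult_left_mono) auto
      also have "\<dots> = real (jump_time (Suc j)) * nu (Suc j) / cell_prob (Suc j)" by simp
      also have "\<dots> \<le> (1 + nu (Suc j)) / cell_prob (Suc j)"
        using jump_time_nu(2)[of "Suc j"] cell_prob_pos[of "Suc j"] by (intro divide_right_mono) auto
      finally show ?thesis .
    qed
    then show "\<forall>\<^sub>F j in sequentially. real (jump_time (Suc j)) * entry_rate (Suc j) \<le> (1 + nu (Suc j)) / cell_prob (Suc j)" by simp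
  qed simp
qed

text \<open>The factor \<open>k\<close> makes the number of entries into the chosen level grow
  without bound; maximality provides the opposite bound on \<open>n\<close>, which controls
  excursions to the next level.\<close>

definition window :: "nat \<Rightarrow> nat" where
  "window n = Max {k. real k / nu k \<le> real n}"

lemma finite_window: "finite {k. real k / nu k \<le> real n}"
proof (rule finite_subset)
  have "real k \<le> real k / nu k" for k
    using nu_pos[of k] nu_le_1[of k] by (simp add: le_divide_eq mult_left_le)
  then have "real k / nu k \<le> real n \<Longrightarrow> k \<le> n" for k using order_trans of_nat_le_iff by metis
  then show "{k. real k / nu k \<le> real n} \<subseteq> {..n}" by auto
qed simp

lemma window_bounds: "real (window n) / nu (window n) \<le> real n" "real n \<le> real (Suc (window n)) / nu (Suc (window n))"
proof -
  have "window n \<in> {k. real k / nu k \<le> real n}"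
    unfolding window_def by (rule Max_in[OF finite_window]) (auto intro!: exI[of _ 0])
  then show "real (window n) / nu (window n) \<le> real n" by simp
  have "Suc (window n) \<notin> {k. real k / nu k \<le> real n}"
    using Max_ge[OF finite_window, of "Suc (window n)" n] unfolding window_def[symmetric] by auto
  then show "real n \<le> real (Suc (window n)) / nu (Suc (window n))" by simp
qed

lemma window_at_top: "filterlim window at_top sequentially"
  unfolding filterlim_at_top
proof
  fix K
  obtain N :: nat where N: "real K / nu K \<le> real N" using real_arch_simple by blast
  show "\<forall>\<^sub>F n in sequentially. K \<le> window n"
  proof (rule eventually_sequentiallyI[of N])
    fix n assume "N \<le> n"
    then have "real K / nu K \<le> real n" using N by simp
    then show "K \<le> window n" unfolding window_def by (intro Max_ge[OF finite_window]) simp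
  qed
qed

section \<open>Quantile bound and limit theorems for the chain\<close>

context
  fixes M :: "'a measure" and Z
  assumes chain: "hierarchy_chain state_law refresh_law M Z"
begin

interpretation C: hierarchy_chain state_law refresh_law M Z by (rule chain)

lemma quantile_bounds:
  assumes "tail (Suc k) \<le> u"
  shows "0 \<le> quantile_fun M (\<lambda>\<omega>. \<bar>X Z 0 \<omega>\<bar>) u" "quantile_fun M (\<lambda>\<omega>. \<bar>X Z 0 \<omega>\<bar>) u \<le> amp k"
proof -
  define A where "A = {t. 0 \<le> t \<and> C.prob {\<omega> \<in> space M. t < \<bar>X Z 0 \<omega>\<bar>} \<le> u}"
  have "C.prob {\<omega> \<in> space M. Z 0 \<omega> \<in> {z. Suc k \<le> lev z}} = tail (Suc k)"
    unfolding C.prob_Z tail_def ..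
  moreover have "amp k < amp i \<longleftrightarrow> Suc k \<le> i" for i
    using strict_mono_less[OF strict_mono_amp] by auto
  ultimately have "C.prob {\<omega> \<in> space M. amp k < \<bar>X Z 0 \<omega>\<bar>} = tail (Suc k)" by (simp add: abs_val)
  then have k: "amp k \<in> A" using assms amp_nonneg by (simp add: A_def)
  show "0 \<le> quantile_fun M (\<lambda>\<omega>. \<bar>X Z 0 \<omega>\<bar>) u"
    unfolding quantile_fun_def A_def[symmetric] by (rule cInf_greatest) (use k in \<open>auto simp: A_def\<close>)
  show "quantile_fun M (\<lambda>\<omega>. \<bar>X Z 0 \<omega>\<bar>) u \<le> amp k"
    unfolding quantile_fun_def A_def[symmetric] by (rule cInf_lower[OF k]) (auto simp: A_def intro!: bdd_belowI[of _ 0])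
qed

text \<open>The estimate runs through the nonnegative integral, which is monotone without
  measurability of the quantile function; if the integrand failed to be integrable, the Bochner
  integral would be 0.\<close>

lemma quantile_integral_le:
  assumes x: "1 \<le> x"
  shows "(LBINT u:{0<..<(1 / x) powr p}. (quantile_fun M (\<lambda>\<omega>. \<bar>X Z 0 \<omega>\<bar>) u)\<^sup>2) \<le> g x / x"
proof -
  define t where "t = (1 / x) powr p"
  define Q where "Q = quantile_fun M (\<lambda>\<omega>. \<bar>X Z 0 \<omega>\<bar>)"
  define A where "A = (\<lambda>k. {tail (Suc k)..<tail k} \<inter> {0<..<t})"
  have t1: "t \<le> 1" unfolding t_def using x p by (intro powr_le1) auto
  have gx: "0 \<le> g x / x" using g_ge[OF x] x by simp
  have ptw: "ennreal (indicator {0<..<t} u *\<^sub>R (Q u)\<^sup>2) \<le> (\<Sum>k. ennreal ((amp k)\<^sup>2) * indicator (A k) u)" for u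
  proof (cases "u \<in> {0<..<t}")
    case True
    then obtain k where k: "tail (Suc k) \<le> u" "u < tail k" using ex_tail_interval[of u] t1 by auto
    have "(Q u)\<^sup>2 \<le> (amp k)\<^sup>2" using quantile_bounds[OF k(1)] unfolding Q_def by (intro power_mono) auto
    then have "ennreal (indicator {0<..<t} u *\<^sub>R (Q u)\<^sup>2) \<le> ennreal ((amp k)\<^sup>2) * indicator (A k) u"
      using True k by (simp add: A_def ennreal_leI)
    also have "\<dots> \<le> (\<Sum>k. ennreal ((amp k)\<^sup>2) * indicator (A k) u)"
    proof -
      have "F k \<le> (\<Sum>i. F i)" for F :: "nat \<Rightarrow> ennreal"
        using sum_le_suminf[OF summableI, of "{k}" F] by simp
      then show ?thesis .
    qed
    finally show ?thesis .
  qed simp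
  have "(\<integral>\<^sup>+u. ennreal (indicator {0<..<t} u *\<^sub>R (Q u)\<^sup>2) \<partial>lborel) \<le>
      (\<integral>\<^sup>+u. (\<Sum>k. ennreal ((amp k)\<^sup>2) * indicator (A k) u) \<partial>lborel)"
    by (intro nn_integral_mono ptw)
  also have "\<dots> = (\<Sum>k. \<integral>\<^sup>+u. ennreal ((amp k)\<^sup>2) * indicator (A k) u \<partial>lborel)"
    by (rule nn_integral_suminf) (simp add: A_def)
  also have "\<dots> = (\<Sum>k. ennreal ((amp k)\<^sup>2) * emeasure lborel (A k))"
    by (intro suminf_cong nn_integral_cmult_indicator) (simp add: A_def)
  also have "\<dots> \<le> (\<Sum>k. ennreal (envelope k x / x))"
  proof (intro suminf_le summableI)
    fix k
    have "ennreal ((amp k)\<^sup>2) * emeasure lborel (A k) \<le> ennreal ((amp k)\<^sup>2) * ennreal (min (level_weight k) t)"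
      unfolding A_def by (intro mult_left_mono tail_interval_le) simp
    also have "\<dots> = ennreal ((amp k)\<^sup>2 * min (level_weight k) t)"
      using level_weight_pos[of k] by (simp add: ennreal_mult' t_def)
    also have "\<dots> \<le> ennreal (envelope k x / x)"
      unfolding t_def by (intro ennreal_leI amp_sq_min_le x)
    finally show "ennreal ((amp k)\<^sup>2) * emeasure lborel (A k) \<le> ennreal (envelope k x / x)" .
  qed
  also have "\<dots> = ennreal (\<Sum>k. envelope k x / x)"
    using x envelope_nonneg[of x] by (intro suminf_ennreal2 summable_divide summable_envelope) auto
  also have "\<dots> \<le> ennreal (g x / x)"
    using x suminf_envelope_le[OF x] by (simp add: suminf_divide[OF summable_envelope[OF x]] divide_right_mono ennreal_leI)
  finally show ?thesis
    unfolding set_lebesgue_integral_def Q_def t_def by (intro integral_real_bounded gx)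
qed

lemma quantile_integral_bigo:
  "(\<lambda>x. LBINT u:{0<..<(1 / x) powr p}. (quantile_fun M (\<lambda>\<omega>. \<bar>X Z 0 \<omega>\<bar>) u)\<^sup>2) \<in> O[at_top](\<lambda>x. (1 / x) * g x)"
proof (rule landau_o.bigI[where c = 1])
  show "\<forall>\<^sub>F x in at_top. norm (LBINT u:{0<..<(1 / x) powr p}. (quantile_fun M (\<lambda>\<omega>. \<bar>X Z 0 \<omega>\<bar>) u)\<^sup>2) \<le>
      1 * norm ((1 / x) * g x)"
    using eventually_ge_at_top[of 1]
  proof eventually_elim
    case (elim x)
    have "0 \<le> (LBINT u:{0<..<(1 / x) powr p}. (quantile_fun M (\<lambda>\<omega>. \<bar>X Z 0 \<omega>\<bar>) u)\<^sup>2)"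
      unfolding set_lebesgue_integral_def by (intro Bochner_Integration.integral_nonneg) simp
    then show ?case using quantile_integral_le[OF elim] g_ge[OF elim] elim by simp
  qed
qed simp

lemma mixing_rates:
  assumes "1 \<le> n"
  shows "alpha_mix M (X Z) n \<le> beta_mix M (X Z) n" "beta_mix M (X Z) n \<le> (1 / real n) powr p"
  using C.alpha_mix_le_beta_mix[OF assms] order_trans[OF C.beta_mix_le[OF assms] integral_\<theta>_power_le[OF assms]] by blast+

text \<open>Every large \<open>n\<close> lies in the window of some level, and that level tends to
  infinity with \<open>n\<close>; so the bound holds along the whole sequence.\<close>

lemma char_normalized_sum_tendsto_0:
  assumes t: "t \<noteq> 0"
  shows "(\<lambda>n. char (distr M borel (\<lambda>\<omega>. partial_sum (X Z) n \<omega> / sqrt (real n))) t) \<longlonglongrightarrow> 0"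
proof (rule Lim_null_comparison)
  define B where "B = (\<lambda>k. (240 * real (Suc k) / t\<^sup>2) / 2 ^ k + 100 * (1 / 2) ^ k + 24 / real k)"
  obtain K where K: "4 * t\<^sup>2 < 2 ^ K" using real_arch_pow[of 2 "4 * t\<^sup>2"] by auto
  have "\<forall>\<^sub>F n in sequentially. Suc K \<le> window n" using window_at_top unfolding filterlim_at_top by blast
  then show "\<forall>\<^sub>F n in sequentially. norm (char (distr M borel (\<lambda>\<omega>. partial_sum (X Z) n \<omega> / sqrt (real n))) t) \<le> B (window n)"
  proof eventually_elim
    case (elim n)
    have "(2::real) ^ K \<le> 2 ^ window n" using elim by (intro power_increasing) auto
    then have "4 * t\<^sup>2 \<le> 2 ^ window n" using K by linarith
    then show ?case
      unfolding C.char_partial_sum B_def using elim t window_bounds[of n]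
      by (intro norm_integral_tilt_pow_window) auto
  qed
  have "(\<lambda>k. real k / 2 ^ k) \<longlonglongrightarrow> 0" using lim_n_over_pown[of "2::real"] by simp
  then have "(\<lambda>k. 240 / t\<^sup>2 * (real k / 2 ^ k + (1 / 2) ^ k) + 100 * (1 / 2) ^ k + 24 / real k) \<longlonglongrightarrow>
      240 / t\<^sup>2 * (0 + 0) + 100 * 0 + 0"
    by (intro tendsto_intros half_power_tendsto lim_const_over_n)
  moreover have "B = (\<lambda>k. 240 / t\<^sup>2 * (real k / 2 ^ k + (1 / 2) ^ k) + 100 * (1 / 2) ^ k + 24 / real k)"
    by (rule ext) (simp add: B_def distrib_left add_divide_distrib power_divide)
  ultimately have "B \<longlonglongrightarrow> 0" by (simp only: add_0_right mult_zero_right)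
  then show "(\<lambda>n. B (window n)) \<longlonglongrightarrow> 0" by (rule filterlim_compose[OF _ window_at_top])
qed

lemma concentration_vanishes:
  assumes "0 < c"
  shows "(\<lambda>n. SUP r. \<P>(\<omega> in M. r - c < partial_sum (X Z) n \<omega> / sqrt (real n) \<and>
    partial_sum (X Z) n \<omega> / sqrt (real n) < r + c)) \<longlonglongrightarrow> 0"
  using measurable_partial_sum[OF chain]
  by (intro C.concentration_tendsto_0[OF _ assms] char_normalized_sum_tendsto_0) auto

lemma char_jump_sum_tendsto:
  "(\<lambda>j. char (distr M borel (\<lambda>\<omega>. partial_sum (X Z) (jump_time (Suc j)) \<omega> / jump_scale (Suc j))) t) \<longlonglongrightarrow> char mu_P1sL t"
proof -
  define x where "x = (\<lambda>j. entry_rate (Suc j) * damping (\<theta> (Suc j)) 1 (t / real (L (Suc j))))"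
  define \<phi> where "\<phi> = (\<lambda>j. char (distr M borel (\<lambda>\<omega>. partial_sum (X Z) (jump_time (Suc j)) \<omega> / jump_scale (Suc j))) t)"
  have x0: "0 \<le> x j" for j
    unfolding x_def using \<theta>_bounds by (intro mult_nonneg_nonneg entry_rate_nonneg damping_nonneg) auto
  have "x \<longlonglongrightarrow> 0 * (t\<^sup>2 / (1 + t\<^sup>2))"
    unfolding x_def by (intro tendsto_mult jump_probability_tendsto damping_tendsto)
  then have x_lim: "x \<longlonglongrightarrow> 0" by simp
  have "(\<lambda>j. real (jump_time (Suc j)) * entry_rate (Suc j) * damping (\<theta> (Suc j)) 1 (t / real (L (Suc j)))) \<longlonglongrightarrow> 1 * (t\<^sup>2 / (1 + t\<^sup>2))"
    by (intro tendsto_mult jump_probability_tendsto damping_tendsto)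
  then have Jx: "(\<lambda>j. real (jump_time (Suc j)) * x j) \<longlonglongrightarrow> t\<^sup>2 / (1 + t\<^sup>2)" by (simp add: x_def mult.assoc)
  have "(\<lambda>j. (1 - x j) ^ jump_time (Suc j)) \<longlonglongrightarrow> exp (- (t\<^sup>2 / (1 + t\<^sup>2)))"
    by (rule power_one_minus_tendsto_exp[OF x0 x_lim Jx])
  moreover have "- (t\<^sup>2 / (1 + t\<^sup>2)) = 1 / (1 + t\<^sup>2) - 1"
  proof -
    have "0 < 1 + t\<^sup>2" by (intro add_pos_nonneg) auto
    then show ?thesis by (simp add: field_simps)
  qed
  ultimately have main: "(\<lambda>j. complex_of_real (1 - x j) ^ jump_time (Suc j)) \<longlonglongrightarrow> char mu_P1sL t"
    unfolding char_mu_P1sL by (simp only: of_real_power[symmetric] tendsto_of_real_iff)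
  have diff: "(\<lambda>j. \<phi> j - complex_of_real (1 - x j) ^ jump_time (Suc j)) \<longlonglongrightarrow> 0"
  proof (rule Lim_null_comparison)
    define B where "B = (\<lambda>j. \<bar>t\<bar> * low_level_error j + 36 * (1 / 2) ^ j)"
    have "norm (\<phi> j - complex_of_real (1 - x j) ^ jump_time (Suc j)) \<le> B j" for j
    proof -
      define n where "n = jump_time (Suc j)"
      define v where "v = nu (Suc j)"
      define m where "m = mass (Suc j)"
      have v: "0 < v" using nu_pos by (simp add: v_def)
      have m: "0 < m" "m \<le> (1 / 2) ^ j"
      proof -
        show "0 < m" using mass_pos by (simp add: m_def)
        show "m \<le> (1 / 2) ^ j" using mass_le_half_power[of "Suc j"] mass_pos[of "Suc j"] by (simp add: m_def)
      qed
      have nv: "real n * v \<le> 2"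
        using jump_time_nu(2)[of "Suc j"] nu_le_1[of "Suc j"] by (simp add: n_def v_def)
      have entry: "entry_rate (Suc j) \<le> 2 * v" using entry_rate_le_2_nu[of "Suc j"] by (simp add: v_def)
      have "entry_rate (Suc j) \<le> 1 / 2"
        using entry nu_le_mass[of "Suc j"] mass_le_eighth[of "Suc j"] by (simp add: v_def)
      \<comment> \<open>The amplitude cancels, leaving the phase \<open>t / L\<close> per step that
        \<open>damping_tendsto\<close> treats.\<close>
      moreover have "t / jump_scale (Suc j) * val (int (Suc j)) = t / real (L (Suc j))"
      proof -
        have v: "val (int i) = amp i" for i by (simp add: val_def)
        show ?thesis unfolding jump_scale_def v using amp_pos[of "Suc j"] by simp
      qed
      moreover have "0 \<le> low_level_error j" by (simp add: low_level_error_def)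
      ultimately have "norm (\<phi> j - complex_of_real (1 - x j) ^ n) \<le>
          \<bar>t\<bar> * low_level_error j + 4 * level_prob (Suc j) +
          n * (4 * entry_rate (Suc j) * level_prob (Suc j) + 4 * measure (measure_pmf state_law) (- cell (Suc j)))"
        using C.char_partial_sum_one_level[where val = val and b = "jump_scale (Suc j)" and k = "Suc j" and t = t
            and n = n and \<delta> = "low_level_error j", OF _ val_odd jump_scale_pos _ low_level_le_jump_scale[of j, folded n_def]]
        by (simp only: \<phi>_def x_def n_def zero_less_Suc simp_thms)
      also have "\<dots> \<le> \<bar>t\<bar> * low_level_error j + 4 * m + 2 * (8 * m + 8 * (1 / 2) ^ j)"
      proof -
        have "4 * entry_rate (Suc j) * level_prob (Suc j) \<le> 4 * (2 * v) * m"
          using entry m unfolding level_prob_eq_mass[OF zero_less_Suc] m_def[symmetric]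
          by (intro mult_right_mono mult_left_mono) auto
        moreover have "4 * measure (measure_pmf state_law) (- cell (Suc j)) \<le> 8 * ((1 / 2) ^ j * v)"
        proof -
          have "(1 / 2) ^ Suc j * v \<le> (1 / 2) ^ j * v" using v by simp
          then show ?thesis
            using measure_Compl_cell_le[of "Suc j"] mass_Suc_le_nu[of "Suc j"] unfolding v_def[symmetric] by linarith
        qed
        ultimately have "n * (4 * entry_rate (Suc j) * level_prob (Suc j) + 4 * measure (measure_pmf state_law) (- cell (Suc j))) \<le>
            n * (4 * (2 * v) * m + 8 * ((1 / 2) ^ j * v))"
          by (intro mult_left_mono add_mono) auto
        also have "\<dots> = (real n * v) * (8 * m + 8 * (1 / 2) ^ j)" by (simp add: algebra_simps)
        also have "\<dots> \<le> 2 * (8 * m + 8 * (1 / 2) ^ j)" using nv m by (intro mult_right_mono) auto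
        finally show ?thesis unfolding level_prob_eq_mass[OF zero_less_Suc] m_def[symmetric] by (rule add_left_mono)
      qed
      also have "\<dots> \<le> B j" using m by (simp add: B_def)
      finally show ?thesis by (simp add: n_def)
    qed
    then show "\<forall>\<^sub>F j in sequentially. norm (\<phi> j - complex_of_real (1 - x j) ^ jump_time (Suc j)) \<le> B j" by simp
    have "(\<lambda>k. real k / 2 ^ k) \<longlonglongrightarrow> 0" using lim_n_over_pown[of "2::real"] by simp
    then have "(\<lambda>k. \<bar>t\<bar> * (2 * (real k / 2 ^ k + (1 / 2) ^ k)) + 36 * (1 / 2) ^ k) \<longlonglongrightarrow> \<bar>t\<bar> * (2 * (0 + 0)) + 36 * 0"
      by (intro tendsto_intros half_power_tendsto)
    moreover have "low_level_error k = 2 * (real k / 2 ^ k + (1 / 2) ^ k)" for k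
      by (simp add: low_level_error_def distrib_left add_divide_distrib power_divide)
    ultimately show "B \<longlonglongrightarrow> 0" by (simp add: B_def)
  qed
  from tendsto_add[OF diff main] show ?thesis by (simp add: \<phi>_def)
qed

lemma jump_sum_weak_conv:
  "weak_conv_m (\<lambda>j. distr M borel (\<lambda>\<omega>. partial_sum (X Z) (jump_time (Suc j)) \<omega> / jump_scale (Suc j))) mu_P1sL"
  using measurable_partial_sum[OF chain]
  by (intro levy_continuity real_distribution_mu_P1sL char_jump_sum_tendsto C.real_distribution_distr) auto

end

end

theorem corollary5p7:
  fixes p :: real and g :: "real \<Rightarrow> real"
  assumes "1 < p"
    and "\<And>x. x \<ge> 1 \<Longrightarrow> g x \<ge> 1"
    and "filterlim g at_top at_top"
  shows "\<exists>(M :: (int \<Rightarrow> real) measure) (S :: real set) (X :: int \<Rightarrow> (int \<Rightarrow> real) \<Rightarrow> real).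
     countable_state_Markov_chain M S X \<and> strictly_stationary M X \<and>
     irreducible_chain M S X \<and> aperiodic_chain M S X \<and> reversible M X \<and>
     integrable M (\<lambda>\<omega>. (X 0 \<omega>)\<^sup>2) \<and> integral\<^sup>L M (X 0) = 0 \<and>
     (\<lambda>x. LBINT u:{0<..<(1 / x) powr p}. (quantile_fun M (\<lambda>\<omega>. \<bar>X 0 \<omega>\<bar>) u)\<^sup>2)
       \<in> O[at_top](\<lambda>x. (1 / x) * g x) \<and>
     (\<forall>n\<ge>1. alpha_mix M X n \<le> beta_mix M X n \<and> beta_mix M X n \<le> (1 / real n) powr p) \<and>
     (filterlim (\<lambda>n. normalized_variance M X n) at_top sequentially \<and>
      (\<forall>c>0. (\<lambda>n. SUP r. \<P>(\<omega> in M. r - c < partial_sum X n \<omega> / sqrt (real n) \<and>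
                                partial_sum X n \<omega> / sqrt (real n) < r + c))
               \<longlonglongrightarrow> 0)) \<and>
     (\<exists>(J :: nat \<Rightarrow> nat) (b :: nat \<Rightarrow> real).
        strict_mono J \<and> (\<forall>n. J n > 0) \<and> (\<forall>n. b n > 0) \<and> filterlim b at_top sequentially \<and>
        weak_conv_m (\<lambda>n. distr M borel (\<lambda>\<omega>. partial_sum X (J n) \<omega> / b n)) mu_P1sL) \<and>
     ((\<forall>n\<ge>1. normalized_variance M X n \<le> g (real n)) \<and>
      (\<forall>N\<ge>1. limsup (\<lambda>n. ereal (normalized_variance M X (N * n) / normalized_variance M X n))
               = ereal (real N)))"
proof -
  obtain L T where scales: "scales p g L T" using ex_scales[OF assms] by blast
  \<comment> \<open>The defined parameters of the locale are instantiated by their defining terms,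
    so the defining equations hold by reflexivity.\<close>
  interpret scales p g L T "\<lambda>k. (1 / 2) ^ k / (4 * p powr p)" "\<lambda>k. 2 ^ (k\<^sup>2)"
      "\<lambda>k. (1 / 2) ^ k / (4 * p powr p) * real (L k) powr - p"
    using scales by - (assumption | rule reflexive)+
  obtain M :: "(int \<Rightarrow> real) measure" and Z where "stationary_chain state_law kernel M Z"
    using ex_stationary_chain by blast
  then have chain: "hierarchy_chain state_law refresh_law M Z"
    by (intro hierarchy_chain.intro hierarchy_axioms)
  interpret C: hierarchy_chain state_law refresh_law M Z by (rule chain)
  \<comment> \<open>The witnesses for the sequences start at level 1, since \<open>amp 0 = 0\<close>
    would make the first normalising constant vanish.\<close>
  show ?thesis
    using C.markov_chain[OF inj_val] C.stationary C.irreducible[OF inj_val] C.aperiodic[OF inj_val] C.reversible_val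
      integrable_X_sq[OF chain] expectation_X[OF chain] quantile_integral_bigo[OF chain] mixing_rates[OF chain]
      normalized_variance_at_top[OF chain] concentration_vanishes[OF chain]
      normalized_variance_le_g[OF chain] limsup_normalized_variance[OF chain]
      strict_mono_jump_time jump_time_pos jump_scale_pos jump_scale_at_top jump_sum_weak_conv[OF chain]
    by (intro exI[of _ M] exI[of _ "range val"] exI[of _ "\<lambda>k \<omega>. val (Z k \<omega>)"]
        exI[of _ "\<lambda>j. jump_time (Suc j)"] exI[of _ "\<lambda>j. jump_scale (Suc j)"] conjI allI impI)
qed

end
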